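(* Let $n\ge 2$ and $p\in(1,\frac{n+2}{n-2})$ (any $p>1$ if $n=2$). Then $W^{\sup}_{\mathbb{H}^n}=W^{\sup}_{\mathbb{R}^n}$; equivalently, the best constant $C$ in the Gagliardo–Nirenberg inequality $\|u\|_{L^{p+1}}^{p+1}\le C\|u\|_{L^2}^{\alpha}\|\nabla u\|_{L^2}^{\beta}$ on $H^1(\mathbb{H}^n)$ equals the best constant on $H^1(\mathbb{R}^n)$.
   Context: $\mathbb{H}^n$ is $n$-dimensional hyperbolic space (constant curvature $-1$), e.g. the hyperboloid model $\{(t,x)\in\mathbb{R}^{1+n}: t^2-|x|^2=1, t>0\}$ with the metric induced by $-dt^2+dx^2$. For a Riemannian $n$-manifold $M$, $W_M(u)=\dfrac{\|u\|_{L^{p+1}(M)}^{p+1}}{\|u\|_{L^2(M)}^{\alpha}\,\|\nabla u\|_{L^2(M)}^{\beta}}$ with $\alpha=2-\frac{(n-2)(p-1)}{2}$, $\beta=\frac{n(p-1)}{2}$, and $W^{\sup}_M$ is the supremum of $W_M(u)$ over $u\in H^1(M)$, $u\neq0$. *)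

theory Defs
  imports "HOL-Analysis.Analysis"
begin

definition partial :: "('a::euclidean_space \<Rightarrow> real) \<Rightarrow> 'a \<Rightarrow> 'a \<Rightarrow> real" where
  "partial f i x = frechet_derivative f (at x) i"

fun Ck :: "nat \<Rightarrow> ('a::euclidean_space \<Rightarrow> real) \<Rightarrow> bool" where
  "Ck 0 f = continuous_on UNIV f"
| "Ck (Suc k) f = ((\<forall>x. f differentiable (at x)) \<and> (\<forall>i\<in>Basis. Ck k (partial f i)))"

definition smooth_fun :: "('a::euclidean_space \<Rightarrow> real) \<Rightarrow> bool" where
  "smooth_fun f \<longleftrightarrow> (\<forall>k. Ck k f)"

definition test_fun :: "'a::euclidean_space set \<Rightarrow> ('a \<Rightarrow> real) \<Rightarrow> bool" where
  "test_fun U \<phi> \<longleftrightarrow> smooth_fun \<phi> \<and> compact (closure {x. \<phi> x \<noteq> 0})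
      \<and> closure {x. \<phi> x \<noteq> 0} \<subseteq> U"

definition weak_gradient :: "'a::euclidean_space set \<Rightarrow> ('a \<Rightarrow> real) \<Rightarrow> ('a \<Rightarrow> 'a) \<Rightarrow> bool" where
  "weak_gradient U u G \<longleftrightarrow>
     u \<in> borel_measurable lebesgue \<and> G \<in> borel_measurable lebesgue \<and>
     (\<forall>K. compact K \<and> K \<subseteq> U \<longrightarrow>
        integrable (lebesgue_on K) u \<and> integrable (lebesgue_on K) (\<lambda>x. norm (G x))) \<and>
     (\<forall>\<phi>. test_fun U \<phi> \<longrightarrow> (\<forall>i\<in>Basis.
        (\<integral>x. u x * partial \<phi> i x \<partial>lebesgue_on U) = - (\<integral>x. (G x \<bullet> i) * \<phi> x \<partial>lebesgue_on U)))"

definition GN_alpha :: "nat \<Rightarrow> real \<Rightarrow> real" where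
  "GN_alpha n p = 2 - (real n - 2) * (p - 1) / 2"

definition GN_beta :: "nat \<Rightarrow> real \<Rightarrow> real" where
  "GN_beta n p = real n * (p - 1) / 2"

text \<open>Generic Weinstein-type quotient on a measure M (the Riemannian volume), given
  the value of ||u||_2^2 and ||grad u||_2^2.  Values in ereal so that an infinite
  numerator / supremum is handled faithfully.\<close>
definition W_quot :: "'a measure \<Rightarrow> nat \<Rightarrow> real \<Rightarrow> ('a \<Rightarrow> real) \<Rightarrow> real \<Rightarrow> real \<Rightarrow> ereal" where
  "W_quot M n p u L2sq gradsq =
     enn2ereal (\<integral>\<^sup>+ x. ennreal (\<bar>u x\<bar> powr (p + 1)) \<partial>M)
     / ereal (L2sq powr (GN_alpha n p / 2) * gradsq powr (GN_beta n p / 2))"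

definition H1_Rn :: "('a::euclidean_space \<Rightarrow> real) \<Rightarrow> ('a \<Rightarrow> 'a) \<Rightarrow> bool" where
  "H1_Rn u G \<longleftrightarrow> weak_gradient UNIV u G
     \<and> integrable lebesgue (\<lambda>x. (u x)\<^sup>2) \<and> integrable lebesgue (\<lambda>x. (norm (G x))\<^sup>2)"

definition W_sup_Rn :: "'a::euclidean_space itself \<Rightarrow> real \<Rightarrow> ereal" where
  "W_sup_Rn TYPE('a) p = (SUP (u, G) \<in> {(u :: 'a \<Rightarrow> real, G). H1_Rn u G \<and> (\<integral>x. (u x)\<^sup>2 \<partial>lebesgue) \<noteq> 0}.
      W_quot lebesgue DIM('a) p u (\<integral>x. (u x)\<^sup>2 \<partial>lebesgue) (\<integral>x. (norm (G x))\<^sup>2 \<partial>lebesgue))"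

text \<open>H^n is realised as the open unit ball with metric g = rho^2 |dx|^2,
  rho x = 2 / (1 - |x|^2).  Volume: rho^n dx; |grad_g u|_g^2 = rho^(-2) |grad u|^2.\<close>
definition hyp_rho :: "'a::euclidean_space \<Rightarrow> real" where
  "hyp_rho x = 2 / (1 - (norm x)\<^sup>2)"

definition hyp_vol :: "'a::euclidean_space measure" where
  "hyp_vol = density (lebesgue_on (ball 0 1)) (\<lambda>x. ennreal (hyp_rho x ^ DIM('a)))"

definition H1_Hn :: "('a::euclidean_space \<Rightarrow> real) \<Rightarrow> ('a \<Rightarrow> 'a) \<Rightarrow> bool" where
  "H1_Hn u G \<longleftrightarrow> weak_gradient (ball 0 1) u G
     \<and> integrable hyp_vol (\<lambda>x. (u x)\<^sup>2)
     \<and> integrable hyp_vol (\<lambda>x. (norm (G x))\<^sup>2 / (hyp_rho x)\<^sup>2)"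

definition W_sup_Hn :: "'a::euclidean_space itself \<Rightarrow> real \<Rightarrow> ereal" where
  "W_sup_Hn TYPE('a) p = (SUP (u, G) \<in> {(u :: 'a \<Rightarrow> real, G). H1_Hn u G \<and> (\<integral>x. (u x)\<^sup>2 \<partial>hyp_vol) \<noteq> 0}.
      W_quot hyp_vol DIM('a) p u (\<integral>x. (u x)\<^sup>2 \<partial>hyp_vol)
        (\<integral>x. (norm (G x))\<^sup>2 / (hyp_rho x)\<^sup>2 \<partial>hyp_vol))"

end

theory Submission
  imports Defs
begin

text \<open>\<open>H\<^sup>n\<close> has the isoperimetric inequality of \<open>R\<^sup>n\<close> with the Euclidean constant. For densities
  \<open>w \<rho>\<^sup>n\<close> on the ball this comes from Gromov's argument with the Knothe map \<open>T\<close> onto the unit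
  ball: arithmetic-geometric mean applied to the diagonal of \<open>DT\<close> and integration by parts give
  the Euclidean bound up to a term with \<open>\<integral> w \<rho>\<^sup>n x \<bullet> T\<close>, which stems from \<open>\<nabla>\<rho> = \<rho>\<^sup>2 x\<close>. Its sign is
  favourable, because each \<open>T\<^sub>i\<close> is increasing in \<open>x\<^sub>i\<close> with conditional mean zero. Applied to the
  level sets of a compactly supported \<open>C\<^sup>1\<close> function on the ball, the inequality shows that the
  radial rearrangement to \<open>R\<^sup>n\<close> keeps all \<open>L\<^sup>s\<close> norms and does not raise the Dirichlet integral, so
  Euclidean Gagliardo--Nirenberg bounds carry over to \<open>H\<^sup>n\<close>. Conversely a Euclidean competitor
  scaled to a small neighbourhood of a point of \<open>H\<^sup>n\<close> has asymptotically the same quotient, as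
  \<open>n \<alpha> + (n - 2) \<beta> = 2 n\<close> makes the quotient scale invariant. In both spaces, cutting off and
  mollifying reduces \<open>H\<^sup>1\<close> to compactly supported \<open>C\<^sup>1\<close> functions.\<close>

section \<open>Line derivatives and weak gradients\<close>

text \<open>The Knothe map asks for little regularity: it is triangular and given by explicit
  one-dimensional quantiles, and only the derivative of its i-th component along the i-th axis
  enters, so all calculus takes place on coordinate lines. The price is a continuous positive
  density on a product domain. Hence the density is extended to the cube \<open>[-1,1]^n\<close> by
  adding a constant \<open>d > 0\<close>, and \<open>d\<close> tends to 0 only in the finished
  inequality. Isoperimetry is proved in functional form, n V^(1/n) int w^(1+1/n) <= (int w)^(1/n)
  int |grad w| with powers of \<open>rho\<close> as weights, for Lipschitz w between 0 and 1. A
  level set of \<open>u\<close> then enters as a ramp between two levels, and the a.e. derivative of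
  that ramp is explicit. The rearrangement is carried out at finitely many levels, chosen so that
  the matching balls have radii in geometric progression of ratio \<open>q\<close>. Jumps and
  plateaus of the distribution function are thereby harmless, and the errors vanish as the number of
  levels grows and \<open>q\<close> tends to 1. The suprema are \<open>ereal\<close> values whose
  finiteness is not known beforehand; what is carried from one space to the other is therefore an
  arbitrary real upper bound \<open>C\<close>.\<close>

lemma lborel_integral_translate:
  fixes g :: "'a::euclidean_space \<Rightarrow> real"
  shows "(\<integral>x. g (x + a) \<partial>lborel) = (\<integral>x. g x \<partial>lborel)"
proof (cases "g \<in> borel_measurable borel")
  case True
  have "(\<integral>x. g x \<partial>lborel) = (\<integral>x. g x \<partial>(distr lborel borel ((+) a)))"
    by (simp add: lborel_distr_plus)
  also have "\<dots> = (\<integral>x. g (a + x) \<partial>lborel)"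
    using True by (intro integral_distr) auto
  finally show ?thesis by (simp add: add.commute)
next
  case False
  \<comment> \<open>Without measurability both integrals take the default value 0.\<close>
  have "\<not> integrable lborel g" using False by (auto dest: borel_measurable_integrable)
  moreover have "\<not> integrable lborel (\<lambda>x. g (x + a))"
  proof
    assume "integrable lborel (\<lambda>x. g (x + a))"
    then have "(\<lambda>x. g (x + a)) \<in> borel_measurable borel" by auto
    then have "(\<lambda>x. (\<lambda>x. g (x + a)) (x - a)) \<in> borel_measurable borel" by measurable
    then show False using False by simp
  qed
  ultimately show ?thesis by (simp add: not_integrable_integral_eq)
qed

lemma lborel_integrable_translate:
  fixes g :: "'a::euclidean_space \<Rightarrow> real"
  assumes "integrable lborel g"
  shows "integrable lborel (\<lambda>x. g (x + a))"
proof -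
  have "integrable (distr lborel borel ((+) a)) g" using assms by (simp add: lborel_distr_plus)
  then have "integrable lborel (\<lambda>x. g (a + x))"
    by (subst (asm) integrable_distr_eq) (use assms in auto)
  then show ?thesis by (simp add: add.commute)
qed

text \<open>Every difference quotient of \<open>g\<close> has integral 0 by translation invariance,
  and the Lipschitz bound along \<open>e\<close> together with bounded support dominates them all,
  so the limit inherits the value 0. Applied to products, this is the integration by parts of the
  whole proof; a derivative almost everywhere is enough, which admits ramps and piecewise linear
  profiles.\<close>

lemma integral_directional_derivative_eq_0:
  fixes g g' :: "'a::euclidean_space \<Rightarrow> real" and e :: 'a
  assumes int: "integrable lborel g" and meas: "g' \<in> borel_measurable borel"
    and bdd: "bounded K" and zero: "\<And>x. x \<notin> K \<Longrightarrow> g x = 0"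
    and lip: "\<And>x t. \<bar>g (x + t *\<^sub>R e) - g x\<bar> \<le> L * \<bar>t\<bar>"
    and der: "AE x in lborel. ((\<lambda>t. g (x + t *\<^sub>R e)) has_real_derivative g' x) (at 0)"
  shows "integrable lborel g'" "(\<integral>x. g' x \<partial>lborel) = 0"
proof -
  define s where "s k x = (g (x + (1 / real (Suc k)) *\<^sub>R e) - g x) * real (Suc k)" for k x
  obtain B where B: "\<And>x. x \<in> K \<Longrightarrow> norm x \<le> B" using bdd bounded_iff by blast
  \<comment> \<open>Dominating function: the steps \<open>1 / Suc k\<close> have size at most 1, so
    the supports of the quotients stay within distance \<open>norm e\<close> of \<open>K\<close>,
    which lies in the ball of radius \<open>B\<close>.\<close>
  define w where "w x = L * indicator (cball (0::'a) (B + norm e)) x" for x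
  have L0: "L \<ge> 0" using lip[of 0 1] by (simp add: order_trans[OF abs_ge_zero])
  have g1: "g \<in> borel_measurable borel" using int by auto
  have ints: "integrable lborel (s k)" for k
    unfolding s_def using int lborel_integrable_translate[OF int] by auto
  have s0: "(\<integral>x. s k x \<partial>lborel) = 0" for k
    unfolding s_def using int lborel_integrable_translate[OF int] lborel_integral_translate[of g]
    by (simp del: of_nat_Suc)
  have w: "integrable lborel w"
    unfolding w_def by (intro integrable_mult_right integrable_real_indicator) (auto intro: emeasure_bounded_finite[unfolded infinity_ennreal_def])
  have bound: "norm (s k x) \<le> w x" for k x
  proof (cases "x \<in> cball 0 (B + norm e)")
    case True
    have "\<bar>g (x + (1 / real (Suc k)) *\<^sub>R e) - g x\<bar> * real (Suc k) \<le> (L * \<bar>1 / real (Suc k)\<bar>) * real (Suc k)"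
      by (intro mult_right_mono lip) auto
    also have "\<dots> = L" by simp
    finally show ?thesis using True by (simp add: s_def w_def abs_mult del: of_nat_Suc)
  next
    case False
    then have n: "norm x > B + norm e" by simp
    have "x \<notin> K" using B[of x] n norm_ge_zero[of e] by linarith
    moreover have "x + (1 / real (Suc k)) *\<^sub>R e \<notin> K"
    proof
      assume "x + (1 / real (Suc k)) *\<^sub>R e \<in> K"
      then have "norm (x + (1 / real (Suc k)) *\<^sub>R e) \<le> B" by (rule B)
      moreover have "norm ((1 / real (Suc k)) *\<^sub>R e) \<le> norm e"
        by (simp add: divide_le_eq mult_le_cancel_left1)
      ultimately show False using n norm_triangle_ineq2[of x "- ((1 / real (Suc k)) *\<^sub>R e)"]
        by simp
    qed
    ultimately show ?thesis using zero L0 by (simp add: s_def w_def)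
  qed
  have lim: "AE x in lborel. (\<lambda>k. s k x) \<longlonglongrightarrow> g' x"
    using der
  proof eventually_elim
    case (elim x)
    have "((\<lambda>h. (g (x + h *\<^sub>R e) - g x) / h) \<longlongrightarrow> g' x) (at 0)"
      using elim by (simp add: DERIV_def)
    then have "(\<lambda>k. (g (x + (1 / real (Suc k)) *\<^sub>R e) - g x) / (1 / real (Suc k))) \<longlonglongrightarrow> g' x"
      by (rule filterlim_compose[where g="\<lambda>h. (g (x + h *\<^sub>R e) - g x) / h"])
         (use LIMSEQ_Suc[OF lim_1_over_n] in \<open>auto simp: filterlim_at simp del: of_nat_Suc\<close>)
    then show ?case by (simp add: s_def)
  qed
  show "integrable lborel g'"
    by (rule integrable_dominated_convergence[OF _ _ w lim]) (use meas ints bound in auto)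
  have "(\<lambda>k. \<integral>x. s k x \<partial>lborel) \<longlonglongrightarrow> (\<integral>x. g' x \<partial>lborel)"
    by (rule integral_dominated_convergence[OF _ _ w lim]) (use meas ints bound in auto)
  then show "(\<integral>x. g' x \<partial>lborel) = 0" using s0 by (simp add: LIMSEQ_const_iff)
qed

lemma line_derivative_shift:
  fixes u :: "'a::real_normed_vector \<Rightarrow> real"
  assumes "\<And>x. ((\<lambda>t. u (x + t *\<^sub>R i)) has_real_derivative d x) (at 0)"
  shows "((\<lambda>t. u (x + t *\<^sub>R i)) has_real_derivative d (x + s *\<^sub>R i)) (at s)"
proof -
  have "((\<lambda>t. u ((x + s *\<^sub>R i) + t *\<^sub>R i)) has_real_derivative d (x + s *\<^sub>R i)) (at 0)"
    by (rule assms)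
  then have "((\<lambda>t. (\<lambda>t. u (x + t *\<^sub>R i)) (t + s)) has_real_derivative d (x + s *\<^sub>R i)) (at 0)"
    by (simp add: algebra_simps)
  then show ?thesis using DERIV_shift[of "\<lambda>t. u (x + t *\<^sub>R i)" "d (x + s *\<^sub>R i)" 0 s] by simp
qed

lemma line_lipschitz:
  fixes u :: "'a::real_normed_vector \<Rightarrow> real"
  assumes "\<And>x. ((\<lambda>t. u (x + t *\<^sub>R i)) has_real_derivative d x) (at 0)"
    and "\<And>x. \<bar>d x\<bar> \<le> L"
  shows "\<bar>u (x + t *\<^sub>R i) - u x\<bar> \<le> L * \<bar>t\<bar>"
proof -
  have "norm (u (x + t *\<^sub>R i) - u (x + 0 *\<^sub>R i)) \<le> L * norm (t - 0)"
    by (rule field_differentiable_bound[of UNIV "\<lambda>t. u (x + t *\<^sub>R i)" "\<lambda>s. d (x + s *\<^sub>R i)"])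
       (use line_derivative_shift[of u i d, OF assms(1)] assms(2) in auto)
  then show ?thesis by simp
qed

lemma differentiable_line_derivative:
  fixes f :: "'a::euclidean_space \<Rightarrow> real"
  assumes "f differentiable (at x)"
  shows "((\<lambda>t. f (x + t *\<^sub>R i)) has_real_derivative partial f i x) (at 0)"
proof -
  have d: "(f has_derivative frechet_derivative f (at x)) (at (x + 0 *\<^sub>R i))"
    using assms by (simp add: frechet_derivative_works)
  have l: "((\<lambda>t. x + t *\<^sub>R i) has_derivative (\<lambda>t. t *\<^sub>R i)) (at 0)"
    by (auto intro!: derivative_eq_intros)
  have "((\<lambda>t. f (x + t *\<^sub>R i)) has_derivative (\<lambda>t. frechet_derivative f (at x) (t *\<^sub>R i))) (at 0)"
    by (rule has_derivative_compose[OF l d])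
  moreover have "frechet_derivative f (at x) (t *\<^sub>R i) = partial f i x * t" for t
    using linear_frechet_derivative[OF assms] by (simp add: linear_cmul partial_def)
  ultimately show ?thesis by (simp add: has_field_derivative_def)
qed

lemma test_fun_basics:
  fixes \<phi> :: "'a::euclidean_space \<Rightarrow> real"
  assumes "test_fun U \<phi>"
  shows test_fun_continuous: "continuous_on UNIV \<phi>"
    and test_fun_line_derivative: "i \<in> Basis \<Longrightarrow> ((\<lambda>t. \<phi> (x + t *\<^sub>R i)) has_real_derivative partial \<phi> i x) (at 0)"
    and test_fun_partial_continuous: "i \<in> Basis \<Longrightarrow> continuous_on UNIV (partial \<phi> i)"
    and test_fun_partial_outside: "x \<notin> closure {x. \<phi> x \<noteq> 0} \<Longrightarrow> partial \<phi> i x = 0"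
    and test_fun_bounded: "\<exists>M. \<forall>x. \<bar>\<phi> x\<bar> \<le> M"
    and test_fun_partial_bounded: "i \<in> Basis \<Longrightarrow> \<exists>M. \<forall>x. \<bar>partial \<phi> i x\<bar> \<le> M"
proof -
  let ?S = "closure {x. \<phi> x \<noteq> 0}"
  have c: "compact ?S" and "Ck 2 \<phi>" using assms by (auto simp: test_fun_def smooth_fun_def)
  then have d: "\<And>x. \<phi> differentiable (at x)" and dd: "\<And>i x. i \<in> Basis \<Longrightarrow> partial \<phi> i differentiable (at x)"
    by (auto simp: numeral_2_eq_2)
  show cp: "continuous_on UNIV \<phi>"
    using d by (simp add: differentiable_imp_continuous_within continuous_on_eq_continuous_within)
  show cpd: "continuous_on UNIV (partial \<phi> i)" if "i \<in> Basis" for i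
    using dd[OF that] by (simp add: differentiable_imp_continuous_within continuous_on_eq_continuous_within)
  show "((\<lambda>t. \<phi> (x + t *\<^sub>R i)) has_real_derivative partial \<phi> i x) (at 0)" for x i
    by (rule differentiable_line_derivative[OF d])
  show z: "partial \<phi> i x = 0" if "x \<notin> ?S" for x i
  proof -
    have "((\<lambda>x. 0) has_derivative (\<lambda>x. 0)) (at x)" by simp
    then have "(\<phi> has_derivative (\<lambda>x. 0)) (at x)"
      by (rule has_derivative_transform_within_open[where s="- ?S"])
         (use that closure_subset[of "{x. \<phi> x \<noteq> 0}"] in \<open>auto simp: open_Compl\<close>)
    then show ?thesis using frechet_derivative_at[of \<phi> "\<lambda>x. 0" x] by (simp add: partial_def fun_eq_iff)
  qed
  have bd: "\<exists>M. \<forall>x. \<bar>f x\<bar> \<le> M" if "continuous_on UNIV f" "\<And>x. x \<notin> ?S \<Longrightarrow> f x = 0" for f :: "'a \<Rightarrow> real"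
  proof -
    have "bounded (f ` ?S)"
      by (intro compact_imp_bounded compact_continuous_image continuous_on_subset[OF that(1)] c) auto
    then obtain M where "\<And>x. x \<in> ?S \<Longrightarrow> \<bar>f x\<bar> \<le> M" by (auto simp: bounded_iff)
    then have "\<forall>x. \<bar>f x\<bar> \<le> max M 0" using that(2) by (metis abs_zero max.cobounded2 max.coboundedI1)
    then show ?thesis by blast
  qed
  show "\<exists>M. \<forall>x. \<bar>\<phi> x\<bar> \<le> M" by (rule bd[OF cp]) (use closure_subset[of "{x. \<phi> x \<noteq> 0}"] in auto)
  show "\<exists>M. \<forall>x. \<bar>partial \<phi> i x\<bar> \<le> M" if "i \<in> Basis" by (rule bd[OF cpd[OF that] z])
qed

lemma lebesgue_on_integral_eq_lborel:
  fixes f :: "'a::euclidean_space \<Rightarrow> real"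
  assumes "f \<in> borel_measurable borel" "U \<in> sets borel" "\<And>x. x \<notin> U \<Longrightarrow> f x = 0"
  shows "(\<integral>x. f x \<partial>lebesgue_on U) = (\<integral>x. f x \<partial>lborel)"
proof -
  have "(\<integral>x. f x \<partial>lebesgue_on U) = (\<integral>x. indicator U x *\<^sub>R f x \<partial>lebesgue)"
    by (rule integral_restrict_space) (use assms in auto)
  also have "(\<lambda>x. indicator U x *\<^sub>R f x) = f" using assms(3) by (force simp: indicator_def)
  also have "(\<integral>x. f x \<partial>lebesgue) = (\<integral>x. f x \<partial>lborel)"
    using assms by (intro integral_completion) auto
  finally show ?thesis .
qed

lemma integrable_bounded_support:
  fixes f :: "'a::euclidean_space \<Rightarrow> 'b::{banach, second_countable_topology}"
  assumes "f \<in> borel_measurable borel" "bounded K" "\<And>x. x \<notin> K \<Longrightarrow> f x = 0" "\<And>x. norm (f x) \<le> M"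
  shows "integrable lborel f"
proof -
  obtain B where B: "K \<subseteq> cball 0 B" using assms(2) unfolding bounded_iff by (auto simp: subset_iff)
  have i: "integrable lborel (\<lambda>x. M * indicator (cball (0::'a) B) x)"
    by (intro integrable_mult_right integrable_real_indicator) (auto intro: emeasure_bounded_finite[unfolded infinity_ennreal_def])
  have "norm (f x) \<le> norm (M * indicator (cball 0 B) x)" for x
  proof (cases "x \<in> cball 0 B")
    case True then show ?thesis using assms(4)[of x] by simp
  next
    case False then have "f x = 0" using B assms(3) by blast
    then show ?thesis by simp
  qed
  then show ?thesis by (intro Bochner_Integration.integrable_bound[OF i]) (use assms in auto)
qed

text \<open>The product of \<open>u\<close> with a test function is again Lipschitz along
  \<open>i\<close> and compactly supported, so the integral of its a.e. derivative vanishes; the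
  product rule splits this into the two sides of the defining identity. Serves both continuously
  differentiable functions and the radial profiles with kinks.\<close>

lemma weak_gradientI_lipschitz:
  fixes u :: "'a::euclidean_space \<Rightarrow> real"
  assumes meas: "u \<in> borel_measurable borel" "G \<in> borel_measurable borel"
    and K: "compact K" "K \<subseteq> U" "\<And>x. x \<notin> K \<Longrightarrow> u x = 0" "\<And>x. x \<notin> K \<Longrightarrow> G x = 0"
    and U: "U \<in> sets borel"
    and bdd: "\<And>x. \<bar>u x\<bar> \<le> M" "\<And>x. norm (G x) \<le> M'"
    and lip: "\<And>x t i. i \<in> Basis \<Longrightarrow> \<bar>u (x + t *\<^sub>R i) - u x\<bar> \<le> L * \<bar>t\<bar>"
    and der: "\<And>i. i \<in> Basis \<Longrightarrow> AE x in lborel. ((\<lambda>t. u (x + t *\<^sub>R i)) has_real_derivative (G x \<bullet> i)) (at 0)"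
  shows "weak_gradient U u G"
  unfolding weak_gradient_def
proof (intro conjI allI impI ballI)
  have KB: "bounded K" using K(1) by (rule compact_imp_bounded)
  have iu: "integrable lborel u"
    by (rule integrable_bounded_support[OF meas(1) KB]) (use K(3) bdd in auto)
  have iG: "integrable lborel G"
    by (rule integrable_bounded_support[OF meas(2) KB]) (use K(4) bdd in auto)
  show "u \<in> borel_measurable lebesgue" "G \<in> borel_measurable lebesgue"
    using meas by (auto intro: measurable_completion)
  show "integrable (lebesgue_on S) u" "integrable (lebesgue_on S) (\<lambda>x. norm (G x))" if "compact S \<and> S \<subseteq> U" for S
  proof -
    have S: "S \<in> sets lebesgue" using that by (auto dest: borel_compact)
    have "integrable lebesgue u" "integrable lebesgue (\<lambda>x. norm (G x))"
      using iu iG meas by (auto simp: integrable_completion)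
    then show "integrable (lebesgue_on S) u" "integrable (lebesgue_on S) (\<lambda>x. norm (G x))"
      using S by (auto simp: integrable_restrict_space intro!: integrable_mult_indicator[where 'b=real, simplified])
  qed
  fix \<phi> and i :: 'a assume \<phi>: "test_fun U \<phi>" and i: "i \<in> Basis"
  obtain M1 M2 where M1: "\<And>x. \<bar>\<phi> x\<bar> \<le> M1" and M2: "\<And>x. \<bar>partial \<phi> i x\<bar> \<le> M2"
    using test_fun_bounded[OF \<phi>] test_fun_partial_bounded[OF \<phi> i] by blast
  have m\<phi>: "\<phi> \<in> borel_measurable borel" "partial \<phi> i \<in> borel_measurable borel"
    using test_fun_continuous[OF \<phi>] test_fun_partial_continuous[OF \<phi> i]
    by (auto intro: borel_measurable_continuous_onI)
  have M0: "M \<ge> 0" "M1 \<ge> 0" using bdd(1)[of 0] M1[of 0] by (auto intro: order_trans[OF abs_ge_zero])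
  let ?g = "\<lambda>x. u x * \<phi> x" and ?g' = "\<lambda>x. u x * partial \<phi> i x + (G x \<bullet> i) * \<phi> x"
  have lp: "\<bar>?g (x + t *\<^sub>R i) - ?g x\<bar> \<le> (M * M2 + L * M1) * \<bar>t\<bar>" for x t
  proof -
    have "?g (x + t *\<^sub>R i) - ?g x = u (x + t *\<^sub>R i) * (\<phi> (x + t *\<^sub>R i) - \<phi> x) + (u (x + t *\<^sub>R i) - u x) * \<phi> x"
      by (simp add: algebra_simps)
    also have "\<bar>\<dots>\<bar> \<le> \<bar>u (x + t *\<^sub>R i)\<bar> * \<bar>\<phi> (x + t *\<^sub>R i) - \<phi> x\<bar> + \<bar>u (x + t *\<^sub>R i) - u x\<bar> * \<bar>\<phi> x\<bar>"
      by (metis abs_mult abs_triangle_ineq)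
    also have "\<dots> \<le> M * (M2 * \<bar>t\<bar>) + (L * \<bar>t\<bar>) * M1"
      by (intro add_mono mult_mono bdd lip[OF i] M1 line_lipschitz[OF test_fun_line_derivative[OF \<phi> i] M2])
         (use M0 lip[OF i, of 0 t] in \<open>auto intro: order_trans[OF abs_ge_zero]\<close>)
    finally show ?thesis by (simp add: algebra_simps)
  qed
  have ig: "integrable lborel ?g"
      by (rule integrable_bounded_support[where K=K and M="M * M1"])
         (use meas m\<phi> KB K(3) bdd(1) M1 M0 in \<open>auto simp: abs_mult intro!: mult_mono\<close>)
  have dg: "AE x in lborel. ((\<lambda>t. ?g (x + t *\<^sub>R i)) has_real_derivative ?g' x) (at 0)"
      using der[OF i] by eventually_elim
       (auto intro!: derivative_eq_intros test_fun_line_derivative[OF \<phi> i])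
  have 0: "integrable lborel ?g'" "(\<integral>x. ?g' x \<partial>lborel) = 0"
    using integral_directional_derivative_eq_0[OF ig _ KB _ lp dg] meas m\<phi> K(3) by auto
  have i1: "integrable lborel (\<lambda>x. u x * partial \<phi> i x)"
    by (rule integrable_bounded_support[where K=K and M="M * M2"])
       (use meas m\<phi> KB K(3) bdd(1) M2 M0 in \<open>auto simp: abs_mult intro!: mult_mono\<close>)
  have i2: "integrable lborel (\<lambda>x. (G x \<bullet> i) * \<phi> x)"
    using Bochner_Integration.integrable_diff[OF 0(1) i1] by simp
  have "(\<integral>x. u x * partial \<phi> i x \<partial>lebesgue_on U) = (\<integral>x. u x * partial \<phi> i x \<partial>lborel)"
    by (rule lebesgue_on_integral_eq_lborel) (use meas m\<phi> U K in auto)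
  moreover have GU: "G x = 0" if "x \<notin> U" for x using K(2,4) that by blast
  have "(\<integral>x. (G x \<bullet> i) * \<phi> x \<partial>lebesgue_on U) = (\<integral>x. (G x \<bullet> i) * \<phi> x \<partial>lborel)"
    by (rule lebesgue_on_integral_eq_lborel) (use meas m\<phi> U GU in auto)
  ultimately show "(\<integral>x. u x * partial \<phi> i x \<partial>lebesgue_on U) = - (\<integral>x. (G x \<bullet> i) * \<phi> x \<partial>lebesgue_on U)"
    using 0(2) i1 i2 by simp
qed

text \<open>Continuously differentiable functions with compact support in \<open>U\<close>, with the
  gradient carried along as data. Differentiability is phrased along coordinate lines, the form in
  which every later computation uses it.\<close>

definition C1c :: "'a::euclidean_space set \<Rightarrow> ('a \<Rightarrow> real) \<Rightarrow> ('a \<Rightarrow> 'a) \<Rightarrow> bool" where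
  "C1c U u G \<longleftrightarrow> continuous_on UNIV u \<and> continuous_on UNIV G \<and>
     (\<exists>K. compact K \<and> K \<subseteq> U \<and> (\<forall>x. x \<notin> K \<longrightarrow> u x = 0 \<and> G x = 0)) \<and>
     (\<forall>x. \<forall>i\<in>Basis. ((\<lambda>t. u (x + t *\<^sub>R i)) has_real_derivative (G x \<bullet> i)) (at 0))"

lemma continuous_compact_support_bounded:
  fixes f :: "'a::euclidean_space \<Rightarrow> 'b::real_normed_vector"
  assumes "continuous_on UNIV f" "compact K" "\<And>x. x \<notin> K \<Longrightarrow> f x = 0"
  obtains M where "M \<ge> 0" "\<And>x. norm (f x) \<le> M"
proof -
  have "bounded (f ` K)"
    by (intro compact_imp_bounded compact_continuous_image continuous_on_subset[OF assms(1)] assms(2)) auto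
  then obtain M where "\<And>x. x \<in> K \<Longrightarrow> norm (f x) \<le> M" by (auto simp: bounded_iff)
  then have "norm (f x) \<le> max M 0" for x using assms(3) by (metis norm_zero max.cobounded2 max.coboundedI1)
  then show ?thesis using that[of "max M 0"] by auto
qed

lemma C1c_weak_gradient:
  fixes u :: "'a::euclidean_space \<Rightarrow> real"
  assumes "C1c U u G" "U \<in> sets borel"
  shows "weak_gradient U u G"
proof -
  have c: "continuous_on UNIV u" "continuous_on UNIV G"
    and d: "\<And>x i. i \<in> Basis \<Longrightarrow> ((\<lambda>t. u (x + t *\<^sub>R i)) has_real_derivative (G x \<bullet> i)) (at 0)"
    using assms by (auto simp: C1c_def)
  obtain K where K: "compact K" "K \<subseteq> U" "\<And>x. x \<notin> K \<Longrightarrow> u x = 0" "\<And>x. x \<notin> K \<Longrightarrow> G x = 0"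
    using assms by (auto simp: C1c_def)
  obtain M where M: "\<And>x. norm (u x) \<le> M" using continuous_compact_support_bounded[OF c(1) K(1,3)] by blast
  obtain M' where M': "\<And>x. norm (G x) \<le> M'" using continuous_compact_support_bounded[OF c(2) K(1,4)] by blast
  have Gi: "\<And>x i. i \<in> Basis \<Longrightarrow> \<bar>G x \<bullet> i\<bar> \<le> M'"
    using M' Basis_le_norm order_trans by blast
  show ?thesis
    by (rule weak_gradientI_lipschitz[OF _ _ K assms(2), where M=M and M'=M' and L=M'])
       (use c M M' d line_lipschitz[of u _ "\<lambda>x. G x \<bullet> _" M', OF d Gi] in
        \<open>auto intro: borel_measurable_continuous_onI\<close>)
qed

section \<open>The Knothe map onto the unit ball\<close>

text \<open>The ratio of the unit ball volumes in dimensions \<open>k + 1\<close> and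
  \<open>k\<close>: the slice of the larger ball at height \<open>s\<close> is a
  \<open>k\<close>-ball of radius \<open>sqrt (1 - s^2)\<close>.\<close>

definition ball_slice :: "nat \<Rightarrow> real" where
  "ball_slice k = integral {-1..1} (\<lambda>s. sqrt (1 - s\<^sup>2) ^ k)"

lemma ball_slice_pos: "ball_slice k > 0"
proof -
  have c: "continuous_on {-1..1} (\<lambda>s::real. sqrt (1 - s\<^sup>2) ^ k)" by (intro continuous_intros)
  have "ball_slice k \<ge> 0" unfolding ball_slice_def
    by (rule integral_nonneg) (auto intro!: integrable_continuous_interval c zero_le_power simp: abs_square_le_1 abs_le_iff)
  moreover have "ball_slice k \<noteq> 0"
  proof
    assume "ball_slice k = 0"
    then have "((\<lambda>s. sqrt (1 - s\<^sup>2) ^ k) has_integral 0) (cbox (-1) 1)"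
      using integrable_integral[OF integrable_continuous_interval[OF c]] by (simp add: ball_slice_def)
    then have "sqrt (1 - 0\<^sup>2) ^ k = (0::real)"
      by (rule has_integral_0_cbox_imp_0[rotated 2]) (use c in \<open>auto simp: abs_square_le_1 abs_le_iff\<close>)
    then show False by simp
  qed
  ultimately show ?thesis by simp
qed

text \<open>The slice integral equals \<open>Beta (1/2) (k/2 + 1)\<close>, and the resulting
  quotient of Gamma values is the ratio of the two volumes.\<close>

lemma unit_ball_vol_Suc: "unit_ball_vol (real (Suc k)) = unit_ball_vol (real k) * ball_slice k"
proof -
  have "ennreal (ball_slice k) = (\<integral>\<^sup>+x. ennreal (sqrt (1 - x\<^sup>2) ^ k) * indicator {-1..1} x \<partial>lborel)"
    unfolding ball_slice_def
    by (intro nn_integral_has_integral_lebesgue'[symmetric] integrable_integral integrable_continuous_interval continuous_intros)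
       (auto intro!: zero_le_power simp: abs_square_le_1 abs_le_iff)
  also have "\<dots> = ennreal (Beta (1/2) (real k / 2 + 1))"
    unfolding emeasure_cball_aux_integral[symmetric]
    by (intro nn_integral_cong) (auto simp: indicator_def)
  finally have "ball_slice k = Beta (1/2) (real k / 2 + 1)"
    using ball_slice_pos[of k] by (subst (asm) ennreal_inj) (auto simp: Beta_def Gamma_real_pos)
  then show ?thesis
    by (auto simp: unit_ball_vol_def Beta_def Gamma_eq_zero_iff field_simps
          Gamma_one_half_real powr_half_sqrt [symmetric] powr_add [symmetric])
qed

lemma unit_ball_vol_eq_prod: "unit_ball_vol (real n) = (\<Prod>k<n. ball_slice k)"
  by (induction n) (auto simp: unit_ball_vol_Suc simp del: of_nat_Suc)

text \<open>A parameter \<open>l < 1\<close> keeps the image away from the unit sphere, where the density of the slices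
  degenerates; it is sent to \<open>1\<close> at the end.\<close>
lemma slice_quantile:
  assumes l: "0 < l" "l < 1"
  obtains Q :: "real \<Rightarrow> real" where
    "continuous_on UNIV Q" "\<And>x. \<bar>Q x\<bar> < 1" "mono Q" "\<And>x. Q (1 - x) = - Q x"
    "\<And>x. 0 < x \<Longrightarrow> x < 1 \<Longrightarrow> (Q has_real_derivative l * ball_slice k / sqrt (1 - (Q x)\<^sup>2) ^ k) (at x)"
proof -
  define h :: "real \<Rightarrow> real" where "h s = sqrt (1 - s\<^sup>2) ^ k" for s
  define Z where "Z = ball_slice k"
  have Z: "Z > 0" by (simp add: Z_def ball_slice_pos)
  have ch: "continuous_on {-1..1} h" unfolding h_def by (intro continuous_intros)
  define I where "I r = integral {-1..r} h" for r
  \<comment> \<open>A primitive of \<open>h / (l * Z)\<close>, antisymmetrised about the value 1/2.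
    Dividing by \<open>l < 1\<close> pushes \<open>P 1\<close> above 1, so the value 1 is already
    attained at some \<open>r1 < 1\<close>; the inverse over \<open>{0..1}\<close> then stays in
    \<open>{- r1..r1}\<close>, where the density is bounded away from 0.\<close>
  define P where "P r = 1/2 + (I r - I (- r)) / (2 * l * Z)" for r
  have dI: "(I has_real_derivative h r) (at r)" if "-1 < r" "r < 1" for r
    using integral_has_real_derivative[OF ch, of r] that unfolding I_def
    by (auto simp: at_within_interior[of _ "{-1..1}"] interior_atLeastAtMost_real)
  have h_even: "h (- r) = h r" for r by (simp add: h_def)
  have hpos: "h r > 0" if "-1 < r" "r < 1" for r
    using that by (auto simp: h_def abs_square_less_1 abs_less_iff intro!: zero_less_power)
  have dP: "(P has_real_derivative h r / (l * Z)) (at r)" if "-1 < r" "r < 1" for r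
  proof -
    have "((\<lambda>r. I (- r)) has_real_derivative h (- r) * (- 1)) (at r)"
      by (rule DERIV_chain'[where g=I, OF DERIV_minus[OF DERIV_ident]]) (use dI[of "- r"] that in auto)
    then show ?thesis unfolding P_def
      using dI[OF that] l Z h_even[of r] by (auto intro!: derivative_eq_intros simp: field_simps)
  qed
  have cI: "continuous_on {-1..1} I" unfolding I_def
    by (rule indefinite_integral_continuous_1) (rule integrable_continuous_interval[OF ch])
  have cP: "continuous_on {-1..1} P" unfolding P_def
  proof (intro continuous_intros cI)
    show "continuous_on {-1..1} (\<lambda>r. I (- r))"
      by (rule continuous_on_compose2[OF cI]) (auto intro: continuous_intros)
  qed (use l Z in auto)
  have P0: "P 0 = 1/2" by (simp add: P_def)
  have P1: "P 1 > 1"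
  proof -
    have "I 1 = Z" "I (-1) = 0" by (auto simp: I_def Z_def ball_slice_def h_def[abs_def])
    then show ?thesis using l Z by (simp add: P_def field_simps)
  qed
  have P_odd: "P (- r) = 1 - P r" for r using l Z by (simp add: P_def field_simps)
  have P_strict: "P a < P b" if "-1 \<le> a" "a < b" "b \<le> 1" for a b
  proof (rule DERIV_pos_imp_increasing_open[OF that(2)])
    show "\<exists>y. (P has_real_derivative y) (at x) \<and> y > 0" if "a < x" "x < b" for x
      using dP[of x] hpos[of x] \<open>-1 \<le> a\<close> \<open>b \<le> 1\<close> that l Z by (intro exI[of _ "h x / (l * Z)"]) auto
    show "continuous_on {a..b} P" by (rule continuous_on_subset[OF cP]) (use that in auto)
  qed
  obtain r1 where r1: "0 \<le> r1" "r1 \<le> 1" "P r1 = 1"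
    using IVT'[of P 0 1 1] P0 P1 continuous_on_subset[OF cP, of "{0..1}"] by auto
  have r1': "0 < r1" "r1 < 1" using r1 P0 P1 by (auto simp: less_le)
  let ?S = "{- r1..r1}"
  have cPS: "continuous_on ?S P" by (rule continuous_on_subset[OF cP]) (use r1 in auto)
  have injP: "inj_on P ?S"
  proof (rule linorder_inj_onI)
    fix x y assume "x < y" "x \<in> ?S" "y \<in> ?S"
    then show "P x \<noteq> P y" using P_strict[of x y] r1 by auto
  qed auto
  have imP: "P ` ?S = {0..1}"
  proof
    show "P ` ?S \<subseteq> {0..1}"
    proof
      fix y assume "y \<in> P ` ?S"
      then obtain x where x: "x \<in> ?S" "y = P x" by auto
      have "P x \<le> P r1" using P_strict[of x r1] x r1 by (cases "x = r1") auto
      moreover have "P (- r1) \<le> P x" using P_strict[of "-r1" x] x r1 by (cases "x = - r1") auto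
      ultimately show "y \<in> {0..1}" using r1 x P_odd[of r1] by auto
    qed
    show "{0..1} \<subseteq> P ` ?S"
    proof
      fix y :: real assume "y \<in> {0..1}"
      then show "y \<in> P ` ?S"
        using IVT'[of P "- r1" y r1] r1 P_odd[of r1] cPS by auto
    qed
  qed
  define g where "g = inv_into ?S P"
  have gP: "g (P x) = x" if "x \<in> ?S" for x unfolding g_def by (rule inv_into_f_f[OF injP that])
  have Pg: "P (g y) = y" and gS: "g y \<in> ?S" if "y \<in> {0..1}" for y
    using that f_inv_into_f[of y P ?S] inv_into_into[of y P ?S] imP by (auto simp: g_def)
  have cg: "continuous_on {0..1} g"
    using continuous_on_inv[OF cPS compact_Icc] gP imP by auto
  \<comment> \<open>Clamping the argument extends the quantile by constants to all of the real line,
    keeping continuity, monotonicity and the symmetry about 1/2.\<close>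
  define c where "c x = max 0 (min 1 x)" for x :: real
  have c01: "c x \<in> {0..1}" for x by (auto simp: c_def)
  define Q where "Q x = g (c x)" for x
  have g_mono: "g x \<le> g y" if "x \<le> y" "x \<in> {0..1}" "y \<in> {0..1}" for x y
    using P_strict[of "g y" "g x"] gS[OF that(2)] gS[OF that(3)] Pg[OF that(2)] Pg[OF that(3)] r1 that(1)
    by fastforce
  show thesis
  proof (rule that[of Q])
    show "continuous_on UNIV Q" unfolding Q_def
      by (rule continuous_on_compose2[OF cg]) (use c01 in \<open>auto simp: c_def intro!: continuous_intros\<close>)
    show "\<bar>Q x\<bar> < 1" for x using gS[OF c01[of x]] r1' by (auto simp: Q_def)
    show "mono Q" unfolding Q_def
      by (intro monoI g_mono c01) (auto simp: c_def)
    show "Q (1 - x) = - Q x" for x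
    proof -
      have "c (1 - x) = 1 - c x" by (auto simp: c_def)
      then have "c (1 - x) = P (- g (c x))" using P_odd[of "g (c x)"] Pg[OF c01[of x]] by simp
      then show ?thesis unfolding Q_def using gP[of "- g (c x)"] gS[OF c01[of x]] by auto
    qed
    fix x :: real assume x: "0 < x" "x < 1"
    have Qg: "Q y = g y" if "0 < y" "y < 1" for y using that by (simp add: Q_def c_def)
    have gx: "-1 < g x" "g x < 1" using gS[of x] x r1' by auto
    have "(g has_real_derivative inverse (h (g x) / (l * Z))) (at x)"
    proof (rule DERIV_inverse_function[where g=g and f=P and a=0 and b=1])
      show "(P has_real_derivative h (g x) / (l * Z)) (at (g x))" by (rule dP[OF gx])
      show "h (g x) / (l * Z) \<noteq> 0" using hpos[OF gx] l Z by simp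
      show "isCont g x" using continuous_on_interior[OF cg] x by (simp add: interior_atLeastAtMost_real)
      show "P (g y) = y" if "0 < y" "y < 1" for y using Pg that by simp
    qed (use x in auto)
    then have "(g has_real_derivative l * Z / h (g x)) (at x)" by (simp add: inverse_eq_divide)
    then have "(Q has_real_derivative l * Z / h (g x)) (at x)"
      by (rule has_field_derivative_transform_within_open[where S="{0<..<1}"]) (use x Qg in auto)
    then show "(Q has_real_derivative l * ball_slice k / sqrt (1 - (Q x)\<^sup>2) ^ k) (at x)"
      using Qg x by (simp add: h_def Z_def)
  qed
qed

section \<open>Integrating out one coordinate of a cube\<close>

definition upd_coord :: "'a::euclidean_space \<Rightarrow> real \<Rightarrow> 'a \<Rightarrow> 'a" where
  "upd_coord e t x = x + (t - x \<bullet> e) *\<^sub>R e"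

text \<open>The result remains a function on the full space, constant in direction \<open>e\<close>.
  Marginals in different numbers of variables thus all have the same type, and the fixed interval
  makes them continuous.\<close>

definition coord_int :: "'a::euclidean_space \<Rightarrow> ('a \<Rightarrow> real) \<Rightarrow> 'a \<Rightarrow> real" where
  "coord_int e g x = integral {-1..1} (\<lambda>t. g (upd_coord e t x))"

abbreviation unit_cube :: "'a::euclidean_space set" where
  "unit_cube \<equiv> cbox (- One) One"

lemma upd_coord_inner:
  assumes "e \<in> Basis" "b \<in> Basis"
  shows "upd_coord e t x \<bullet> b = (if b = e then t else x \<bullet> b)"
  using assms by (auto simp: upd_coord_def inner_add_left inner_Basis)

lemma upd_coord_same [simp]: "upd_coord e (x \<bullet> e) x = x"
  by (simp add: upd_coord_def)

lemma upd_coord_upd_coord [simp]: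
  "e \<in> Basis \<Longrightarrow> upd_coord e t (upd_coord e s x) = upd_coord e t x"
  by (rule euclidean_eqI) (simp add: upd_coord_inner)

lemma upd_coord_commute:
  "e \<in> Basis \<Longrightarrow> e' \<in> Basis \<Longrightarrow> e \<noteq> e' \<Longrightarrow> upd_coord e t (upd_coord e' s x) = upd_coord e' s (upd_coord e t x)"
  by (rule euclidean_eqI) (simp add: upd_coord_inner)

lemma upd_coord_add: "e \<in> Basis \<Longrightarrow> x + t *\<^sub>R e = upd_coord e (x \<bullet> e + t) x"
  by (simp add: upd_coord_def)

lemma continuous_upd_coord [continuous_intros]:
  assumes "continuous_on S f" "continuous_on S g"
  shows "continuous_on S (\<lambda>x. upd_coord e (f x) (g x))"
  unfolding upd_coord_def by (intro continuous_intros assms)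

lemma upd_coord_cube:
  "e \<in> Basis \<Longrightarrow> x \<in> unit_cube \<Longrightarrow> t \<in> {-1..1} \<Longrightarrow> upd_coord e t x \<in> unit_cube"
  by (auto simp: mem_box upd_coord_inner)

lemma continuous_line:
  assumes "continuous_on UNIV g"
  shows "continuous_on S (\<lambda>t. g (upd_coord e t x))"
  by (rule continuous_on_compose2[OF assms]) (auto intro!: continuous_intros)

lemma line_integrable:
  fixes g :: "'a::euclidean_space \<Rightarrow> real"
  assumes "continuous_on UNIV g"
  shows "(\<lambda>t. g (upd_coord e t x)) integrable_on {a..b}"
  by (intro integrable_continuous_interval continuous_line assms)

lemma coord_int_continuous:
  assumes "continuous_on UNIV g"
  shows "continuous_on UNIV (coord_int e g)"
proof -
  have "continuous_on UNIV (\<lambda>x. integral (cbox (-1) 1) (\<lambda>t. g (upd_coord e t x)))"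
  proof (rule integral_continuous_on_param)
    show "continuous_on (UNIV \<times> cbox (-1) 1) (\<lambda>(x, t). g (upd_coord e t x))"
      unfolding case_prod_unfold
      by (rule continuous_on_compose2[OF assms]) (auto intro!: continuous_intros)
  qed
  then show ?thesis by (simp add: coord_int_def[abs_def])
qed

lemma coord_int_upd [simp]: "e \<in> Basis \<Longrightarrow> coord_int e g (upd_coord e s x) = coord_int e g x"
  by (simp add: coord_int_def)

lemma coord_int_upd_other:
  assumes "e \<in> Basis" "e' \<in> Basis" "\<And>x s. g (upd_coord e' s x) = g x"
  shows "coord_int e g (upd_coord e' s x) = coord_int e g x"
proof (cases "e = e'")
  case False
  then have "upd_coord e t (upd_coord e' s x) = upd_coord e' s (upd_coord e t x)" for t
    using assms by (intro upd_coord_commute) auto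
  then show ?thesis using assms(3) by (simp add: coord_int_def)
qed (use assms in simp)

lemma coord_int_mult:
  assumes "\<And>t. h (upd_coord e t x) = h x"
  shows "coord_int e (\<lambda>x. h x * g x) x = h x * coord_int e g x"
  by (simp add: coord_int_def assms)

lemma coord_int_pos:
  assumes "continuous_on UNIV g" "\<And>x. g x \<ge> d"
  shows "coord_int e g x \<ge> 2 * d"
proof -
  have "integral {-1..1::real} (\<lambda>t. d) \<le> coord_int e g x"
    unfolding coord_int_def
    by (rule integral_le) (use assms line_integrable[OF assms(1)] in \<open>auto simp: integrable_const_ivl\<close>)
  then show ?thesis by simp
qed

lemma cube_integrable:
  fixes g :: "'a::euclidean_space \<Rightarrow> real"
  assumes "continuous_on UNIV g"
  shows "set_integrable lborel unit_cube g"
  unfolding set_integrable_def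
  by (rule borel_integrable_compact) (auto intro: continuous_on_subset[OF assms])

lemma lborel_integral_split_coord:
  fixes F :: "'a::euclidean_space \<Rightarrow> real"
  assumes e: "e \<in> Basis" and F: "integrable lborel F"
  shows "(\<integral>x. F x \<partial>lborel) =
    (\<integral>x. (\<integral>y. F (y *\<^sub>R e + (\<Sum>b\<in>Basis - {e}. x b *\<^sub>R b)) \<partial>lborel) \<partial>(\<Pi>\<^sub>M b\<in>Basis - {e}. lborel))"
proof -
  interpret product_sigma_finite "\<lambda>_::'a. lborel :: real measure" by standard
  let ?P = "\<lambda>f. \<Sum>b\<in>(Basis::'a set). f b *\<^sub>R b"
  have [measurable]: "F \<in> borel_measurable borel" using F by auto
  have B: "insert e (Basis - {e}) = Basis" using e by auto
  have [measurable]: "?P \<in> measurable (\<Pi>\<^sub>M b\<in>(Basis::'a set). lborel) borel"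
    by measurable
  have i: "integrable (\<Pi>\<^sub>M b\<in>insert e (Basis - {e}). lborel) (\<lambda>f. F (?P f))"
    unfolding B using F by (subst (asm) lborel_eq) (subst (asm) integrable_distr_eq, auto)
  have "(\<integral>x. F x \<partial>lborel) = (\<integral>f. F (?P f) \<partial>(\<Pi>\<^sub>M b\<in>insert e (Basis - {e}). lborel))"
    unfolding B using F by (subst lborel_eq) (subst integral_distr, auto)
  also have "\<dots> = (\<integral>x. (\<integral>y. F (?P (x(e := y))) \<partial>lborel) \<partial>(\<Pi>\<^sub>M b\<in>Basis - {e}. lborel))"
    by (rule product_integral_insert[OF _ _ i]) auto
  also have "(\<lambda>x. \<integral>y. F (?P (x(e := y))) \<partial>lborel) =
      (\<lambda>x. (\<integral>y. F (y *\<^sub>R e + (\<Sum>b\<in>Basis - {e}. x b *\<^sub>R b)) \<partial>lborel))"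
  proof (intro ext Bochner_Integration.integral_cong refl arg_cong[where f=F])
    fix x y
    have "?P (x(e := y)) = (x(e := y)) e *\<^sub>R e + (\<Sum>b\<in>Basis - {e}. (x(e := y)) b *\<^sub>R b)"
      by (rule sum.remove) (use e in auto)
    also have "(\<Sum>b\<in>Basis - {e}. (x(e := y)) b *\<^sub>R b) = (\<Sum>b\<in>Basis - {e}. x b *\<^sub>R b)"
      by (rule sum.cong) auto
    finally show "?P (x(e := y)) = y *\<^sub>R e + (\<Sum>b\<in>Basis - {e}. x b *\<^sub>R b)" by simp
  qed
  finally show ?thesis .
qed

text \<open>Fubini in direction \<open>e\<close>. After integrating out this coordinate the function
  is constant in it, and integrating over \<open>[-1,1]\<close> once more produces the factor
  2.\<close>

lemma cube_integral_coord_int: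
  fixes g :: "'a::euclidean_space \<Rightarrow> real"
  assumes e: "e \<in> Basis" and g: "continuous_on UNIV g"
  shows "(LINT x:unit_cube|lborel. coord_int e g x) = 2 * (LINT x:unit_cube|lborel. g x)"
proof -
  let ?M = "\<Pi>\<^sub>M b\<in>Basis - {e}. (lborel :: real measure)"
  define X where "X x = (\<Sum>b\<in>Basis - {e}. x b *\<^sub>R b)" for x :: "'a \<Rightarrow> real"
  have Xe: "X x \<bullet> e = 0" for x
    unfolding X_def using e by (auto simp: inner_sum_left inner_Basis intro!: sum.neutral)
  have upd: "y *\<^sub>R e + X x = upd_coord e y (X x)" for x y by (simp add: upd_coord_def Xe)
  \<comment> \<open>The vector \<open>X x\<close> has coordinate 0 along \<open>e\<close>, which is
    within bounds, so its membership in the cube tests exactly the remaining coordinates.\<close>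
  have ind: "indicator unit_cube (upd_coord e y (X x)) = (indicator {-1..1} y * indicator unit_cube (X x) :: real)" for x y
  proof -
    have "upd_coord e y (X x) \<in> unit_cube \<longleftrightarrow> y \<in> {-1..1} \<and> X x \<in> unit_cube"
    proof
      assume a: "upd_coord e y (X x) \<in> unit_cube"
      then have "\<And>b. b \<in> Basis \<Longrightarrow> -1 \<le> upd_coord e y (X x) \<bullet> b \<and> upd_coord e y (X x) \<bullet> b \<le> 1"
        by (auto simp: mem_box)
      then have *: "\<And>b. b \<in> Basis \<Longrightarrow> -1 \<le> (if b = e then y else X x \<bullet> b) \<and> (if b = e then y else X x \<bullet> b) \<le> 1"
        using e by (simp add: upd_coord_inner)
      have "X x \<in> unit_cube" unfolding mem_box
      proof
        fix b :: 'a assume "b \<in> Basis"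
        then show "- One \<bullet> b \<le> X x \<bullet> b \<and> X x \<bullet> b \<le> One \<bullet> b"
          using *[of b] Xe[of x] by (cases "b = e") auto
      qed
      then show "y \<in> {-1..1} \<and> X x \<in> unit_cube" using *[OF e] by auto
    qed (use e upd_coord_cube in auto)
    then show ?thesis by (auto simp: indicator_def)
  qed
  have inner: "(\<integral>y. indicator unit_cube (y *\<^sub>R e + X x) *\<^sub>R h (y *\<^sub>R e + X x) \<partial>lborel)
      = indicator unit_cube (X x) * coord_int e h (X x)" if "continuous_on UNIV h" for h x
  proof -
    have "(\<integral>y. indicator unit_cube (y *\<^sub>R e + X x) *\<^sub>R h (y *\<^sub>R e + X x) \<partial>lborel)
        = indicator unit_cube (X x) * (LINT y:{-1..1}|lborel. h (upd_coord e y (X x)))"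
      unfolding upd ind set_lebesgue_integral_def
      by (simp only: Bochner_Integration.integral_mult_right_zero[symmetric] real_scaleR_def mult_ac)
    also have "(LINT y:{-1..1}|lborel. h (upd_coord e y (X x))) = coord_int e h (X x)"
      unfolding coord_int_def
      by (rule set_borel_integral_eq_integral)
         (auto intro!: borel_integrable_atLeastAtMost' continuous_line that)
    finally show ?thesis .
  qed
  have split: "(LINT x:unit_cube|lborel. h x) = (\<integral>x. indicator unit_cube (X x) * coord_int e h (X x) \<partial>?M)"
    if "continuous_on UNIV h" for h
    unfolding set_lebesgue_integral_def
    by (subst lborel_integral_split_coord[OF e])
       (use cube_integrable[OF that] inner[OF that] in \<open>auto simp: set_integrable_def X_def\<close>)
  have "coord_int e (coord_int e g) x = 2 * coord_int e g x" for x
    using e by (subst coord_int_def) simp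
  then show ?thesis
    using split[OF g] split[OF coord_int_continuous[OF g, of e]]
    by (simp add: mult.left_commute)
qed

lemma continuous_antiderivative:
  fixes h :: "real \<Rightarrow> real"
  assumes "continuous_on UNIV h"
  obtains H where "\<And>x. (H has_real_derivative h x) (at x)"
  using einterval_antiderivative[of "-\<infinity>" "\<infinity>" h] assms
  by (auto simp: continuous_on_eq_continuous_at has_real_derivative_iff_has_vector_derivative)

lemma integral_eq_antiderivative:
  fixes h :: "real \<Rightarrow> real"
  assumes "\<And>x. (H has_real_derivative h x) (at x)" "a \<le> b"
  shows "integral {a..b} h = H b - H a"
  by (rule integral_unique, rule fundamental_theorem_of_calculus)
     (use assms in \<open>auto simp: has_real_derivative_iff_has_vector_derivative[symmetric] intro: has_field_derivative_at_within\<close>)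

lemma affine_integral_eq_antiderivative:
  fixes h :: "real \<Rightarrow> real"
  assumes "\<And>x. (H has_real_derivative h x) (at x)"
  shows "integral {0..1} (\<lambda>s. c * h (a + c * s)) = H (a + c) - H a"
proof -
  have "integral {0..1} (\<lambda>s. h (a + c * s) * c) = H (a + c * 1) - H (a + c * 0)"
    by (rule integral_eq_antiderivative[where H="\<lambda>s. H (a + c * s)"])
       (auto intro!: DERIV_chain2[OF assms] derivative_eq_intros)
  then show ?thesis by (simp add: mult.commute)
qed

text \<open>With \<open>F\<close> the distribution function of \<open>h\<close> on
  \<open>[-1,1]\<close>, the variable Q(F) has mean zero because \<open>Q\<close> is odd about 1/2,
  and it increases with \<open>t\<close>, so its covariance with \<open>t\<close> is nonnegative.
  For the proof let \<open>K\<close> be the primitive of \<open>Q\<close> with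
  \<open>K 0 = 0\<close>. The derivative of \<open>t * K (F t)\<close> integrates to 0 since
  \<open>K\<close> vanishes at 0 and 1, so the wanted integral is, up to the mass, minus the
  integral of K(F), and \<open>K \<le> 0\<close> on \<open>[0,1]\<close>.\<close>

lemma monotone_covariance_nonneg:
  fixes h Q H :: "real \<Rightarrow> real"
  assumes H: "\<And>t. (H has_real_derivative h t) (at t)" and ch: "continuous_on UNIV h"
    and m: "H 1 - H (-1) > 0" "\<And>t. t \<in> {-1..1} \<Longrightarrow> H (-1) \<le> H t \<and> H t \<le> H 1"
    and Q: "continuous_on UNIV Q" "mono Q" "\<And>y. Q (1 - y) = - Q y"
  shows "integral {-1..1} (\<lambda>t. t * Q ((H t - H (-1)) / (H 1 - H (-1))) * h t) \<ge> 0"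
proof -
  define m where "m = H 1 - H (-1)"
  define F where "F t = (H t - H (-1)) / m" for t
  have m0: "m > 0" using m by (simp add: m_def)
  have F01: "F t \<in> {0..1}" if "t \<in> {-1..1}" for t
    using m(2)[OF that] m0 by (auto simp: F_def m_def)
  have dF: "(F has_real_derivative h t / m) (at t)" for t
    unfolding F_def using H[of t] m0 by (auto intro!: derivative_eq_intros)
  obtain K' where K': "\<And>x. (K' has_real_derivative Q x) (at x)"
    using continuous_antiderivative[OF Q(1)] by blast
  define K where "K y = K' y - K' 0" for y
  have dK: "(K has_real_derivative Q y) (at y)" for y
    unfolding K_def using K'[of y] by (auto intro!: derivative_eq_intros)
  \<comment> \<open>Oddness of \<open>Q\<close> about 1/2 makes \<open>K\<close> symmetric about
    1/2. This yields \<open>K 1 = K 0 = 0\<close> and reduces the sign of \<open>K\<close> to the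
    left half, where \<open>Q \<le> 0\<close>.\<close>
  have "((\<lambda>y. K y - K (1 - y)) has_real_derivative Q y - Q (1 - y) * (- 1)) (at y)" for y
    by (intro DERIV_diff dK DERIV_chain2[OF dK]) (auto intro!: derivative_eq_intros)
  then have "((\<lambda>y. K y - K (1 - y)) has_real_derivative 0) (at y)" for y using Q(3) by simp
  then have const: "K y - K (1 - y) = K 0 - K (1 - 0)" for y
    using DERIV_const_ratio_const DERIV_isconst_all by blast
  have K0: "K 0 = 0" by (simp add: K_def)
  have K1: "K 1 = 0" using const[of 1] K0 by simp
  have sym: "K y = K (1 - y)" for y using const[of y] K0 K1 by simp
  have Qhalf: "Q y \<le> 0" if "y \<le> 1/2" for y
  proof -
    have "Q (1/2) = 0" using Q(3)[of "1/2"] by simp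
    then show ?thesis using monoD[OF Q(2) that] by simp
  qed
  have Kneg': "K y \<le> 0" if "0 \<le> y" "y \<le> 1/2" for y
    using DERIV_nonpos_imp_nonincreasing[of 0 y K] that dK Qhalf K0 by fastforce
  have Kneg: "K y \<le> 0" if "y \<in> {0..1}" for y
    using Kneg'[of y] Kneg'[of "1 - y"] sym[of y] that by (cases "y \<le> 1/2") auto
  have cF: "continuous_on A F" for A
    using dF by (meson DERIV_isCont continuous_at_imp_continuous_on)
  have cK: "continuous_on A (\<lambda>t. K (F t))" for A
    by (rule continuous_on_compose2[of UNIV K, OF _ cF]) (use dK DERIV_isCont continuous_at_imp_continuous_on in blast, auto)
  have cQ: "continuous_on A (\<lambda>t. t * Q (F t) * (h t / m))" for A
    by (intro continuous_intros continuous_on_compose2[OF Q(1) cF] continuous_on_subset[OF ch]) (use m0 in auto)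
  have "((\<lambda>t. t * K (F t)) has_real_derivative K (F t) + t * Q (F t) * (h t / m)) (at t)" for t
    by (rule derivative_eq_intros DERIV_chain2[OF dK dF] refl | simp)+
  then have "integral {-1..1} (\<lambda>t. K (F t) + t * Q (F t) * (h t / m)) = 1 * K (F 1) - (-1) * K (F (-1))"
    by (rule integral_eq_antiderivative) simp
  also have "\<dots> = 0" using K0 K1 m0 by (simp add: F_def m_def)
  finally have "integral {-1..1} (\<lambda>t. K (F t)) + integral {-1..1} (\<lambda>t. t * Q (F t) * (h t / m)) = 0"
    by (subst (asm) Henstock_Kurzweil_Integration.integral_add) (intro integrable_continuous_interval cK cQ)+
  moreover have "integral {-1..1} (\<lambda>t. K (F t)) \<le> integral {-1..1::real} (\<lambda>t. 0)"
    by (rule integral_le) (auto intro!: integrable_continuous_interval cK Kneg F01)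
  moreover have "integral {-1..1} (\<lambda>t::real. 0::real) = 0" by simp
  ultimately have "0 \<le> integral {-1..1} (\<lambda>t. t * Q (F t) * (h t / m))" by linarith
  then have "0 \<le> m * integral {-1..1} (\<lambda>t. t * Q (F t) * (h t / m))"
    using m0 by (intro mult_nonneg_nonneg) (rule less_imp_le)
  also have "\<dots> = integral {-1..1} (\<lambda>t. m * (t * Q (F t) * (h t / m)))"
    by (rule integral_mult_right[symmetric])
  also have "(\<lambda>t. m * (t * Q (F t) * (h t / m))) = (\<lambda>t. t * Q (F t) * h t)" using m0 by auto
  finally show ?thesis by (simp add: F_def m_def)
qed

text \<open>The order of the coordinates given by \<open>e\<close> fixes the triangular structure.
  The lower bound \<open>d\<close> keeps every marginal positive, so that conditional densities are
  defined everywhere; \<open>l\<close> is the parameter of the slice quantiles.\<close>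

locale knothe =
  fixes e :: "nat \<Rightarrow> 'a::euclidean_space" and f :: "'a \<Rightarrow> real" and d l :: real and n :: nat
  assumes n_eq: "n = DIM('a)" and e_bij: "bij_betw e {..<n} Basis"
    and f_cont: "continuous_on UNIV f" and d_pos: "d > 0" and f_ge: "\<And>x. f x \<ge> d"
    and l: "0 < l" "l < 1"
begin

lemma e_Basis [simp]: "i < n \<Longrightarrow> e i \<in> Basis"
  using e_bij by (auto simp: bij_betw_def)

lemma e_inj: "i < n \<Longrightarrow> j < n \<Longrightarrow> i \<noteq> j \<Longrightarrow> e i \<noteq> e j"
  using e_bij by (auto simp: bij_betw_def inj_on_def)

text \<open>The last \<open>j\<close> coordinates \<open>e (n - 1)\<close>, ...,
  \<open>e (n - j)\<close> are integrated out, so \<open>marg i\<close> below is the joint density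
  of the first \<open>i\<close> coordinates: \<open>marg n\<close> is the density itself and
  \<open>marg 0\<close> its total mass over the cube.\<close>

fun iter_int :: "nat \<Rightarrow> 'a \<Rightarrow> real" where
  "iter_int 0 = f"
| "iter_int (Suc j) = coord_int (e (n - Suc j)) (iter_int j)"

definition marg :: "nat \<Rightarrow> 'a \<Rightarrow> real" where
  "marg i = iter_int (n - i)"

lemma marg_n: "marg n = f" by (simp add: marg_def)

lemma marg_rec: "i < n \<Longrightarrow> marg i = coord_int (e i) (marg (Suc i))"
proof -
  assume i: "i < n"
  then have "n - i = Suc (n - Suc i)" by simp
  then show ?thesis using i unfolding marg_def by simp
qed

lemma iter_int_cont: "continuous_on UNIV (iter_int j)"
  by (induction j) (auto simp: f_cont coord_int_continuous)

lemma marg_cont: "continuous_on UNIV (marg i)"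
  by (simp add: marg_def iter_int_cont)

lemma iter_int_ge: "iter_int j x \<ge> d"
proof (induction j arbitrary: x)
  case (Suc j)
  show ?case using coord_int_pos[OF iter_int_cont Suc.IH, of "e (n - Suc j)" x] d_pos by simp
qed (simp add: f_ge)

lemma marg_pos: "marg i x > 0"
  using iter_int_ge[of "n - i" x] d_pos by (simp add: marg_def)

lemma marg_nonzero: "marg i x \<noteq> 0"
  using marg_pos[of i x] by simp

lemma iter_int_upd: "n - j \<le> k \<Longrightarrow> k < n \<Longrightarrow> iter_int j (upd_coord (e k) t x) = iter_int j x"
proof (induction j arbitrary: x t)
  case (Suc j)
  show ?case
  proof (cases "k = n - Suc j")
    case True
    then show ?thesis using Suc.prems by simp
  next
    case False
    then have "n - j \<le> k" using Suc.prems by simp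
    then show ?thesis using Suc by (simp add: coord_int_upd_other)
  qed
qed simp

lemma marg_upd: "i \<le> k \<Longrightarrow> k < n \<Longrightarrow> marg i (upd_coord (e k) t x) = marg i x"
  unfolding marg_def by (rule iter_int_upd) auto

lemma marg_0_const: "marg 0 x = marg 0 0"
proof -
  \<comment> \<open>The point \<open>x\<close> with its coordinates before \<open>k\<close> set to
    0; passing from \<open>k\<close> to \<open>k + 1\<close> changes a single coordinate.\<close>
  define y where "y k = (\<Sum>j\<in>{k..<n}. (x \<bullet> e j) *\<^sub>R e j)" for k
  have "marg 0 (y k) = marg 0 (y n)" if "k \<le> n" for k
    using that
  proof (induction k rule: inc_induct)
    case (step k)
    have "{k..<n} = insert k {Suc k..<n}" using step by auto
    then have 1: "y k = (x \<bullet> e k) *\<^sub>R e k + y (Suc k)" by (simp add: y_def)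
    have "y (Suc k) \<bullet> e k = 0" unfolding y_def using step e_inj
      by (auto simp: inner_sum_left inner_Basis intro!: sum.neutral)
    then have "y k = upd_coord (e k) (x \<bullet> e k) (y (Suc k))"
      by (simp add: 1 upd_coord_def)
    then show ?case using marg_upd[of 0 k] step by simp
  qed simp
  from this[of 0] have "marg 0 (y 0) = marg 0 (y n)" by simp
  moreover have "y 0 = x"
  proof -
    have "y 0 = (\<Sum>b\<in>Basis. (x \<bullet> b) *\<^sub>R b)"
      unfolding y_def using sum.reindex_bij_betw[OF e_bij, of "\<lambda>b. (x \<bullet> b) *\<^sub>R b"]
      by (simp add: atLeast0LessThan)
    then show ?thesis by (simp add: euclidean_representation)
  qed
  moreover have "y n = 0" by (simp add: y_def)
  ultimately show ?thesis by simp
qed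

text \<open>Each of the \<open>n - i\<close> coordinates integrated out contributes one factor 2,
  and \<open>h\<close> passes through the integration because it is constant in just those
  coordinates.\<close>

lemma cube_integral_marg_mult:
  assumes i: "i \<le> n" and h: "continuous_on UNIV h"
    and ind: "\<And>k t x. i \<le> k \<Longrightarrow> k < n \<Longrightarrow> h (upd_coord (e k) t x) = h x"
  shows "(LINT x:unit_cube|lborel. h x * marg i x) = 2 ^ (n - i) * (LINT x:unit_cube|lborel. h x * f x)"
  using i ind
proof (induction i rule: inc_induct)
  case (step i)
  have "(LINT x:unit_cube|lborel. h x * marg i x)
      = (LINT x:unit_cube|lborel. coord_int (e i) (\<lambda>x. h x * marg (Suc i) x) x)"
    using step by (simp add: marg_rec coord_int_mult)
  also have "\<dots> = 2 * (LINT x:unit_cube|lborel. h x * marg (Suc i) x)"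
    by (rule cube_integral_coord_int) (use step in \<open>auto intro!: continuous_intros h marg_cont\<close>)
  also have "\<dots> = 2 * (2 ^ (n - Suc i) * (LINT x:unit_cube|lborel. h x * f x))"
    using step.IH step.prems by simp
  also have "\<dots> = 2 ^ (n - i) * (LINT x:unit_cube|lborel. h x * f x)"
    using step by (simp add: Suc_diff_Suc[symmetric])
  finally show ?case .
qed (simp add: marg_n)

lemma marg_0_eq: "marg 0 x = (LINT x:unit_cube|lborel. f x)"
proof -
  have c: "measure lborel (unit_cube :: 'a set) = 2 ^ n"
    by (subst content_cbox) (auto simp: n_eq)
  have "(LINT x:unit_cube|lborel. marg 0 x) = 2 ^ n * (LINT x:unit_cube|lborel. f x)"
    using cube_integral_marg_mult[of 0 "\<lambda>x. 1"] by simp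
  moreover have "(LINT x:unit_cube|lborel. marg 0 x) = (LINT x:(unit_cube::'a set)|lborel. marg 0 0)"
  proof -
    have "marg 0 = (\<lambda>_. marg 0 0)" by (rule ext) (rule marg_0_const)
    from arg_cong[OF this, of "\<lambda>g. LINT x:unit_cube|lborel. g x"] show ?thesis .
  qed
  moreover have "(LINT x:(unit_cube::'a set)|lborel. marg 0 0) = 2 ^ n * marg 0 0"
    using c by (simp add: set_lebesgue_integral_def mult.commute)
  ultimately show ?thesis using marg_0_const[of x] by simp
qed

definition slice_q :: "nat \<Rightarrow> real \<Rightarrow> real" where
  "slice_q k = (SOME Q. continuous_on UNIV Q \<and> (\<forall>x. \<bar>Q x\<bar> < 1) \<and> mono Q \<and> (\<forall>x. Q (1 - x) = - Q x) \<and>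
     (\<forall>x. 0 < x \<longrightarrow> x < 1 \<longrightarrow> (Q has_real_derivative l * ball_slice k / sqrt (1 - (Q x)\<^sup>2) ^ k) (at x)))"

lemma slice_q:
  shows slice_q_cont: "continuous_on UNIV (slice_q k)" and slice_q_less: "\<bar>slice_q k x\<bar> < 1"
    and slice_q_mono: "mono (slice_q k)" and slice_q_odd: "slice_q k (1 - x) = - slice_q k x"
    and slice_q_deriv: "0 < x \<Longrightarrow> x < 1 \<Longrightarrow>
      (slice_q k has_real_derivative l * ball_slice k / sqrt (1 - (slice_q k x)\<^sup>2) ^ k) (at x)"
proof -
  let ?P = "\<lambda>Q. continuous_on UNIV Q \<and> (\<forall>x. \<bar>Q x\<bar> < 1) \<and> mono Q \<and> (\<forall>x. Q (1 - x) = - Q x) \<and>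
     (\<forall>x. 0 < x \<longrightarrow> x < 1 \<longrightarrow> (Q has_real_derivative l * ball_slice k / sqrt (1 - (Q x)\<^sup>2) ^ k) (at x))"
  have "\<exists>Q. ?P Q"
  proof (rule slice_quantile[OF l, of k])
    fix Q :: "real \<Rightarrow> real"
    assume Q: "continuous_on UNIV Q" "\<And>x. \<bar>Q x\<bar> < 1" "mono Q" "\<And>x. Q (1 - x) = - Q x"
      "\<And>x. 0 < x \<Longrightarrow> x < 1 \<Longrightarrow> (Q has_real_derivative l * ball_slice k / sqrt (1 - (Q x)\<^sup>2) ^ k) (at x)"
    show "\<exists>Q. ?P Q" by (rule exI[of _ Q]) (intro conjI allI impI Q)
  qed
  then have "?P (SOME Q. ?P Q)" by (rule someI_ex)
  then have P: "?P (slice_q k)" unfolding slice_q_def .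
  from P show "continuous_on UNIV (slice_q k)" by (elim conjE)
  from P show "\<bar>slice_q k x\<bar> < 1" by (elim conjE) (erule spec)
  from P show "mono (slice_q k)" by (elim conjE)
  from P show "slice_q k (1 - x) = - slice_q k x" by (elim conjE) (erule spec)
  from P have "\<forall>x. 0 < x \<longrightarrow> x < 1 \<longrightarrow> (slice_q k has_real_derivative l * ball_slice k / sqrt (1 - (slice_q k x)\<^sup>2) ^ k) (at x)"
    by (elim conjE)
  then show "(slice_q k has_real_derivative l * ball_slice k / sqrt (1 - (slice_q k x)\<^sup>2) ^ k) (at x)" if "0 < x" "x < 1"
    using that by (elim allE impE)
qed

text \<open>The substitution \<open>t = -1 + (x \<bullet> e i + 1) s\<close> turns the integral of the marginal up to
  \<open>x \<bullet> e i\<close> into one over a fixed interval, which makes its continuity in \<open>x\<close> evident.\<close>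
definition cond_cdf :: "nat \<Rightarrow> 'a \<Rightarrow> real" where
  "cond_cdf i x = integral {0..1} (\<lambda>s. (x \<bullet> e i + 1) * marg (Suc i) (upd_coord (e i) (-1 + (x \<bullet> e i + 1) * s) x)) / marg i x"

text \<open>The target coordinate relative to its slice: once the first \<open>i\<close> target
  coordinates are fixed, the unit ball leaves a ball of radius \<open>radius i\<close>, and
  \<open>polar i\<close> in \<open>(-1,1)\<close> is the position along its first axis. The index
  \<open>n - Suc i\<close> counts the coordinates still to come, hence it is the dimension of the
  slices in the quantile.\<close>

definition polar :: "nat \<Rightarrow> 'a \<Rightarrow> real" where
  "polar i x = slice_q (n - Suc i) (cond_cdf i x)"

definition radius :: "nat \<Rightarrow> 'a \<Rightarrow> real" where
  "radius i x = (\<Prod>j<i. sqrt (1 - (polar j x)\<^sup>2))"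

definition T :: "nat \<Rightarrow> 'a \<Rightarrow> real" where
  "T i x = radius i x * polar i x"

text \<open>The diagonal entry of the Jacobian by the chain rule: derivative of the slice quantile
  times the conditional density \<open>marg (Suc i) x / marg i x\<close>. As a formula it is
  continuous on the whole space; it is the derivative of \<open>T i\<close> where coordinate
  \<open>i\<close> lies strictly inside \<open>(-1,1)\<close>.\<close>

definition DT :: "nat \<Rightarrow> 'a \<Rightarrow> real" where
  "DT i x = radius i x * (l * ball_slice (n - Suc i) / sqrt (1 - (polar i x)\<^sup>2) ^ (n - Suc i) * (marg (Suc i) x / marg i x))"

lemma cond_cdf_cont: "continuous_on UNIV (cond_cdf i)"
proof -
  have "continuous_on UNIV (\<lambda>x. integral (cbox 0 1) (\<lambda>s. (x \<bullet> e i + 1) * marg (Suc i) (upd_coord (e i) (-1 + (x \<bullet> e i + 1) * s) x)))"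
  proof (rule integral_continuous_on_param)
    show "continuous_on (UNIV \<times> cbox 0 1) (\<lambda>(x, s). (x \<bullet> e i + 1) * marg (Suc i) (upd_coord (e i) (-1 + (x \<bullet> e i + 1) * s) x))"
      unfolding case_prod_unfold
      by (intro continuous_intros continuous_on_compose2[OF marg_cont]) auto
  qed
  then have "continuous_on UNIV (\<lambda>x. integral {0..1} (\<lambda>s. (x \<bullet> e i + 1) * marg (Suc i) (upd_coord (e i) (-1 + (x \<bullet> e i + 1) * s) x)))"
    by (simp only: cbox_interval)
  from continuous_on_divide[OF this marg_cont[of i]] show ?thesis
    unfolding cond_cdf_def[abs_def] by (simp add: marg_nonzero)
qed

lemma polar_cont: "continuous_on UNIV (polar i)"
  unfolding polar_def[abs_def] by (rule continuous_on_compose2[OF slice_q_cont cond_cdf_cont subset_UNIV])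

lemma polar_less: "\<bar>polar i x\<bar> < 1" by (simp add: polar_def slice_q_less)

lemma polar_sq_less: "(polar i x)\<^sup>2 < 1" using polar_less[of i x] by (simp add: abs_square_less_1)

lemma radius_cont: "continuous_on UNIV (radius i)"
  unfolding radius_def[abs_def]
  by (intro continuous_on_prod continuous_on_real_sqrt continuous_on_diff continuous_on_const continuous_on_power polar_cont)

lemma T_cont: "continuous_on UNIV (T i)"
  unfolding T_def[abs_def] by (intro continuous_on_mult polar_cont radius_cont)

lemma radius_pos: "radius i x > 0"
  unfolding radius_def by (intro prod_pos) (simp add: polar_sq_less)

lemma DT_cont: "continuous_on UNIV (DT i)"
proof -
  have "sqrt (1 - (polar i x)\<^sup>2) ^ k \<noteq> 0" for x k
    using polar_sq_less[of i x] by simp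
  note nz = this
  show ?thesis
    unfolding DT_def[abs_def]
    by (intro continuous_on_mult continuous_on_divide continuous_on_power continuous_on_real_sqrt continuous_on_diff
        continuous_on_const polar_cont radius_cont marg_cont ballI nz marg_nonzero)
qed

lemma DT_nonneg: "DT i x \<ge> 0"
  unfolding DT_def
  by (intro mult_nonneg_nonneg divide_nonneg_nonneg zero_le_power real_sqrt_ge_zero
      less_imp_le[OF radius_pos] less_imp_le[OF ball_slice_pos] less_imp_le[OF marg_pos] less_imp_le[OF l(1)])
     (use polar_sq_less[of i x] in simp)

text \<open>Telescoping, since passing from \<open>radius m\<close> to \<open>radius (Suc m)\<close>
  removes exactly the square of \<open>T m\<close>. In particular the image lies in the open unit
  ball.\<close>

lemma sum_T_sq: "(\<Sum>i<m. (T i x)\<^sup>2) = 1 - (radius m x)\<^sup>2"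
proof (induction m)
  case (Suc m)
  have "(sqrt (1 - (polar m x)\<^sup>2))\<^sup>2 = 1 - (polar m x)\<^sup>2" using polar_sq_less[of m x] by simp
  then have "(radius (Suc m) x)\<^sup>2 = (radius m x)\<^sup>2 * (1 - (polar m x)\<^sup>2)"
    by (simp add: radius_def power_mult_distrib)
  then show ?case using Suc by (simp add: T_def power_mult_distrib algebra_simps)
qed (simp add: radius_def)

text \<open>The Jacobian equation of the triangular map. In the product over \<open>i\<close> the
  radii cancel the powers in the slice quantiles, the marginal quotients telescope to the density
  over its mass, and the slice constants multiply to the volume of the unit ball.\<close>

lemma prod_DT: "(\<Prod>i<n. DT i x) = l ^ n * unit_ball_vol (real n) * f x / marg 0 0"
proof -
  define c where "c j = sqrt (1 - (polar j x)\<^sup>2)" for j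
  have c: "c j > 0" for j using polar_sq_less[of j x] by (simp add: c_def)
  have marg0: "marg i x \<noteq> 0" for i using marg_pos[of i x] by simp
  have R: "(\<Prod>i<m. radius i x) = (\<Prod>j<m. c j ^ (m - Suc j))" for m
  proof (induction m)
    case (Suc m)
    have "(\<Prod>j<Suc m. c j ^ (Suc m - Suc j)) = (\<Prod>j<m. c j ^ (m - Suc j) * c j)"
      by (simp, intro prod.cong refl) (auto simp: Suc_diff_Suc power_Suc2[symmetric] simp del: power_Suc)
    then show ?case using Suc by (simp add: prod.distrib radius_def c_def)
  qed simp
  have M: "(\<Prod>i<m. marg (Suc i) x / marg i x) = marg m x / marg 0 x" for m
    by (induction m) (use marg0 in auto)
  have B: "(\<Prod>i<n. ball_slice (n - Suc i)) = unit_ball_vol (real n)"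
    unfolding unit_ball_vol_eq_prod by (rule prod.nat_diff_reindex)
  have C: "(\<Prod>j<n. c j ^ (n - Suc j)) \<noteq> 0" using c by (simp add: less_imp_neq[OF c, symmetric])
  have "(\<Prod>i<n. DT i x) = (\<Prod>i<n. radius i x) * (l ^ n * (\<Prod>i<n. ball_slice (n - Suc i)) / (\<Prod>j<n. c j ^ (n - Suc j)) * (\<Prod>i<n. marg (Suc i) x / marg i x))"
    unfolding DT_def c_def by (simp only: prod.distrib prod_dividef prod_constant card_lessThan)
  also have "\<dots> = l ^ n * unit_ball_vol (real n) * (marg n x / marg 0 x)"
    unfolding R B M using C by (simp only: times_divide_eq_right times_divide_eq_left) simp
  finally show ?thesis using marg_0_const[of x] by (simp add: marg_n)
qed

text \<open>On a line in direction \<open>e i\<close> the conditional distribution function is a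
  normalised primitive of the marginal. This form supplies its derivative and matches the hypotheses
  of \<open>monotone_covariance_nonneg\<close>.\<close>

lemma cond_cdf_line:
  assumes i: "i < n"
  obtains H where "\<And>t. (H has_real_derivative marg (Suc i) (upd_coord (e i) t x)) (at t)"
    "\<And>t. cond_cdf i (upd_coord (e i) t x) = (H t - H (-1)) / (H 1 - H (-1))"
    "H 1 - H (-1) = marg i x" "strict_mono H"
proof -
  let ?h = "\<lambda>t. marg (Suc i) (upd_coord (e i) t x)"
  obtain H where H: "\<And>t. (H has_real_derivative ?h t) (at t)"
    using continuous_antiderivative[OF continuous_line[OF marg_cont]] by blast
  have 1: "H 1 - H (-1) = marg i x"
    using integral_eq_antiderivative[of H ?h "-1" 1, OF H] i by (simp add: marg_rec coord_int_def)
  have 2: "cond_cdf i (upd_coord (e i) t x) = (H t - H (-1)) / (H 1 - H (-1))" for t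
    using affine_integral_eq_antiderivative[of H ?h "t + 1" "-1", OF H] 1 i
    by (simp add: cond_cdf_def upd_coord_inner marg_upd)
  have 3: "strict_mono H"
    using DERIV_pos_imp_increasing[of _ _ H] H marg_pos by (metis strict_monoI)
  show thesis by (rule that[OF H 2 1 3])
qed

text \<open>Triangularity: later coordinates have been integrated out of the marginals that enter
  component \<open>i\<close>.\<close>

lemma polar_upd: "i < k \<Longrightarrow> k < n \<Longrightarrow> polar i (upd_coord (e k) t x) = polar i x"
  using e_inj[of i k] by (simp add: polar_def cond_cdf_def upd_coord_inner marg_upd upd_coord_commute[of "e i" "e k"])

lemma radius_upd: "i \<le> k \<Longrightarrow> k < n \<Longrightarrow> radius i (upd_coord (e k) t x) = radius i x"
  unfolding radius_def by (intro prod.cong refl) (simp add: polar_upd)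

lemma T_upd: "i < k \<Longrightarrow> k < n \<Longrightarrow> T i (upd_coord (e k) t x) = T i x"
  by (simp add: T_def polar_upd radius_upd)

text \<open>The radius in front is constant along \<open>e i\<close>, so only the quantile is
  differentiated. The condition on \<open>x\<close> puts the conditional distribution function
  strictly between 0 and 1, the range in which the quantile is differentiable.\<close>

lemma T_deriv:
  assumes i: "i < n" and x: "\<bar>x \<bullet> e i\<bar> < 1"
  shows "((\<lambda>t. T i (x + t *\<^sub>R e i)) has_real_derivative DT i x) (at 0)"
proof -
  obtain H where H: "\<And>t. (H has_real_derivative marg (Suc i) (upd_coord (e i) t x)) (at t)"
    "\<And>t. cond_cdf i (upd_coord (e i) t x) = (H t - H (-1)) / (H 1 - H (-1))"
    "H 1 - H (-1) = marg i x" "strict_mono H" using cond_cdf_line[OF i, of x] by blast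
  define F where "F t = (H t - H (-1)) / marg i x" for t
  let ?a = "x \<bullet> e i"
  have Fa: "F ?a = cond_cdf i x" using H(2)[of ?a] H(3) by (simp add: F_def)
  have "H (-1) < H ?a" "H ?a < H 1"
    using strict_monoD[OF H(4), of "-1" ?a] strict_monoD[OF H(4), of ?a 1] x by (auto simp: abs_less_iff)
  then have F01: "0 < F ?a" "F ?a < 1"
    using H(3) marg_pos[of i x] by (simp_all add: F_def divide_less_eq)
  have dF: "((\<lambda>t. F (?a + t)) has_real_derivative marg (Suc i) x / marg i x) (at 0)"
  proof -
    have "(H has_real_derivative marg (Suc i) (upd_coord (e i) (?a + 0) x)) (at (?a + 0))" by (rule H(1))
    then have "((\<lambda>t. H (?a + t)) has_real_derivative marg (Suc i) x * 1) (at 0)"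
      by (intro DERIV_chain2[where f=H]) (auto intro!: derivative_eq_intros)
    then have "((\<lambda>t. (H (?a + t) - H (-1)) / marg i x) has_real_derivative (marg (Suc i) x * 1 - 0) / marg i x) (at 0)"
      by (intro DERIV_cdivide DERIV_diff DERIV_const)
    then show ?thesis by (simp add: F_def)
  qed
  have eq: "T i (x + t *\<^sub>R e i) = radius i x * slice_q (n - Suc i) (F (?a + t))" for t
    using i H(2)[of "?a + t"] H(3) by (simp add: upd_coord_add T_def radius_upd polar_def F_def)
  have "((\<lambda>t. slice_q (n - Suc i) (F (?a + t))) has_real_derivative
      l * ball_slice (n - Suc i) / sqrt (1 - (slice_q (n - Suc i) (F (?a + 0)))\<^sup>2) ^ (n - Suc i) * (marg (Suc i) x / marg i x)) (at 0)"
    by (rule DERIV_chain2[OF slice_q_deriv dF]) (use F01 in simp_all)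
  from DERIV_cmult[OF this, of "radius i x"] show ?thesis
    by (simp add: eq DT_def polar_def Fa)
qed

text \<open>This is the sign that makes the Euclidean isoperimetric constant survive the conformal factor.\<close>
lemma T_covariance:
  assumes i: "i < n"
  shows "(LINT x:unit_cube|lborel. f x * ((x \<bullet> e i) * T i x)) \<ge> 0"
proof -
  let ?h = "\<lambda>x. (x \<bullet> e i) * T i x"
  have ch: "continuous_on UNIV ?h" by (intro continuous_intros T_cont)
  \<comment> \<open>With the earlier coordinates fixed, this is the one-variable covariance for the
    density \<open>marg (Suc i)\<close> along a line, multiplied by the positive constant
    \<open>radius i x\<close>. Integrating over the remaining coordinates preserves the
    sign.\<close>
  have "coord_int (e i) (\<lambda>x. ?h x * marg (Suc i) x) x \<ge> 0" for x
  proof -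
    obtain H where H: "\<And>t. (H has_real_derivative marg (Suc i) (upd_coord (e i) t x)) (at t)"
      "\<And>t. cond_cdf i (upd_coord (e i) t x) = (H t - H (-1)) / (H 1 - H (-1))"
      "H 1 - H (-1) = marg i x" "strict_mono H" using cond_cdf_line[OF i, of x] by blast
    have "integral {-1..1} (\<lambda>t. t * slice_q (n - Suc i) ((H t - H (-1)) / (H 1 - H (-1))) * marg (Suc i) (upd_coord (e i) t x)) \<ge> 0"
    proof (rule monotone_covariance_nonneg[OF H(1) continuous_line[OF marg_cont] _ _ slice_q_cont slice_q_mono slice_q_odd])
      show "H 1 - H (-1) > 0" using H(3) marg_pos[of i x] by simp
      show "H (-1) \<le> H t \<and> H t \<le> H 1" if "t \<in> {-1..1}" for t
        using that strict_mono_less_eq[OF H(4)] by simp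
    qed
    then have "0 \<le> radius i x * integral {-1..1} (\<lambda>t. t * slice_q (n - Suc i) ((H t - H (-1)) / (H 1 - H (-1))) * marg (Suc i) (upd_coord (e i) t x))"
      using radius_pos[of i x] by (intro mult_nonneg_nonneg) (rule less_imp_le)
    also have "\<dots> = integral {-1..1} (\<lambda>t. radius i x * (t * slice_q (n - Suc i) ((H t - H (-1)) / (H 1 - H (-1))) * marg (Suc i) (upd_coord (e i) t x)))"
      by (rule integral_mult_right[symmetric])
    also have "\<dots> = coord_int (e i) (\<lambda>x. ?h x * marg (Suc i) x) x"
      unfolding coord_int_def
    proof (rule Henstock_Kurzweil_Integration.integral_cong)
      fix t
      have "upd_coord (e i) t x \<bullet> e i = t" using i by (simp add: upd_coord_inner)
      moreover have "T i (upd_coord (e i) t x) = radius i x * slice_q (n - Suc i) ((H t - H (-1)) / (H 1 - H (-1)))"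
        using i by (simp only: T_def polar_def radius_upd[OF order.refl i] H(2))
      ultimately show "radius i x * (t * slice_q (n - Suc i) ((H t - H (-1)) / (H 1 - H (-1))) * marg (Suc i) (upd_coord (e i) t x))
          = upd_coord (e i) t x \<bullet> e i * T i (upd_coord (e i) t x) * marg (Suc i) (upd_coord (e i) t x)"
        by (simp only: mult_ac)
    qed
    finally show ?thesis .
  qed
  then have "0 \<le> (LINT x:unit_cube|lborel. coord_int (e i) (\<lambda>x. ?h x * marg (Suc i) x) x)"
    unfolding set_lebesgue_integral_def by (intro Bochner_Integration.integral_nonneg) auto
  also have "\<dots> = 2 * (LINT x:unit_cube|lborel. ?h x * marg (Suc i) x)"
    by (rule cube_integral_coord_int) (use i in \<open>auto intro!: continuous_intros marg_cont T_cont\<close>)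
  also have "\<dots> = 2 * (2 ^ (n - Suc i) * (LINT x:unit_cube|lborel. ?h x * f x))"
    by (subst cube_integral_marg_mult)
       (use i ch e_inj in \<open>auto simp: upd_coord_inner T_upd Suc_le_eq\<close>)
  finally have "0 \<le> (2 * 2 ^ (n - Suc i)) * (LINT x:unit_cube|lborel. ?h x * f x)" by simp
  then have "0 \<le> (LINT x:unit_cube|lborel. ?h x * f x)"
    using mult_pos_neg[of "2 * 2 ^ (n - Suc i)"] by (meson not_le zero_less_mult_iff zero_less_numeral zero_less_power)
  then show ?thesis by (simp add: mult.commute)
qed

end

section \<open>The isoperimetric inequality\<close>

abbreviation rho :: "'a::euclidean_space \<Rightarrow> real" where "rho \<equiv> hyp_rho"

lemma norm_less_1_sq: "norm x < 1 \<Longrightarrow> (norm x)\<^sup>2 < 1"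
  by (simp add: power_less_one_iff)

lemma hyp_rho_ge_2: "norm x < 1 \<Longrightarrow> hyp_rho x \<ge> 2"
  using norm_less_1_sq[of x] by (simp add: hyp_rho_def field_simps)

lemma hyp_rho_pos: "norm x < 1 \<Longrightarrow> hyp_rho x > 0"
  using hyp_rho_ge_2[of x] by simp

lemma hyp_rho_continuous: "continuous_on (ball 0 1) (hyp_rho :: 'a::euclidean_space \<Rightarrow> real)"
  unfolding hyp_rho_def[abs_def] using norm_less_1_sq by (intro continuous_intros) force

lemma hyp_rho_measurable [measurable]: "hyp_rho \<in> borel_measurable borel"
  unfolding hyp_rho_def[abs_def] by measurable

lemma hyp_rho_line_derivative:
  fixes x :: "'a::euclidean_space"
  assumes x: "norm x < 1"
  shows "((\<lambda>t. hyp_rho (x + t *\<^sub>R e)) has_real_derivative (hyp_rho x)\<^sup>2 * (x \<bullet> e)) (at 0)"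
proof -
  have "((\<lambda>t. 2 / (1 - (x + t *\<^sub>R e) \<bullet> (x + t *\<^sub>R e))) has_real_derivative 4 * (x \<bullet> e) / (1 - x \<bullet> x)\<^sup>2) (at 0)"
  proof -
    have 1: "((\<lambda>t. 1 - (x \<bullet> x + 2 * t * (x \<bullet> e) + t\<^sup>2 * (e \<bullet> e))) has_real_derivative - (2 * (x \<bullet> e))) (at 0)"
      by (auto intro!: derivative_eq_intros)
    have 2: "(\<lambda>t. (x + t *\<^sub>R e) \<bullet> (x + t *\<^sub>R e)) = (\<lambda>t. x \<bullet> x + 2 * t * (x \<bullet> e) + t\<^sup>2 * (e \<bullet> e))"
      by (auto simp: inner_add_left inner_add_right inner_commute power2_eq_square algebra_simps)
    have 3: "1 - x \<bullet> x \<noteq> 0" using norm_less_1_sq[OF x] by (simp add: power2_norm_eq_inner)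
    show ?thesis
      unfolding fun_cong[OF 2]
      by (rule derivative_eq_intros 1 refl | use 3 in \<open>simp add: power2_eq_square field_simps\<close>)+
  qed
  then show ?thesis
    by (simp add: hyp_rho_def power2_norm_eq_inner power_divide)
qed

lemma continuous_on_local_support:
  fixes h :: "'a::t2_space \<Rightarrow> 'b::topological_space"
  assumes "open U" "compact K" "K \<subseteq> U" "continuous_on U h" "\<And>x. x \<notin> K \<Longrightarrow> h x = c"
  shows "continuous_on UNIV h"
proof -
  have "continuous_on (- K) h \<longleftrightarrow> continuous_on (- K) (\<lambda>x. c)"
    by (rule continuous_on_cong) (use assms in auto)
  then have "continuous_on (U \<union> - K) h"
    using assms by (intro continuous_on_open_Un) (auto simp: compact_imp_closed open_Compl)
  moreover have "U \<union> - K = UNIV" using assms by auto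
  ultimately show ?thesis by simp
qed

text \<open>If one endpoint lies outside \<open>C\<close>, then \<open>w\<close> vanishes there and
  the increment of \<open>w\<close> alone bounds the increment of the product. So \<open>b\<close>
  has to be controlled on \<open>C\<close> only, which suits factors that blow up at the unit
  sphere.\<close>

lemma line_lipschitz_mult:
  fixes w b :: "'a::real_normed_vector \<Rightarrow> real"
  assumes w: "\<And>x. \<bar>w x\<bar> \<le> M" "\<And>x t. \<bar>w (x + t *\<^sub>R e) - w x\<bar> \<le> L * \<bar>t\<bar>" "\<And>x. x \<notin> C \<Longrightarrow> w x = 0"
    and b: "\<And>x. x \<in> C \<Longrightarrow> \<bar>b x\<bar> \<le> M2"
      "\<And>x t. x \<in> C \<Longrightarrow> x + t *\<^sub>R e \<in> C \<Longrightarrow> \<bar>b (x + t *\<^sub>R e) - b x\<bar> \<le> L2 * \<bar>t\<bar>"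
    and M2: "M2 \<ge> 0" and L2: "L2 \<ge> 0"
  shows "\<bar>w (x + t *\<^sub>R e) * b (x + t *\<^sub>R e) - w x * b x\<bar> \<le> (M * L2 + L * M2) * \<bar>t\<bar>"
proof -
  let ?y = "x + t *\<^sub>R e"
  have M0: "M \<ge> 0" using w(1)[of 0] abs_ge_zero order_trans by blast
  have Lt: "L * \<bar>t\<bar> \<ge> 0" using w(2)[of 0 t] abs_ge_zero order_trans by blast
  have p: "M * L2 * \<bar>t\<bar> \<ge> 0" "L * M2 * \<bar>t\<bar> \<ge> 0"
    using M0 L2 mult_nonneg_nonneg[OF Lt M2] by (auto simp: mult_ac)
  consider "x \<in> C" "?y \<in> C" | "x \<in> C" "?y \<notin> C" | "x \<notin> C" "?y \<in> C" | "x \<notin> C" "?y \<notin> C" by blast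
  then show ?thesis
  proof cases
    case 1
    have "w ?y * b ?y - w x * b x = w ?y * (b ?y - b x) + (w ?y - w x) * b x" by (simp add: algebra_simps)
    also have "\<bar>\<dots>\<bar> \<le> \<bar>w ?y\<bar> * \<bar>b ?y - b x\<bar> + \<bar>w ?y - w x\<bar> * \<bar>b x\<bar>" by (metis abs_mult abs_triangle_ineq)
    also have "\<dots> \<le> M * (L2 * \<bar>t\<bar>) + (L * \<bar>t\<bar>) * M2"
      by (intro add_mono mult_mono w b 1) (use M0 Lt in auto)
    finally show ?thesis by (simp add: algebra_simps)
  next
    case 2
    have "\<bar>w ?y * b ?y - w x * b x\<bar> = \<bar>w ?y - w x\<bar> * \<bar>b x\<bar>" using w(3)[OF 2(2)] by (simp add: abs_mult)
    also have "\<dots> \<le> (L * \<bar>t\<bar>) * M2" by (intro mult_mono w b 2) (use Lt in auto)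
    finally show ?thesis using p by (simp add: algebra_simps)
  next
    case 3
    have "\<bar>w ?y * b ?y - w x * b x\<bar> = \<bar>w ?y - w x\<bar> * \<bar>b ?y\<bar>" using w(3)[OF 3(1)] by (simp add: abs_mult)
    also have "\<dots> \<le> (L * \<bar>t\<bar>) * M2" by (intro mult_mono w b 3) (use Lt in auto)
    finally show ?thesis using p by (simp add: algebra_simps)
  qed (use w(3) p in \<open>simp add: algebra_simps\<close>)
qed

lemma convex_line_lipschitz:
  fixes b :: "'a::real_normed_vector \<Rightarrow> real"
  assumes C: "convex C" and der: "\<And>x. x \<in> C \<Longrightarrow> ((\<lambda>t. b (x + t *\<^sub>R e)) has_real_derivative d x) (at 0)"
    and bd: "\<And>x. x \<in> C \<Longrightarrow> \<bar>d x\<bar> \<le> L" and x: "x \<in> C" "x + t *\<^sub>R e \<in> C"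
  shows "\<bar>b (x + t *\<^sub>R e) - b x\<bar> \<le> L * \<bar>t\<bar>"
proof -
  let ?S = "{s. x + s *\<^sub>R e \<in> C}"
  have S: "convex ?S"
  proof (rule convexI)
    fix r s u v :: real assume a: "r \<in> ?S" "s \<in> ?S" "0 \<le> u" "0 \<le> v" "u + v = 1"
    have "u *\<^sub>R (x + r *\<^sub>R e) + v *\<^sub>R (x + s *\<^sub>R e) = (u + v) *\<^sub>R x + (u *\<^sub>R r + v *\<^sub>R s) *\<^sub>R e"
      by (simp add: algebra_simps)
    then show "u *\<^sub>R r + v *\<^sub>R s \<in> ?S"
      using convexD[OF C, of "x + r *\<^sub>R e" "x + s *\<^sub>R e" u v] a by simp
  qed
  have "norm (b (x + t *\<^sub>R e) - b (x + 0 *\<^sub>R e)) \<le> L * norm (t - 0)"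
  proof (rule field_differentiable_bound[OF S, of "\<lambda>s. b (x + s *\<^sub>R e)" "\<lambda>s. d (x + s *\<^sub>R e)"])
    fix s assume s: "s \<in> ?S"
    then have "((\<lambda>t. (\<lambda>s. b (x + s *\<^sub>R e)) (t + s)) has_real_derivative d (x + s *\<^sub>R e)) (at 0)"
      using der[of "x + s *\<^sub>R e"] by (simp add: algebra_simps)
    then have "((\<lambda>s. b (x + s *\<^sub>R e)) has_real_derivative d (x + s *\<^sub>R e)) (at s)"
      using DERIV_shift[of "\<lambda>s. b (x + s *\<^sub>R e)" "d (x + s *\<^sub>R e)" 0 s] by simp
    then show "((\<lambda>s. b (x + s *\<^sub>R e)) has_real_derivative d (x + s *\<^sub>R e)) (at s within ?S)"
      by (rule has_field_derivative_at_within)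
  qed (use bd x in auto)
  then show ?thesis by simp
qed

lemma ball_subset_cube: "ball (0::'a::euclidean_space) 1 \<subseteq> unit_cube"
proof
  fix x :: 'a assume "x \<in> ball 0 1"
  then have "\<bar>x \<bullet> i\<bar> \<le> 1" if "i \<in> Basis" for i
    using Basis_le_norm[OF that, of x] by simp
  then show "x \<in> unit_cube" by (auto simp: mem_box abs_le_iff minus_le_iff)
qed

text \<open>The function \<open>w\<close> plays the role of a smoothed indicator of a level set, and
  \<open>g\<close> is its gradient almost everywhere, so that |g| stands for the boundary
  area.\<close>

locale ball_lipschitz =
  fixes w :: "'a::euclidean_space \<Rightarrow> real" and g :: "'a \<Rightarrow> 'a" and K :: "'a set" and L M :: real
  assumes K: "compact K" "K \<subseteq> ball 0 1" and wK: "\<And>x. x \<notin> K \<Longrightarrow> w x = 0" and gK: "\<And>x. x \<notin> K \<Longrightarrow> g x = 0"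
    and w_nonneg: "\<And>x. w x \<ge> 0" and w_le: "\<And>x. w x \<le> 1" and w_cont: "continuous_on UNIV w"
    and w_lip: "\<And>x t i. i \<in> Basis \<Longrightarrow> \<bar>w (x + t *\<^sub>R i) - w x\<bar> \<le> L * \<bar>t\<bar>"
    and g_meas [measurable]: "g \<in> borel_measurable borel" and g_bdd: "\<And>x. norm (g x) \<le> M"
    and w_der: "\<And>i. i \<in> Basis \<Longrightarrow> AE x in lborel. ((\<lambda>t. w (x + t *\<^sub>R i)) has_real_derivative (g x \<bullet> i)) (at 0)"
begin

lemma w_meas [measurable]: "w \<in> borel_measurable borel"
  by (rule borel_measurable_continuous_onI[OF w_cont])

lemma cont_mult_w:
  assumes "continuous_on (ball 0 1) b"
  shows "continuous_on UNIV (\<lambda>x. w x * b x)"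
  by (rule continuous_on_local_support[OF open_ball K, where c=0])
     (auto intro!: continuous_intros continuous_on_subset[OF w_cont] assms simp: wK)

lemma integrable_mult_w:
  assumes "continuous_on (ball 0 1) b"
  shows "integrable lborel (\<lambda>x. w x * b x)"
proof -
  have c: "continuous_on UNIV (\<lambda>x. w x * b x)" by (rule cont_mult_w[OF assms])
  obtain M where "\<And>x. norm (w x * b x) \<le> M"
    using continuous_compact_support_bounded[OF c K(1)] wK by (metis mult_zero_left)
  then show ?thesis
    by (intro integrable_bounded_support[where K=K and M=M])
       (use K wK c in \<open>auto intro: compact_imp_bounded borel_measurable_continuous_onI\<close>)
qed

definition f0 :: "'a \<Rightarrow> real" where "f0 x = w x * rho x ^ DIM('a)"

lemma rho_pow_cont: "continuous_on (ball 0 1) (\<lambda>x::'a. rho x ^ k)"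
  by (intro continuous_on_power hyp_rho_continuous)

lemma f0_cont: "continuous_on UNIV f0"
  unfolding f0_def[abs_def] by (rule cont_mult_w[OF rho_pow_cont])

lemma f0_nonneg: "f0 x \<ge> 0"
proof (cases "x \<in> K")
  case True
  then have "norm x < 1" using K by auto
  then show ?thesis using hyp_rho_pos[of x] w_nonneg[of x] by (simp add: f0_def)
qed (simp add: f0_def wK)

text \<open>Integrates the i-th derivative of \<open>w * rho^m * T\<close> with
  \<open>m = n - 1\<close>. Since the derivative of \<open>rho^m\<close> is m rho^(m+1) times the
  coordinate, the conformal factor reproduces the volume density \<open>f0\<close> in the middle
  term, which is why that term becomes a covariance.\<close>

lemma divergence_identity:
  fixes T D :: "'a \<Rightarrow> real"
  assumes i: "i \<in> Basis" and T: "continuous_on UNIV T" "continuous_on UNIV D"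
    and der: "\<And>x. norm x < 1 \<Longrightarrow> ((\<lambda>t. T (x + t *\<^sub>R i)) has_real_derivative D x) (at 0)"
  defines "m \<equiv> DIM('a) - 1"
  shows "integrable lborel (\<lambda>x. rho x ^ m * T x * (g x \<bullet> i))"
    "(\<integral>x. rho x ^ m * T x * (g x \<bullet> i) \<partial>lborel)
      + real m * (\<integral>x. f0 x * ((x \<bullet> i) * T x) \<partial>lborel) + (\<integral>x. w x * (rho x ^ m * D x) \<partial>lborel) = 0"
proof -
  have n: "DIM('a) = Suc m" using DIM_positive[where 'a='a] by (simp add: m_def)
  have [measurable]: "T \<in> borel_measurable borel" "D \<in> borel_measurable borel"
    using T by (auto intro: borel_measurable_continuous_onI)
  define b where "b x = rho x ^ m * T x" for x
  define d where "d x = real m * (rho x ^ Suc m * ((x \<bullet> i) * T x)) + rho x ^ m * D x" for x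
  have Tb: "continuous_on (ball 0 1) T" "continuous_on (ball 0 1) D" using T continuous_on_subset by blast+
  have cb: "continuous_on (ball 0 1) b" unfolding b_def by (intro continuous_on_mult rho_pow_cont Tb)
  have cd1: "continuous_on (ball 0 1) (\<lambda>x. rho x ^ Suc m * ((x \<bullet> i) * T x))"
    by (intro continuous_on_mult rho_pow_cont Tb continuous_on_inner continuous_on_id continuous_on_const)
  have cd2: "continuous_on (ball 0 1) (\<lambda>x. rho x ^ m * D x)"
    by (intro continuous_on_mult rho_pow_cont Tb)
  have cd: "continuous_on (ball 0 1) d" unfolding d_def
    by (intro continuous_on_add continuous_on_mult[OF continuous_on_const] cd1 cd2)
  have db: "((\<lambda>t. b (x + t *\<^sub>R i)) has_real_derivative d x) (at 0)" if x: "norm x < 1" for x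
  proof -
    have "((\<lambda>t. rho (x + t *\<^sub>R i) ^ m * T (x + t *\<^sub>R i)) has_real_derivative
        (real m * rho x ^ (m - 1) * (rho x ^ 2 * (x \<bullet> i))) * T x + rho x ^ m * D x) (at 0)"
      by (rule derivative_eq_intros hyp_rho_line_derivative[OF x] der[OF x] refl | simp)+
    moreover have "(real m * rho x ^ (m - 1) * (rho x ^ 2 * (x \<bullet> i))) * T x + rho x ^ m * D x = d x"
      \<comment> \<open>For \<open>m = 0\<close> the power \<open>m - 1\<close> is truncated, but
        its factor \<open>real m\<close> vanishes.\<close>
      by (cases m) (auto simp: d_def power2_eq_square mult_ac)
    ultimately show ?thesis by (simp only: b_def)
  qed
  \<comment> \<open>A closed ball around \<open>K\<close> inside the unit ball is convex, so the
    mean value bound applies along segments, and \<open>rho\<close> and the derivatives are bounded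
    on it.\<close>
  obtain r where r: "r < 1" "K \<subseteq> cball 0 r"
  proof (cases "K = {}")
    case True then show ?thesis using that[of 0] by simp
  next
    case False
    obtain y where y: "y \<in> K" "\<And>x. x \<in> K \<Longrightarrow> norm x \<le> norm y"
      using continuous_attains_sup[OF K(1) False, of norm] continuous_on_norm_id by auto
    have "norm y < 1" using y(1) K(2) by auto
    moreover have "K \<subseteq> cball 0 (norm y)" using y(2) by auto
    ultimately show ?thesis by (rule that)
  qed
  have rb: "cball 0 r \<subseteq> ball (0::'a) 1" using r by auto
  obtain M2 where M2: "M2 \<ge> 0" "\<And>x. x \<in> cball 0 r \<Longrightarrow> \<bar>b x\<bar> \<le> M2"
  proof -
    obtain C where "C > 0" "\<forall>y\<in>b ` cball 0 r. norm y \<le> C"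
      using compact_imp_bounded[OF compact_continuous_image[OF continuous_on_subset[OF cb rb] compact_cball]]
      unfolding bounded_pos by blast
    then show ?thesis using that[of C] by auto
  qed
  obtain L2 where L2: "L2 \<ge> 0" "\<And>x. x \<in> cball 0 r \<Longrightarrow> \<bar>d x\<bar> \<le> L2"
  proof -
    obtain C where "C > 0" "\<forall>y\<in>d ` cball 0 r. norm y \<le> C"
      using compact_imp_bounded[OF compact_continuous_image[OF continuous_on_subset[OF cd rb] compact_cball]]
      unfolding bounded_pos by blast
    then show ?thesis using that[of C] by auto
  qed
  have lip: "\<bar>w (x + t *\<^sub>R i) * b (x + t *\<^sub>R i) - w x * b x\<bar> \<le> (1 * L2 + L * M2) * \<bar>t\<bar>" for x t
  proof (rule line_lipschitz_mult[where C="cball 0 r"])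
    show "\<bar>b (x + t *\<^sub>R i) - b x\<bar> \<le> L2 * \<bar>t\<bar>" if "x \<in> cball 0 r" "x + t *\<^sub>R i \<in> cball 0 r" for x t
      by (rule convex_line_lipschitz[OF convex_cball _ L2(2) that]) (use db rb in auto)
    show "w x = 0" if "x \<notin> cball 0 r" for x using that r(2) wK by blast
    show "\<bar>w x\<bar> \<le> 1" for x using w_nonneg[of x] w_le[of x] by simp
  qed (use w_lip[OF i] M2 L2 in auto)
  let ?g' = "\<lambda>x. rho x ^ m * T x * (g x \<bullet> i) + w x * d x"
  have aeD: "AE x in lborel. ((\<lambda>t. w (x + t *\<^sub>R i) * b (x + t *\<^sub>R i)) has_real_derivative ?g' x) (at 0)"
    using w_der[OF i]
  proof eventually_elim
    case (elim x)
    show ?case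
    proof (cases "norm x < 1")
      case True
      show ?thesis
        by (rule derivative_eq_intros elim db[OF True] refl | simp add: b_def)+
    next
      case False
      then have xK: "x \<notin> K" using K by auto
      have "open (- K)" using K(1) by (simp add: compact_imp_closed open_Compl)
      then have "eventually (\<lambda>t. x + t *\<^sub>R i \<in> - K) (at 0)"
        by (intro topological_tendstoD[where l=x]) (use xK in \<open>auto intro!: tendsto_eq_intros\<close>)
      then have ev: "eventually (\<lambda>t. w (x + t *\<^sub>R i) * b (x + t *\<^sub>R i) = 0) (nhds 0)"
        unfolding eventually_at_filter using xK by (auto elim!: eventually_mono simp: wK)
      have "((\<lambda>t::real. 0::real) has_real_derivative 0) (at 0)" by simp
      then show ?thesis
        using DERIV_cong_ev[OF refl ev refl, of 0] xK by (simp add: gK wK)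
    qed
  qed
  have iw: "integrable lborel (\<lambda>x. w x * b x)" by (rule integrable_mult_w[OF cb])
  have z: "integrable lborel ?g'" "(\<integral>x. ?g' x \<partial>lborel) = 0"
    by (rule integral_directional_derivative_eq_0[OF iw _ compact_imp_bounded[OF K(1)] _ lip aeD];
        simp add: wK d_def b_def)+
  have iwd: "integrable lborel (\<lambda>x. w x * d x)" by (rule integrable_mult_w[OF cd])
  show i1: "integrable lborel (\<lambda>x. rho x ^ m * T x * (g x \<bullet> i))"
    using Bochner_Integration.integrable_diff[OF z(1) iwd] by simp
  have i2: "integrable lborel (\<lambda>x. f0 x * ((x \<bullet> i) * T x))"
    using integrable_mult_w[OF cd1] by (simp add: f0_def n mult_ac)
  have i3: "integrable lborel (\<lambda>x. w x * (rho x ^ m * D x))" by (rule integrable_mult_w[OF cd2])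
  have e: "?g' = (\<lambda>x. rho x ^ m * T x * (g x \<bullet> i) + real m * (f0 x * ((x \<bullet> i) * T x)) + w x * (rho x ^ m * D x))"
    by (rule ext) (simp add: d_def f0_def n algebra_simps)
  have "(\<integral>x. ?g' x \<partial>lborel) = (\<integral>x. rho x ^ m * T x * (g x \<bullet> i) \<partial>lborel)
      + real m * (\<integral>x. f0 x * ((x \<bullet> i) * T x) \<partial>lborel) + (\<integral>x. w x * (rho x ^ m * D x) \<partial>lborel)"
    unfolding e using i1 i2 i3 by simp
  then show "(\<integral>x. rho x ^ m * T x * (g x \<bullet> i) \<partial>lborel)
      + real m * (\<integral>x. f0 x * ((x \<bullet> i) * T x) \<partial>lborel) + (\<integral>x. w x * (rho x ^ m * D x) \<partial>lborel) = 0"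
    using z(2) by simp
qed

text \<open>The divergence identities are summed over all coordinates: the terms with derivatives of
  \<open>T\<close> are bounded below, those with \<open>g\<close> above, and the covariances have
  the good sign up to an error. In the bound, \<open>2 ^ n * d\<close> is the mass that the added
  constant puts on the cube; the last summand collects the covariance errors, at most
  \<open>2 ^ n * d\<close> per coordinate with weight \<open>n - 1 < n\<close>.\<close>

lemma isoperimetric_approx:
  assumes d: "d > 0" and l: "0 < l" "l < 1"
  defines "n \<equiv> DIM('a)"
  shows "real n * l * unit_ball_vol (real n) powr (1 / real n) * (\<integral>x. rho x ^ n * w x powr (1 + 1 / real n) \<partial>lborel)
    \<le> ((\<integral>x. f0 x \<partial>lborel) + 2 ^ n * d) powr (1 / real n)
        * ((\<integral>x. rho x ^ (n - 1) * norm (g x) \<partial>lborel) + real n * real n * 2 ^ n * d)"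
proof -
  define m where "m = n - 1"
  have n0: "n > 0" by (simp add: n_def)
  have nm: "n = Suc m" using n0 by (simp add: m_def)
  obtain e :: "nat \<Rightarrow> 'a" where e: "bij_betw e {..<n} Basis"
    using ex_bij_betw_nat_finite[of "Basis :: 'a set"] by (auto simp: n_def atLeast0LessThan)
  have fd: "continuous_on UNIV (\<lambda>x. f0 x + d)" by (intro continuous_intros f0_cont)
  interpret kn: knothe e "\<lambda>x. f0 x + d" d l n
    by unfold_locales (use e fd d f0_nonneg l in \<open>auto simp: n_def\<close>)
  have eB: "e i \<in> Basis" if "i < n" for i using that by (rule kn.e_Basis)
  have cube_meas: "measure lborel (unit_cube :: 'a set) = 2 ^ n"
    by (subst content_cbox) (auto simp: n_def)
  have cube_fin: "emeasure lborel (unit_cube :: 'a set) < \<infinity>"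
    by (rule emeasure_bounded_finite) simp
  let ?V = "unit_ball_vol (real n)"
  define M0 where "M0 = kn.marg 0 0"
  have f0_cube: "f0 x = indicator unit_cube x * f0 x" for x
    using wK[of x] K(2) ball_subset_cube by (cases "x \<in> K") (auto simp: f0_def indicator_def)
  have if0: "integrable lborel f0"
    unfolding f0_def[abs_def] by (rule integrable_mult_w[OF rho_pow_cont])
  have M0: "M0 = (\<integral>x. f0 x \<partial>lborel) + 2 ^ n * d"
  proof -
    have "M0 = (\<integral>x. indicator unit_cube x * f0 x + indicator unit_cube x * d \<partial>lborel)"
      unfolding M0_def by (subst kn.marg_0_eq) (simp add: set_lebesgue_integral_def algebra_simps)
    also have "\<dots> = (\<integral>x. f0 x \<partial>lborel) + 2 ^ n * d"
      unfolding f0_cube[symmetric] using if0 cube_meas cube_fin by (subst Bochner_Integration.integral_add) auto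
    finally show ?thesis .
  qed
  have M0_pos: "M0 > 0" unfolding M0_def by (rule kn.marg_pos)
  have Tle: "\<bar>kn.T i x\<bar> \<le> 1" for i x
  proof -
    have "(kn.T i x)\<^sup>2 \<le> (\<Sum>j<Suc i. (kn.T j x)\<^sup>2)" by (simp add: sum_nonneg)
    also have "\<dots> \<le> 1" by (simp only: kn.sum_T_sq) simp
    finally show ?thesis by (simp add: abs_square_le_1)
  qed
  have Tder: "((\<lambda>t. kn.T i (x + t *\<^sub>R e i)) has_real_derivative kn.DT i x) (at 0)" if "i < n" "norm x < 1" for i x
    by (rule kn.T_deriv[OF that(1)]) (use Basis_le_norm[OF eB[OF that(1)], of x] that in simp)
  define I1 where "I1 i = (\<integral>x. rho x ^ m * kn.T i x * (g x \<bullet> e i) \<partial>lborel)" for i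
  define I2 where "I2 i = (\<integral>x. f0 x * ((x \<bullet> e i) * kn.T i x) \<partial>lborel)" for i
  define I3 where "I3 i = (\<integral>x. w x * (rho x ^ m * kn.DT i x) \<partial>lborel)" for i
  have ident: "I1 i + real m * I2 i + I3 i = 0" and i1: "integrable lborel (\<lambda>x. rho x ^ m * kn.T i x * (g x \<bullet> e i))"
    if "i < n" for i
    using divergence_identity[OF eB[OF that] kn.T_cont kn.DT_cont Tder[OF that]]
    by (auto simp: I1_def I2_def I3_def m_def n_def)
  \<comment> \<open>The covariance inequality concerns \<open>f0 + d\<close> on the cube. There both
    the coordinate and \<open>T i\<close> are at most 1 in absolute value, so the share of
    \<open>d\<close> is at most \<open>d\<close> times the volume of the cube.\<close>
  have I2_ge: "I2 i \<ge> - (2 ^ n * d)" if i: "i < n" for i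
  proof -
    let ?h = "\<lambda>x. (x \<bullet> e i) * kn.T i x"
    have ch: "continuous_on UNIV ?h" by (intro continuous_on_mult kn.T_cont continuous_on_inner continuous_on_id continuous_on_const)
    have ih: "integrable lborel (\<lambda>x. indicator unit_cube x * ?h x)"
      using cube_integrable[OF ch] by (simp add: set_integrable_def)
    have "integrable lborel (\<lambda>x. indicator unit_cube x * (f0 x * ?h x))"
      using cube_integrable[OF continuous_on_mult[OF f0_cont ch]] by (simp add: set_integrable_def)
    moreover have "(\<lambda>x. indicator unit_cube x * (f0 x * ?h x)) = (\<lambda>x. f0 x * ?h x)"
      by (rule ext) (metis f0_cube mult.assoc)
    ultimately have ifh: "integrable lborel (\<lambda>x. f0 x * ?h x)" by simp
    have "0 \<le> (LINT x:unit_cube|lborel. (f0 x + d) * ?h x)" by (rule kn.T_covariance[OF i])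
    also have "\<dots> = (\<integral>x. f0 x * ?h x + d * (indicator unit_cube x * ?h x) \<partial>lborel)"
      unfolding set_lebesgue_integral_def
    proof (rule Bochner_Integration.integral_cong[OF refl])
      fix x show "indicator unit_cube x *\<^sub>R ((f0 x + d) * ?h x) = f0 x * ?h x + d * (indicator unit_cube x * ?h x)"
        using f0_cube[of x] by (cases "x \<in> unit_cube") (auto simp: algebra_simps)
    qed
    also have "\<dots> = I2 i + d * (\<integral>x. indicator unit_cube x * ?h x \<partial>lborel)"
      using ifh ih by (simp add: I2_def)
    also have "(\<integral>x. indicator unit_cube x * ?h x \<partial>lborel) \<le> (\<integral>x. indicator (unit_cube::'a set) x \<partial>lborel)"
    proof (rule integral_mono[OF ih])
      fix x :: 'a
      show "indicator unit_cube x * ?h x \<le> (indicator unit_cube x :: real)"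
      proof (cases "x \<in> unit_cube")
        case True
        then have "\<bar>x \<bullet> e i\<bar> \<le> 1" using eB[OF i] by (auto simp: mem_box abs_le_iff minus_le_iff)
        then have "\<bar>?h x\<bar> \<le> 1 * 1" unfolding abs_mult by (intro mult_mono Tle) auto
        then show ?thesis using True by simp
      qed simp
    qed (use cube_fin in auto)
    finally show ?thesis using d cube_meas by (simp add: mult.commute[of d])
  qed
  have gi: "integrable lborel (\<lambda>x. rho x ^ m * norm (g x))"
  proof -
    define G where "G x = indicator K x * rho x ^ m" for x
    have iG: "integrable lborel G"
      using borel_integrable_compact[OF K(1) continuous_on_subset[OF rho_pow_cont K(2)], of m] by (simp add: G_def[abs_def])
    show ?thesis
      by (rule Bochner_Integration.integrable_bound[OF integrable_mult_right[OF iG, of M]])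
         (auto simp: G_def indicator_def gK abs_mult intro!: AE_I2 mult_mono g_bdd order_trans[OF g_bdd abs_ge_self] simp: mult.commute[of M])
  qed
  have S1: "- (\<Sum>i<n. I1 i) \<le> (\<integral>x. rho x ^ m * norm (g x) \<partial>lborel)"
  proof -
    have "- (\<Sum>i<n. I1 i) = (\<integral>x. - (\<Sum>i<n. rho x ^ m * kn.T i x * (g x \<bullet> e i)) \<partial>lborel)"
      using i1 by (simp add: I1_def Bochner_Integration.integral_sum)
    also have "\<dots> \<le> (\<integral>x. rho x ^ m * norm (g x) \<partial>lborel)"
    proof (rule integral_mono[OF _ gi])
      show "integrable lborel (\<lambda>x. - (\<Sum>i<n. rho x ^ m * kn.T i x * (g x \<bullet> e i)))"
        using i1 by auto
      fix x :: 'a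
      show "- (\<Sum>i<n. rho x ^ m * kn.T i x * (g x \<bullet> e i)) \<le> rho x ^ m * norm (g x)"
      proof (cases "x \<in> K")
        case True
        then have r: "rho x > 0" using K hyp_rho_pos[of x] by auto
        \<comment> \<open>Cauchy-Schwarz, with the vector of the \<open>T i\<close> inside the unit
          ball: the only place where the shape of the target enters.\<close>
        have "(\<Sum>i<n. kn.T i x * (g x \<bullet> e i))\<^sup>2 \<le> (\<Sum>i<n. (kn.T i x)\<^sup>2) * (\<Sum>i<n. (g x \<bullet> e i)\<^sup>2)"
          by (rule Cauchy_Schwarz_ineq_sum)
        also have "(\<Sum>i<n. (g x \<bullet> e i)\<^sup>2) = (\<Sum>b\<in>Basis. (g x \<bullet> b)\<^sup>2)"
          by (rule sum.reindex_bij_betw[OF e])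
        also have "\<dots> = (norm (g x))\<^sup>2" by (simp add: norm_eq_sqrt_inner euclidean_inner[of "g x" "g x"] power2_eq_square sum_nonneg)
        also have "(\<Sum>i<n. (kn.T i x)\<^sup>2) * (norm (g x))\<^sup>2 \<le> 1 * (norm (g x))\<^sup>2"
          by (intro mult_right_mono) (simp_all add: kn.sum_T_sq)
        finally have "\<bar>\<Sum>i<n. kn.T i x * (g x \<bullet> e i)\<bar> \<le> norm (g x)"
          by (simp add: abs_le_square_iff[symmetric])
        then have "- (\<Sum>i<n. kn.T i x * (g x \<bullet> e i)) \<le> norm (g x)" by simp
        then have "rho x ^ m * - (\<Sum>i<n. kn.T i x * (g x \<bullet> e i)) \<le> rho x ^ m * norm (g x)"
          using r by (intro mult_left_mono) auto
        then show ?thesis by (simp add: sum_distrib_left mult.assoc)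
      qed (simp add: gK)
    qed
    finally show ?thesis .
  qed
  let ?c = "real n * l * ?V powr (1 / real n) / M0 powr (1 / real n)"
  let ?A = "\<lambda>x. rho x ^ n * w x powr (1 + 1 / real n)"
  have S3: "?c * (\<integral>x. ?A x \<partial>lborel) \<le> (\<Sum>i<n. I3 i)"
  proof -
    have cw: "continuous_on UNIV (\<lambda>x. w x powr (1 / real n))"
      by (rule continuous_on_powr'[OF w_cont continuous_on_const]) (use n0 w_nonneg in auto)
    have Aeq: "?A x = w x * (rho x ^ n * w x powr (1 / real n))" for x
      using w_nonneg[of x] by (cases "w x = 0") (auto simp: powr_add)
    have iA: "integrable lborel ?A"
      unfolding Aeq by (intro integrable_mult_w continuous_on_mult rho_pow_cont continuous_on_subset[OF cw]) auto
    have iD: "integrable lborel (\<lambda>x. w x * (rho x ^ m * kn.DT i x))" for i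
      by (intro integrable_mult_w continuous_on_mult rho_pow_cont continuous_on_subset[OF kn.DT_cont]) auto
    have "?c * (\<integral>x. ?A x \<partial>lborel) = (\<integral>x. ?c * ?A x \<partial>lborel)" by simp
    also have "\<dots> \<le> (\<integral>x. (\<Sum>i<n. w x * (rho x ^ m * kn.DT i x)) \<partial>lborel)"
    proof (rule integral_mono)
      show "integrable lborel (\<lambda>x. ?c * ?A x)" using iA by simp
      show "integrable lborel (\<lambda>x. \<Sum>i<n. w x * (rho x ^ m * kn.DT i x))" using iD by simp
      fix x :: 'a
      show "?c * ?A x \<le> (\<Sum>i<n. w x * (rho x ^ m * kn.DT i x))"
      proof (cases "x \<in> K")
        case True
        then have r: "rho x > 0" using K hyp_rho_pos[of x] by auto
        \<comment> \<open>The geometric mean of the diagonal is known from the Jacobian equation.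
          Dropping \<open>d\<close> from the density, its n-th root contains
          \<open>rho x * w x powr (1/n)\<close>; multiplied by the weight
          \<open>w x * rho x ^ m\<close> this gives the integrand with exponent
          \<open>1 + 1/n\<close>.\<close>
        have "(\<Prod>i<n. kn.DT i x) powr (1 / real (card {..<n})) \<le> (\<Sum>i<n. kn.DT i x / real (card {..<n}))"
          by (rule arith_geom_mean) (use n0 kn.DT_nonneg in auto)
        then have am: "real n * (\<Prod>i<n. kn.DT i x) powr (1 / real n) \<le> (\<Sum>i<n. kn.DT i x)"
          using n0 by (simp add: sum_divide_distrib[symmetric] field_simps)
        have "l ^ n * ?V * f0 x / M0 \<le> l ^ n * ?V * (f0 x + d) / M0"
          using l d M0_pos by (intro divide_right_mono mult_left_mono) auto
        also have "\<dots> = (\<Prod>i<n. kn.DT i x)" by (simp add: kn.prod_DT M0_def)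
        finally have pr: "(l ^ n * ?V * f0 x / M0) powr (1 / real n) \<le> (\<Prod>i<n. kn.DT i x) powr (1 / real n)"
          using l M0_pos f0_nonneg by (intro powr_mono2) auto
        have ln: "(l ^ n) powr (1 / real n) = l" "(rho x ^ n) powr (1 / real n) = rho x"
          using l r n0 by (simp_all add: powr_realpow[symmetric] powr_powr)
        have "(l ^ n * ?V * f0 x / M0) powr (1 / real n) = l * ?V powr (1 / real n) * (w x powr (1 / real n) * rho x) / M0 powr (1 / real n)"
          using l M0_pos w_nonneg[of x] r by (simp add: f0_def powr_mult powr_divide ln n_def[symmetric])
        then have "?c * (w x powr (1 / real n) * rho x) = real n * (l ^ n * ?V * f0 x / M0) powr (1 / real n)"
          by simp
        also have "\<dots> \<le> (\<Sum>i<n. kn.DT i x)" using pr am n0 by (meson mult_left_mono of_nat_0_le_iff order_trans)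
        finally have "(w x * rho x ^ m) * (?c * (w x powr (1 / real n) * rho x)) \<le> (w x * rho x ^ m) * (\<Sum>i<n. kn.DT i x)"
          using r w_nonneg[of x] by (intro mult_left_mono) auto
        moreover have "rho x ^ n = rho x ^ m * rho x" by (simp add: nm)
        then have "(w x * rho x ^ m) * (?c * (w x powr (1 / real n) * rho x)) = ?c * ?A x"
          unfolding Aeq by (simp only: mult_ac)
        moreover have "(w x * rho x ^ m) * (\<Sum>i<n. kn.DT i x) = (\<Sum>i<n. w x * (rho x ^ m * kn.DT i x))"
          by (simp only: sum_distrib_left mult.assoc)
        ultimately show ?thesis by (simp only:)
      qed (simp add: wK)
    qed
    also have "\<dots> = (\<Sum>i<n. I3 i)" using iD by (simp add: I3_def Bochner_Integration.integral_sum)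
    finally show ?thesis .
  qed
  have E3: "(\<Sum>i<n. I3 i) = - (\<Sum>i<n. I1 i) + real m * (\<Sum>i<n. - I2 i)"
  proof -
    have "I3 i = - I1 i + real m * - I2 i" if "i < n" for i using ident[OF that] by simp
    then have "(\<Sum>i<n. I3 i) = (\<Sum>i<n. - I1 i + real m * - I2 i)" by (intro sum.cong) auto
    then show ?thesis by (simp add: sum_subtractf sum_negf sum_distrib_left)
  qed
  have "(\<Sum>i<n. - I2 i) \<le> (\<Sum>i<n. 2 ^ n * d)"
    by (intro sum_mono) (use I2_ge in \<open>auto simp: minus_le_iff\<close>)
  then have "real m * (\<Sum>i<n. - I2 i) \<le> real m * (\<Sum>i<n. 2 ^ n * d)" by (rule mult_left_mono) simp
  also have "\<dots> \<le> real n * (\<Sum>i<n. 2 ^ n * d)"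
    using d by (intro mult_right_mono sum_nonneg) (auto simp: nm)
  also have "\<dots> = real n * real n * 2 ^ n * d" by simp
  finally have fin: "?c * (\<integral>x. ?A x \<partial>lborel) \<le> (\<integral>x. rho x ^ m * norm (g x) \<partial>lborel) + real n * real n * 2 ^ n * d"
    using S1 S3 E3 by linarith
  have "real n * l * ?V powr (1 / real n) * (\<integral>x. ?A x \<partial>lborel) = M0 powr (1 / real n) * (?c * (\<integral>x. ?A x \<partial>lborel))"
    using M0_pos by simp
  also have "\<dots> \<le> M0 powr (1 / real n) * ((\<integral>x. rho x ^ m * norm (g x) \<partial>lborel) + real n * real n * 2 ^ n * d)"
    by (intro mult_left_mono fin) simp
  finally show ?thesis by (simp only: M0 m_def)
qed

text \<open>Limit of the previous bound as \<open>d\<close> tends to 0 and \<open>l\<close> to 1.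
  For \<open>w\<close> close to the indicator of a set it reads n V^(1/n) vol <= vol^(1/n) per, the
  Euclidean isoperimetric inequality for hyperbolic volume and perimeter.\<close>

theorem isoperimetric_L1:
  defines "n \<equiv> DIM('a)"
  shows "real n * unit_ball_vol (real n) powr (1 / real n) * (\<integral>x. rho x ^ n * w x powr (1 + 1 / real n) \<partial>lborel)
    \<le> (\<integral>x. rho x ^ n * w x \<partial>lborel) powr (1 / real n) * (\<integral>x. rho x ^ (n - 1) * norm (g x) \<partial>lborel)"
proof -
  have n0: "n > 0" by (simp add: n_def)
  define d where "d k = 1 / real (Suc k)" for k
  define l where "l k = 1 - 1 / real (Suc (Suc k))" for k
  have d0: "d \<longlonglongrightarrow> 0" unfolding d_def using LIMSEQ_Suc[OF lim_1_over_n] .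
  have l1: "l \<longlonglongrightarrow> 1 - 0" unfolding l_def
    by (intro tendsto_diff tendsto_const) (use LIMSEQ_Suc[OF LIMSEQ_Suc[OF lim_1_over_n]] in simp)
  let ?A = "\<integral>x. rho x ^ n * w x powr (1 + 1 / real n) \<partial>lborel"
  let ?B = "\<integral>x. f0 x \<partial>lborel" and ?D = "\<integral>x. rho x ^ (n - 1) * norm (g x) \<partial>lborel"
  have B0: "?B \<ge> 0" by (intro Bochner_Integration.integral_nonneg f0_nonneg)
  have L: "(\<lambda>k. real n * l k * unit_ball_vol (real n) powr (1 / real n) * ?A) \<longlonglongrightarrow> real n * (1 - 0) * unit_ball_vol (real n) powr (1 / real n) * ?A"
    by (intro tendsto_intros l1)
  have R: "(\<lambda>k. (?B + 2 ^ n * d k) powr (1 / real n) * (?D + real n * real n * 2 ^ n * d k))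
      \<longlonglongrightarrow> (?B + 2 ^ n * 0) powr (1 / real n) * (?D + real n * real n * 2 ^ n * 0)"
    by (intro tendsto_mult tendsto_powr' tendsto_add tendsto_const d0)
       (use n0 B0 in \<open>auto simp: d_def\<close>)
  have "real n * (1 - 0) * unit_ball_vol (real n) powr (1 / real n) * ?A
      \<le> (?B + 2 ^ n * 0) powr (1 / real n) * (?D + real n * real n * 2 ^ n * 0)"
    by (rule LIMSEQ_le[OF L R])
       (intro exI[of _ 0] allI impI isoperimetric_approx[folded n_def], auto simp: d_def l_def field_simps)
  then show ?thesis by (simp add: f0_def n_def mult.commute)
qed

end

section \<open>Rearrangement to radial profiles\<close>

text \<open>A discrete layer-cake principle: the levels reached at a given point form an initial
  segment, so the sum of the increments over them telescopes to a single level.\<close>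

lemma initial_segment:
  assumes "\<And>k. P (Suc k) \<Longrightarrow> P k"
  obtains j where "j \<le> N" "\<And>k. k < N \<Longrightarrow> P k \<longleftrightarrow> k < j"
proof -
  have down: "P k" if "P m" "k \<le> m" for k m
    using that(2,1) by (induction rule: inc_induct) (use assms in auto)
  have "\<exists>j\<le>N. \<forall>k<N. P k \<longleftrightarrow> k < j"
  proof (induction N)
    case (Suc N)
    then obtain j where j: "j \<le> N" "\<forall>k<N. P k \<longleftrightarrow> k < j" by blast
    show ?case
    proof (cases "P N")
      case True
      then show ?thesis using down by (intro exI[of _ "Suc N"]) auto
    next
      case False
      then show ?thesis using j by (intro exI[of _ j]) (auto simp: less_Suc_eq)
    qed
  qed simp
  then show ?thesis using that by blast
qed

lemma sum_initial_segment:
  fixes s :: "nat \<Rightarrow> real"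
  assumes "j \<le> N" "\<And>k. k < N \<Longrightarrow> P k \<longleftrightarrow> k < j"
  shows "(\<Sum>k<N. (s (Suc k) - s k) * of_bool (P k)) = s j - s 0"
proof -
  have "(\<Sum>k<N. (s (Suc k) - s k) * of_bool (P k)) = (\<Sum>k<j. s (Suc k) - s k)"
    by (rule sum.mono_neutral_cong_right) (use assms in auto)
  then show ?thesis by (simp add: sum_lessThan_telescope)
qed

lemma norm_line_derivative:
  fixes x :: "'a::real_inner"
  assumes "x \<noteq> 0"
  shows "((\<lambda>t. norm (x + t *\<^sub>R i)) has_real_derivative (x \<bullet> i) / norm x) (at 0)"
proof -
  have 1: "((\<lambda>t. x + t *\<^sub>R i) has_derivative (\<lambda>t. t *\<^sub>R i)) (at 0)"
    by (auto intro!: derivative_eq_intros)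
  have "((\<lambda>t. norm (x + t *\<^sub>R i)) has_derivative (\<lambda>t. (t *\<^sub>R i) \<bullet> sgn (x + 0 *\<^sub>R i))) (at 0)"
    by (rule has_derivative_compose[OF 1 has_derivative_norm]) (use assms in auto)
  then show ?thesis
    by (simp add: has_field_derivative_def sgn_div_norm inner_commute divide_inverse mult_ac)
       (simp add: mult_commute_abs mult_ac)
qed

text \<open>The profile takes the value \<open>t j\<close> at radius \<open>R j\<close> for
  \<open>j \<le> N\<close>, is affine in the norm in between, constant inside \<open>R N\<close> and
  zero outside \<open>R 0\<close>. Geometric radii make the ratio of consecutive ball volumes a
  constant, so replacing one ball by the next costs a factor \<open>q ^ n\<close>.\<close>

locale radial_profile =
  fixes t :: "nat \<Rightarrow> real" and R0 q :: real and N :: nat and dummy :: "'a::euclidean_space itself"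
  assumes t0: "t 0 = 0" and t_mono: "mono t" and R0: "R0 > 0" and q: "0 < q" "q < 1"
begin

definition R :: "nat \<Rightarrow> real" where "R k = R0 * q ^ k"

lemma R_pos: "R k > 0" using R0 q by (simp add: R_def)

lemma R_Suc: "R (Suc k) = q * R k" by (simp add: R_def)

lemma R_less: "R (Suc k) < R k" using R_pos[of k] q by (simp add: R_Suc)

lemma R_anti: "i \<le> j \<Longrightarrow> R j \<le> R i"
  by (rule lift_Suc_antimono_le) (use R_less less_imp_le in auto)

definition tent :: "nat \<Rightarrow> real \<Rightarrow> real" where
  "tent k r = max 0 (min 1 ((R k - r) / (R k - R (Suc k))))"

lemma tent_range: "0 \<le> tent k r" "tent k r \<le> 1" by (auto simp: tent_def)

lemma tent_eq_0: "R k \<le> r \<Longrightarrow> tent k r = 0"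
  using R_less[of k] divide_nonpos_pos[of "R k - r" "R k - R (Suc k)"] by (simp add: tent_def)

lemma tent_eq_1: "r \<le> R (Suc k) \<Longrightarrow> tent k r = 1"
  using R_less[of k] by (auto simp: tent_def le_divide_eq)

lemma tent_mid: "R (Suc k) \<le> r \<Longrightarrow> r \<le> R k \<Longrightarrow> tent k r = (R k - r) / (R k - R (Suc k))"
  using R_less[of k] by (auto simp: tent_def max_def min_def divide_le_eq le_divide_eq)

lemma tent_lipschitz: "\<bar>tent k r - tent k s\<bar> \<le> \<bar>r - s\<bar> / (R k - R (Suc k))"
proof -
  have "\<bar>tent k r - tent k s\<bar> \<le> \<bar>(R k - r) / (R k - R (Suc k)) - (R k - s) / (R k - R (Suc k))\<bar>"
    by (auto simp: tent_def)
  also have "(R k - r) / (R k - R (Suc k)) - (R k - s) / (R k - R (Suc k)) = (s - r) / (R k - R (Suc k))"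
    by (simp add: diff_divide_distrib)
  finally show ?thesis using R_less[of k] by (simp add: abs_divide abs_minus_commute)
qed

definition slope :: "nat \<Rightarrow> real" where "slope k = (t (Suc k) - t k) / (R k - R (Suc k))"

lemma t_le: "t k \<le> t (Suc k)" using t_mono by (simp add: mono_def)

lemma t_nonneg: "t k \<ge> 0" using monoD[OF t_mono, of 0 k] t0 by simp

lemma slope_nonneg: "slope k \<ge> 0" using t_le[of k] R_less[of k] by (simp add: slope_def)

definition prof :: "'a \<Rightarrow> real" where "prof x = (\<Sum>k<N. (t (Suc k) - t k) * tent k (norm x))"

definition shell :: "nat \<Rightarrow> 'a set" where "shell k = {x. R (Suc k) < norm x \<and> norm x < R k}"

definition prof_grad :: "'a \<Rightarrow> 'a" where
  "prof_grad x = (- (\<Sum>k<N. slope k * indicator (shell k) x)) *\<^sub>R (inverse (norm x) *\<^sub>R x)"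

lemma shell_meas [measurable]: "shell k \<in> sets borel" unfolding shell_def by measurable

lemma prof_cont: "continuous_on UNIV prof"
  unfolding prof_def[abs_def] tent_def
  by (intro continuous_on_sum continuous_on_mult continuous_on_max continuous_on_min continuous_on_divide
       continuous_on_diff continuous_on_const continuous_on_norm continuous_on_id) (use R_less in \<open>metis less_irrefl right_minus_eq\<close>)

lemma prof_grad_meas: "prof_grad \<in> borel_measurable borel"
  unfolding prof_grad_def[abs_def] by measurable

lemma prof_nonneg: "prof x \<ge> 0"
  unfolding prof_def using t_le tent_range by (intro sum_nonneg mult_nonneg_nonneg) auto

lemma prof_le: "prof x \<le> t N"
proof -
  have "prof x \<le> (\<Sum>k<N. (t (Suc k) - t k) * 1)"
    unfolding prof_def using t_le tent_range by (intro sum_mono mult_left_mono) auto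
  then show ?thesis by (simp add: sum_lessThan_telescope t0)
qed

lemma prof_weak_gradient: "weak_gradient UNIV prof prof_grad"
proof (rule weak_gradientI_lipschitz[where K="cball 0 R0" and M="t N" and M'="\<Sum>k<N. slope k" and L="\<Sum>k<N. slope k"])
  have Rk: "R k \<le> R0" for k using R_anti[of 0 k] by (simp add: R_def)
  show "prof x = 0" if "x \<notin> cball 0 R0" for x
    unfolding prof_def using that Rk by (intro sum.neutral) (auto intro!: tent_eq_0 order_trans[OF Rk])
  have ind: "x \<notin> shell k" if "x \<notin> cball 0 R0" for x k using that Rk[of k] by (auto simp: shell_def)
  show "prof_grad x = 0" if "x \<notin> cball 0 R0" for x
    using ind[OF that] by (simp add: prof_grad_def)
  show "\<bar>prof x\<bar> \<le> t N" for x using prof_nonneg[of x] prof_le[of x] by simp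
  have sg: "0 \<le> (\<Sum>k<N. slope k * indicator (shell k) x)" "(\<Sum>k<N. slope k * indicator (shell k) x) \<le> (\<Sum>k<N. slope k)" for x
  proof -
    show "0 \<le> (\<Sum>k<N. slope k * indicator (shell k) x)"
      by (intro sum_nonneg mult_nonneg_nonneg slope_nonneg) auto
    show "(\<Sum>k<N. slope k * indicator (shell k) x) \<le> (\<Sum>k<N. slope k)"
      by (intro sum_mono mult_left_le slope_nonneg) (auto simp: indicator_def)
  qed
  show "norm (prof_grad x) \<le> (\<Sum>k<N. slope k)" for x
  proof -
    have "norm (prof_grad x) = (\<Sum>k<N. slope k * indicator (shell k) x) * norm (inverse (norm x) *\<^sub>R x)"
      using sg(1)[of x] by (simp add: prof_grad_def)
    also have "\<dots> \<le> (\<Sum>k<N. slope k) * 1"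
    proof (rule mult_mono[OF sg(2)])
      show "norm (inverse (norm x) *\<^sub>R x) \<le> 1" by (cases "x = 0") auto
    qed (auto intro!: sum_nonneg slope_nonneg)
    finally show ?thesis by simp
  qed
  show "\<bar>prof (x + s *\<^sub>R i) - prof x\<bar> \<le> (\<Sum>k<N. slope k) * \<bar>s\<bar>" if i: "i \<in> Basis" for x s i
  proof -
    have "\<bar>norm (x + s *\<^sub>R i) - norm x\<bar> \<le> norm (s *\<^sub>R i)" using norm_triangle_ineq3[of "x + s *\<^sub>R i" x] by simp
    then have nl: "\<bar>norm (x + s *\<^sub>R i) - norm x\<bar> \<le> \<bar>s\<bar>" using i by simp
    have "prof (x + s *\<^sub>R i) - prof x = (\<Sum>k<N. (t (Suc k) - t k) * (tent k (norm (x + s *\<^sub>R i)) - tent k (norm x)))"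
      by (simp add: prof_def sum_subtractf right_diff_distrib)
    also have "\<bar>\<dots>\<bar> \<le> (\<Sum>k<N. slope k * \<bar>s\<bar>)"
    proof (rule order_trans[OF sum_abs sum_mono])
      fix k
      have "\<bar>tent k (norm (x + s *\<^sub>R i)) - tent k (norm x)\<bar> \<le> \<bar>s\<bar> / (R k - R (Suc k))"
        using tent_lipschitz[of k "norm (x + s *\<^sub>R i)" "norm x"] divide_right_mono[OF nl, of "R k - R (Suc k)"] R_less[of k] by linarith
      then have "(t (Suc k) - t k) * \<bar>tent k (norm (x + s *\<^sub>R i)) - tent k (norm x)\<bar> \<le> (t (Suc k) - t k) * (\<bar>s\<bar> / (R k - R (Suc k)))"
        using t_le[of k] by (intro mult_left_mono) auto
      then show "\<bar>(t (Suc k) - t k) * (tent k (norm (x + s *\<^sub>R i)) - tent k (norm x))\<bar> \<le> slope k * \<bar>s\<bar>"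
        using t_le[of k] by (simp add: abs_mult slope_def)
    qed
    finally show ?thesis by (simp add: sum_distrib_right)
  qed
  show "AE x in lborel. ((\<lambda>s. prof (x + s *\<^sub>R i)) has_real_derivative prof_grad x \<bullet> i) (at 0)" if i: "i \<in> Basis" for i
  proof -
    \<comment> \<open>The kinks of the profile lie on countably many spheres, which together with
      the origin form a null set.\<close>
    have "AE x in lborel. \<forall>k. x \<notin> sphere (0::'a) (R k)"
    proof (rule AE_all_countable[THEN iffD2], rule allI)
      fix k
      have "sphere (0::'a) (R k) \<in> null_sets lborel"
        using negligible_sphere[of 0 "R k"] closed_sphere[of "0::'a" "R k"]
        by (metis borel_closed negligible_iff_null_sets null_sets_completion_iff sets_lborel)
      then show "AE x in lborel. x \<notin> sphere (0::'a) (R k)" by (rule AE_not_in)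
    qed
    moreover have "AE x in lborel. x \<notin> {0::'a}" by (rule AE_not_in) (simp add: null_sets_def)
    ultimately show ?thesis
    proof eventually_elim
      case (elim x)
      then have x0: "x \<noteq> 0" and nR: "norm x \<noteq> R k" for k by auto
      let ?d = "(x \<bullet> i) / norm x"
      have nd: "((\<lambda>s. norm (x + s *\<^sub>R i)) has_real_derivative ?d) (at 0)" by (rule norm_line_derivative[OF x0])
      have tk: "(tent k has_real_derivative (if x \<in> shell k then - 1 / (R k - R (Suc k)) else 0)) (at (norm x))" for k
      proof -
        consider "norm x < R (Suc k)" | "x \<in> shell k" | "norm x > R k"
          using nR[of k] nR[of "Suc k"] by (force simp: shell_def)
        then show ?thesis
        proof cases
          case 1
          have "((\<lambda>_. 1) has_real_derivative 0) (at (norm x))" by simp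
          then have "(tent k has_real_derivative 0) (at (norm x))"
            by (rule has_field_derivative_transform_within_open[where S="{..<R (Suc k)}"]) (use 1 tent_eq_1 in auto)
          then show ?thesis using 1 by (simp add: shell_def)
        next
          case 2
          have "((\<lambda>r. (R k - r) / (R k - R (Suc k))) has_real_derivative - 1 / (R k - R (Suc k))) (at (norm x))"
            by (rule DERIV_cdivide) (auto intro!: derivative_eq_intros)
          then have "(tent k has_real_derivative - 1 / (R k - R (Suc k))) (at (norm x))"
            by (rule has_field_derivative_transform_within_open[where S="{R (Suc k)<..<R k}"])
               (use 2 tent_mid in \<open>auto simp: shell_def\<close>)
          then show ?thesis using 2 by simp
        next
          case 3
          have "((\<lambda>_. 0) has_real_derivative 0) (at (norm x))" by simp
          then have "(tent k has_real_derivative 0) (at (norm x))"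
            by (rule has_field_derivative_transform_within_open[where S="{R k<..}"]) (use 3 tent_eq_0 in auto)
          then show ?thesis using 3 by (simp add: shell_def)
        qed
      qed
      have "((\<lambda>s. (t (Suc k) - t k) * tent k (norm (x + s *\<^sub>R i))) has_real_derivative
          (t (Suc k) - t k) * ((if x \<in> shell k then - 1 / (R k - R (Suc k)) else 0) * ?d)) (at 0)" for k
        by (intro DERIV_cmult DERIV_chain2[OF _ nd]) (use tk[of k] in simp)
      then have "((\<lambda>s. prof (x + s *\<^sub>R i)) has_real_derivative
          (\<Sum>k<N. (t (Suc k) - t k) * ((if x \<in> shell k then - 1 / (R k - R (Suc k)) else 0) * ?d))) (at 0)"
        unfolding prof_def by (intro DERIV_sum)
      also have "(\<Sum>k<N. (t (Suc k) - t k) * ((if x \<in> shell k then - 1 / (R k - R (Suc k)) else 0) * ?d))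
          = (\<Sum>k<N. - (slope k * indicator (shell k) x) * ?d)"
        by (intro sum.cong) (auto simp: slope_def)
      also have "\<dots> = (- (\<Sum>k<N. slope k * indicator (shell k) x)) * ?d"
        by (simp only: sum_distrib_right[symmetric] sum_negf)
      also have "\<dots> = prof_grad x \<bullet> i"
        by (simp only: prof_grad_def inner_scaleR_left divide_inverse mult_ac)
      finally show ?case .
    qed
  qed
qed (use prof_cont prof_grad_meas in \<open>auto intro: borel_measurable_continuous_onI\<close>)

definition c :: "nat \<Rightarrow> real" where "c k = unit_ball_vol (real DIM('a)) * R k ^ DIM('a)"

lemma prof_grad_energy:
  "integrable lborel (\<lambda>x. (norm (prof_grad x))\<^sup>2)"
  "(\<integral>x. (norm (prof_grad x))\<^sup>2 \<partial>lborel) = (\<Sum>k<N. (slope k)\<^sup>2 * (c k - c (Suc k)))"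
proof -
  have eq: "(norm (prof_grad x))\<^sup>2 = (\<Sum>k<N. (slope k)\<^sup>2 * indicator (shell k) x)" for x
  proof (cases "\<exists>k<N. x \<in> shell k")
    case True
    then obtain k where k: "k < N" "x \<in> shell k" by blast
    have u: "x \<notin> shell j" if "j \<noteq> k" for j
    proof
      assume "x \<in> shell j"
      then show False using k(2) that R_anti[of "Suc j" k] R_anti[of "Suc k" j] by (cases "j < k") (auto simp: shell_def)
    qed
    have S: "(\<Sum>j<N. F j * indicator (shell j) x) = F k" for F :: "nat \<Rightarrow> real"
    proof -
      have "(\<Sum>j<N. F j * indicator (shell j) x) = (\<Sum>j<N. if j = k then F j else 0)"
        using u k by (intro sum.cong) auto
      then show ?thesis using k(1) by simp
    qed
    have "norm x > 0" using k(2) R_pos[of "Suc k"] by (auto simp: shell_def)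
    then show ?thesis unfolding prof_grad_def S by (simp add: power_mult_distrib power_inverse)
  next
    case False
    then have "x \<notin> shell k" if "k < N" for k using that by blast
    then show ?thesis by (simp add: prof_grad_def)
  qed
  have sh: "shell k = ball 0 (R k) - cball 0 (R (Suc k))" for k
    by (auto simp: shell_def)
  have m: "emeasure lborel (shell k) < \<infinity>" "measure lborel (shell k) = c k - c (Suc k)" for k
  proof -
    show "emeasure lborel (shell k) < \<infinity>" by (rule emeasure_bounded_finite) (auto simp: sh intro: bounded_subset[OF bounded_ball[of 0 "R k"]])
    have "measure lborel (shell k) = measure lborel (ball (0::'a) (R k)) - measure lborel (cball (0::'a) (R (Suc k)))"
      unfolding sh
    proof (rule measure_Diff)
      have "emeasure lborel (ball (0::'a) (R k)) < \<infinity>" by (rule emeasure_bounded_finite) simp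
      then show "emeasure lborel (ball (0::'a) (R k)) \<noteq> \<infinity>" by simp
    qed (use R_less[of k] in auto)
    then show "measure lborel (shell k) = c k - c (Suc k)"
      using R_pos by (simp add: content_ball content_cball less_imp_le c_def)
  qed
  show "integrable lborel (\<lambda>x. (norm (prof_grad x))\<^sup>2)"
    unfolding eq
    by (intro Bochner_Integration.integrable_sum integrable_mult_right integrable_real_indicator;
        use m(1)[unfolded infinity_ennreal_def] in simp)
  show "(\<integral>x. (norm (prof_grad x))\<^sup>2 \<partial>lborel) = (\<Sum>k<N. (slope k)\<^sup>2 * (c k - c (Suc k)))"
    unfolding eq using m by (subst Bochner_Integration.integral_sum) auto
qed

text \<open>The profile lies between two step functions with the same levels: the lower one jumps to
  \<open>t (Suc k)\<close> at the inner radius of the shell, the upper one already at the outer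
  radius. Their powers integrate to the two sums.\<close>

lemma prof_powr_bounds:
  assumes r: "r > 0"
  shows "integrable lborel (\<lambda>x. prof x powr r)"
    "(\<integral>x. prof x powr r \<partial>lborel) \<le> (\<Sum>k<N. (t (Suc k) powr r - t k powr r) * c k)"
    "(\<Sum>k<N. (t (Suc k) powr r - t k powr r) * c (Suc k)) \<le> (\<integral>x. prof x powr r \<partial>lborel)"
proof -
  have tp: "t k powr r \<le> t (Suc k) powr r" for k using t_le t_nonneg r by (intro powr_mono2) auto
  let ?F = "\<lambda>S x. \<Sum>k<N. (t (Suc k) powr r - t k powr r) * indicator (S k :: 'a set) x"
  have up: "prof x powr r \<le> ?F (\<lambda>k. ball 0 (R k)) x" for x
  proof -
    obtain j where j: "j \<le> N" "\<And>k. k < N \<Longrightarrow> norm x < R k \<longleftrightarrow> k < j"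
      by (rule initial_segment[of "\<lambda>k. norm x < R k" N]) (use R_less less_trans in blast)+
    have "prof x \<le> (\<Sum>k<N. (t (Suc k) - t k) * of_bool (norm x < R k))"
      unfolding prof_def using t_le tent_range tent_eq_0 by (intro sum_mono mult_left_mono) (auto simp: not_less)
    also have "\<dots> = t j" using sum_initial_segment[OF j, of t] t0 by simp
    finally have "prof x powr r \<le> t j powr r" using prof_nonneg r by (intro powr_mono2) auto
    also have "\<dots> = (\<Sum>k<N. (t (Suc k) powr r - t k powr r) * of_bool (norm x < R k))"
      using sum_initial_segment[OF j, of "\<lambda>k. t k powr r"] t0 r by simp
    finally show ?thesis by (simp add: indicator_def)
  qed
  have lo: "?F (\<lambda>k. cball 0 (R (Suc k))) x \<le> prof x powr r" for x
  proof -
    obtain j where j: "j \<le> N" "\<And>k. k < N \<Longrightarrow> norm x \<le> R (Suc k) \<longleftrightarrow> k < j"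
      by (rule initial_segment[of "\<lambda>k. norm x \<le> R (Suc k)" N]) (use R_less less_imp_le order_trans in blast)+
    have "(\<Sum>k<N. (t (Suc k) - t k) * of_bool (norm x \<le> R (Suc k))) \<le> prof x"
      unfolding prof_def using t_le tent_range tent_eq_1 by (intro sum_mono mult_left_mono) auto
    then have "t j \<le> prof x" using sum_initial_segment[OF j, of t] t0 by simp
    then have "t j powr r \<le> prof x powr r" using t_nonneg r by (intro powr_mono2) auto
    moreover have "(\<Sum>k<N. (t (Suc k) powr r - t k powr r) * of_bool (norm x \<le> R (Suc k))) = t j powr r"
      using sum_initial_segment[OF j, of "\<lambda>k. t k powr r"] t0 r by simp
    ultimately show ?thesis by (simp add: indicator_def)
  qed
  have Rk: "R k \<le> R0" for k using R_anti[of 0 k] by (simp add: R_def)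
  have z: "prof x = 0" if "x \<notin> cball 0 R0" for x
    unfolding prof_def using that Rk by (intro sum.neutral) (auto intro!: tent_eq_0 order_trans[OF Rk])
  have pm: "prof \<in> borel_measurable borel" by (rule borel_measurable_continuous_onI[OF prof_cont])
  show i: "integrable lborel (\<lambda>x. prof x powr r)"
    by (rule integrable_bounded_support[where K="cball 0 R0" and M="t N powr r"])
       (use z pm prof_nonneg prof_le r in \<open>auto intro!: powr_mono2\<close>)
  have fin: "emeasure lborel (ball (0::'a) (R k)) < \<infinity>" "emeasure lborel (cball (0::'a) (R k)) < \<infinity>" for k
    by (rule emeasure_bounded_finite, simp)+
  have ms: "measure lborel (ball (0::'a) (R k)) = c k" "measure lborel (cball (0::'a) (R k)) = c k" for k
    using R_pos[of k] by (simp_all add: content_ball content_cball c_def)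
  have i1: "integrable lborel (?F (\<lambda>k. ball 0 (R k)))" "integrable lborel (?F (\<lambda>k. cball 0 (R (Suc k))))"
    by (intro Bochner_Integration.integrable_sum integrable_mult_right integrable_real_indicator;
        use fin[unfolded infinity_ennreal_def] in simp)+
  have e1: "(\<integral>x. ?F (\<lambda>k. ball 0 (R k)) x \<partial>lborel) = (\<Sum>k<N. (t (Suc k) powr r - t k powr r) * c k)"
    using fin ms by (subst Bochner_Integration.integral_sum) auto
  have e2: "(\<integral>x. ?F (\<lambda>k. cball 0 (R (Suc k))) x \<partial>lborel) = (\<Sum>k<N. (t (Suc k) powr r - t k powr r) * c (Suc k))"
    using fin ms by (subst Bochner_Integration.integral_sum) auto
  show "(\<integral>x. prof x powr r \<partial>lborel) \<le> (\<Sum>k<N. (t (Suc k) powr r - t k powr r) * c k)"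
    unfolding e1[symmetric] by (rule integral_mono[OF i i1(1) up])
  show "(\<Sum>k<N. (t (Suc k) powr r - t k powr r) * c (Suc k)) \<le> (\<integral>x. prof x powr r \<partial>lborel)"
    unfolding e2[symmetric] by (rule integral_mono[OF i1(2) i lo])
qed

lemma prof_H1: "H1_Rn prof prof_grad"
proof -
  have "(\<lambda>x. (prof x)\<^sup>2) = (\<lambda>x. prof x powr 2)" using prof_nonneg by (simp add: powr_numeral)
  then have "integrable lborel (\<lambda>x. (prof x)\<^sup>2)" using prof_powr_bounds(1)[of 2] by simp
  moreover have "(\<lambda>x. (prof x)\<^sup>2) \<in> borel_measurable borel" "(\<lambda>x. (norm (prof_grad x))\<^sup>2) \<in> borel_measurable borel"
    using borel_measurable_continuous_onI[OF prof_cont] prof_grad_meas by auto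
  ultimately show ?thesis using prof_weak_gradient prof_grad_energy(1)
    by (simp add: H1_Rn_def integrable_completion)
qed

end

text \<open>\<open>T c\<close> is the decreasing rearrangement of \<open>f\<close> at volume
  \<open>c\<close>. Plateaus of \<open>f\<close> are covered by the pair of bounds: the strict
  superlevel set has volume at most \<open>c\<close>, and the weak one at least
  \<open>c\<close>.\<close>

lemma level_quantile:
  fixes f :: "'b \<Rightarrow> real"
  assumes f [measurable]: "f \<in> borel_measurable M" and le: "\<forall>x\<in>space M. f x \<le> B" and B: "B \<ge> 0"
    and fin: "emeasure M {x \<in> space M. f x > 0} < \<infinity>" and c: "c > 0"
  defines "T \<equiv> \<lambda>c. Inf {s. s \<ge> 0 \<and> measure M {x \<in> space M. f x > s} \<le> c}"
  shows "T c \<ge> 0" "measure M {x \<in> space M. f x > T c} \<le> c"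
    "T c > 0 \<Longrightarrow> c \<le> measure M {x \<in> space M. f x \<ge> T c}"
    "\<And>c'. c \<le> c' \<Longrightarrow> T c' \<le> T c"
    "measure M {x \<in> space M. f x > 0} \<le> c \<Longrightarrow> T c = 0"
proof -
  let ?m = "\<lambda>s. measure M {x \<in> space M. f x > s}"
  let ?S = "\<lambda>c. {s. s \<ge> 0 \<and> ?m s \<le> c}"
  have fin': "emeasure M {x \<in> space M. f x > s} \<noteq> \<infinity>" if "s \<ge> 0" for s
  proof -
    have "emeasure M {x \<in> space M. f x > s} \<le> emeasure M {x \<in> space M. f x > 0}"
      by (rule emeasure_mono) (use that in auto)
    then show ?thesis using fin by auto
  qed
  have mono: "?m s \<le> ?m s'" if "0 \<le> s'" "s' \<le> s" for s s'
    by (rule measure_mono_fmeasurable) (use that fin'[of s'] in \<open>auto simp: fmeasurable_def top.not_eq_extremum\<close>)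
  have e: "{x \<in> space M. f x > B} = {}" using le by (auto simp: not_less)
  have "?m B = 0" unfolding e by (rule measure_empty)
  then have BS: "B \<in> ?S c" using B c by (intro CollectI conjI) linarith+
  have ne: "?S c \<noteq> {}" using BS by (intro notI) (simp only: empty_iff)
  have bdd: "bdd_below (?S c)" for c by (rule bdd_belowI[of _ 0]) (elim CollectE conjE)
  show T0: "T c \<ge> 0" unfolding T_def
    by (rule cInf_greatest[OF ne]) (elim CollectE conjE)
  have above: "?m s \<le> c" if "s > T c" for s
  proof -
    have "Inf (?S c) < s" using that by (simp only: T_def)
    from cInf_lessD[OF ne this] obtain s' where s': "s' \<in> ?S c" "s' < s" by (elim bexE)
    from s'(1) have k: "0 \<le> s' \<and> ?m s' \<le> c" by (rule CollectD)
    show ?thesis using mono[of s' s] s'(2) conjunct1[OF k] conjunct2[OF k] by linarith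
  qed
  \<comment> \<open>Continuity of the measure from below, along levels decreasing to
    \<open>T c\<close>.\<close>
  show "?m (T c) \<le> c"
  proof -
    let ?A = "\<lambda>j. {x \<in> space M. f x > T c + 1 / real (Suc j)}"
    have U: "(\<Union>j. ?A j) = {x \<in> space M. f x > T c}"
    proof (intro equalityI subsetI)
      fix x assume x: "x \<in> {x \<in> space M. f x > T c}"
      then obtain j where "inverse (real (Suc j)) < f x - T c" using reals_Archimedean[of "f x - T c"] by auto
      then show "x \<in> (\<Union>j. ?A j)" using x by (auto simp: inverse_eq_divide algebra_simps intro!: exI[of _ j])
    next
      fix x assume "x \<in> (\<Union>j. ?A j)"
      then obtain j where j: "x \<in> space M" "T c + 1 / real (Suc j) < f x" by auto
      have "1 / real (Suc j) > 0" by simp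
      then have "T c < f x" using j(2) by linarith
      then show "x \<in> {x \<in> space M. f x > T c}" using j(1) by (intro CollectI conjI)
    qed
    have "(\<lambda>j. measure M (?A j)) \<longlonglongrightarrow> measure M (\<Union>j. ?A j)"
    proof (rule Lim_measure_incseq)
      show "incseq ?A"
      proof (rule incseq_SucI)
        fix j
        have "1 / real (Suc (Suc j)) \<le> 1 / real (Suc j)" by (simp add: field_simps)
        then show "?A j \<subseteq> ?A (Suc j)" by auto
      qed
      show "emeasure M (\<Union>j. ?A j) \<noteq> \<infinity>" unfolding U by (rule fin'[OF T0])
    qed auto
    then have "(\<lambda>j. measure M (?A j)) \<longlonglongrightarrow> ?m (T c)" unfolding U .
    then show ?thesis by (rule LIMSEQ_le_const2) (intro exI[of _ 0] allI impI above, simp)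
  qed
  \<comment> \<open>Continuity from above, along nonnegative levels increasing to
    \<open>T c\<close>; their superlevel sets have finite measure, as this limit requires.\<close>
  show "c \<le> measure M {x \<in> space M. f x \<ge> T c}" if Tp: "T c > 0"
  proof -
    define s where "s j = T c * (1 - 1 / real (Suc j))" for j
    have s: "0 \<le> s j" "s j < T c" for j using Tp by (auto simp: s_def field_simps)
    let ?A = "\<lambda>j. {x \<in> space M. f x > s j}"
    have below: "c < ?m (s j)" for j
    proof (rule ccontr)
      assume "\<not> c < ?m (s j)"
      then have "s j \<in> ?S c" using s(1)[of j] by (intro CollectI conjI) linarith+
      then have "T c \<le> s j" unfolding T_def by (rule cInf_lower[OF _ bdd])
      then show False using s(2)[of j] by simp
    qed
    have "(\<lambda>j. measure M (?A j)) \<longlonglongrightarrow> measure M (\<Inter>j. ?A j)"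
    proof (rule Lim_measure_decseq)
      show "decseq ?A"
      proof (rule decseq_SucI)
        fix j
        have "1 / real (Suc (Suc j)) \<le> 1 / real (Suc j)" by (simp add: field_simps)
        then have "s j \<le> s (Suc j)" unfolding s_def using Tp by (intro mult_left_mono) auto
        then show "?A (Suc j) \<subseteq> ?A j" by auto
      qed
      show "emeasure M (?A j) \<noteq> \<infinity>" for j using fin'[OF s(1)] .
    qed auto
    moreover have "(\<Inter>j. ?A j) = {x \<in> space M. f x \<ge> T c}"
    proof (intro equalityI subsetI)
      fix x assume x: "x \<in> (\<Inter>j. ?A j)"
      have "s \<longlonglongrightarrow> T c * (1 - 0)" unfolding s_def
        by (intro tendsto_intros LIMSEQ_Suc[OF lim_1_over_n])
      then have "T c * (1 - 0) \<le> f x" by (rule LIMSEQ_le_const2) (intro exI[of _ 0] allI impI, use x in \<open>auto intro: less_imp_le\<close>)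
      then show "x \<in> {x \<in> space M. f x \<ge> T c}" using x by auto
    qed (use s(2) in \<open>auto intro: less_le_trans\<close>)
    ultimately have "(\<lambda>j. measure M (?A j)) \<longlonglongrightarrow> measure M {x \<in> space M. f x \<ge> T c}" by simp
    then show ?thesis by (rule LIMSEQ_le_const) (intro exI[of _ 0] allI impI less_imp_le[OF below])
  qed
  show "T c' \<le> T c" if "c \<le> c'" for c'
    unfolding T_def using that by (intro cInf_superset_mono[OF ne bdd] Collect_mono) (auto intro: order_trans)
  show "T c = 0" if "?m 0 \<le> c"
  proof -
    have "0 \<in> ?S c" using that by (intro CollectI conjI) linarith+
    then have "T c \<le> 0" unfolding T_def by (rule cInf_lower[OF _ bdd])
    then show ?thesis using T0 by simp
  qed
qed

text \<open>Pointwise, the power of \<open>f\<close> lies between its discretisations downwards and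
  upwards to the levels \<open>t\<close>. Rounding up fails above the top level \<open>t N\<close>,
  where the bound \<open>B\<close> is used instead; this accounts for the extra summand.\<close>

lemma level_sum_bounds:
  fixes f :: "'b \<Rightarrow> real" and t :: "nat \<Rightarrow> real"
  assumes f [measurable]: "f \<in> borel_measurable M" and f0: "\<forall>x\<in>space M. 0 \<le> f x"
    and le: "\<forall>x\<in>space M. f x \<le> B"
    and fin: "emeasure M {x \<in> space M. f x > 0} < \<infinity>"
    and t: "t 0 = 0" "mono t" and r: "r > 0"
  shows "integrable M (\<lambda>x. f x powr r)"
    "(\<integral>x. f x powr r \<partial>M) \<le> (\<Sum>k<N. (t (Suc k) powr r - t k powr r) * measure M {x \<in> space M. f x > t k})
        + B powr r * measure M {x \<in> space M. f x > t N}"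
    "(\<Sum>k<N. (t (Suc k) powr r - t k powr r) * measure M {x \<in> space M. f x \<ge> t (Suc k)}) \<le> (\<integral>x. f x powr r \<partial>M)"
proof -
  have t_le: "t k \<le> t (Suc k)" for k using t(2) by (simp add: mono_def)
  have t_nonneg: "t k \<ge> 0" for k using monoD[OF t(2), of 0 k] t(1) by simp
  have sp: "{x \<in> space M. P x} \<inter> space M = {x \<in> space M. P x}" for P by auto
  have finA: "emeasure M A < \<infinity>" if "A \<in> sets M" "A \<subseteq> {x \<in> space M. f x > 0}" for A
    using emeasure_mono[OF that(2), of M] fin by (auto intro: le_less_trans)
  have fin1: "emeasure M {x \<in> space M. f x > t k} < \<infinity>" for k
    by (rule finA) (use t_nonneg[of k] in auto)
  have i0: "integrable M (\<lambda>x. B powr r * indicator {x \<in> space M. f x > 0} x)"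
    using fin by (intro integrable_mult_right integrable_real_indicator) auto
  show i: "integrable M (\<lambda>x. f x powr r)"
  proof (rule Bochner_Integration.integrable_bound[OF i0])
    show "AE x in M. norm (f x powr r) \<le> norm (B powr r * indicator {x \<in> space M. f x > 0} x)"
    proof (rule AE_I2)
      fix x assume x: "x \<in> space M"
      show "norm (f x powr r) \<le> norm (B powr r * indicator {x \<in> space M. f x > 0} x)"
        using f0[rule_format, OF x] le[rule_format, OF x] x r by (cases "f x = 0") (auto intro: powr_mono2)
    qed
  qed measurable
  let ?F = "\<lambda>x. (\<Sum>k<N. (t (Suc k) powr r - t k powr r) * indicator {x \<in> space M. f x > t k} x)
     + B powr r * indicator {x \<in> space M. f x > t N} x"
  have iF: "integrable M ?F"
    by (intro Bochner_Integration.integrable_add Bochner_Integration.integrable_sum integrable_mult_right integrable_real_indicator;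
        use fin1[unfolded infinity_ennreal_def] in simp)
  have eF: "(\<integral>x. ?F x \<partial>M) = (\<Sum>k<N. (t (Suc k) powr r - t k powr r) * measure M {x \<in> space M. f x > t k})
        + B powr r * measure M {x \<in> space M. f x > t N}"
  proof -
    have "integrable M (\<lambda>x. \<Sum>k<N. (t (Suc k) powr r - t k powr r) * indicator {x \<in> space M. f x > t k} x)"
      "integrable M (\<lambda>x. B powr r * indicator {x \<in> space M. f x > t N} x)"
      "\<And>k. integrable M (\<lambda>x. (t (Suc k) powr r - t k powr r) * indicator {x \<in> space M. f x > t k} x)"
      by (intro Bochner_Integration.integrable_sum integrable_mult_right integrable_real_indicator;
        use fin1[unfolded infinity_ennreal_def] in simp)+
    then show ?thesis
      by (simp only: Bochner_Integration.integral_add Bochner_Integration.integral_sum)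
         (simp add: sp)
  qed
  show "(\<integral>x. f x powr r \<partial>M) \<le> (\<Sum>k<N. (t (Suc k) powr r - t k powr r) * measure M {x \<in> space M. f x > t k})
        + B powr r * measure M {x \<in> space M. f x > t N}"
    unfolding eF[symmetric]
  proof (rule integral_mono[OF i iF])
    fix x assume x: "x \<in> space M"
    obtain j where j: "j \<le> Suc N" "\<And>k. k < Suc N \<Longrightarrow> f x > t k \<longleftrightarrow> k < j"
      by (rule initial_segment[of "\<lambda>k. f x > t k" "Suc N"]) (use t_le le_less_trans in blast)+
    have S: "(\<Sum>k<N. (t (Suc k) powr r - t k powr r) * indicator {x \<in> space M. f x > t k} x)
        = (\<Sum>k<N. (t (Suc k) powr r - t k powr r) * of_bool (f x > t k))"
      using x by (intro sum.cong) (auto simp: indicator_def)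
    have tp: "t k powr r \<le> t (Suc k) powr r" for k using t_le t_nonneg r by (intro powr_mono2) auto
    have B0: "f x powr r \<le> B powr r" using f0[rule_format, OF x] le[rule_format, OF x] r by (intro powr_mono2) auto
    show "f x powr r \<le> ?F x"
    proof (cases "j = Suc N")
      case True
      then have "f x > t N" using j by simp
      moreover have "0 \<le> (\<Sum>k<N. (t (Suc k) powr r - t k powr r) * indicator {x \<in> space M. f x > t k} x)"
        using tp by (intro sum_nonneg mult_nonneg_nonneg) auto
      ultimately show ?thesis using B0 x by (simp only: indicator_def) simp
    next
      case False
      then have jN: "j \<le> N" using j by simp
      then have "\<not> f x > t j" using j(2)[of j] by simp
      then have "f x powr r \<le> t j powr r" using f0[rule_format, OF x] r by (intro powr_mono2) auto
      also have "\<dots> = (\<Sum>k<N. (t (Suc k) powr r - t k powr r) * of_bool (f x > t k))"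
        using sum_initial_segment[OF jN, of "\<lambda>k. f x > t k" "\<lambda>k. t k powr r"] j(2) t r by simp
      finally show ?thesis unfolding S[symmetric] by (simp add: add_increasing2)
    qed
  qed
  \<comment> \<open>A summand with \<open>t (Suc k) = 0\<close> has coefficient 0. This matters
    because \<open>{f \<ge> 0}\<close> is the whole space, whose measure may be infinite.\<close>
  have tpos: "0 < t (Suc k)" if "t (Suc k) powr r - t k powr r \<noteq> 0" for k
    using that t_nonneg[of k] t_le[of k] by (cases "t (Suc k) = 0") auto
  let ?c = "\<lambda>k. t (Suc k) powr r - t k powr r"
  let ?G = "\<lambda>x. \<Sum>k<N. ?c k * indicator {x \<in> space M. f x \<ge> t (Suc k)} x"
  have iG1: "integrable M (\<lambda>x. ?c k * indicator {x \<in> space M. f x \<ge> t (Suc k)} x)" for k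
  proof (cases "?c k = 0")
    case False
    then have "emeasure M {x \<in> space M. f x \<ge> t (Suc k)} < \<infinity>" by (intro finA) (use tpos in force)+
    then show ?thesis by (intro integrable_mult_right integrable_real_indicator) auto
  qed simp
  have eG: "(\<integral>x. ?G x \<partial>M) = (\<Sum>k<N. ?c k * measure M {x \<in> space M. f x \<ge> t (Suc k)})"
    using iG1 by (simp only: Bochner_Integration.integral_sum) (simp add: sp)
  show "(\<Sum>k<N. ?c k * measure M {x \<in> space M. f x \<ge> t (Suc k)}) \<le> (\<integral>x. f x powr r \<partial>M)"
    unfolding eG[symmetric]
  proof (rule integral_mono[OF _ i])
    show "integrable M ?G" using iG1 by (rule Bochner_Integration.integrable_sum)
    fix x assume x: "x \<in> space M"
    obtain j where j: "j \<le> N" "\<And>k. k < N \<Longrightarrow> f x \<ge> t (Suc k) \<longleftrightarrow> k < j"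
      by (rule initial_segment[of "\<lambda>k. f x \<ge> t (Suc k)" N]) (use t_le order_trans in blast)+
    have "?G x = (\<Sum>k<N. ?c k * of_bool (f x \<ge> t (Suc k)))"
      using x by (intro sum.cong) (auto simp: indicator_def)
    also have "\<dots> = t j powr r" using sum_initial_segment[OF j, of "\<lambda>k. t k powr r"] t r by simp
    also have "\<dots> \<le> f x powr r"
    proof (cases j)
      case (Suc k)
      then have "t j \<le> f x" using j(2)[of k] j(1) by simp
      then show ?thesis using t_nonneg r by (intro powr_mono2) auto
    qed (use t r in simp)
    finally show "?G x \<le> f x powr r" .
  qed
qed

text \<open>\<open>Dn s t\<close> stands for the Dirichlet energy between the levels \<open>s\<close> and \<open>t\<close>, and \<open>shell\<close> combines the
  isoperimetric inequality with Cauchy--Schwarz. The comparison profiles are radial and piecewise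
  linear in \<open>norm x\<close>, with nodes at radii in geometric progression of ratio \<open>q\<close> tending to \<open>1\<close>.\<close>
theorem symmetrization_bound:
  fixes f :: "'b \<Rightarrow> real" and Dn :: "real \<Rightarrow> real \<Rightarrow> real" and dummy :: "'a::euclidean_space itself"
  assumes f [measurable]: "f \<in> borel_measurable M" and f0: "\<forall>x\<in>space M. 0 \<le> f x"
    and le: "\<forall>x\<in>space M. f x \<le> B" and B: "B \<ge> 0"
    and fin: "emeasure M {x \<in> space M. f x > 0} < \<infinity>"
    and C: "C \<ge> 0" and r: "r > 0" and a: "a > 0" and b: "b > 0"
    and euclid: "\<And>(v :: 'a \<Rightarrow> real) G. H1_Rn v G \<Longrightarrow> (\<And>x. v x \<ge> 0) \<Longrightarrow> (\<And>s. s > 0 \<Longrightarrow> integrable lborel (\<lambda>x. v x powr s)) \<Longrightarrow>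
        integrable lborel (\<lambda>x. (norm (G x))\<^sup>2) \<Longrightarrow>
        (\<integral>x. v x powr r \<partial>lborel) \<le> C * ((\<integral>x. v x powr 2 \<partial>lborel) powr a * (\<integral>x. (norm (G x))\<^sup>2 \<partial>lborel) powr b)"
    and shell: "\<And>s t. 0 \<le> s \<Longrightarrow> s < t \<Longrightarrow>
        (t - s)\<^sup>2 * real DIM('a) ^ 2 * unit_ball_vol (real DIM('a)) powr (2 / real DIM('a)) * (measure M {x \<in> space M. f x \<ge> t})\<^sup>2
        \<le> measure M {x \<in> space M. f x > s} powr (2 / real DIM('a)) * measure M {x \<in> space M. s < f x \<and> f x < t} * Dn s t"
    and Dn: "\<And>s t. Dn s t \<ge> 0" "\<And>t N. mono t \<Longrightarrow> t 0 \<ge> 0 \<Longrightarrow> (\<Sum>k<N. Dn (t k) (t (Suc k))) \<le> D"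
  shows "(\<integral>x. f x powr r \<partial>M) \<le> C * ((\<integral>x. f x powr 2 \<partial>M) powr a * D powr b)"
proof -
  define n where "n = DIM('a)"
  have n0: "n > 0" by (simp add: n_def)
  define V where "V = unit_ball_vol (real n)"
  have V: "V > 0" by (simp add: V_def)
  define m0 where "m0 = measure M {x \<in> space M. f x > 0}"
  \<comment> \<open>A radius at least 1 whose ball has volume at least that of the set where
    \<open>f\<close> is positive, so that the level belonging to the outermost ball is 0.\<close>
  define R0 where "R0 = m0 / V + 1"
  have m0: "m0 \<ge> 0" by (simp add: m0_def)
  have R0: "R0 \<ge> 1" using m0 V by (simp add: R0_def)
  have R0m: "m0 \<le> V * R0 ^ n"
  proof -
    have "m0 \<le> V * R0" using V by (simp add: R0_def field_simps)
    also have "R0 \<le> R0 ^ n" using R0 n0 self_le_power by blast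
    finally show ?thesis using V by simp
  qed
  define T where "T c = Inf {s. s \<ge> 0 \<and> measure M {x \<in> space M. f x > s} \<le> c}" for c
  note Q = level_quantile[OF f le B fin, folded T_def]
  have Dsum0: "D \<ge> 0" using Dn(2)[of "\<lambda>_. 0" 0] by (simp add: mono_def)
  let ?A = "\<integral>x. f x powr r \<partial>M" and ?B = "\<integral>x. f x powr 2 \<partial>M"
  have B2: "?B \<ge> 0" by simp
  \<comment> \<open>The discretised inequality with its losses made explicit: \<open>q ^ n\<close>
    for each comparison of consecutive ball volumes, \<open>q ^ (2 * n)\<close> in the energy
    because that volume enters squared, and the contribution above the top level, which decays
    geometrically in \<open>N\<close>.\<close>
  have key: "q ^ n * (?A - B powr r * (V * R0 ^ n * (q ^ n) ^ N)) \<le> C * ((?B / q ^ n) powr a * (D / q ^ (2 * n)) powr b)"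
    if q: "0 < q" "q < 1" for q N
  proof -
    define c where "c k = V * (R0 * q ^ k) ^ n" for k
    define t where "t k = T (c k)" for k
    have c0: "c k > 0" for k using V R0 q by (simp add: c_def)
    have c_Suc: "c (Suc k) = q ^ n * c k" for k by (simp add: c_def power_mult_distrib)
    have c_anti: "c (Suc k) \<le> c k" for k
      using c0[of k] q by (simp add: c_Suc mult_le_cancel_right1 power_le_one)
    have t_le: "t k \<le> t (Suc k)" for k unfolding t_def by (rule Q(4)[OF c0 c_anti])
    have t: "t 0 = 0" "mono t"
    proof -
      show "t 0 = 0" unfolding t_def by (rule Q(5)[OF c0]) (use R0m in \<open>simp add: c_def m0_def\<close>)
      show "mono t" by (rule mono_iff_le_Suc[THEN iffD2]) (use t_le in auto)
    qed
    have t_nonneg: "t k \<ge> 0" for k unfolding t_def by (rule Q(1)[OF c0])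
    have up: "measure M {x \<in> space M. f x > t k} \<le> c k" for k unfolding t_def by (rule Q(2)[OF c0])
    have lo: "c k \<le> measure M {x \<in> space M. f x \<ge> t k}" if "t k > 0" for k
      using that unfolding t_def by (rule Q(3)[OF c0])
    interpret rp: radial_profile t R0 q N "TYPE('a)"
      by unfold_locales (use t R0 q in auto)
    have rc: "rp.c k = c k" for k by (simp add: rp.c_def rp.R_def c_def V_def n_def)
    define S where "S s = (\<Sum>k<N. (t (Suc k) powr s - t k powr s) * c k)" for s
    have S_Suc: "(\<Sum>k<N. (t (Suc k) powr s - t k powr s) * c (Suc k)) = q ^ n * S s" for s
      by (simp add: S_def c_Suc sum_distrib_left mult_ac)
    have tp: "t k powr s \<le> t (Suc k) powr s" if "s > 0" for k s
      using t_le t_nonneg that by (intro powr_mono2) auto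
    have cN: "c N = V * R0 ^ n * (q ^ n) ^ N"
      by (simp add: c_def power_mult_distrib power_mult[symmetric] mult.commute)
    have "?A \<le> (\<Sum>k<N. (t (Suc k) powr r - t k powr r) * measure M {x \<in> space M. f x > t k})
        + B powr r * measure M {x \<in> space M. f x > t N}"
      by (rule level_sum_bounds(2)[OF f f0 le fin t r])
    also have "\<dots> \<le> S r + B powr r * c N"
      unfolding S_def using tp[OF r] up by (intro add_mono sum_mono mult_left_mono) auto
    finally have A1: "?A - B powr r * c N \<le> S r" by simp
    have "q ^ n * S r \<le> (\<integral>x. rp.prof x powr r \<partial>lborel)"
      using rp.prof_powr_bounds(3)[OF r] unfolding rc S_Suc .
    also have "\<dots> \<le> C * ((\<integral>x. rp.prof x powr 2 \<partial>lborel) powr a * (\<integral>x. (norm (rp.prof_grad x))\<^sup>2 \<partial>lborel) powr b)"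
      by (rule euclid[OF rp.prof_H1 rp.prof_nonneg rp.prof_powr_bounds(1) rp.prof_grad_energy(1)])
    also have "\<dots> \<le> C * ((?B / q ^ n) powr a * (D / q ^ (2 * n)) powr b)"
    proof (intro mult_left_mono mult_mono powr_mono2)
      have "(\<integral>x. rp.prof x powr 2 \<partial>lborel) \<le> S 2"
        using rp.prof_powr_bounds(2)[of 2] unfolding rc S_def by simp
      also have "S 2 \<le> ?B / q ^ n"
      proof -
        have "q ^ n * S 2 \<le> (\<Sum>k<N. (t (Suc k) powr 2 - t k powr 2) * measure M {x \<in> space M. f x \<ge> t (Suc k)})"
          unfolding S_Suc[symmetric]
        proof (rule sum_mono)
          fix k
          show "(t (Suc k) powr 2 - t k powr 2) * c (Suc k) \<le> (t (Suc k) powr 2 - t k powr 2) * measure M {x \<in> space M. f x \<ge> t (Suc k)}"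
            using lo[of "Suc k"] tp[of 2 k] t_nonneg[of "Suc k"] t_nonneg[of k] t_le[of k]
            by (cases "t (Suc k) = 0") (auto intro!: mult_left_mono)
        qed
        also have "\<dots> \<le> ?B" by (rule level_sum_bounds(3)[OF f f0 le fin t]) simp
        finally show ?thesis using q by (simp add: field_simps)
      qed
      finally show "(\<integral>x. rp.prof x powr 2 \<partial>lborel) \<le> ?B / q ^ n" .
      have "(\<integral>x. (norm (rp.prof_grad x))\<^sup>2 \<partial>lborel) = (\<Sum>k<N. (rp.slope k)\<^sup>2 * (c k - c (Suc k)))"
        using rp.prof_grad_energy(2) by (simp add: rc)
      also have "\<dots> \<le> (\<Sum>k<N. Dn (t k) (t (Suc k)) / q ^ (2 * n))"
      proof (rule sum_mono)
        fix k
        show "(rp.slope k)\<^sup>2 * (c k - c (Suc k)) \<le> Dn (t k) (t (Suc k)) / q ^ (2 * n)"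
        proof (cases "t k < t (Suc k)")
          case False
          then show ?thesis using t_le[of k] Dn(1) q by (simp add: rp.slope_def)
        next
          case True
          define d where "d = t (Suc k) - t k"
          define Rk where "Rk = R0 * q ^ k"
          define X where "X = c k - c (Suc k)"
          have Rk: "Rk > 0" using R0 q by (simp add: Rk_def)
          have ck: "c k = V * Rk ^ n" by (simp add: c_def Rk_def)
          have qn: "q ^ n < 1" "q ^ n > 0" using q n0 by (simp_all add: power_less_one_iff)
          have X: "X = V * Rk ^ n * (1 - q ^ n)" by (simp add: X_def c_Suc ck algebra_simps)
          have X0: "X > 0" using X V Rk qn by simp
          \<comment> \<open>Bernoulli compares the volume of a shell with its width times its outer
            area. The factor \<open>1 - q\<close> gained here cancels the one from the slope
            below.\<close>
          have bern: "1 - q ^ n \<le> real n * (1 - q)"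
            using Bernoulli_inequality[of "q - 1" n] q by (simp add: algebra_simps)
          have lower: "c (Suc k) \<le> measure M {x \<in> space M. f x \<ge> t (Suc k)}"
            using lo[of "Suc k"] True t_nonneg[of k] by simp
          have sets: "{x \<in> space M. f x > t k} \<in> fmeasurable M"
          proof -
            have "emeasure M {x \<in> space M. f x > t k} \<le> emeasure M {x \<in> space M. f x > 0}"
              by (rule emeasure_mono) (use t_nonneg[of k] in auto)
            then show ?thesis using fin by (auto simp: fmeasurable_def)
          qed
          have msh: "measure M {x \<in> space M. t k < f x \<and> f x < t (Suc k)} \<le> X"
          proof -
            have e: "{x \<in> space M. t k < f x \<and> f x < t (Suc k)} = {x \<in> space M. f x > t k} - {x \<in> space M. f x \<ge> t (Suc k)}"
              by auto
            have "measure M {x \<in> space M. t k < f x \<and> f x < t (Suc k)}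
              = measure M {x \<in> space M. f x > t k} - measure M {x \<in> space M. f x \<ge> t (Suc k)}"
              unfolding e
            proof (rule measure_Diff)
              show "emeasure M {x \<in> space M. f x > t k} \<noteq> \<infinity>" using fmeasurableD2[OF sets] by simp
              show "{x \<in> space M. f x \<ge> t (Suc k)} \<subseteq> {x \<in> space M. f x > t k}" using True by auto
            qed measurable
            then show ?thesis using up[of k] lower by (simp add: X_def)
          qed
          have s1: "d\<^sup>2 * (real n)\<^sup>2 * V powr (2 / real n) * (c (Suc k))\<^sup>2
              \<le> d\<^sup>2 * (real n)\<^sup>2 * V powr (2 / real n) * (measure M {x \<in> space M. f x \<ge> t (Suc k)})\<^sup>2"
            using lower c0[of "Suc k"] by (intro mult_left_mono power_mono) auto
          have s2: "d\<^sup>2 * (real n)\<^sup>2 * V powr (2 / real n) * (measure M {x \<in> space M. f x \<ge> t (Suc k)})\<^sup>2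
              \<le> measure M {x \<in> space M. f x > t k} powr (2 / real n)
              * measure M {x \<in> space M. t k < f x \<and> f x < t (Suc k)} * Dn (t k) (t (Suc k))"
            using shell[OF t_nonneg[of k] True] by (simp only: d_def n_def V_def)
          have s3: "measure M {x \<in> space M. f x > t k} powr (2 / real n)
              * measure M {x \<in> space M. t k < f x \<and> f x < t (Suc k)} * Dn (t k) (t (Suc k))
              \<le> c k powr (2 / real n) * X * Dn (t k) (t (Suc k))"
          proof (rule mult_right_mono[OF _ Dn(1)], rule mult_mono)
            show "measure M {x \<in> space M. f x > t k} powr (2 / real n) \<le> c k powr (2 / real n)"
              by (rule powr_mono2[OF _ measure_nonneg up]) simp
          qed (rule msh, rule powr_ge_zero, rule measure_nonneg)
          have s4: "c k powr (2 / real n) = V powr (2 / real n) * Rk\<^sup>2"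
          proof -
            have "(Rk ^ n) powr (2 / real n) = (Rk powr real n) powr (2 / real n)"
              by (simp only: powr_realpow[OF Rk])
            also have "\<dots> = Rk\<^sup>2" using Rk n0 by (simp add: powr_powr)
            finally have "(Rk ^ n) powr (2 / real n) = Rk\<^sup>2" .
            then show ?thesis using V Rk by (simp add: ck powr_mult)
          qed
          have "d\<^sup>2 * (real n)\<^sup>2 * V powr (2 / real n) * (c (Suc k))\<^sup>2 \<le> c k powr (2 / real n) * X * Dn (t k) (t (Suc k))"
            by (rule order_trans[OF s1 order_trans[OF s2 s3]])
          then have "V powr (2 / real n) * (d\<^sup>2 * (real n)\<^sup>2 * (c (Suc k))\<^sup>2) \<le> V powr (2 / real n) * (Rk\<^sup>2 * X * Dn (t k) (t (Suc k)))"
            unfolding s4 by (simp only: mult_ac)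
          then have main: "d\<^sup>2 * (real n)\<^sup>2 * (c (Suc k))\<^sup>2 \<le> Rk\<^sup>2 * X * Dn (t k) (t (Suc k))"
            using V by (simp add: mult_le_cancel_left_pos)
          have Xle: "X \<le> c k * (real n * (1 - q))"
            unfolding X ck using bern V Rk by (intro mult_left_mono) auto
          have "X * X \<le> (c k * (real n * (1 - q))) * (c k * (real n * (1 - q)))"
            using Xle X0 by (intro mult_mono) auto
          then have XX: "X * X \<le> (c k)\<^sup>2 * (real n)\<^sup>2 * (1 - q)\<^sup>2"
            by (simp add: power2_eq_square mult_ac)
          have sl: "(rp.slope k)\<^sup>2 = d\<^sup>2 / (Rk\<^sup>2 * (1 - q)\<^sup>2)"
          proof -
            have "rp.R k - rp.R (Suc k) = Rk * (1 - q)" by (simp add: rp.R_def Rk_def algebra_simps)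
            then show ?thesis by (simp add: rp.slope_def d_def power_divide power_mult_distrib)
          qed
          have q2: "(q ^ n)\<^sup>2 = q ^ (2 * n)" by (simp add: power_mult[symmetric] mult.commute)
          \<comment> \<open>Both sides are multiplied by the positive \<open>Rk\<^sup>2 * X\<close>,
            the factor on the right of \<open>main\<close>. Bounding \<open>X\<close> twice by
            \<open>Xle\<close> removes \<open>1 - q\<close>, and replacing \<open>c k\<close> by
            \<open>c (Suc k)\<close> costs \<open>q ^ (2 * n)\<close>.\<close>
          have "((rp.slope k)\<^sup>2 * X) * (Rk\<^sup>2 * X) = d\<^sup>2 / (1 - q)\<^sup>2 * (X * X)"
          proof -
            have "A / (B * z) * X * (B * X) = A / z * (X * X)" if "B \<noteq> 0" for A B z :: real
              using that by (cases "z = 0") (simp_all add: field_simps)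
            then show ?thesis unfolding sl using Rk by simp
          qed
          also have "\<dots> \<le> d\<^sup>2 / (1 - q)\<^sup>2 * ((c k)\<^sup>2 * (real n)\<^sup>2 * (1 - q)\<^sup>2)"
            using XX by (intro mult_left_mono) auto
          also have "\<dots> = (d\<^sup>2 * (real n)\<^sup>2 * (c (Suc k))\<^sup>2) / q ^ (2 * n)"
            using q by (simp add: c_Suc power_mult_distrib q2)
          also have "\<dots> \<le> (Rk\<^sup>2 * X * Dn (t k) (t (Suc k))) / q ^ (2 * n)"
            using main q by (intro divide_right_mono) auto
          also have "\<dots> = (Dn (t k) (t (Suc k)) / q ^ (2 * n)) * (Rk\<^sup>2 * X)" by simp
          finally have "((rp.slope k)\<^sup>2 * X) * (Rk\<^sup>2 * X) \<le> (Dn (t k) (t (Suc k)) / q ^ (2 * n)) * (Rk\<^sup>2 * X)" .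
          then have "(rp.slope k)\<^sup>2 * X \<le> Dn (t k) (t (Suc k)) / q ^ (2 * n)"
            by (rule mult_right_le_imp_le) (use Rk X0 in simp)
          then show ?thesis by (simp only: X_def)
        qed
      qed
      also have "\<dots> \<le> D / q ^ (2 * n)"
        unfolding sum_divide_distrib[symmetric] using Dn(2)[OF t(2), of N] t q by (intro divide_right_mono) auto
      finally show "(\<integral>x. (norm (rp.prof_grad x))\<^sup>2 \<partial>lborel) \<le> D / q ^ (2 * n)" .
    qed (use a b C in auto)
    finally have "q ^ n * S r \<le> C * ((?B / q ^ n) powr a * (D / q ^ (2 * n)) powr b)" .
    moreover have "q ^ n * (?A - B powr r * c N) \<le> q ^ n * S r" using A1 q by (intro mult_left_mono) auto
    ultimately show ?thesis by (simp add: cN)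
  qed
  have key2: "q ^ n * ?A \<le> C * ((?B / q ^ n) powr a * (D / q ^ (2 * n)) powr b)" if q: "0 < q" "q < 1" for q
  proof -
    have "(\<lambda>N. q ^ n * (?A - B powr r * (V * R0 ^ n * (q ^ n) ^ N))) \<longlonglongrightarrow> q ^ n * (?A - B powr r * (V * R0 ^ n * 0))"
      by (intro tendsto_intros LIMSEQ_realpow_zero) (use q n0 in \<open>auto simp: power_less_one_iff\<close>)
    then show ?thesis using LIMSEQ_le_const2 key[OF q] by fastforce
  qed
  define q where "q k = 1 - 1 / real (Suc (Suc k))" for k
  have q1: "q \<longlonglongrightarrow> 1 - 0" unfolding q_def
    by (intro tendsto_diff tendsto_const) (use LIMSEQ_Suc[OF LIMSEQ_Suc[OF lim_1_over_n]] in simp)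
  have q01: "0 < q k" "q k < 1" for k by (auto simp: q_def field_simps)
  have L: "(\<lambda>k. q k ^ n * ?A) \<longlonglongrightarrow> (1 - 0) ^ n * ?A" by (intro tendsto_intros q1)
  have R: "(\<lambda>k. C * ((?B / q k ^ n) powr a * (D / q k ^ (2 * n)) powr b)) \<longlonglongrightarrow>
      C * ((?B / (1 - 0) ^ n) powr a * (D / (1 - 0) ^ (2 * n)) powr b)"
    by (intro tendsto_mult tendsto_const tendsto_powr' tendsto_divide tendsto_power q1)
       (use a b B2 Dsum0 q01 in \<open>auto intro!: always_eventually less_imp_le\<close>)
  have "(1 - 0) ^ n * ?A \<le> C * ((?B / (1 - 0) ^ n) powr a * (D / (1 - 0) ^ (2 * n)) powr b)"
    by (rule LIMSEQ_le[OF L R]) (use key2 q01 in blast)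
  then show ?thesis by simp
qed

section \<open>Compactly supported functions on the hyperbolic ball\<close>

lemma integral_Cauchy_Schwarz:
  fixes X Y :: "'b \<Rightarrow> real"
  assumes [measurable]: "X \<in> borel_measurable M" "Y \<in> borel_measurable M"
    and X: "integrable M (\<lambda>x. (X x)\<^sup>2)" and Y: "integrable M (\<lambda>x. (Y x)\<^sup>2)"
  shows "integrable M (\<lambda>x. X x * Y x)"
    and "(\<integral>x. X x * Y x \<partial>M)\<^sup>2 \<le> (\<integral>x. (X x)\<^sup>2 \<partial>M) * (\<integral>x. (Y x)\<^sup>2 \<partial>M)"
proof -
  show XY: "integrable M (\<lambda>x. X x * Y x)"
  proof (rule Bochner_Integration.integrable_bound[OF Bochner_Integration.integrable_add[OF X Y]])
    show "AE x in M. norm (X x * Y x) \<le> norm ((X x)\<^sup>2 + (Y x)\<^sup>2)"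
    proof (rule AE_I2)
      fix x
      have "2 * \<bar>X x * Y x\<bar> \<le> (X x)\<^sup>2 + (Y x)\<^sup>2"
        using sum_squares_bound[of "\<bar>X x\<bar>" "\<bar>Y x\<bar>"] by (simp add: abs_mult)
      moreover have "0 \<le> \<bar>X x * Y x\<bar>" by simp
      ultimately show "norm (X x * Y x) \<le> norm ((X x)\<^sup>2 + (Y x)\<^sup>2)" by simp
    qed
  qed measurable
  define a b c where "a = (\<integral>x. (X x)\<^sup>2 \<partial>M)" and "b = (\<integral>x. X x * Y x \<partial>M)" and "c = (\<integral>x. (Y x)\<^sup>2 \<partial>M)"
  have q: "0 \<le> t\<^sup>2 * a + 2 * t * b + c" for t
  proof -
    have "0 \<le> (\<integral>x. (t * X x + Y x)\<^sup>2 \<partial>M)" by simp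
    also have "(\<lambda>x. (t * X x + Y x)\<^sup>2) = (\<lambda>x. t\<^sup>2 * (X x)\<^sup>2 + 2 * t * (X x * Y x) + (Y x)\<^sup>2)"
      by (rule ext) (simp add: power2_eq_square algebra_simps)
    also have "(\<integral>x. t\<^sup>2 * (X x)\<^sup>2 + 2 * t * (X x * Y x) + (Y x)\<^sup>2 \<partial>M) = t\<^sup>2 * a + 2 * t * b + c"
      using X Y XY by (simp add: a_def b_def c_def)
    finally show ?thesis .
  qed
  have "b\<^sup>2 \<le> a * c"
  proof (cases "a = 0")
    case True
    have "b = 0"
    proof (rule ccontr)
      assume "b \<noteq> 0"
      \<comment> \<open>With \<open>a = 0\<close> the nonnegative quadratic is affine in
        \<open>t\<close>; a slope \<open>b\<close> different from 0 would let this \<open>t\<close>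
        give the value -1.\<close>
      then have "2 * (- (c + 1) / (2 * b)) * b = - (c + 1)" by (simp add: field_simps)
      then show False using q[of "- (c + 1) / (2 * b)"] True by simp
    qed
    then show ?thesis using True by simp
  next
    case False
    moreover have "a \<ge> 0" by (simp add: a_def)
    ultimately have "a > 0" by simp
    then show ?thesis using q[of "- b / a"] by (simp add: power2_eq_square field_simps)
  qed
  then show "(\<integral>x. X x * Y x \<partial>M)\<^sup>2 \<le> (\<integral>x. (X x)\<^sup>2 \<partial>M) * (\<integral>x. (Y x)\<^sup>2 \<partial>M)"
    by (simp add: a_def b_def c_def)
qed

section \<open>Level shells and the isoperimetric inequality for them\<close>

lemma clamp_lipschitz: "\<bar>max 0 (min 1 a) - max 0 (min 1 b)\<bar> \<le> \<bar>a - b\<bar>" for a b :: real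
  by (auto simp: max_def min_def)

text \<open>The image of the finite measure on \<open>K\<close> under \<open>f\<close> has only
  countably many atoms, so some level in the interval is no atom. The ramp between two such levels
  is differentiable almost everywhere.\<close>

lemma generic_level:
  fixes f :: "'a::euclidean_space \<Rightarrow> real"
  assumes f [measurable]: "f \<in> borel_measurable borel" and K: "compact K" "\<And>x. x \<notin> K \<Longrightarrow> f x = 0"
    and ab: "0 \<le> a" "a < b"
  obtains s where "a < s" "s < b" "AE x in lborel. f x \<noteq> s"
proof -
  have Kb: "K \<in> sets borel" using K(1) by (simp add: borel_compact)
  define N where "N = distr (restrict_space lborel K) borel f"
  have fin: "emeasure lborel K < \<infinity>" using emeasure_bounded_finite compact_imp_bounded K(1) by blast
  have [measurable]: "f \<in> borel_measurable (restrict_space lborel K)"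
    by (rule measurable_restrict_space1) simp
  interpret N: finite_measure N
  proof (rule finite_measureI)
    have "emeasure N (space N) = emeasure (restrict_space lborel K) (space (restrict_space lborel K))"
      unfolding N_def by (subst emeasure_distr) (auto intro!: arg_cong2[where f=emeasure])
    also have "\<dots> = emeasure lborel K"
      using Kb by (simp add: emeasure_restrict_space space_restrict_space)
    finally show "emeasure N (space N) \<noteq> \<infinity>" using fin by simp
  qed
  have "uncountable {a<..<b}" using ab by (simp add: uncountable_open_interval)
  then have "\<not> {a<..<b} \<subseteq> {s. measure N {s} \<noteq> 0}"
    using N.countable_support countable_subset by blast
  then obtain s where s: "a < s" "s < b" "measure N {s} = 0" by auto
  have ms: "{x. f x = s} \<in> sets borel" by measurable
  have "{x. f x = s} \<subseteq> K" using K(2) s ab by force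
  then have "emeasure lborel {x. f x = s} = emeasure (restrict_space lborel K) (f -` {s} \<inter> space (restrict_space lborel K))"
    using Kb by (subst emeasure_restrict_space) (auto simp: space_restrict_space intro!: arg_cong2[where f=emeasure])
  also have "\<dots> = emeasure N {s}" unfolding N_def by (subst emeasure_distr) auto
  also have "\<dots> = 0" using s(3) N.emeasure_eq_measure by simp
  finally have "{x. f x = s} \<in> null_sets lborel" using ms by (auto simp: null_sets_def)
  then have "AE x in lborel. x \<notin> {x. f x = s}" by (rule AE_not_in)
  then show ?thesis using that[OF s(1,2)] by simp
qed

text \<open>With n the dimension, \<open>hvw n\<close> is the hyperbolic volume density and
  \<open>hvw (n - 2)\<close> the weight of the Dirichlet integral, since the squared hyperbolic
  gradient carries \<open>rho^(-2)\<close>. \<open>hvw (n - 1)\<close> is the weight of the area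
  term. The indicator discards the values of \<open>rho\<close> outside the ball, where they have no
  meaning.\<close>

definition hvw :: "nat \<Rightarrow> 'a::euclidean_space \<Rightarrow> real" where
  "hvw k x = indicator (ball 0 1) x * rho x ^ k"

lemma hvw_nonneg: "hvw k x \<ge> 0"
  using hyp_rho_pos[of x] by (auto simp: hvw_def indicator_def)

lemma hvw_meas [measurable]: "hvw k \<in> borel_measurable borel"
  unfolding hvw_def[abs_def]
  by (intro borel_measurable_times borel_measurable_indicator borel_measurable_power hyp_rho_measurable) simp

lemma hvw_integrable:
  fixes h :: "'a::euclidean_space \<Rightarrow> real"
  assumes K: "compact K" "K \<subseteq> ball 0 1" and h [measurable]: "h \<in> borel_measurable borel"
    and hK: "\<And>x. x \<notin> K \<Longrightarrow> h x = 0" and B: "\<And>x. \<bar>h x\<bar> \<le> B"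
  shows "integrable lborel (\<lambda>x. hvw k x * h x)"
proof -
  have c: "continuous_on K (\<lambda>x. rho x ^ k)"
    by (rule continuous_on_subset[OF continuous_on_power[OF hyp_rho_continuous] K(2)])
  obtain C where C: "\<And>x. x \<in> K \<Longrightarrow> \<bar>rho x ^ k\<bar> \<le> C"
    using compact_imp_bounded[OF compact_continuous_image[OF c K(1)]] by (auto simp: bounded_iff)
  have B0: "B \<ge> 0" using B[of 0] by simp
  have "norm (hvw k x * h x) \<le> max C 0 * B" for x
  proof (cases "x \<in> K")
    case True
    then have "hvw k x \<le> max C 0" using C[OF True] K(2) by (auto simp: hvw_def indicator_def)
    then show ?thesis using hvw_nonneg[of k x] B[of x] B0 by (auto simp: abs_mult intro!: mult_mono)
  qed (use hK B0 in auto)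
  then show ?thesis
    by (intro integrable_bounded_support[where K=K]) (use K hK in \<open>auto intro: compact_imp_bounded\<close>)
qed

locale ball_C1 =
  fixes u :: "'a::euclidean_space \<Rightarrow> real" and G :: "'a \<Rightarrow> 'a"
  assumes C1: "C1c (ball 0 1) u G" and dim: "DIM('a) \<ge> 2"
begin

lemma uG_cont: "continuous_on UNIV u" "continuous_on UNIV G"
  using C1 by (auto simp: C1c_def)

lemma uG_meas [measurable]: "u \<in> borel_measurable borel" "G \<in> borel_measurable borel"
  using uG_cont by (auto intro: borel_measurable_continuous_onI)

lemma u_der: "i \<in> Basis \<Longrightarrow> ((\<lambda>t. u (x + t *\<^sub>R i)) has_real_derivative (G x \<bullet> i)) (at 0)"
  using C1 by (auto simp: C1c_def)

definition K where "K = (SOME K. compact K \<and> K \<subseteq> ball 0 1 \<and> (\<forall>x. x \<notin> K \<longrightarrow> u x = 0 \<and> G x = 0))"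

lemma K: "compact K" "K \<subseteq> ball 0 1" "\<And>x. x \<notin> K \<Longrightarrow> u x = 0" "\<And>x. x \<notin> K \<Longrightarrow> G x = 0"
proof -
  have "\<exists>K. compact K \<and> K \<subseteq> ball 0 1 \<and> (\<forall>x. x \<notin> K \<longrightarrow> u x = 0 \<and> G x = 0)"
    using C1 by (simp add: C1c_def)
  then have *: "compact K \<and> K \<subseteq> ball 0 1 \<and> (\<forall>x. x \<notin> K \<longrightarrow> u x = 0 \<and> G x = 0)"
    unfolding K_def by (rule someI_ex)
  then show "compact K" "K \<subseteq> ball 0 1" by auto
  show "u x = 0" "G x = 0" if "x \<notin> K" for x using * that by auto
qed

lemma u_bdd: "\<exists>B\<ge>0. \<forall>x. \<bar>u x\<bar> \<le> B"
  using continuous_compact_support_bounded[OF uG_cont(1) K(1,3)] by (metis real_norm_def)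

lemma G_bdd: "\<exists>B\<ge>0. \<forall>x. norm (G x) \<le> B"
  using continuous_compact_support_bounded[OF uG_cont(2) K(1,4)] by metis

definition Sh where "Sh s t = {x. s < \<bar>u x\<bar> \<and> \<bar>u x\<bar> < t}"

lemma Sh_meas [measurable]: "Sh s t \<in> sets borel" unfolding Sh_def by measurable

lemma G_integrable: "integrable lborel (\<lambda>x. hvw k x * (indicator (Sh s t) x * norm (G x)))"
  "integrable lborel (\<lambda>x. hvw k x * (indicator (Sh s t) x * (norm (G x))\<^sup>2))"
  "integrable lborel (\<lambda>x. hvw k x * (norm (G x))\<^sup>2)"
proof -
  obtain B where B: "B \<ge> 0" "\<forall>x. norm (G x) \<le> B" using G_bdd by (elim exE conjE)
  have B2: "(norm (G x))\<^sup>2 \<le> B\<^sup>2" for x using B by (intro power_mono) auto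
  show "integrable lborel (\<lambda>x. hvw k x * (indicator (Sh s t) x * norm (G x)))"
  proof (rule hvw_integrable[OF K(1,2)])
    show "\<bar>indicator (Sh s t) x * norm (G x)\<bar> \<le> B" for x using B by (simp add: indicator_def)
  qed (measurable, simp add: K(4))
  show "integrable lborel (\<lambda>x. hvw k x * (indicator (Sh s t) x * (norm (G x))\<^sup>2))"
  proof (rule hvw_integrable[OF K(1,2)])
    show "\<bar>indicator (Sh s t) x * (norm (G x))\<^sup>2\<bar> \<le> B\<^sup>2" for x using B2[of x] by (simp add: indicator_def)
  qed (measurable, simp add: K(4))
  show "integrable lborel (\<lambda>x. hvw k x * (norm (G x))\<^sup>2)"
  proof (rule hvw_integrable[OF K(1,2)])
    show "\<bar>(norm (G x))\<^sup>2\<bar> \<le> B\<^sup>2" for x using B2[of x] by simp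
  qed (measurable, simp add: K(4))
qed

text \<open>The isoperimetric inequality is applied to the ramp \<open>w\<close>, which is 0 where
  |u| is at most \<open>s\<close>, 1 where it is at least \<open>t\<close>, and affine in |u|
  between. It is squeezed between the indicators of the two superlevel sets, and its gradient is
  that of |u| divided by \<open>t - s\<close> on the shell.\<close>

lemma shell_generic:
  assumes st: "0 < s" "s < t" and ae: "AE x in lborel. \<bar>u x\<bar> \<noteq> s" "AE x in lborel. \<bar>u x\<bar> \<noteq> t"
  shows "real DIM('a) * unit_ball_vol (real DIM('a)) powr (1 / real DIM('a)) * (t - s) * (\<integral>x. hvw DIM('a) x * indicator {x. \<bar>u x\<bar> \<ge> t} x \<partial>lborel)
    \<le> (\<integral>x. hvw DIM('a) x * indicator {x. \<bar>u x\<bar> > s} x \<partial>lborel) powr (1 / real DIM('a))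
       * (\<integral>x. hvw (DIM('a) - 1) x * (indicator (Sh s t) x * norm (G x)) \<partial>lborel)"
proof -
  define n where "n = DIM('a)"
  obtain B' where B': "B' \<ge> 0" "\<forall>x. norm (G x) \<le> B'" using G_bdd by (elim exE conjE)
  define w where "w x = max 0 (min 1 ((\<bar>u x\<bar> - s) / (t - s)))" for x
  define g where "g x = (indicator (Sh s t) x * sgn (u x) / (t - s)) *\<^sub>R G x" for x
  have ts: "t - s > 0" using st by simp
  have w_lo: "w x = 0" if "\<bar>u x\<bar> \<le> s" for x
    using divide_nonpos_pos[of "\<bar>u x\<bar> - s" "t - s"] ts that by (simp add: w_def)
  have w_hi: "w x = 1" if "\<bar>u x\<bar> \<ge> t" for x
  proof -
    have "1 \<le> (\<bar>u x\<bar> - s) / (t - s)" using ts that by (subst le_divide_eq_1_pos) auto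
    then show ?thesis by (simp add: w_def min_absorb1)
  qed
  have w_mid: "w x = (\<bar>u x\<bar> - s) / (t - s)" if "s \<le> \<bar>u x\<bar>" "\<bar>u x\<bar> \<le> t" for x
  proof -
    have "0 \<le> (\<bar>u x\<bar> - s) / (t - s)" using ts that by (intro divide_nonneg_pos) auto
    moreover have "(\<bar>u x\<bar> - s) / (t - s) \<le> 1" using ts that by (subst divide_le_eq_1_pos) auto
    ultimately show ?thesis by (simp add: w_def)
  qed
  have [measurable]: "g \<in> borel_measurable borel" unfolding g_def[abs_def] by measurable
  have wK: "w x = 0" if "x \<notin> K" for x
    by (rule w_lo) (use K(3)[OF that] st in simp)
  have gn: "norm (g x) = indicator (Sh s t) x * norm (G x) / (t - s)" for x
    using st ts by (auto simp: g_def Sh_def indicator_def abs_sgn_eq)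
  have Kc: "closed K" using K(1) by (rule compact_imp_closed)
  interpret bl: ball_lipschitz w g K "B' / (t - s)" "B' / (t - s)"
  proof
    show "compact K" "K \<subseteq> ball 0 1" by (rule K)+
    show "w x = 0" if "x \<notin> K" for x by (rule wK[OF that])
    show "g x = 0" if "x \<notin> K" for x using K(4)[OF that] by (simp add: g_def)
    show "0 \<le> w x" "w x \<le> 1" for x by (auto simp: w_def)
    show "continuous_on UNIV w" unfolding w_def
      by (intro continuous_on_max continuous_on_min continuous_on_divide continuous_on_diff continuous_on_const
          continuous_on_rabs uG_cont) (use ts in auto)
    show "\<bar>w (x + h *\<^sub>R i) - w x\<bar> \<le> B' / (t - s) * \<bar>h\<bar>" if i: "i \<in> Basis" for x h i
    proof -
      have "\<bar>w (x + h *\<^sub>R i) - w x\<bar> \<le> \<bar>(\<bar>u (x + h *\<^sub>R i)\<bar> - s) / (t - s) - (\<bar>u x\<bar> - s) / (t - s)\<bar>"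
        unfolding w_def by (rule clamp_lipschitz)
      also have "\<dots> = \<bar>\<bar>u (x + h *\<^sub>R i)\<bar> - \<bar>u x\<bar>\<bar> / (t - s)"
        using ts by (simp add: diff_divide_distrib[symmetric])
      also have "\<dots> \<le> (B' * \<bar>h\<bar>) / (t - s)"
      proof (rule divide_right_mono)
        have "\<bar>\<bar>u (x + h *\<^sub>R i)\<bar> - \<bar>u x\<bar>\<bar> \<le> \<bar>u (x + h *\<^sub>R i) - u x\<bar>" by (rule abs_triangle_ineq3)
        also have "\<dots> \<le> B' * \<bar>h\<bar>"
          by (rule line_lipschitz[of u i "\<lambda>x. G x \<bullet> i", OF u_der[OF i]])
             (use B'(2) Basis_le_norm[OF i] order_trans in blast)
        finally show "\<bar>\<bar>u (x + h *\<^sub>R i)\<bar> - \<bar>u x\<bar>\<bar> \<le> B' * \<bar>h\<bar>" .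
      qed (use ts in simp)
      finally show ?thesis by simp
    qed
    show "g \<in> borel_measurable borel" by measurable
    show "norm (g x) \<le> B' / (t - s)" for x
      unfolding gn using ts B' by (intro divide_right_mono) (auto simp: indicator_def)
    show "AE x in lborel. ((\<lambda>h. w (x + h *\<^sub>R i)) has_real_derivative g x \<bullet> i) (at 0)" if i: "i \<in> Basis" for i
      using ae
    proof eventually_elim
      case (elim x)
      have cu: "continuous_on UNIV (\<lambda>h. \<bar>u (x + h *\<^sub>R i)\<bar>)"
        by (intro continuous_on_rabs continuous_on_compose2[OF uG_cont(1)] continuous_intros) auto
      consider "\<bar>u x\<bar> < s" | "\<bar>u x\<bar> > t" | "s < \<bar>u x\<bar>" "\<bar>u x\<bar> < t" using elim by linarith
      then show ?case
      proof cases
        case 1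
        let ?S = "{h. \<bar>u (x + h *\<^sub>R i)\<bar> < s}"
        have "((\<lambda>h::real. 0) has_real_derivative 0) (at 0)" by simp
        then have "((\<lambda>h. w (x + h *\<^sub>R i)) has_real_derivative 0) (at 0)"
        proof (rule has_field_derivative_transform_within_open[where S="?S"])
          show "open ?S" by (rule open_Collect_less[OF cu continuous_on_const])
          show "0 = w (x + h *\<^sub>R i)" if "h \<in> ?S" for h
            using w_lo[of "x + h *\<^sub>R i"] that by simp
        qed (use 1 in simp)
        moreover have "g x = 0" using 1 by (simp add: g_def Sh_def)
        ultimately show ?thesis by simp
      next
        case 2
        let ?S = "{h. t < \<bar>u (x + h *\<^sub>R i)\<bar>}"
        have "((\<lambda>h::real. 1) has_real_derivative 0) (at 0)" by simp
        then have "((\<lambda>h. w (x + h *\<^sub>R i)) has_real_derivative 0) (at 0)"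
        proof (rule has_field_derivative_transform_within_open[where S="?S"])
          show "open ?S" by (rule open_Collect_less[OF continuous_on_const cu])
          show "1 = w (x + h *\<^sub>R i)" if "h \<in> ?S" for h
            using w_hi[of "x + h *\<^sub>R i"] that by simp
        qed (use 2 in simp)
        moreover have "g x = 0" using 2 by (simp add: g_def Sh_def)
        ultimately show ?thesis by simp
      next
        case 3
        \<comment> \<open>Near \<open>h = 0\<close> the function keeps the sign of
          \<open>u x\<close>, so the absolute value is replaced by multiplication with this fixed
          sign and the ramp becomes affine in \<open>u\<close>.\<close>
        let ?S = "{h. s < sgn (u x) * u (x + h *\<^sub>R i)} \<inter> {h. sgn (u x) * u (x + h *\<^sub>R i) < t}"
        have cs: "continuous_on UNIV (\<lambda>h. sgn (u x) * u (x + h *\<^sub>R i))"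
          by (intro continuous_on_mult continuous_on_const continuous_on_compose2[OF uG_cont(1)] continuous_intros) auto
        have ux: "u x \<noteq> 0" using 3 st by auto
        have su: "sgn (u x) * u x = \<bar>u x\<bar>" by (simp add: abs_sgn mult.commute)
        have "((\<lambda>h. (sgn (u x) * u (x + h *\<^sub>R i) - s) / (t - s)) has_real_derivative (sgn (u x) * (G x \<bullet> i) - 0) / (t - s)) (at 0)"
          by (intro DERIV_cdivide DERIV_diff DERIV_const DERIV_cmult u_der[OF i])
        then have "((\<lambda>h. w (x + h *\<^sub>R i)) has_real_derivative (sgn (u x) * (G x \<bullet> i) - 0) / (t - s)) (at 0)"
        proof (rule has_field_derivative_transform_within_open[where S="?S"])
          show "open ?S" by (intro open_Int open_Collect_less cs continuous_on_const)
          show "(sgn (u x) * u (x + h *\<^sub>R i) - s) / (t - s) = w (x + h *\<^sub>R i)" if h: "h \<in> ?S" for h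
          proof -
            have "sgn (u x) * u (x + h *\<^sub>R i) > 0" using h st by auto
            then have "\<bar>u (x + h *\<^sub>R i)\<bar> = sgn (u x) * u (x + h *\<^sub>R i)"
              using ux by (auto simp: sgn_if split: if_splits)
            then show ?thesis using h w_mid[of "x + h *\<^sub>R i"] by simp
          qed
        qed (use 3 su in simp)
        moreover have "x \<in> Sh s t" using 3 by (simp add: Sh_def)
        ultimately show ?thesis by (simp add: g_def)
      qed
    qed
  qed
  have w_K: "hvw k x * w x = rho x ^ k * w x" for k x
    using wK[of x] K(2) by (cases "x \<in> K") (auto simp: hvw_def)
  have i1: "integrable lborel (\<lambda>x. hvw n x * w x)"
    by (rule hvw_integrable[OF K(1,2), where B=1]) (use wK bl.w_nonneg bl.w_le bl.w_meas in auto)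
  have i2: "integrable lborel (\<lambda>x. hvw n x * indicator {x. \<bar>u x\<bar> \<ge> t} x)"
    by (rule hvw_integrable[OF K(1,2), where B=1]) (use K(3) st in \<open>auto simp: indicator_def\<close>)
  have i3: "integrable lborel (\<lambda>x. hvw n x * indicator {x. \<bar>u x\<bar> > s} x)"
    by (rule hvw_integrable[OF K(1,2), where B=1]) (use K(3) st in \<open>auto simp: indicator_def\<close>)
  have i4: "integrable lborel (\<lambda>x. hvw n x * w x powr (1 + 1 / real n))"
    by (rule hvw_integrable[OF K(1,2), where B=1])
       (use wK bl.w_nonneg bl.w_le bl.w_meas in \<open>auto intro!: powr_le_one_le[of _ 1] powr_le1\<close>)
  have iso: "real n * unit_ball_vol (real n) powr (1 / real n) * (\<integral>x. rho x ^ n * w x powr (1 + 1 / real n) \<partial>lborel)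
    \<le> (\<integral>x. rho x ^ n * w x \<partial>lborel) powr (1 / real n) * (\<integral>x. rho x ^ (n - 1) * norm (g x) \<partial>lborel)"
    unfolding n_def by (rule bl.isoperimetric_L1)
  have e1: "rho x ^ n * w x powr (1 + 1 / real n) = hvw n x * w x powr (1 + 1 / real n)" for x
    using wK[of x] K(2) by (cases "x \<in> K") (auto simp: hvw_def)
  have e2: "rho x ^ (n - 1) * norm (g x) = hvw (n - 1) x * (indicator (Sh s t) x * norm (G x)) / (t - s)" for x
    using K(2) K(4)[of x] by (cases "x \<in> K") (auto simp: hvw_def gn)
  define I where "I = (\<integral>x. hvw (n - 1) x * (indicator (Sh s t) x * norm (G x)) \<partial>lborel)"
  have I0: "I \<ge> 0" unfolding I_def by (intro Bochner_Integration.integral_nonneg mult_nonneg_nonneg hvw_nonneg) auto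
  have "(\<integral>x. hvw n x * indicator {x. \<bar>u x\<bar> \<ge> t} x \<partial>lborel) \<le> (\<integral>x. hvw n x * w x powr (1 + 1 / real n) \<partial>lborel)"
  proof (rule integral_mono[OF i2 i4 mult_left_mono[OF _ hvw_nonneg]])
    fix x
    show "indicator {x. \<bar>u x\<bar> \<ge> t} x \<le> w x powr (1 + 1 / real n)"
    proof (cases "\<bar>u x\<bar> \<ge> t")
      case True
      then have "w x = 1" by (rule w_hi)
      then show ?thesis by simp
    qed simp
  qed
  then have "real n * unit_ball_vol (real n) powr (1 / real n) * (\<integral>x. hvw n x * indicator {x. \<bar>u x\<bar> \<ge> t} x \<partial>lborel)
     \<le> real n * unit_ball_vol (real n) powr (1 / real n) * (\<integral>x. hvw n x * w x powr (1 + 1 / real n) \<partial>lborel)"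
    by (intro mult_left_mono) auto
  also have "\<dots> \<le> (\<integral>x. hvw n x * w x \<partial>lborel) powr (1 / real n) * (I / (t - s))"
    using iso unfolding e1 e2 w_K[symmetric] I_def by simp
  also have "\<dots> \<le> (\<integral>x. hvw n x * indicator {x. \<bar>u x\<bar> > s} x \<partial>lborel) powr (1 / real n) * (I / (t - s))"
  proof (intro mult_right_mono powr_mono2 integral_mono[OF i1 i3 mult_left_mono[OF _ hvw_nonneg]])
    show "w x \<le> indicator {x. \<bar>u x\<bar> > s} x" for x
      using bl.w_le[of x] w_lo[of x] by (cases "\<bar>u x\<bar> > s") auto
    show "0 \<le> (\<integral>x. hvw n x * w x \<partial>lborel)"
      by (intro Bochner_Integration.integral_nonneg mult_nonneg_nonneg hvw_nonneg bl.w_nonneg)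
  qed (use I0 ts in auto)
  finally show ?thesis using ts unfolding I_def n_def by (simp add: field_simps)
qed

definition vol :: "'a set \<Rightarrow> real" where "vol A = (\<integral>x. hvw DIM('a) x * indicator A x \<partial>lborel)"

definition Dsh :: "real \<Rightarrow> real \<Rightarrow> real" where
  "Dsh s t = (\<integral>x. hvw (DIM('a) - 2) x * (indicator (Sh s t) x * (norm (G x))\<^sup>2) \<partial>lborel)"

lemma vol_integrable:
  assumes "A \<in> sets borel" "A \<subseteq> {x. u x \<noteq> 0}"
  shows "integrable lborel (\<lambda>x. hvw k x * indicator A x)"
proof (rule hvw_integrable[OF K(1,2)])
  show "indicator A x = (0::real)" if "x \<notin> K" for x using K(3)[OF that] assms(2) by (auto simp: indicator_def)
  show "\<bar>indicator A x :: real\<bar> \<le> 1" for x by (simp add: indicator_def)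
qed (rule borel_measurable_indicator, rule assms(1))

lemma vol_nonneg: "vol A \<ge> 0"
  unfolding vol_def by (intro Bochner_Integration.integral_nonneg mult_nonneg_nonneg hvw_nonneg) simp

lemma vol_mono:
  assumes "A \<in> sets borel" "B \<in> sets borel" "A \<subseteq> B" "B \<subseteq> {x. u x \<noteq> 0}"
  shows "vol A \<le> vol B"
  unfolding vol_def
proof (rule integral_mono)
  show "integrable lborel (\<lambda>x. hvw DIM('a) x * indicator A x)" "integrable lborel (\<lambda>x. hvw DIM('a) x * indicator B x)"
    by (rule vol_integrable; use assms in blast)+
  show "hvw DIM('a) x * indicator A x \<le> hvw DIM('a) x * indicator B x" for x
    using assms(3) by (intro mult_left_mono hvw_nonneg) (auto simp: indicator_def)
qed

lemma Sh_sub: "0 \<le> s \<Longrightarrow> Sh s t \<subseteq> {x. u x \<noteq> 0}" by (auto simp: Sh_def)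

text \<open>Cauchy-Schwarz with the weight \<open>rho^(n-1)\<close> split as
  \<open>rho^(n/2)\<close> times \<open>rho^((n-2)/2)\<close>, so that the squares carry the weights
  of volume and of Dirichlet energy.\<close>

lemma shell_I_sq:
  assumes "0 \<le> s"
  shows "(\<integral>x. hvw (DIM('a) - 1) x * (indicator (Sh s t) x * norm (G x)) \<partial>lborel)\<^sup>2 \<le> vol (Sh s t) * Dsh s t"
proof -
  define m where "m = DIM('a) - 2"
  have m: "DIM('a) = m + 2" "DIM('a) - 1 = m + 1" using dim by (simp_all add: m_def)
  define X where "X x = sqrt (hvw (m + 2) x) * indicator (Sh s t) x" for x
  define Y where "Y x = sqrt (hvw m x) * (indicator (Sh s t) x * norm (G x))" for x
  have XX: "(X x)\<^sup>2 = hvw (m + 2) x * indicator (Sh s t) x" for x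
    using hvw_nonneg[of "m + 2" x] by (simp add: X_def power_mult_distrib indicator_def)
  have YY: "(Y x)\<^sup>2 = hvw m x * (indicator (Sh s t) x * (norm (G x))\<^sup>2)" for x
    using hvw_nonneg[of m x] by (simp add: Y_def power_mult_distrib indicator_def)
  have XY: "X x * Y x = hvw (m + 1) x * (indicator (Sh s t) x * norm (G x))" for x
  proof (cases "norm x < 1")
    case True
    then have r: "rho x > 0" by (rule hyp_rho_pos)
    have "sqrt (hvw (m + 2) x) * sqrt (hvw m x) = sqrt ((rho x ^ (m + 1))\<^sup>2)"
      using True by (simp add: hvw_def real_sqrt_mult[symmetric] power2_eq_square mult_ac)
    also have "\<dots> = hvw (m + 1) x" using r True by (simp add: hvw_def)
    finally show ?thesis by (simp add: X_def Y_def indicator_def)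
  qed (simp add: X_def Y_def hvw_def)
  have [measurable]: "X \<in> borel_measurable lborel" "Y \<in> borel_measurable lborel"
    unfolding X_def[abs_def] Y_def[abs_def] by measurable
  have iX: "integrable lborel (\<lambda>x. (X x)\<^sup>2)" unfolding XX by (rule vol_integrable[OF Sh_meas Sh_sub[OF assms]])
  have iY: "integrable lborel (\<lambda>x. (Y x)\<^sup>2)" unfolding YY by (rule G_integrable(2))
  have "(\<integral>x. X x * Y x \<partial>lborel)\<^sup>2 \<le> (\<integral>x. (X x)\<^sup>2 \<partial>lborel) * (\<integral>x. (Y x)\<^sup>2 \<partial>lborel)"
    by (rule integral_Cauchy_Schwarz(2)[OF _ _ iX iY]) measurable
  then show ?thesis unfolding XX YY XY vol_def Dsh_def m by simp
qed

text \<open>Arbitrary levels are approached from inside by generic ones at distance below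
  \<open>e\<close>, which shortens the height of the shell by at most \<open>2 * e\<close>. After
  the limit the inequality is squared, so that the Dirichlet energy can replace the area
  term.\<close>

lemma shell_inequality:
  assumes st: "0 \<le> s" "s < t"
  shows "(t - s)\<^sup>2 * (real DIM('a))\<^sup>2 * unit_ball_vol (real DIM('a)) powr (2 / real DIM('a)) * (vol {x. \<bar>u x\<bar> \<ge> t})\<^sup>2
     \<le> vol {x. \<bar>u x\<bar> > s} powr (2 / real DIM('a)) * vol (Sh s t) * Dsh s t"
proof -
  define c where "c = real DIM('a) * unit_ball_vol (real DIM('a)) powr (1 / real DIM('a))"
  define I where "I = (\<integral>x. hvw (DIM('a) - 1) x * (indicator (Sh s t) x * norm (G x)) \<partial>lborel)"
  have c0: "c \<ge> 0" by (simp add: c_def)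
  have I0: "I \<ge> 0" unfolding I_def by (intro Bochner_Integration.integral_nonneg mult_nonneg_nonneg hvw_nonneg) auto
  have uabs: "(\<lambda>x. \<bar>u x\<bar>) \<in> borel_measurable borel" by measurable
  have main: "c * (t - s - 2 * e) * vol {x. \<bar>u x\<bar> \<ge> t} \<le> vol {x. \<bar>u x\<bar> > s} powr (1 / real DIM('a)) * I"
    if e: "0 < e" "2 * e < t - s" for e
  proof -
    obtain s' where s': "s < s'" "s' < s + e" "AE x in lborel. \<bar>u x\<bar> \<noteq> s'"
      by (rule generic_level[OF uabs K(1), of s "s + e"]) (use K(3) st e in auto)
    obtain t' where t': "t - e < t'" "t' < t" "AE x in lborel. \<bar>u x\<bar> \<noteq> t'"
      by (rule generic_level[OF uabs K(1), of "t - e" t]) (use K(3) st e in auto)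
    have st': "0 < s'" "s' < t'" using s' t' st e by auto
    have "c * (t - s - 2 * e) * vol {x. \<bar>u x\<bar> \<ge> t} \<le> c * (t' - s') * vol {x. \<bar>u x\<bar> \<ge> t'}"
    proof (intro mult_mono mult_left_mono vol_mono)
      show "t - s - 2 * e \<le> t' - s'" using s' t' by simp
      show "{x. \<bar>u x\<bar> \<ge> t} \<subseteq> {x. \<bar>u x\<bar> \<ge> t'}" using t' by auto
      show "{x. \<bar>u x\<bar> \<ge> t'} \<subseteq> {x. u x \<noteq> 0}" using st' by auto
      show "0 \<le> c * (t' - s')" using c0 st' by simp
    qed (use c0 vol_nonneg e in \<open>auto\<close>)
    also have "\<dots> \<le> vol {x. \<bar>u x\<bar> > s'} powr (1 / real DIM('a))
       * (\<integral>x. hvw (DIM('a) - 1) x * (indicator (Sh s' t') x * norm (G x)) \<partial>lborel)"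
      using shell_generic[OF st' s'(3) t'(3)] by (simp add: c_def vol_def)
    also have "\<dots> \<le> vol {x. \<bar>u x\<bar> > s} powr (1 / real DIM('a)) * I"
    proof (intro mult_mono powr_mono2 vol_mono vol_nonneg powr_ge_zero)
      show "(\<integral>x. hvw (DIM('a) - 1) x * (indicator (Sh s' t') x * norm (G x)) \<partial>lborel) \<le> I"
        unfolding I_def
      proof (rule integral_mono[OF G_integrable(1) G_integrable(1) mult_left_mono[OF _ hvw_nonneg]])
        show "indicator (Sh s' t') x * norm (G x) \<le> indicator (Sh s t) x * norm (G x)" for x
          using s' t' by (intro mult_right_mono) (auto simp: indicator_def Sh_def)
      qed
      show "0 \<le> (\<integral>x. hvw (DIM('a) - 1) x * (indicator (Sh s' t') x * norm (G x)) \<partial>lborel)"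
        by (intro Bochner_Integration.integral_nonneg mult_nonneg_nonneg hvw_nonneg) auto
      show "{x. \<bar>u x\<bar> > s'} \<subseteq> {x. \<bar>u x\<bar> > s}" "{x. \<bar>u x\<bar> > s} \<subseteq> {x. u x \<noteq> 0}" using s' st by auto
    qed auto
    finally show ?thesis .
  qed
  define e where "e k = (t - s) / 4 * (1 / real (Suc k))" for k
  have e: "0 < e k" "2 * e k < t - s" for k
  proof -
    show "0 < e k" using st by (simp add: e_def)
    have "e k \<le> (t - s) / 4 * 1" unfolding e_def by (rule mult_left_mono) (use st in auto)
    then show "2 * e k < t - s" using st by simp
  qed
  have "e \<longlonglongrightarrow> (t - s) / 4 * 0" unfolding e_def
    by (intro tendsto_mult tendsto_const LIMSEQ_Suc[OF lim_1_over_n])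
  then have "(\<lambda>k. c * (t - s - 2 * e k) * vol {x. \<bar>u x\<bar> \<ge> t}) \<longlonglongrightarrow> c * (t - s - 2 * ((t - s) / 4 * 0)) * vol {x. \<bar>u x\<bar> \<ge> t}"
    by (intro tendsto_intros)
  then have "c * (t - s - 2 * ((t - s) / 4 * 0)) * vol {x. \<bar>u x\<bar> \<ge> t} \<le> vol {x. \<bar>u x\<bar> > s} powr (1 / real DIM('a)) * I"
    by (rule LIMSEQ_le_const2) (intro exI[of _ 0] allI impI main e)
  then have "c * (t - s) * vol {x. \<bar>u x\<bar> \<ge> t} \<le> vol {x. \<bar>u x\<bar> > s} powr (1 / real DIM('a)) * I" by simp
  then have "(c * (t - s) * vol {x. \<bar>u x\<bar> \<ge> t})\<^sup>2 \<le> (vol {x. \<bar>u x\<bar> > s} powr (1 / real DIM('a)) * I)\<^sup>2"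
    by (rule power_mono) (use c0 st vol_nonneg in simp)
  also have "\<dots> = (vol {x. \<bar>u x\<bar> > s} powr (1 / real DIM('a)))\<^sup>2 * I\<^sup>2" by (simp add: power_mult_distrib)
  also have "\<dots> \<le> (vol {x. \<bar>u x\<bar> > s} powr (1 / real DIM('a)))\<^sup>2 * (vol (Sh s t) * Dsh s t)"
    unfolding I_def by (intro mult_left_mono shell_I_sq st) simp
  finally have fin: "(c * (t - s) * vol {x. \<bar>u x\<bar> \<ge> t})\<^sup>2 \<le> (vol {x. \<bar>u x\<bar> > s} powr (1 / real DIM('a)))\<^sup>2 * (vol (Sh s t) * Dsh s t)" .
  have sq: "(y powr (1 / real DIM('a)))\<^sup>2 = y powr (2 / real DIM('a))" for y :: real
    by (simp add: power2_eq_square powr_add[symmetric])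
  show ?thesis using fin unfolding c_def by (simp add: power_mult_distrib sq mult_ac)
qed

lemma sum_Dsh:
  assumes "mono t" "t 0 \<ge> 0"
  shows "(\<Sum>k<N. Dsh (t k) (t (Suc k))) \<le> (\<integral>x. hvw (DIM('a) - 2) x * (norm (G x))\<^sup>2 \<partial>lborel)"
proof -
  \<comment> \<open>Disjointness of the shells, in a form strong enough for induction: the shells up
    to \<open>t N\<close> lie in the set where |u| is below \<open>t N\<close>.\<close>
  have ind: "(\<Sum>k<N. indicator (Sh (t k) (t (Suc k))) x) \<le> (indicator {x. \<bar>u x\<bar> < t N} x :: real)" for x N
  proof (induction N)
    case (Suc N)
    have "t N \<le> t (Suc N)" using assms(1) by (simp add: mono_def)
    then have "indicator {x. \<bar>u x\<bar> < t N} x + indicator (Sh (t N) (t (Suc N))) x \<le> (indicator {x. \<bar>u x\<bar> < t (Suc N)} x :: real)"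
      by (auto simp: indicator_def Sh_def)
    then show ?case using Suc by simp
  qed (use assms in simp)
  have "(\<Sum>k<N. Dsh (t k) (t (Suc k))) = (\<integral>x. (\<Sum>k<N. hvw (DIM('a) - 2) x * (indicator (Sh (t k) (t (Suc k))) x * (norm (G x))\<^sup>2)) \<partial>lborel)"
    unfolding Dsh_def by (rule Bochner_Integration.integral_sum[symmetric]) (rule G_integrable(2))
  also have "\<dots> \<le> (\<integral>x. hvw (DIM('a) - 2) x * (norm (G x))\<^sup>2 \<partial>lborel)"
  proof (rule integral_mono[OF Bochner_Integration.integrable_sum[OF G_integrable(2)] G_integrable(3)])
    fix x
    have "(\<Sum>k<N. indicator (Sh (t k) (t (Suc k))) x) \<le> (1::real)"
      using ind[where N=N and x=x] by (rule order_trans) (simp add: indicator_def)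
    then have "(\<Sum>k<N. indicator (Sh (t k) (t (Suc k))) x) * (hvw (DIM('a) - 2) x * (norm (G x))\<^sup>2) \<le> 1 * (hvw (DIM('a) - 2) x * (norm (G x))\<^sup>2)"
      by (rule mult_right_mono) (simp add: hvw_nonneg)
    moreover have "(\<Sum>k<N. hvw (DIM('a) - 2) x * (indicator (Sh (t k) (t (Suc k))) x * (norm (G x))\<^sup>2))
       = (\<Sum>k<N. indicator (Sh (t k) (t (Suc k))) x) * (hvw (DIM('a) - 2) x * (norm (G x))\<^sup>2)"
      by (simp only: sum_distrib_right) (simp only: mult_ac)
    ultimately show "(\<Sum>k<N. hvw (DIM('a) - 2) x * (indicator (Sh (t k) (t (Suc k))) x * (norm (G x))\<^sup>2)) \<le> hvw (DIM('a) - 2) x * (norm (G x))\<^sup>2"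
      by simp
  qed
  finally show ?thesis .
qed

definition hM :: "'a measure" where "hM = density lborel (\<lambda>x. ennreal (hvw DIM('a) x))"

lemma hM_measurable: "borel_measurable hM = borel_measurable borel" "space hM = UNIV" "sets hM = sets borel"
proof -
  show s: "sets hM = sets borel" by (simp add: hM_def)
  show "borel_measurable hM = borel_measurable borel" by (rule measurable_cong_sets[OF s refl])
qed (simp add: hM_def)

lemma measure_hM:
  assumes "A \<in> sets borel" "A \<subseteq> {x. u x \<noteq> 0}"
  shows "emeasure hM A < \<infinity>" "measure hM A = vol A"
proof -
  have "emeasure hM A = (\<integral>\<^sup>+x. ennreal (hvw DIM('a) x) * indicator A x \<partial>lborel)"
    unfolding hM_def using assms(1) by (intro emeasure_density) auto
  also have "\<dots> = (\<integral>\<^sup>+x. ennreal (hvw DIM('a) x * indicator A x) \<partial>lborel)"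
    by (intro nn_integral_cong) (auto simp: indicator_def)
  also have "\<dots> = ennreal (vol A)"
    unfolding vol_def by (rule nn_integral_eq_integral[OF vol_integrable[OF assms]]) (simp add: hvw_nonneg)
  finally have e: "emeasure hM A = ennreal (vol A)" .
  show "emeasure hM A < \<infinity>" "measure hM A = vol A"
    using vol_nonneg[of A] by (simp_all add: e measure_def)
qed

lemma integral_hM:
  fixes h :: "'a \<Rightarrow> real"
  assumes "h \<in> borel_measurable borel"
  shows "(\<integral>x. h x \<partial>hM) = (\<integral>x. hvw DIM('a) x * h x \<partial>lborel)"
  unfolding hM_def using assms by (subst integral_density) (auto simp: hvw_nonneg)

theorem GN_ball_C1c:
  assumes C: "C \<ge> 0" and r: "r > 0" and a: "a > 0" and b: "b > 0"
    and euclid: "\<And>(v :: 'a \<Rightarrow> real) G. H1_Rn v G \<Longrightarrow> (\<And>x. v x \<ge> 0) \<Longrightarrow> (\<And>s. s > 0 \<Longrightarrow> integrable lborel (\<lambda>x. v x powr s)) \<Longrightarrow>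
        integrable lborel (\<lambda>x. (norm (G x))\<^sup>2) \<Longrightarrow>
        (\<integral>x. v x powr r \<partial>lborel) \<le> C * ((\<integral>x. v x powr 2 \<partial>lborel) powr a * (\<integral>x. (norm (G x))\<^sup>2 \<partial>lborel) powr b)"
  shows "(\<integral>x. hvw DIM('a) x * \<bar>u x\<bar> powr r \<partial>lborel)
    \<le> C * ((\<integral>x. hvw DIM('a) x * (u x)\<^sup>2 \<partial>lborel) powr a * (\<integral>x. hvw (DIM('a) - 2) x * (norm (G x))\<^sup>2 \<partial>lborel) powr b)"
proof -
  obtain B where B: "B \<ge> 0" "\<forall>x. \<bar>u x\<bar> \<le> B" using u_bdd by (elim exE conjE)
  have um: "(\<lambda>x. \<bar>u x\<bar>) \<in> borel_measurable hM" unfolding hM_measurable by measurable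
  have sp: "{x \<in> space hM. P x} = {x. P x}" for P by (simp add: hM_measurable)
  have "(\<integral>x. \<bar>u x\<bar> powr r \<partial>hM) \<le> C * ((\<integral>x. \<bar>u x\<bar> powr 2 \<partial>hM) powr a * (\<integral>x. hvw (DIM('a) - 2) x * (norm (G x))\<^sup>2 \<partial>lborel) powr b)"
  proof (rule symmetrization_bound[where Dn=Dsh and B=B and 'a='a, OF um _ _ B(1) _ C r a b euclid])
    show "\<forall>x\<in>space hM. 0 \<le> \<bar>u x\<bar>" "\<forall>x\<in>space hM. \<bar>u x\<bar> \<le> B" using B by auto
    show "emeasure hM {x \<in> space hM. 0 < \<bar>u x\<bar>} < \<infinity>"
      unfolding sp by (rule measure_hM) auto
    show "0 \<le> Dsh s t" for s t unfolding Dsh_def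
      by (intro Bochner_Integration.integral_nonneg mult_nonneg_nonneg hvw_nonneg) auto
    show "(\<Sum>k<N. Dsh (t k) (t (Suc k))) \<le> (\<integral>x. hvw (DIM('a) - 2) x * (norm (G x))\<^sup>2 \<partial>lborel)" if "mono t" "0 \<le> t 0" for t N
      by (rule sum_Dsh[OF that])
    fix s t :: real assume st: "0 \<le> s" "s < t"
    have m1: "measure hM {x. t \<le> \<bar>u x\<bar>} = vol {x. \<bar>u x\<bar> \<ge> t}"
      by (rule measure_hM(2)) (measurable, use st in auto)
    have m2: "measure hM {x. s < \<bar>u x\<bar>} = vol {x. \<bar>u x\<bar> > s}"
      by (rule measure_hM(2)) (measurable, use st in auto)
    have m3: "measure hM {x. s < \<bar>u x\<bar> \<and> \<bar>u x\<bar> < t} = vol (Sh s t)"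
      using measure_hM(2)[OF Sh_meas Sh_sub[OF st(1)]] by (simp add: Sh_def)
    show "(t - s)\<^sup>2 * real DIM('a) ^ 2 * unit_ball_vol (real DIM('a)) powr (2 / real DIM('a)) * (measure hM {x \<in> space hM. t \<le> \<bar>u x\<bar>})\<^sup>2
        \<le> measure hM {x \<in> space hM. s < \<bar>u x\<bar>} powr (2 / real DIM('a)) * measure hM {x \<in> space hM. s < \<bar>u x\<bar> \<and> \<bar>u x\<bar> < t} * Dsh s t"
      unfolding sp m1 m2 m3 by (rule shell_inequality[OF st])
  qed
  moreover have "(\<integral>x. \<bar>u x\<bar> powr r \<partial>hM) = (\<integral>x. hvw DIM('a) x * \<bar>u x\<bar> powr r \<partial>lborel)"
    by (rule integral_hM) measurable
  moreover have "(\<integral>x. \<bar>u x\<bar> powr 2 \<partial>hM) = (\<integral>x. hvw DIM('a) x * (u x)\<^sup>2 \<partial>lborel)"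
    by (subst integral_hM) (simp_all add: powr_numeral)
  ultimately show ?thesis by simp
qed

end

section \<open>Mollification\<close>

lemma partial_eq:
  assumes "(f has_derivative D) (at x)"
  shows "partial f i x = D i"
  using frechet_derivative_at[OF assms] by (simp add: partial_def)

lemma Ck_continuous: "Ck k f \<Longrightarrow> continuous_on UNIV f"
  by (cases k) (auto simp: differentiable_imp_continuous_within continuous_on_eq_continuous_within)

lemma Ck_Suc_imp: "Ck (Suc k) f \<Longrightarrow> Ck k f"
proof (induction k arbitrary: f)
  case 0
  then show ?case using Ck_continuous[OF 0] by simp
next
  case (Suc k)
  then show ?case by (subst Ck.simps) simp
qed

lemma Ck_const: "Ck k (\<lambda>x. c)"
proof (induction k arbitrary: c)
  case (Suc k)
  have "partial (\<lambda>x. c) i = (\<lambda>x. 0)" for i :: 'a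
    by (rule ext) (rule partial_eq, simp)
  then show ?case using Suc by simp
qed simp

lemma Ck_add:
  assumes "Ck k f" "Ck k g"
  shows "Ck k (\<lambda>x. f x + g x)"
  using assms
proof (induction k arbitrary: f g)
  case 0
  then show ?case by (auto intro: continuous_on_add)
next
  case (Suc k)
  have df: "f differentiable (at x)" "g differentiable (at x)" for x using Suc.prems by auto
  have "partial (\<lambda>x. f x + g x) i = (\<lambda>x. partial f i x + partial g i x)" for i
  proof
    fix x
    have "((\<lambda>x. f x + g x) has_derivative (\<lambda>h. frechet_derivative f (at x) h + frechet_derivative g (at x) h)) (at x)"
      using df by (intro has_derivative_add) (auto simp: frechet_derivative_works[symmetric])
    from partial_eq[OF this] show "partial (\<lambda>x. f x + g x) i x = partial f i x + partial g i x"
      by (simp add: partial_def)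
  qed
  then show ?case using Suc df by auto
qed

lemma Ck_mult:
  assumes "Ck k f" "Ck k g"
  shows "Ck k (\<lambda>x. f x * g x)"
  using assms
proof (induction k arbitrary: f g)
  case 0
  then show ?case by (auto intro: continuous_on_mult)
next
  case (Suc k)
  have df: "f differentiable (at x)" "g differentiable (at x)" for x using Suc.prems by auto
  have "partial (\<lambda>x. f x * g x) i = (\<lambda>x. f x * partial g i x + partial f i x * g x)" for i
  proof
    fix x
    have "((\<lambda>x. f x * g x) has_derivative (\<lambda>h. f x * frechet_derivative g (at x) h + frechet_derivative f (at x) h * g x)) (at x)"
      using df by (intro has_derivative_mult) (auto simp: frechet_derivative_works[symmetric])
    from partial_eq[OF this] show "partial (\<lambda>x. f x * g x) i x = f x * partial g i x + partial f i x * g x"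
      by (simp add: partial_def)
  qed
  moreover have "Ck k (\<lambda>x. f x * partial g i x + partial f i x * g x)" if "i \<in> Basis" for i
    using Suc.prems that by (intro Ck_add Suc.IH Ck_Suc_imp[of k f] Ck_Suc_imp[of k g]) auto
  ultimately show ?case using df by (auto intro: differentiable_mult)
qed

lemma Ck_coord: "Ck k (\<lambda>y::'a::euclidean_space. (y - c) \<bullet> i)"
proof (cases k)
  case (Suc m)
  have d: "((\<lambda>y::'a. (y - c) \<bullet> i) has_derivative (\<lambda>h. h \<bullet> i)) (at x)" for x
    by (auto intro!: derivative_eq_intros)
  have "partial (\<lambda>y::'a. (y - c) \<bullet> i) j = (\<lambda>x. j \<bullet> i)" for j
    by (rule ext) (rule partial_eq[OF d])
  then show ?thesis using d Suc Ck_const by (auto simp: differentiable_def)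
qed (auto intro!: continuous_intros)

text \<open>The functions \<open>flat m\<close> for varying \<open>m\<close> are closed under differentiation up to linear combinations.\<close>
definition flat :: "nat \<Rightarrow> real \<Rightarrow> real" where
  "flat m t = (if t > 0 then (1 / t) ^ m * exp (- (1 / t)) else 0)"

lemma flat_nonneg: "flat m t \<ge> 0" by (simp add: flat_def)

text \<open>The term of order \<open>m + 1\<close> in the exponential series of \<open>1 / t\<close>
  is at most the whole sum. One power more than \<open>m\<close> leaves the factor \<open>t\<close>,
  which makes \<open>flat m\<close> vanish at 0 at least linearly.\<close>

lemma flat_bound: "\<bar>flat m t\<bar> \<le> fact (Suc m) * \<bar>t\<bar>"
proof (cases "t > 0")
  case True
  have E1: "(1 / t) ^ Suc m / fact (Suc m) \<le> exp (1 / t)"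
  proof -
    have "(1 / t) ^ Suc m /\<^sub>R fact (Suc m) \<le> (\<Sum>k. (1 / t) ^ k /\<^sub>R fact k)"
      using sum_le_suminf[OF summable_exp_generic[of "1 / t"], of "{Suc m}"] True by simp
    then show ?thesis by (simp add: exp_def divide_inverse mult.commute)
  qed
  have "(1 / t) ^ Suc m * exp (- (1 / t)) \<le> fact (Suc m)"
  proof -
    have "(1 / t) ^ Suc m \<le> exp (1 / t) * fact (Suc m)"
      using E1 by (subst (asm) pos_divide_le_eq) (rule fact_gt_zero)
    then have "(1 / t) ^ Suc m * exp (- (1 / t)) \<le> exp (1 / t) * fact (Suc m) * exp (- (1 / t))"
      by (rule mult_right_mono) simp
    also have "\<dots> = fact (Suc m) * (exp (1 / t) * exp (- (1 / t)))" by (simp only: mult_ac)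
    also have "exp (1 / t) * exp (- (1 / t)) = 1" by (simp add: exp_minus)
    finally show ?thesis by simp
  qed
  then have "((1 / t) ^ Suc m * exp (- (1 / t))) * t \<le> fact (Suc m) * t"
    using True by (intro mult_right_mono) auto
  moreover have "((1 / t) ^ Suc m * exp (- (1 / t))) * t = (1 / t) ^ m * exp (- (1 / t))" using True by simp
  ultimately have "(1 / t) ^ m * exp (- (1 / t)) \<le> fact (Suc m) * t" by simp
  then show ?thesis using True by (simp add: flat_def)
next
  case False
  then have "flat m t = 0" by (simp add: flat_def)
  moreover have "0 \<le> (fact (Suc m) :: real) * \<bar>t\<bar>" by (intro mult_nonneg_nonneg) simp_all
  ultimately show ?thesis by (simp only: abs_zero)
qed

lemma flat_deriv: "(flat m has_real_derivative - real m * flat (Suc m) t + flat (Suc (Suc m)) t) (at t)"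
proof -
  consider "t < 0" | "t = 0" | "t > 0" by linarith
  then show ?thesis
  proof cases
    case 1
    have "((\<lambda>t. 0) has_real_derivative 0) (at t)" by simp
    then have "(flat m has_real_derivative 0) (at t)"
      by (rule has_field_derivative_transform_within_open[where S="{..<0}"]) (use 1 in \<open>auto simp: flat_def\<close>)
    then show ?thesis using 1 by (simp add: flat_def)
  next
    case 2
    have "((\<lambda>h. (flat m (0 + h) - flat m 0) / h) \<longlongrightarrow> 0) (at 0)"
    proof (rule Lim_null_comparison)
      show "\<forall>\<^sub>F h in at 0. norm ((flat m (0 + h) - flat m 0) / h) \<le> fact (Suc (Suc m)) * \<bar>h\<bar>"
      proof (rule eventuallyI)
        fix h :: real
        \<comment> \<open>Dividing by \<open>h\<close> just raises the index, so the difference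
          quotient at 0 tends to 0 by \<open>flat_bound\<close>.\<close>
        have "(flat m (0 + h) - flat m 0) / h = flat (Suc m) h" by (simp add: flat_def)
        then show "norm ((flat m (0 + h) - flat m 0) / h) \<le> fact (Suc (Suc m)) * \<bar>h\<bar>"
          using flat_bound[of "Suc m" h] by simp
      qed
      show "((\<lambda>h::real. fact (Suc (Suc m)) * \<bar>h\<bar>) \<longlongrightarrow> 0) (at 0)"
        by (auto intro!: tendsto_eq_intros)
    qed
    then show ?thesis using 2 by (simp add: DERIV_def flat_def)
  next
    case 3
    have "((\<lambda>t. (1 / t) ^ m * exp (- (1 / t))) has_real_derivative
        - real m * ((1 / t) ^ Suc m * exp (- (1 / t))) + (1 / t) ^ Suc (Suc m) * exp (- (1 / t))) (at t)"
    proof -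
      have d1: "((\<lambda>t. 1 / t) has_real_derivative - ((1 / t) * (1 / t))) (at t)"
        using 3 by (auto intro!: derivative_eq_intros simp: power2_eq_square)
      have alg: "real m * (- (y * y) * y ^ (m - Suc 0)) * E + E * - (- (y * y)) * y ^ m
          = - real m * (y ^ Suc m * E) + y ^ Suc (Suc m) * E" for y E :: real
        by (cases m) (simp_all add: algebra_simps)
      show ?thesis
        by (rule DERIV_cong, rule DERIV_mult[OF DERIV_power[OF d1] DERIV_fun_exp[OF DERIV_minus[OF d1]]])
           (rule alg)
    qed
    then have "(flat m has_real_derivative
        - real m * ((1 / t) ^ Suc m * exp (- (1 / t))) + (1 / t) ^ Suc (Suc m) * exp (- (1 / t))) (at t)"
      by (rule has_field_derivative_transform_within_open[where S="{0<..}"]) (use 3 in \<open>auto simp: flat_def\<close>)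
    then show ?thesis using 3 by (simp add: flat_def)
  qed
qed

text \<open>The standard exp(-1/(h^2 - |z|^2)) on the ball of radius \<open>h\<close>; the inner
  product in place of the norm makes the argument of \<open>flat\<close> a polynomial in
  \<open>z\<close>.\<close>

definition bump :: "real \<Rightarrow> 'a::euclidean_space \<Rightarrow> real" where
  "bump h z = flat 0 (h\<^sup>2 - z \<bullet> z)"

lemma Ck_flat: "Ck k (\<lambda>y::'a::euclidean_space. flat m (h\<^sup>2 - (y - c) \<bullet> (y - c)))"
proof (induction k arbitrary: m)
  case 0
  have "continuous_on UNIV (flat m)"
    using flat_deriv by (meson DERIV_isCont continuous_at_imp_continuous_on)
  then show ?case by (auto intro!: continuous_on_compose2[of UNIV "flat m"] continuous_intros)
next
  case (Suc k)
  let ?q = "\<lambda>y::'a. h\<^sup>2 - (y - c) \<bullet> (y - c)"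
  let ?f = "\<lambda>y. flat m (?q y)"
  have d: "(?f has_derivative (\<lambda>v. (- 2 * ((x - c) \<bullet> v)) * (- real m * flat (Suc m) (?q x) + flat (Suc (Suc m)) (?q x)))) (at x)" for x
  proof -
    have "(?q has_derivative (\<lambda>v. - 2 * ((x - c) \<bullet> v))) (at x)"
      by (auto intro!: derivative_eq_intros simp: inner_commute algebra_simps)
    from has_derivative_compose[OF this flat_deriv[unfolded has_field_derivative_def]] show ?thesis
      by (simp add: mult.commute)
  qed
  have p: "partial ?f i = (\<lambda>x. (- 2 * ((x - c) \<bullet> i)) * (- real m * flat (Suc m) (?q x) + flat (Suc (Suc m)) (?q x)))" for i
    by (rule ext) (rule partial_eq[OF d])
  have "Ck k (partial ?f i)" for i
    unfolding p by (intro Ck_mult Ck_add Ck_const Ck_coord Suc)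
  then show ?case using d by (auto simp: differentiable_def)
qed

lemma bump_test_fun:
  assumes h: "h > 0" and U: "cball x h \<subseteq> U"
  shows "test_fun U (\<lambda>y. c * bump h (y - x))"
proof -
  have sub: "{y. c * bump h (y - x) \<noteq> 0} \<subseteq> cball x h"
  proof
    fix y assume "y \<in> {y. c * bump h (y - x) \<noteq> 0}"
    then have "(y - x) \<bullet> (y - x) < h\<^sup>2" by (auto simp: bump_def flat_def split: if_splits)
    then have "norm (y - x) < h" using h by (simp add: power2_norm_eq_inner[symmetric] power_less_imp_less_base)
    then show "y \<in> cball x h" by (simp add: dist_norm norm_minus_commute)
  qed
  then have cl: "closure {y. c * bump h (y - x) \<noteq> 0} \<subseteq> cball x h" by (simp add: closure_minimal)
  moreover have "compact (closure {y. c * bump h (y - x) \<noteq> 0})"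
    using bounded_subset[OF bounded_cball sub] by (simp add: compact_closure)
  moreover have "smooth_fun (\<lambda>y. c * bump h (y - x))"
    unfolding smooth_fun_def bump_def by (intro allI Ck_mult Ck_const Ck_flat)
  ultimately show ?thesis using U by (auto simp: test_fun_def)
qed

locale mollifier =
  fixes h :: real and dummy :: "'a::euclidean_space itself"
  assumes h: "h > 0"
begin

definition b :: "'a \<Rightarrow> real" where "b z = inverse (\<integral>x. bump h (x::'a) \<partial>lborel) * bump h z"

lemma b_test: "cball x h \<subseteq> U \<Longrightarrow> test_fun U (\<lambda>y. b (y - x))"
  unfolding b_def by (rule bump_test_fun[OF h])

lemma b_test0: "test_fun UNIV b"
  using b_test[of 0 UNIV] by simp

lemma b_cont: "continuous_on UNIV b" by (rule test_fun_continuous[OF b_test0])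

lemma b_meas [measurable]: "b \<in> borel_measurable borel" by (rule borel_measurable_continuous_onI[OF b_cont])

lemma b_even: "b (- z) = b z" by (simp add: b_def bump_def)

lemma b_zero: "norm z \<ge> h \<Longrightarrow> b z = 0"
proof -
  assume "norm z \<ge> h"
  then have "h\<^sup>2 \<le> z \<bullet> z" using h by (simp add: power2_norm_eq_inner[symmetric] power_mono)
  then show ?thesis by (simp add: b_def bump_def flat_def)
qed

lemma bump_nonneg: "bump h z \<ge> 0" by (simp add: bump_def flat_nonneg)

lemma b_nonneg: "b z \<ge> 0"
  unfolding b_def by (intro mult_nonneg_nonneg bump_nonneg) (simp add: bump_nonneg)

lemma bump_integrable: "integrable lborel (bump h :: 'a \<Rightarrow> real)"
proof -
  have t: "test_fun UNIV (\<lambda>y::'a. 1 * bump h (y - 0))" by (rule bump_test_fun[OF h]) simp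
  have c: "continuous_on UNIV (bump h :: 'a \<Rightarrow> real)" using test_fun_continuous[OF t] by simp
  obtain M where "\<forall>x::'a. \<bar>1 * bump h (x - 0)\<bar> \<le> M" using test_fun_bounded[OF t] by blast
  moreover have "bump h z = 0" if "z \<notin> cball 0 h" for z :: 'a
  proof -
    have "h\<^sup>2 \<le> z \<bullet> z" using h that by (simp add: power2_norm_eq_inner[symmetric] power_mono)
    then show ?thesis by (simp add: bump_def flat_def)
  qed
  ultimately show ?thesis
    by (intro integrable_bounded_support[where K="cball 0 h" and M=M] borel_measurable_continuous_onI c) auto
qed

lemma bump_integral_pos: "(\<integral>x. bump h (x::'a) \<partial>lborel) > 0"
proof -
  have "(\<integral>x. bump h (x::'a) \<partial>lborel) \<noteq> 0"
  proof
    assume "(\<integral>x. bump h (x::'a) \<partial>lborel) = 0"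
    then have "AE x in lborel. bump h (x::'a) = 0"
      using integral_nonneg_eq_0_iff_AE[OF bump_integrable] bump_nonneg by auto
    then have "AE x in lborel. (x::'a) \<notin> ball 0 h"
    proof eventually_elim
      case (elim x)
      show ?case
      proof
        assume "x \<in> ball 0 h"
        then have "x \<bullet> x < h\<^sup>2" using h by (simp add: power2_norm_eq_inner[symmetric] power_strict_mono)
        then show False using elim by (simp add: bump_def flat_def)
      qed
    qed
    then have "ball (0::'a) h \<in> null_sets lborel"
      by (subst AE_iff_null_sets) auto
    then have "emeasure lborel (ball (0::'a) h) = 0" by auto
    then show False using h content_ball[of h "0::'a"] unit_ball_vol_pos[of "real DIM('a)"] by (simp add: measure_def)
  qed
  moreover have "(\<integral>x. bump h (x::'a) \<partial>lborel) \<ge> 0" by (simp add: bump_nonneg)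
  ultimately show ?thesis by simp
qed

lemma b_integrable: "integrable lborel b"
  unfolding b_def[abs_def] using bump_integrable by simp

lemma b_integral: "(\<integral>z. b z \<partial>lborel) = 1"
  unfolding b_def using bump_integral_pos by simp

lemma b_nn_integral: "(\<integral>\<^sup>+y. ennreal (b (y - x)) \<partial>lborel) = 1" "(\<integral>\<^sup>+y. ennreal (b (x - y)) \<partial>lborel) = 1"
proof -
  have i: "integrable lborel (\<lambda>y. b (y + - x))" by (rule lborel_integrable_translate[OF b_integrable])
  have "(\<integral>\<^sup>+y. ennreal (b (y - x)) \<partial>lborel) = ennreal (\<integral>y. b (y + - x) \<partial>lborel)"
    using nn_integral_eq_integral[OF i] by (simp add: b_nonneg)
  then show 1: "(\<integral>\<^sup>+y. ennreal (b (y - x)) \<partial>lborel) = 1" using lborel_integral_translate[of b "- x"] b_integral by simp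
  have "b (x - y) = b (y - x)" for y using b_even[of "y - x"] by simp
  then show "(\<integral>\<^sup>+y. ennreal (b (x - y)) \<partial>lborel) = 1" using 1 by simp
qed

lemma b_partial_translate:
  assumes i: "i \<in> Basis"
  shows "partial (\<lambda>y. b (y - x)) i y = partial b i (y - x)"
proof -
  have "((\<lambda>t. b (y + t *\<^sub>R i - x)) has_real_derivative partial (\<lambda>y. b (y - x)) i y) (at 0)"
    using test_fun_line_derivative[OF b_test[of x UNIV] i] by simp
  moreover have "((\<lambda>t. b (y - x + t *\<^sub>R i)) has_real_derivative partial b i (y - x)) (at 0)"
    by (rule test_fun_line_derivative[OF b_test0 i])
  ultimately show ?thesis by (auto intro: DERIV_unique simp: algebra_simps)
qed

lemma b_bounded: "\<exists>B. \<forall>x. \<bar>b x\<bar> \<le> B" by (rule test_fun_bounded[OF b_test0])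

lemma b_shift_integrable:
  assumes f: "integrable lborel f"
  shows "integrable lborel (\<lambda>y. f y * b (y - x))"
proof -
  obtain B where B: "\<forall>x. \<bar>b x\<bar> \<le> B" using b_bounded by blast
  have [measurable]: "f \<in> borel_measurable borel" using f by auto
  show ?thesis
  proof (rule Bochner_Integration.integrable_bound[OF integrable_mult_right[OF f, of B]])
    show "AE y in lborel. norm (f y * b (y - x)) \<le> norm (B * f y)"
    proof (rule AE_I2)
      fix y
      have "norm (f y * b (y - x)) = \<bar>f y\<bar> * \<bar>b (y - x)\<bar>" by (simp add: abs_mult)
      also have "\<dots> \<le> \<bar>f y\<bar> * \<bar>B\<bar>"
        using B[rule_format, of "y - x"] by (intro mult_left_mono) auto
      finally show "norm (f y * b (y - x)) \<le> norm (B * f y)" by (simp add: abs_mult mult.commute)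
    qed
  qed measurable
qed

text \<open>Convolution with an even kernel, written with \<open>b (y - x)\<close> so that the
  kernel is literally a test function of \<open>y\<close> centred at \<open>x\<close>, to which the
  weak gradient applies.\<close>

definition moll :: "('a \<Rightarrow> real) \<Rightarrow> 'a \<Rightarrow> real" where
  "moll f x = (\<integral>y. f y * b (y - x) \<partial>lborel)"

lemma moll_continuous:
  assumes f: "integrable lborel f"
  shows "continuous_on UNIV (moll f)"
proof -
  obtain B where B: "\<forall>x. \<bar>b x\<bar> \<le> B" using b_bounded by blast
  have [measurable]: "f \<in> borel_measurable borel" using f by auto
  have "(\<lambda>n. moll f (s n)) \<longlonglongrightarrow> moll f x" if s: "s \<longlonglongrightarrow> x" for s x
    unfolding moll_def
  proof (rule integral_dominated_convergence[where w="\<lambda>y. B * \<bar>f y\<bar>"])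
    show "integrable lborel (\<lambda>y. B * \<bar>f y\<bar>)" using f by simp
    show "AE y in lborel. (\<lambda>n. f y * b (y - s n)) \<longlonglongrightarrow> f y * b (y - x)"
    proof (rule AE_I2)
      fix y
      have "(\<lambda>n. b (y - s n)) \<longlonglongrightarrow> b (y - x)"
        by (rule continuous_on_tendsto_compose[OF b_cont]) (auto intro!: tendsto_intros s)
      then show "(\<lambda>n. f y * b (y - s n)) \<longlonglongrightarrow> f y * b (y - x)" by (intro tendsto_intros)
    qed
    show "AE y in lborel. norm (f y * b (y - s n)) \<le> B * \<bar>f y\<bar>" for n
    proof (rule AE_I2)
      fix y
      have "\<bar>f y\<bar> * \<bar>b (y - s n)\<bar> \<le> \<bar>f y\<bar> * B" using B by (intro mult_left_mono) auto
      then show "norm (f y * b (y - s n)) \<le> B * \<bar>f y\<bar>" by (simp add: abs_mult mult.commute)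
    qed
  qed measurable
  then show ?thesis by (auto simp: continuous_on_sequentially o_def)
qed

text \<open>Differentiation under the integral by dominated convergence, using that the kernel is
  Lipschitz. Moving the derivative from \<open>x\<close> to \<open>y\<close> changes the sign and
  produces the expression in the definition of a weak gradient.\<close>

lemma moll_line_derivative:
  assumes f: "integrable lborel f" and i: "i \<in> Basis"
  shows "((\<lambda>t. moll f (x + t *\<^sub>R i)) has_real_derivative - (\<integral>y. f y * partial (\<lambda>y. b (y - x)) i y \<partial>lborel)) (at 0)"
proof -
  obtain B where B: "\<forall>x. \<bar>partial b i x\<bar> \<le> B" using test_fun_partial_bounded[OF b_test0 i] by blast
  have [measurable]: "f \<in> borel_measurable borel" using f by auto
  have pm [measurable]: "partial b i \<in> borel_measurable borel"
    by (rule borel_measurable_continuous_onI[OF test_fun_partial_continuous[OF b_test0 i]])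
  have lip: "\<bar>b (z + t *\<^sub>R i) - b z\<bar> \<le> B * \<bar>t\<bar>" for z t
    by (rule line_lipschitz[OF test_fun_line_derivative[OF b_test0 i]]) (use B in auto)
  let ?D = "\<lambda>t y. f y * ((b (y - x - t *\<^sub>R i) - b (y - x)) / t)"
  have eq: "(moll f (x + t *\<^sub>R i) - moll f x) / t = (\<integral>y. ?D t y \<partial>lborel)" for t
  proof -
    have "moll f (x + t *\<^sub>R i) - moll f x = (\<integral>y. f y * b (y - (x + t *\<^sub>R i)) - f y * b (y - x) \<partial>lborel)"
      unfolding moll_def by (rule Bochner_Integration.integral_diff[symmetric]) (rule b_shift_integrable[OF f])+
    also have "\<dots> / t = (\<integral>y. (f y * b (y - (x + t *\<^sub>R i)) - f y * b (y - x)) / t \<partial>lborel)" by simp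
    also have "(\<lambda>y. (f y * b (y - (x + t *\<^sub>R i)) - f y * b (y - x)) / t) = ?D t"
      by (rule ext) (simp add: algebra_simps diff_divide_distrib)
    finally show ?thesis .
  qed
  have "((\<lambda>t. (\<integral>y. ?D t y \<partial>lborel)) \<longlongrightarrow> (\<integral>y. f y * - partial b i (y - x) \<partial>lborel)) (at 0)"
    unfolding tendsto_at_iff_sequentially
  proof (intro allI impI)
    fix s :: "nat \<Rightarrow> real" assume s: "\<forall>n. s n \<in> UNIV - {0}" "s \<longlonglongrightarrow> 0"
    have s': "filterlim s (at 0) sequentially" using s by (auto simp: filterlim_at)
    have "(\<lambda>n. (\<integral>y. ?D (s n) y \<partial>lborel)) \<longlonglongrightarrow> (\<integral>y. f y * - partial b i (y - x) \<partial>lborel)"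
    proof (rule integral_dominated_convergence[where w="\<lambda>y. B * \<bar>f y\<bar>"])
      show "integrable lborel (\<lambda>y. B * \<bar>f y\<bar>)" using f by simp
      show "AE y in lborel. (\<lambda>n. ?D (s n) y) \<longlonglongrightarrow> f y * - partial b i (y - x)"
      proof (rule AE_I2)
        fix y
        have "((\<lambda>t. b (y - x + t *\<^sub>R i)) has_real_derivative partial b i (y - x)) (at 0)"
          by (rule test_fun_line_derivative[OF b_test0 i])
        then have "((\<lambda>t. b (y - x + (- t) *\<^sub>R i)) has_real_derivative partial b i (y - x) * - 1) (at 0)"
          by (intro DERIV_chain2[where f="\<lambda>t. b (y - x + t *\<^sub>R i)" and g=uminus]) (auto intro!: derivative_eq_intros)
        then have "((\<lambda>t. (b (y - x - t *\<^sub>R i) - b (y - x)) / t) \<longlongrightarrow> - partial b i (y - x)) (at 0)"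
          by (simp add: DERIV_def)
        from filterlim_compose[OF this s'] show "(\<lambda>n. ?D (s n) y) \<longlonglongrightarrow> f y * - partial b i (y - x)"
          by (rule tendsto_mult[OF tendsto_const])
      qed
      show "AE y in lborel. norm (?D (s n) y) \<le> B * \<bar>f y\<bar>" for n
      proof (rule AE_I2)
        fix y
        have sn: "\<bar>s n\<bar> > 0" using s(1) by auto
        have "\<bar>b (y - x - s n *\<^sub>R i) - b (y - x)\<bar> \<le> B * \<bar>s n\<bar>" using lip[of "y - x" "- s n"] by simp
        then have "\<bar>(b (y - x - s n *\<^sub>R i) - b (y - x)) / s n\<bar> \<le> B"
          using sn by (simp add: abs_divide pos_divide_le_eq)
        then have "\<bar>f y\<bar> * \<bar>(b (y - x - s n *\<^sub>R i) - b (y - x)) / s n\<bar> \<le> \<bar>f y\<bar> * B" by (rule mult_left_mono) simp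
        then show "norm (?D (s n) y) \<le> B * \<bar>f y\<bar>" by (simp only: real_norm_def abs_mult mult.commute)
      qed
    qed measurable
    then show "((\<lambda>t. \<integral>y. ?D t y \<partial>lborel) \<circ> s) \<longlonglongrightarrow> (\<integral>y. f y * - partial b i (y - x) \<partial>lborel)"
      by (simp add: o_def)
  qed
  then show ?thesis unfolding DERIV_def by (simp add: eq b_partial_translate[OF i])
qed

text \<open>Jensen's inequality for the probability density \<open>b\<close>, obtained from
  Cauchy-Schwarz.\<close>

lemma moll_square_le:
  assumes f: "integrable lborel f" and f2: "integrable lborel (\<lambda>x. (f x)\<^sup>2)"
  shows "(moll f x)\<^sup>2 \<le> moll (\<lambda>x. (f x)\<^sup>2) x"
proof -
  have [measurable]: "f \<in> borel_measurable borel" using f by auto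
  define X where "X y = f y * sqrt (b (y - x))" for y
  define Y where "Y y = sqrt (b (y - x))" for y
  have XX: "(X y)\<^sup>2 = (f y)\<^sup>2 * b (y - x)" for y by (simp add: X_def power_mult_distrib b_nonneg)
  have YY: "(Y y)\<^sup>2 = b (y - x)" for y by (simp add: Y_def b_nonneg)
  have XY: "X y * Y y = f y * b (y - x)" for y by (simp add: X_def Y_def b_nonneg mult.assoc)
  have bi: "integrable lborel (\<lambda>y. b (y - x))" "(\<integral>y. b (y - x) \<partial>lborel) = 1"
    using lborel_integrable_translate[OF b_integrable, of "- x"] lborel_integral_translate[of b "- x"] b_integral by simp_all
  have "(\<integral>y. X y * Y y \<partial>lborel)\<^sup>2 \<le> (\<integral>y. (X y)\<^sup>2 \<partial>lborel) * (\<integral>y. (Y y)\<^sup>2 \<partial>lborel)"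
  proof (rule integral_Cauchy_Schwarz(2))
    show "X \<in> borel_measurable lborel" "Y \<in> borel_measurable lborel"
      unfolding X_def[abs_def] Y_def[abs_def] by measurable
    show "integrable lborel (\<lambda>y. (X y)\<^sup>2)" unfolding XX by (rule b_shift_integrable[OF f2])
    show "integrable lborel (\<lambda>y. (Y y)\<^sup>2)" unfolding YY by (rule bi)
  qed
  then show ?thesis unfolding XX YY XY moll_def bi by simp
qed

lemma moll_nn:
  assumes f: "integrable lborel f" and nn: "\<And>x. f x \<ge> 0"
  shows "ennreal (moll f x) = (\<integral>\<^sup>+y. ennreal (f y * b (y - x)) \<partial>lborel)"
  unfolding moll_def by (rule nn_integral_eq_integral[OF b_shift_integrable[OF f], symmetric]) (simp add: nn b_nonneg)

text \<open>By Fubini the kernel is integrated in \<open>x\<close> first and gives 1, after the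
  weight at \<open>x\<close> has been exchanged for the weight at \<open>y\<close> at the price of
  \<open>C\<close>. The comparison contains \<open>f y\<close> and so is required only where
  \<open>f\<close> lives.\<close>

lemma moll_weighted_le:
  assumes f: "integrable lborel f" "\<And>x. f x \<ge> 0"
    and w [measurable]: "w \<in> borel_measurable borel" "\<And>x. w x \<ge> 0"
    and v: "\<And>x y. norm (y - x) < h \<Longrightarrow> w x * f y \<le> C * (v y * f y)"
    and C: "C \<ge> 0" and vf: "\<And>y. 0 \<le> v y * f y" and v_meas [measurable]: "v \<in> borel_measurable borel"
  shows "(\<integral>\<^sup>+x. ennreal (w x * moll f x) \<partial>lborel) \<le> ennreal C * (\<integral>\<^sup>+y. ennreal (v y * f y) \<partial>lborel)"
proof -
  have [measurable]: "f \<in> borel_measurable borel" using f by auto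
  have "(\<integral>\<^sup>+x. ennreal (w x * moll f x) \<partial>lborel) = (\<integral>\<^sup>+x. (\<integral>\<^sup>+y. ennreal (w x * (f y * b (y - x))) \<partial>lborel) \<partial>lborel)"
  proof (rule nn_integral_cong)
    fix x
    have "ennreal (w x * moll f x) = ennreal (w x) * (\<integral>\<^sup>+y. ennreal (f y * b (y - x)) \<partial>lborel)"
      using moll_nn[OF f] w(2) by (simp add: ennreal_mult')
    also have "\<dots> = (\<integral>\<^sup>+y. ennreal (w x) * ennreal (f y * b (y - x)) \<partial>lborel)"
      by (rule nn_integral_cmult[symmetric]) measurable
    finally show "ennreal (w x * moll f x) = (\<integral>\<^sup>+y. ennreal (w x * (f y * b (y - x))) \<partial>lborel)"
      using w(2) by (simp add: ennreal_mult')
  qed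
  also have "\<dots> = (\<integral>\<^sup>+y. (\<integral>\<^sup>+x. ennreal (w x * (f y * b (y - x))) \<partial>lborel) \<partial>lborel)"
    by (rule lborel_pair.Fubini'[symmetric]) measurable
  also have "\<dots> \<le> (\<integral>\<^sup>+y. ennreal (C * (v y * f y)) \<partial>lborel)"
  proof (rule nn_integral_mono)
    fix y
    have "(\<integral>\<^sup>+x. ennreal (w x * (f y * b (y - x))) \<partial>lborel) \<le> (\<integral>\<^sup>+x. ennreal (C * (v y * f y)) * ennreal (b (y - x)) \<partial>lborel)"
    proof (rule nn_integral_mono)
      fix x
      have "w x * (f y * b (y - x)) \<le> C * (v y * f y) * b (y - x)"
      proof (cases "norm (y - x) < h")
        case True
        then show ?thesis using mult_right_mono[OF v[OF True] b_nonneg[of "y - x"]] by (simp add: mult.assoc)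
      next
        case False
        then show ?thesis using b_zero[of "y - x"] by simp
      qed
      then show "ennreal (w x * (f y * b (y - x))) \<le> ennreal (C * (v y * f y)) * ennreal (b (y - x))"
        using C vf[of y] by (simp add: ennreal_mult'[symmetric] ennreal_leI)
    qed
    also have "\<dots> = ennreal (C * (v y * f y)) * (\<integral>\<^sup>+x. ennreal (b (y - x)) \<partial>lborel)"
      by (rule nn_integral_cmult) measurable
    finally show "(\<integral>\<^sup>+x. ennreal (w x * (f y * b (y - x))) \<partial>lborel) \<le> ennreal (C * (v y * f y))"
      by (simp add: b_nn_integral)
  qed
  also have "\<dots> = (\<integral>\<^sup>+y. ennreal C * ennreal (v y * f y) \<partial>lborel)"
    using C by (simp add: ennreal_mult')
  also have "\<dots> = ennreal C * (\<integral>\<^sup>+y. ennreal (v y * f y) \<partial>lborel)"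
    by (rule nn_integral_cmult) measurable
  finally show ?thesis .
qed

lemma moll_diff:
  "integrable lborel f \<Longrightarrow> integrable lborel g \<Longrightarrow> moll (\<lambda>x. f x - g x) x = moll f x - moll g x"
  unfolding moll_def
  by (subst Bochner_Integration.integral_diff[symmetric])
     (simp_all add: b_shift_integrable left_diff_distrib)

lemma moll_meas:
  assumes "integrable lborel f"
  shows "moll f \<in> borel_measurable borel"
  by (rule borel_measurable_continuous_onI[OF moll_continuous[OF assms]])

lemma moll_L1:
  assumes f: "integrable lborel f"
  shows "(\<integral>\<^sup>+x. ennreal \<bar>moll f x\<bar> \<partial>lborel) \<le> (\<integral>\<^sup>+x. ennreal \<bar>f x\<bar> \<partial>lborel)"
proof -
  have fa: "integrable lborel (\<lambda>x. \<bar>f x\<bar>)" using f by simp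
  have "(\<integral>\<^sup>+x. ennreal \<bar>moll f x\<bar> \<partial>lborel) \<le> (\<integral>\<^sup>+x. ennreal (1 * moll (\<lambda>x. \<bar>f x\<bar>) x) \<partial>lborel)"
  proof (intro nn_integral_mono ennreal_leI)
    fix x
    have "\<bar>moll f x\<bar> \<le> (\<integral>y. \<bar>f y * b (y - x)\<bar> \<partial>lborel)" unfolding moll_def by (rule integral_abs_bound)
    then show "\<bar>moll f x\<bar> \<le> 1 * moll (\<lambda>x. \<bar>f x\<bar>) x" by (simp add: moll_def abs_mult b_nonneg)
  qed
  also have "\<dots> \<le> ennreal 1 * (\<integral>\<^sup>+y. ennreal (1 * \<bar>f y\<bar>) \<partial>lborel)"
    by (rule moll_weighted_le[OF fa]) auto
  finally show ?thesis by simp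
qed

lemma moll_uniform:
  assumes g: "integrable lborel g" and e: "\<And>y. norm (y - x) < h \<Longrightarrow> \<bar>g y - g x\<bar> \<le> e"
  shows "\<bar>moll g x - g x\<bar> \<le> e"
proof -
  have bi: "integrable lborel (\<lambda>y. b (y - x))" "(\<integral>y. b (y - x) \<partial>lborel) = 1"
    using lborel_integrable_translate[OF b_integrable, of "- x"] lborel_integral_translate[of b "- x"] b_integral by simp_all
  have "moll g x - g x = (\<integral>y. g y * b (y - x) \<partial>lborel) - g x * (\<integral>y. b (y - x) \<partial>lborel)" by (simp add: moll_def bi)
  also have "\<dots> = (\<integral>y. g y * b (y - x) - g x * b (y - x) \<partial>lborel)"
    using b_shift_integrable[OF g] bi by simp
  also have "\<bar>\<dots>\<bar> \<le> (\<integral>y. \<bar>g y * b (y - x) - g x * b (y - x)\<bar> \<partial>lborel)" by (rule integral_abs_bound)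
  also have "\<dots> \<le> (\<integral>y. e * b (y - x) \<partial>lborel)"
  proof (rule integral_mono)
    show "integrable lborel (\<lambda>y. \<bar>g y * b (y - x) - g x * b (y - x)\<bar>)"
      using b_shift_integrable[OF g] bi by simp
    show "integrable lborel (\<lambda>y. e * b (y - x))" using bi by simp
    fix y
    show "\<bar>g y * b (y - x) - g x * b (y - x)\<bar> \<le> e * b (y - x)"
    proof (cases "norm (y - x) < h")
      case True
      have "\<bar>g y * b (y - x) - g x * b (y - x)\<bar> = \<bar>g y - g x\<bar> * b (y - x)"
        by (simp add: left_diff_distrib[symmetric] abs_mult b_nonneg)
      then show ?thesis using mult_right_mono[OF e[OF True] b_nonneg] by simp
    qed (simp add: b_zero)
  qed
  also have "\<dots> = e" using bi by simp
  finally show ?thesis .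
qed

end

text \<open>Two dominated limits: clamp \<open>f\<close> at height \<open>N\<close>, then clamp
  continuous functions that converge to \<open>f\<close> almost everywhere and multiply them by a
  continuous cutoff. The clamp and the cutoff supply the dominating function.\<close>

lemma L1_approx_continuous:
  fixes f :: "'a::euclidean_space \<Rightarrow> real"
  assumes f: "integrable lborel f" and R: "\<And>x. norm x > R \<Longrightarrow> f x = 0" and e: "e > 0"
  obtains g where "continuous_on UNIV g" "\<And>x. norm x > R + 1 \<Longrightarrow> g x = 0" "(\<integral>x. \<bar>f x - g x\<bar> \<partial>lborel) < e"
proof -
  have [measurable]: "f \<in> borel_measurable borel" using f by auto
  define cl where "cl N y = max (- real N) (min (real N) y)" for N and y :: real
  have cl_le: "\<bar>cl N y\<bar> \<le> real N" "\<bar>cl N y\<bar> \<le> \<bar>y\<bar>" for N y by (auto simp: cl_def)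
  have cl_cont: "continuous_on UNIV (cl N)" for N unfolding cl_def by (intro continuous_intros)
  have "(\<lambda>N. \<integral>x. \<bar>f x - cl N (f x)\<bar> \<partial>lborel) \<longlonglongrightarrow> (\<integral>x. (0::real) \<partial>(lborel :: 'a measure))"
  proof (rule integral_dominated_convergence[where w="\<lambda>x. 2 * \<bar>f x\<bar>"])
    show "integrable lborel (\<lambda>x. 2 * \<bar>f x\<bar>)" using f by simp
    show "AE x in lborel. (\<lambda>N. \<bar>f x - cl N (f x)\<bar>) \<longlonglongrightarrow> 0"
    proof (rule AE_I2)
      fix x
      obtain M where M: "\<bar>f x\<bar> \<le> real M" using real_arch_simple by blast
      have "\<forall>\<^sub>F N in sequentially. \<bar>f x - cl N (f x)\<bar> = 0"
        using eventually_ge_at_top[of M] by eventually_elim (use M in \<open>auto simp: cl_def\<close>)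
      then show "(\<lambda>N. \<bar>f x - cl N (f x)\<bar>) \<longlonglongrightarrow> 0" by (rule tendsto_eventually)
    qed
    show "AE x in lborel. norm \<bar>f x - cl N (f x)\<bar> \<le> 2 * \<bar>f x\<bar>" for N
      using cl_le(2)[of N] by (intro AE_I2) (simp, smt (verit))
  qed (unfold cl_def, measurable)
  then have "\<forall>\<^sub>F N in sequentially. (\<integral>x. \<bar>f x - cl N (f x)\<bar> \<partial>lborel) < e / 2"
    using order_tendstoD(2)[of _ 0 _ "e / 2"] e by simp
  then obtain N where N: "(\<integral>x. \<bar>f x - cl N (f x)\<bar> \<partial>lborel) < e / 2"
    by (auto simp: eventually_sequentially)
  have "f measurable_on UNIV"
    by (rule lebesgue_measurable_imp_measurable_on) (auto intro: measurable_completion)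
  then obtain Nn G where Nn: "negligible Nn" and G: "\<And>k. continuous_on UNIV (G k)"
    "\<And>x. x \<notin> Nn \<Longrightarrow> (\<lambda>k. G k x) \<longlonglongrightarrow> f x"
    by (auto simp: measurable_on_def)
  define \<psi> where "\<psi> x = max 0 (min 1 (R + 1 - norm x))" for x :: 'a
  have \<psi>: "continuous_on UNIV \<psi>" unfolding \<psi>_def by (intro continuous_intros)
  have \<psi>01: "0 \<le> \<psi> x" "\<psi> x \<le> 1" for x by (auto simp: \<psi>_def)
  have \<psi>0: "norm x > R + 1 \<Longrightarrow> \<psi> x = 0" for x by (simp add: \<psi>_def)
  define g where "g k x = \<psi> x * cl N (G k x)" for k x
  have gc: "continuous_on UNIV (g k)" for k
    unfolding g_def by (intro continuous_on_mult \<psi> continuous_on_compose2[OF cl_cont] G) auto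
  then have [measurable]: "g k \<in> borel_measurable borel" for k by (rule borel_measurable_continuous_onI)
  have "emeasure lborel (cball (0::'a) (R + 1)) < \<infinity>" by (rule emeasure_bounded_finite) simp
  then have iw: "integrable lborel (\<lambda>x. 2 * real N * indicator (cball (0::'a) (R + 1)) x)" by simp
  have "(\<lambda>k. \<integral>x. \<bar>cl N (f x) - g k x\<bar> \<partial>lborel) \<longlonglongrightarrow> (\<integral>x. (0::real) \<partial>(lborel :: 'a measure))"
  proof (rule integral_dominated_convergence[OF _ _ iw])
    have "AE x in lborel. x \<notin> Nn"
    proof -
      have "Nn \<in> null_sets lebesgue" using Nn by (simp add: negligible_iff_null_sets)
      then have "AE x in lebesgue. x \<notin> Nn" by (rule AE_not_in)
      then show ?thesis by (simp add: AE_completion_iff)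
    qed
    then show "AE x in lborel. (\<lambda>k. \<bar>cl N (f x) - g k x\<bar>) \<longlonglongrightarrow> 0"
    proof eventually_elim
      case (elim x)
      have 1: "(\<lambda>k. cl N (G k x)) \<longlonglongrightarrow> cl N (f x)"
        by (rule continuous_on_tendsto_compose[OF cl_cont G(2)[OF elim]]) auto
      have 2: "\<psi> x * cl N (f x) = cl N (f x)"
      proof (cases "norm x > R")
        case True
        then have "cl N (f x) = 0" using R by (simp add: cl_def)
        then show ?thesis by simp
      qed (simp add: \<psi>_def)
      have "(\<lambda>k. \<bar>cl N (f x) - \<psi> x * cl N (G k x)\<bar>) \<longlonglongrightarrow> \<bar>cl N (f x) - \<psi> x * cl N (f x)\<bar>"
        by (intro tendsto_intros 1)
      then show ?case by (simp add: g_def 2)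
    qed
    show "AE x in lborel. norm \<bar>cl N (f x) - g k x\<bar> \<le> 2 * real N * indicator (cball 0 (R + 1)) x" for k
    proof (rule AE_I2)
      fix x :: 'a
      show "norm \<bar>cl N (f x) - g k x\<bar> \<le> 2 * real N * indicator (cball 0 (R + 1)) x"
      proof (cases "norm x > R + 1")
        case True
        then have "f x = 0" "g k x = 0" using R \<psi>0[OF True] by (auto simp: g_def)
        then show ?thesis by (simp add: cl_def)
      next
        case False
        have "\<bar>g k x\<bar> \<le> 1 * real N" unfolding g_def abs_mult
          using \<psi>01[of x] cl_le(1) by (intro mult_mono) auto
        then show ?thesis using False cl_le(1)[of N "f x"] by simp
      qed
    qed
  qed (unfold cl_def, measurable)
  then have "\<forall>\<^sub>F k in sequentially. (\<integral>x. \<bar>cl N (f x) - g k x\<bar> \<partial>lborel) < e / 2"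
    using order_tendstoD(2)[of _ 0 _ "e / 2"] e by simp
  then obtain k where k: "(\<integral>x. \<bar>cl N (f x) - g k x\<bar> \<partial>lborel) < e / 2"
    by (auto simp: eventually_sequentially)
  have gz: "g k x = 0" if "norm x > R + 1" for x using \<psi>0[OF that] by (simp add: g_def)
  have clm [measurable]: "cl N \<in> borel_measurable borel" by (rule borel_measurable_continuous_onI[OF cl_cont])
  have icl: "integrable lborel (\<lambda>x. cl N (f x))"
    by (rule Bochner_Integration.integrable_bound[OF f]) (use cl_le(2) in auto)
  have ig: "integrable lborel (g k)"
    by (rule integrable_bounded_support[where K="cball 0 (R + 1)" and M="real N"])
       (use gz \<psi>01 cl_le(1) in \<open>auto simp: g_def abs_mult intro!: mult_le_one mult_left_le_one_le order_trans[OF mult_left_le_one_le]\<close>)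
  have "(\<integral>x. \<bar>f x - g k x\<bar> \<partial>lborel) \<le> (\<integral>x. \<bar>f x - cl N (f x)\<bar> + \<bar>cl N (f x) - g k x\<bar> \<partial>lborel)"
    by (rule integral_mono) (use f icl ig in auto)
  also have "\<dots> = (\<integral>x. \<bar>f x - cl N (f x)\<bar> \<partial>lborel) + (\<integral>x. \<bar>cl N (f x) - g k x\<bar> \<partial>lborel)"
    using f icl ig by simp
  also have "\<dots> < e" using N k by simp
  finally show ?thesis using that[OF gc gz] by blast
qed

text \<open>Mollification contracts the L1 norm and converges uniformly on a continuous
  \<open>g\<close> of bounded support. The error splits into thirds: twice the L1 distance of
  \<open>f\<close> to \<open>g\<close>, and the uniform error for \<open>g\<close>.\<close>

lemma moll_tendsto_L1:
  fixes f :: "'a::euclidean_space \<Rightarrow> real"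
  assumes f: "integrable lborel f" and R: "\<And>x. norm x > R \<Longrightarrow> f x = 0" and e: "e > 0"
  obtains d where "d > 0" "\<And>h. 0 < h \<Longrightarrow> h < d \<Longrightarrow> (\<integral>x. \<bar>mollifier.moll h f x - f x\<bar> \<partial>lborel) \<le> e"
proof -
  obtain g where g: "continuous_on UNIV g" "\<And>x. norm x > R + 1 \<Longrightarrow> g x = 0" "(\<integral>x. \<bar>f x - g x\<bar> \<partial>lborel) < e / 3"
    using L1_approx_continuous[of f R "e / 3"] f R e by (metis divide_pos_pos zero_less_numeral)
  have gK: "g x = 0" if "x \<notin> cball 0 (R + 1)" for x using g(2) that by simp
  have ig: "integrable lborel g"
  proof -
    obtain M where M: "\<And>x. norm (g x) \<le> M"
      using continuous_compact_support_bounded[OF g(1) compact_cball gK] by blast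
    show ?thesis
      by (rule integrable_bounded_support[where K="cball 0 (R + 1)" and M=M])
         (use gK M g(1) in \<open>auto intro: borel_measurable_continuous_onI\<close>)
  qed
  define V where "V = measure lborel (cball (0::'a) (R + 2))"
  have V: "V \<ge> 0" by (simp add: V_def)
  \<comment> \<open>Uniform error that amounts to at most \<open>e / 3\<close> over the ball of
    radius \<open>R + 2\<close>, which contains the support of \<open>g\<close> enlarged by
    \<open>h < 1\<close>; the 1 added to \<open>V\<close> avoids division by zero.\<close>
  define \<eta> where "\<eta> = e / (3 * (V + 1))"
  have \<eta>: "\<eta> > 0" using e V by (simp add: \<eta>_def)
  have "uniformly_continuous_on (cball 0 (R + 3)) g"
    by (intro compact_uniformly_continuous continuous_on_subset[OF g(1)]) auto
  then obtain d0 where d0: "d0 > 0"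
    "\<And>x y. x \<in> cball 0 (R + 3) \<Longrightarrow> y \<in> cball 0 (R + 3) \<Longrightarrow> dist y x < d0 \<Longrightarrow> dist (g y) (g x) < \<eta>"
    unfolding uniformly_continuous_on_def using \<eta> by metis
  define d where "d = min d0 1"
  have bound: "(\<integral>x. \<bar>mollifier.moll h f x - f x\<bar> \<partial>lborel) \<le> e" if h: "0 < h" "h < d" for h
  proof -
    have h1: "h < 1" "h < d0" using h by (auto simp: d_def)
    interpret mollifier h "TYPE('a)" by unfold_locales (rule h)
    have pt: "\<bar>moll g x - g x\<bar> \<le> \<eta> * indicator (cball 0 (R + 2)) x" for x
    proof (cases "x \<in> cball 0 (R + 2)")
      case True
      have "\<bar>moll g x - g x\<bar> \<le> \<eta>"
      proof (rule moll_uniform[OF ig])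
        fix y assume y: "norm (y - x) < h"
        have "norm y \<le> norm (y - x) + norm x" using norm_triangle_ineq[of "y - x" x] by simp
        then have "y \<in> cball 0 (R + 3)" using y h1 True by simp
        then show "\<bar>g y - g x\<bar> \<le> \<eta>"
          using d0(2)[of x y] True y h1 by (simp add: dist_norm less_imp_le)
      qed
      then show ?thesis using True by simp
    next
      case False
      have "\<bar>moll g x - g x\<bar> \<le> 0"
      proof (rule moll_uniform[OF ig])
        fix y assume y: "norm (y - x) < h"
        have "norm x \<le> norm (x - y) + norm y" using norm_triangle_ineq[of "x - y" y] by simp
        then have "norm y > R + 1" "norm x > R + 1"
          using y h1 False by (simp_all add: norm_minus_commute)
        then show "\<bar>g y - g x\<bar> \<le> 0" using g(2) by simp
      qed
      then show ?thesis using False by simp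
    qed
    have im: "integrable lborel (moll k)" if k: "integrable lborel k" for k :: "'a \<Rightarrow> real"
    proof (rule integrableI_bounded)
      show "moll k \<in> borel_measurable lborel" using moll_meas[OF k] by simp
      show "(\<integral>\<^sup>+ x. ennreal (norm (moll k x)) \<partial>lborel) < \<infinity>"
        using moll_L1[OF k] k by (auto simp: integrable_iff_bounded intro: le_less_trans)
    qed
    have L1: "(\<integral>x. \<bar>moll k x\<bar> \<partial>lborel) \<le> (\<integral>x. \<bar>k x\<bar> \<partial>lborel)" if k: "integrable lborel k" for k :: "'a \<Rightarrow> real"
      using moll_L1[OF k] nn_integral_eq_integral[OF integrable_abs[OF k]] nn_integral_eq_integral[OF integrable_abs[OF im[OF k]]]
      by (simp add: ennreal_le_iff)
    have ifg: "integrable lborel (\<lambda>x. f x - g x)" using f ig by simp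
    have fin: "emeasure lborel (cball (0::'a) (R + 2)) < \<infinity>" by (rule emeasure_bounded_finite) simp
    have ii: "integrable lborel (\<lambda>x::'a. \<eta> * indicator (cball 0 (R + 2)) x)" using fin by simp
    have "(\<integral>x. \<bar>moll f x - f x\<bar> \<partial>lborel) \<le> (\<integral>x. \<bar>moll (\<lambda>x. f x - g x) x\<bar> + \<bar>moll g x - g x\<bar> + \<bar>f x - g x\<bar> \<partial>lborel)"
    proof (rule integral_mono)
      show "integrable lborel (\<lambda>x. \<bar>moll f x - f x\<bar>)" using im[OF f] f by simp
      show "integrable lborel (\<lambda>x. \<bar>moll (\<lambda>x. f x - g x) x\<bar> + \<bar>moll g x - g x\<bar> + \<bar>f x - g x\<bar>)"
        using im[OF ifg] im[OF ig] ig ifg by simp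
      show "\<bar>moll f x - f x\<bar> \<le> \<bar>moll (\<lambda>x. f x - g x) x\<bar> + \<bar>moll g x - g x\<bar> + \<bar>f x - g x\<bar>" for x
        using moll_diff[OF f ig, of x] by simp
    qed
    also have "\<dots> = (\<integral>x. \<bar>moll (\<lambda>x. f x - g x) x\<bar> \<partial>lborel) + (\<integral>x. \<bar>moll g x - g x\<bar> \<partial>lborel) + (\<integral>x. \<bar>f x - g x\<bar> \<partial>lborel)"
      using im[OF ifg] im[OF ig] ig ifg by simp
    also have "\<dots> \<le> e / 3 + \<eta> * V + e / 3"
    proof (intro add_mono)
      show "(\<integral>x. \<bar>moll (\<lambda>x. f x - g x) x\<bar> \<partial>lborel) \<le> e / 3" using L1[OF ifg] g(3) by simp
      have "(\<integral>x. \<bar>moll g x - g x\<bar> \<partial>lborel) \<le> (\<integral>x. \<eta> * indicator (cball (0::'a) (R + 2)) x \<partial>lborel)"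
        by (rule integral_mono) (use im[OF ig] ig ii pt in auto)
      then show "(\<integral>x. \<bar>moll g x - g x\<bar> \<partial>lborel) \<le> \<eta> * V" by (simp add: V_def)
    qed (use g(3) in simp)
    also have "\<eta> * V \<le> e / 3"
    proof -
      have "\<eta> * V \<le> \<eta> * (V + 1)" using \<eta> by simp
      also have "\<dots> = e / 3" using V unfolding \<eta>_def by (simp add: divide_eq_eq)
      finally show ?thesis .
    qed
    finally show ?thesis by simp
  qed
  show ?thesis by (rule that[of d]) (use d0 bound in \<open>auto simp: d_def\<close>)
qed

section \<open>Positive weights on compact sets\<close>

lemma C1c_weight_integrable:
  fixes v :: "'a::euclidean_space \<Rightarrow> 'b::real_normed_vector"
  assumes U: "open U" and w: "continuous_on U w" and v: "continuous_on UNIV v"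
    and K: "compact K" "K \<subseteq> U" "\<And>x. x \<notin> K \<Longrightarrow> v x = 0"
    and \<phi>: "continuous_on UNIV \<phi>" "\<phi> 0 = (0::real)"
  shows "integrable lborel (\<lambda>x. w x * \<phi> (v x))"
proof -
  have z: "w x * \<phi> (v x) = 0" if "x \<notin> K" for x using K(3)[OF that] \<phi>(2) by simp
  have c: "continuous_on UNIV (\<lambda>x. w x * \<phi> (v x))"
    by (rule continuous_on_local_support[OF U K(1,2), where c=0])
       (auto intro!: continuous_on_mult w continuous_on_compose2[OF \<phi>(1)] continuous_on_subset[OF v] simp: z)
  obtain M where M: "\<And>x. norm (w x * \<phi> (v x)) \<le> M"
    using continuous_compact_support_bounded[OF c K(1) z] by blast
  show ?thesis
    by (rule integrable_bounded_support[where K=K and M=M])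
       (use z M c K(1) in \<open>auto intro: borel_measurable_continuous_onI compact_imp_bounded\<close>)
qed

lemma compact_thicken:
  fixes K :: "'a::euclidean_space set"
  assumes "compact K" "open U" "K \<subseteq> U"
  obtains d K' where "d > 0" "compact K'" "K' \<subseteq> U" "K \<subseteq> K'" "\<And>x y. x \<in> K \<Longrightarrow> dist x y \<le> d \<Longrightarrow> y \<in> K'"
proof -
  obtain e where e: "e > 0" "(\<Union>x\<in>K. ball x e) \<subseteq> U"
    using compact_subset_open_imp_ball_epsilon_subset[OF assms] by blast
  let ?K' = "{x + y |x y. x \<in> K \<and> y \<in> cball 0 (e / 2)}"
  show ?thesis
  proof (rule that[of "e / 2" ?K'])
    show "e / 2 > 0" using e by simp
    show "compact ?K'" by (rule compact_sums[OF assms(1) compact_cball])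
    show mem: "y \<in> ?K'" if "x \<in> K" "dist x y \<le> e / 2" for x y
      by (intro CollectI exI[of _ x] exI[of _ "y - x"] conjI)
         (use that in \<open>simp_all add: dist_norm norm_minus_commute\<close>)
    show "K \<subseteq> ?K'" using mem e(1) by force
    show "?K' \<subseteq> U"
    proof
      fix z assume "z \<in> ?K'"
      then obtain x y where "z = x + y" "x \<in> K" "norm y \<le> e / 2" by auto
      then have "z \<in> ball x e" "x \<in> K" using e(1) by (auto simp: dist_norm)
      then show "z \<in> U" using e(2) by blast
    qed
  qed
qed

lemma weight_lower_bound:
  fixes w :: "'a::euclidean_space \<Rightarrow> real"
  assumes "compact K" "continuous_on K w" "\<And>x. x \<in> K \<Longrightarrow> w x > 0"
  obtains c where "c > 0" "\<And>x. x \<in> K \<Longrightarrow> c \<le> w x"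
proof (cases "K = {}")
  case False
  then obtain x where "x \<in> K" "\<And>y. y \<in> K \<Longrightarrow> w x \<le> w y"
    using continuous_attains_inf[OF assms(1) _ assms(2)] by blast
  then show ?thesis using that[of "w x"] assms(3) by blast
qed (use that[of 1] in auto)

lemma weight_ratio:
  fixes w :: "'a::euclidean_space \<Rightarrow> real"
  assumes K: "compact K'" "continuous_on K' w" "\<And>x. x \<in> K' \<Longrightarrow> w x > 0" and e: "e > 0"
  obtains d where "d > 0" "\<And>x y. x \<in> K' \<Longrightarrow> y \<in> K' \<Longrightarrow> norm (y - x) < d \<Longrightarrow> w x \<le> (1 + e) * w y"
proof -
  obtain c where c: "c > 0" "\<And>x. x \<in> K' \<Longrightarrow> c \<le> w x" using weight_lower_bound[OF K] by blast
  have "uniformly_continuous_on K' w" by (rule compact_uniformly_continuous[OF K(2,1)])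
  moreover have "e * c > 0" using e c by simp
  ultimately obtain d where d: "d > 0" "\<And>x y. x \<in> K' \<Longrightarrow> y \<in> K' \<Longrightarrow> dist y x < d \<Longrightarrow> dist (w y) (w x) < e * c"
    unfolding uniformly_continuous_on_def by metis
  show ?thesis
  proof (rule that[OF d(1)])
    fix x y assume xy: "x \<in> K'" "y \<in> K'" "norm (y - x) < d"
    have "w x \<le> w y + e * c" using d(2)[of x y] xy by (simp add: dist_norm dist_real_def)
    also have "e * c \<le> e * w y" using c(2)[OF xy(2)] e by simp
    finally show "w x \<le> (1 + e) * w y" by (simp add: algebra_simps)
  qed
qed

lemma norm_add_square_le:
  fixes a b :: "'a::real_inner"
  assumes k: "k > 0"
  shows "(norm (a + b))\<^sup>2 \<le> (1 + k) * (norm a)\<^sup>2 + (1 + 1 / k) * (norm b)\<^sup>2"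
proof -
  have "0 \<le> (norm (sqrt k *\<^sub>R a - (1 / sqrt k) *\<^sub>R b))\<^sup>2" by simp
  also have "\<dots> = k * (norm a)\<^sup>2 - 2 * (a \<bullet> b) + (norm b)\<^sup>2 / k"
    using k by (simp add: power2_norm_eq_inner inner_diff_left inner_diff_right inner_commute algebra_simps power2_eq_square[symmetric])
  finally have "2 * (a \<bullet> b) \<le> k * (norm a)\<^sup>2 + (norm b)\<^sup>2 / k" by simp
  moreover have "(norm (a + b))\<^sup>2 = (norm a)\<^sup>2 + 2 * (a \<bullet> b) + (norm b)\<^sup>2"
    by (simp add: power2_norm_eq_inner inner_add_left inner_add_right inner_commute)
  ultimately show ?thesis by (simp add: algebra_simps)
qed

section \<open>From compactly supported to weakly differentiable functions\<close>

text \<open>Here \<open>p\<close> and \<open>q\<close> are weights for function and gradient,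
  constantly 1 on the Euclidean space and \<open>hvw\<close> weights on the ball. The exponents
  \<open>r\<close>, \<open>a\<close>, \<open>b\<close> will be the integrability exponent plus 1 and
  half of \<open>GN_alpha\<close> and \<open>GN_beta\<close>, as the integrals are squared
  norms.\<close>

definition GN_bound :: "'a::euclidean_space set \<Rightarrow> ('a \<Rightarrow> real) \<Rightarrow> ('a \<Rightarrow> real) \<Rightarrow> real \<Rightarrow> real \<Rightarrow> real \<Rightarrow> real \<Rightarrow> bool" where
  "GN_bound U p q C r a b \<longleftrightarrow> (\<forall>v H. C1c U v H \<longrightarrow>
     (\<integral>x. p x * \<bar>v x\<bar> powr r \<partial>lborel) \<le> C * ((\<integral>x. p x * (v x)\<^sup>2 \<partial>lborel) powr a * (\<integral>x. q x * (norm (H x))\<^sup>2 \<partial>lborel) powr b))"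

text \<open>General weights let one approximation serve both spaces. The last hypothesis measures
  the gradient of the cutoff relative to the weights: multiplying by the cutoff changes the energy
  only by terms that vanish with \<kappa>.\<close>

locale cutoff_approx =
  fixes U :: "'a::euclidean_space set" and p q :: "'a \<Rightarrow> real" and u :: "'a \<Rightarrow> real" and G :: "'a \<Rightarrow> 'a"
    and \<zeta> :: "'a \<Rightarrow> real" and D\<zeta> :: "'a \<Rightarrow> 'a" and \<kappa> :: real
  assumes U: "open U"
    and p: "p \<in> borel_measurable borel" "continuous_on U p" "\<And>x. x \<in> U \<Longrightarrow> p x > 0" "\<And>x. p x \<ge> 0"
    and q: "q \<in> borel_measurable borel" "continuous_on U q" "\<And>x. x \<in> U \<Longrightarrow> q x > 0" "\<And>x. q x \<ge> 0"
    and u_meas [measurable]: "u \<in> borel_measurable borel" and G_meas [measurable]: "G \<in> borel_measurable borel"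
    and wg: "weak_gradient U u G"
    and iu: "integrable lborel (\<lambda>x. p x * (u x)\<^sup>2)" and iG: "integrable lborel (\<lambda>x. q x * (norm (G x))\<^sup>2)"
    and \<zeta>: "C1c U \<zeta> D\<zeta>" "\<And>x. 0 \<le> \<zeta> x" "\<And>x. \<zeta> x \<le> 1"
    and \<kappa>: "\<kappa> > 0" "\<And>x. q x * (norm (D\<zeta> x))\<^sup>2 \<le> \<kappa>\<^sup>2 * p x"
begin

definition Bu :: real where "Bu = (\<integral>x. p x * (u x)\<^sup>2 \<partial>lborel)"
definition Du :: real where "Du = (\<integral>x. q x * (norm (G x))\<^sup>2 \<partial>lborel)"

lemma Bu_nonneg: "Bu \<ge> 0" and Du_nonneg: "Du \<ge> 0"
  unfolding Bu_def Du_def by (intro Bochner_Integration.integral_nonneg mult_nonneg_nonneg p q zero_le_power2)+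

text \<open>The approximant is the cutoff times a mollification of \<open>u\<close>. Near the
  support of the cutoff both weights are almost constant at scale \<open>h\<close>, so Jensen's
  inequality costs only \<open>1 + eps\<close>; Young's inequality with parameter \<kappa> separates
  the gradient of the cutoff. The function \<open>f\<close> in the conclusion is the mollification
  error, small in L1.\<close>

lemma approximants:
  assumes eps: "eps > 0"
  shows "\<exists>v H f. C1c U v H \<and> (\<integral>x. p x * (v x)\<^sup>2 \<partial>lborel) \<le> (1 + eps) * Bu \<and>
     (\<integral>x. q x * (norm (H x))\<^sup>2 \<partial>lborel) \<le> (1 + eps) * ((1 + \<kappa>) * (Du + \<kappa> * Bu)) \<and>
     integrable lborel f \<and> (\<integral>x. \<bar>f x\<bar> \<partial>lborel) \<le> eps \<and> (\<forall>x. v x = \<zeta> x * (u x + f x))"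
proof -
  obtain K where K: "compact K" "K \<subseteq> U" "\<And>x. x \<notin> K \<Longrightarrow> \<zeta> x = 0" "\<And>x. x \<notin> K \<Longrightarrow> D\<zeta> x = 0"
    using \<zeta>(1) by (auto simp: C1c_def)
  have \<zeta>c: "continuous_on UNIV \<zeta>" "continuous_on UNIV D\<zeta>"
    and \<zeta>d: "\<And>x i. i \<in> Basis \<Longrightarrow> ((\<lambda>t. \<zeta> (x + t *\<^sub>R i)) has_real_derivative (D\<zeta> x \<bullet> i)) (at 0)"
    using \<zeta>(1) by (auto simp: C1c_def)
  obtain d0 K' where d0: "d0 > 0" and K': "compact K'" "K' \<subseteq> U" "K \<subseteq> K'"
    and thick: "\<And>x y. x \<in> K \<Longrightarrow> dist x y \<le> d0 \<Longrightarrow> y \<in> K'"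
    using compact_thicken[OF K(1) U K(2)] by metis
  have K'b: "K' \<in> sets borel" using K'(1) by (simp add: borel_compact)
  have Kb: "K \<in> sets borel" using K(1) by (simp add: borel_compact)
  note [measurable] = p(1) q(1) K'b Kb
  have pK: "continuous_on K' p" "\<And>x. x \<in> K' \<Longrightarrow> p x > 0" using p K' continuous_on_subset by auto
  have qK: "continuous_on K' q" "\<And>x. x \<in> K' \<Longrightarrow> q x > 0" using q K' continuous_on_subset by auto
  obtain cp where cp: "cp > 0" "\<And>x. x \<in> K' \<Longrightarrow> cp \<le> p x" using weight_lower_bound[OF K'(1) pK] by blast
  obtain cq where cq: "cq > 0" "\<And>x. x \<in> K' \<Longrightarrow> cq \<le> q x" using weight_lower_bound[OF K'(1) qK] by blast
  \<comment> \<open>The function and its gradient are truncated to the compact neighbourhood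
    \<open>K'\<close>, where the weights are bounded below and weighted integrability therefore
    becomes ordinary integrability.\<close>
  define f where "f x = indicator K' x * u x" for x
  define F where "F i x = indicator K' x * (G x \<bullet> i)" for i x
  have fm [measurable]: "f \<in> borel_measurable borel" "F i \<in> borel_measurable borel" for i
    unfolding f_def[abs_def] F_def[abs_def] by measurable
  have loc: "integrable (lebesgue_on K') u" "integrable (lebesgue_on K') (\<lambda>x. norm (G x))"
    using wg K' by (auto simp: weak_gradient_def)
  have to_lborel: "integrable lborel (\<lambda>x. indicator K' x * g x)" if "integrable (lebesgue_on K') g" "g \<in> borel_measurable borel"
    for g :: "'a \<Rightarrow> real"
  proof -
    have "integrable lebesgue (\<lambda>x. indicator K' x *\<^sub>R g x)"
      using that(1) K'b by (subst (asm) integrable_restrict_space) auto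
    then show ?thesis using that(2) by (subst (asm) integrable_completion) auto
  qed
  have fi: "integrable lborel f" unfolding f_def[abs_def] by (rule to_lborel[OF loc(1)]) measurable
  have Fi: "integrable lborel (F i)" if "i \<in> Basis" for i
  proof (rule Bochner_Integration.integrable_bound)
    show "integrable lborel (\<lambda>x. indicator K' x * norm (G x))" by (rule to_lborel[OF loc(2)]) measurable
    show "AE x in lborel. norm (F i x) \<le> norm (indicator K' x * norm (G x))"
      using Basis_le_norm[OF that] by (intro AE_I2) (auto simp: F_def abs_mult intro!: mult_left_mono)
  qed measurable
  have f2: "integrable lborel (\<lambda>x. (f x)\<^sup>2)"
  proof (rule Bochner_Integration.integrable_bound)
    show "integrable lborel (\<lambda>x. (1 / cp) * (p x * (u x)\<^sup>2))" using iu by (rule integrable_mult_right)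
    show "AE x in lborel. norm ((f x)\<^sup>2) \<le> norm ((1 / cp) * (p x * (u x)\<^sup>2))"
    proof (rule AE_I2)
      fix x
      have "cp * (f x)\<^sup>2 \<le> p x * (u x)\<^sup>2"
        using cp(2)[of x] p(4)[of x] by (auto simp: f_def indicator_def intro!: mult_right_mono)
      then have "(f x)\<^sup>2 \<le> p x * (u x)\<^sup>2 / cp" using cp(1) by (simp add: field_simps)
      then show "norm ((f x)\<^sup>2) \<le> norm ((1 / cp) * (p x * (u x)\<^sup>2))" using cp(1) p(4)[of x] by simp
    qed
  qed measurable
  define Z where "Z x = indicator K' x * (norm (G x))\<^sup>2" for x
  have Zm [measurable]: "Z \<in> borel_measurable borel" unfolding Z_def[abs_def] by measurable
  have Zi: "integrable lborel Z"
  proof (rule Bochner_Integration.integrable_bound)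
    show "integrable lborel (\<lambda>x. (1 / cq) * (q x * (norm (G x))\<^sup>2))" using iG by (rule integrable_mult_right)
    show "AE x in lborel. norm (Z x) \<le> norm ((1 / cq) * (q x * (norm (G x))\<^sup>2))"
    proof (rule AE_I2)
      fix x
      have "cq * Z x \<le> q x * (norm (G x))\<^sup>2"
        using cq(2)[of x] q(4)[of x] by (auto simp: Z_def indicator_def intro!: mult_right_mono)
      then have "Z x \<le> q x * (norm (G x))\<^sup>2 / cq" using cq(1) by (simp add: field_simps)
      moreover have "Z x \<ge> 0" by (simp add: Z_def)
      ultimately show "norm (Z x) \<le> norm ((1 / cq) * (q x * (norm (G x))\<^sup>2))" using cq(1) q(4)[of x] by simp
    qed
  qed measurable
  have Zsum: "Z x = (\<Sum>i\<in>Basis. (F i x)\<^sup>2)" for x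
  proof -
    have "(norm (G x))\<^sup>2 = (\<Sum>i\<in>Basis. (G x \<bullet> i)\<^sup>2)"
      unfolding power2_norm_eq_inner euclidean_inner[of "G x" "G x"] by (simp only: power2_eq_square)
    then show ?thesis by (simp add: Z_def F_def power_mult_distrib indicator_def)
  qed
  have F2: "integrable lborel (\<lambda>x. (F i x)\<^sup>2)" if "i \<in> Basis" for i
  proof (rule Bochner_Integration.integrable_bound[OF Zi])
    show "AE x in lborel. norm ((F i x)\<^sup>2) \<le> norm (Z x)"
      unfolding Zsum using that by (intro AE_I2) (auto intro!: member_le_sum simp: sum_nonneg)
  qed measurable
  obtain dp where dp: "dp > 0" "\<And>x y. x \<in> K' \<Longrightarrow> y \<in> K' \<Longrightarrow> norm (y - x) < dp \<Longrightarrow> p x \<le> (1 + eps) * p y"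
    using weight_ratio[OF K'(1) pK eps] by metis
  obtain dq where dq: "dq > 0" "\<And>x y. x \<in> K' \<Longrightarrow> y \<in> K' \<Longrightarrow> norm (y - x) < dq \<Longrightarrow> q x \<le> (1 + eps) * q y"
    using weight_ratio[OF K'(1) qK eps] by metis
  obtain R where R: "\<And>x. x \<in> K' \<Longrightarrow> norm x \<le> R" using compact_imp_bounded[OF K'(1)] bounded_iff by metis
  have fR: "f x = 0" if "norm x > R" for x using R[of x] that by (auto simp: f_def indicator_def)
  obtain dm where dm: "dm > 0" "\<And>h. 0 < h \<Longrightarrow> h < dm \<Longrightarrow> (\<integral>x. \<bar>mollifier.moll h f x - f x\<bar> \<partial>lborel) \<le> eps"
    using moll_tendsto_L1[OF fi fR eps] by metis
  \<comment> \<open>Below \<open>d0\<close> the kernel at a point of \<open>K\<close> stays in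
    \<open>K'\<close>; below \<open>dp\<close> and \<open>dq\<close> the weights vary by a factor at
    most \<open>1 + eps\<close>; below \<open>dm\<close> the L1 error is at most
    \<open>eps\<close>.\<close>
  define h where "h = min (min d0 dp) (min dq dm) / 2"
  have hh: "h > 0" "h < d0" "h < dp" "h < dq" "h < dm" using d0 dp dq dm by (auto simp: h_def min_def)
  interpret mo: mollifier h "TYPE('a)" by unfold_locales (rule hh)
  let ?g = "\<lambda>x. \<Sum>i\<in>Basis. mo.moll (F i) x *\<^sub>R i"
  define v where "v x = \<zeta> x * mo.moll f x" for x
  define H where "H x = \<zeta> x *\<^sub>R ?g x + mo.moll f x *\<^sub>R D\<zeta> x" for x
  have gi: "?g x \<bullet> i = mo.moll (F i) x" if "i \<in> Basis" for x i
    using that by (simp add: inner_sum_left inner_Basis if_distrib[of "\<lambda>y. _ * y"] cong: if_cong)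
  have gc: "continuous_on UNIV ?g"
    by (intro continuous_on_sum continuous_on_scaleR continuous_on_const mo.moll_continuous Fi)
  have fc: "continuous_on UNIV (mo.moll f)" by (rule mo.moll_continuous[OF fi])
  have vc: "continuous_on UNIV v" unfolding v_def by (intro continuous_on_mult \<zeta>c fc)
  have Hc: "continuous_on UNIV H" unfolding H_def by (intro continuous_on_add continuous_on_scaleR \<zeta>c fc gc)
  have vK: "v x = 0" and HK: "H x = 0" if "x \<notin> K" for x using K(3,4)[OF that] by (auto simp: v_def H_def)
  have der_f: "((\<lambda>t. mo.moll f (x + t *\<^sub>R i)) has_real_derivative mo.moll (F i) x) (at 0)"
    if i: "i \<in> Basis" and x: "x \<in> K" for i x
  proof -
    have cb: "cball x h \<subseteq> K'" using thick[OF x] hh by auto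
    let ?\<phi> = "\<lambda>y. mo.b (y - x)"
    have tf: "test_fun U ?\<phi>" by (rule mo.b_test) (use cb K' in blast)
    have tm [measurable]: "?\<phi> \<in> borel_measurable borel" "partial ?\<phi> i \<in> borel_measurable borel"
      by (rule borel_measurable_continuous_onI[OF test_fun_continuous[OF tf]],
          rule borel_measurable_continuous_onI[OF test_fun_partial_continuous[OF tf i]])
    have z1: "?\<phi> y = 0" if "y \<notin> cball x h" for y
      using mo.b_zero[of "y - x"] that by (simp add: dist_norm norm_minus_commute)
    have z2: "partial ?\<phi> i y = 0" if "y \<notin> cball x h" for y
    proof (rule test_fun_partial_outside[OF tf])
      have "{y. ?\<phi> y \<noteq> 0} \<subseteq> cball x h" using z1 by blast
      then have "closure {y. ?\<phi> y \<noteq> 0} \<subseteq> cball x h" by (simp add: closure_minimal)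
      then show "y \<notin> closure {y. ?\<phi> y \<noteq> 0}" using that by blast
    qed
    have out: "y \<notin> cball x h" if "y \<notin> K'" for y using that cb by blast
    \<comment> \<open>For \<open>x\<close> in \<open>K\<close> the kernel is supported in
      \<open>K'\<close>, so the truncation is invisible and the weak gradient identity holds for
      \<open>f\<close> and \<open>F\<close> as well.\<close>
    have e1: "u y * partial ?\<phi> i y = f y * partial ?\<phi> i y" for y
      using z2[OF out, of y] by (cases "y \<in> K'") (auto simp: f_def)
    have e2: "(G y \<bullet> i) * ?\<phi> y = F i y * ?\<phi> y" for y
      using z1[OF out, of y] by (cases "y \<in> K'") (auto simp: F_def)
    have "(\<integral>y. u y * partial ?\<phi> i y \<partial>lebesgue_on U) = - (\<integral>y. (G y \<bullet> i) * ?\<phi> y \<partial>lebesgue_on U)"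
      using wg tf i unfolding weak_gradient_def by blast
    moreover have "(\<integral>y. u y * partial ?\<phi> i y \<partial>lebesgue_on U) = (\<integral>y. u y * partial ?\<phi> i y \<partial>lborel)"
    proof (rule lebesgue_on_integral_eq_lborel)
      show "u y * partial ?\<phi> i y = 0" if "y \<notin> U" for y using z2[OF out, of y] that K'(2) by auto
    qed (intro borel_measurable_times u_meas tm, rule borel_open[OF U])
    moreover have "(\<integral>y. (G y \<bullet> i) * ?\<phi> y \<partial>lebesgue_on U) = (\<integral>y. (G y \<bullet> i) * ?\<phi> y \<partial>lborel)"
    proof (rule lebesgue_on_integral_eq_lborel)
      show "(G y \<bullet> i) * ?\<phi> y = 0" if "y \<notin> U" for y using z1[OF out, of y] that K'(2) by auto
    qed (intro borel_measurable_times borel_measurable_inner borel_measurable_const G_meas tm, rule borel_open[OF U])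
    ultimately have "- (\<integral>y. f y * partial ?\<phi> i y \<partial>lborel) = mo.moll (F i) x"
      by (simp add: e1 e2 mo.moll_def)
    then show ?thesis using mo.moll_line_derivative[OF fi i, of x] by simp
  qed
  have C1: "C1c U v H"
    unfolding C1c_def
  proof (intro conjI allI ballI exI[of _ K])
    fix x i :: 'a assume i: "i \<in> Basis"
    show "((\<lambda>t. v (x + t *\<^sub>R i)) has_real_derivative H x \<bullet> i) (at 0)"
    proof (cases "x \<in> K")
      case True
      have "((\<lambda>t. \<zeta> (x + t *\<^sub>R i) * mo.moll f (x + t *\<^sub>R i)) has_real_derivative
          (D\<zeta> x \<bullet> i) * mo.moll f (x + 0 *\<^sub>R i) + mo.moll (F i) x * \<zeta> (x + 0 *\<^sub>R i)) (at 0)"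
        by (rule DERIV_mult[OF \<zeta>d[OF i] der_f[OF i True]])
      then show ?thesis using gi[OF i] by (simp add: v_def H_def inner_add_left algebra_simps)
    next
      case False
      have "open (- K)" using K(1) by (simp add: compact_imp_closed open_Compl)
      then have "eventually (\<lambda>t. x + t *\<^sub>R i \<in> - K) (nhds 0)"
        by (intro topological_tendstoD[where l=x]) (use False in \<open>auto intro!: tendsto_eq_intros filterlim_ident\<close>)
      then have ev: "eventually (\<lambda>t. v (x + t *\<^sub>R i) = 0) (nhds 0)"
        by eventually_elim (simp add: vK)
      have "((\<lambda>t::real. 0::real) has_real_derivative 0) (at 0)" by simp
      then show ?thesis using DERIV_cong_ev[OF refl ev refl, of 0] False by (simp add: HK)
    qed
  qed (use vc Hc K vK HK in auto)
  have opm: "0 \<le> (1 + eps)" using eps by simp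
  have M1: "(\<integral>\<^sup>+x. ennreal ((p x * indicator K x) * mo.moll (\<lambda>x. (f x)\<^sup>2) x) \<partial>lborel) \<le> ennreal ((1 + eps) * Bu)"
  proof -
    have "(\<integral>\<^sup>+x. ennreal ((p x * indicator K x) * mo.moll (\<lambda>x. (f x)\<^sup>2) x) \<partial>lborel)
       \<le> ennreal (1 + eps) * (\<integral>\<^sup>+y. ennreal (p y * (f y)\<^sup>2) \<partial>lborel)"
    proof (rule mo.moll_weighted_le[OF f2])
      fix x y :: 'a assume n: "norm (y - x) < h"
      show "p x * indicator K x * (f y)\<^sup>2 \<le> (1 + eps) * (p y * (f y)\<^sup>2)"
      proof (cases "x \<in> K")
        case True
        have "y \<in> K'" by (rule thick[OF True]) (use n hh in \<open>simp add: dist_norm norm_minus_commute\<close>)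
        then have "p x \<le> (1 + eps) * p y" using dp(2)[of x y] True K'(3) n hh by auto
        then show ?thesis using True mult_right_mono[of "p x" "(1 + eps) * p y" "(f y)\<^sup>2"] by (simp add: mult.assoc)
      qed (use p(4) opm in simp)
    qed (use p opm in auto)
    also have "(\<integral>\<^sup>+y. ennreal (p y * (f y)\<^sup>2) \<partial>lborel) \<le> (\<integral>\<^sup>+y. ennreal (p y * (u y)\<^sup>2) \<partial>lborel)"
      using p(4) by (intro nn_integral_mono ennreal_leI mult_left_mono) (auto simp: f_def indicator_def)
    also have "\<dots> = ennreal Bu" unfolding Bu_def by (rule nn_integral_eq_integral[OF iu]) (simp add: p)
    finally show ?thesis using opm by (simp add: ennreal_mult' mult_left_mono)
  qed
  have M2: "(\<integral>\<^sup>+x. ennreal ((q x * indicator K x) * mo.moll Z x) \<partial>lborel) \<le> ennreal ((1 + eps) * Du)"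
  proof -
    have "(\<integral>\<^sup>+x. ennreal ((q x * indicator K x) * mo.moll Z x) \<partial>lborel)
       \<le> ennreal (1 + eps) * (\<integral>\<^sup>+y. ennreal (q y * Z y) \<partial>lborel)"
    proof (rule mo.moll_weighted_le[OF Zi])
      show Z0: "0 \<le> Z y" for y by (simp add: Z_def)
      fix x y :: 'a assume n: "norm (y - x) < h"
      show "q x * indicator K x * Z y \<le> (1 + eps) * (q y * Z y)"
      proof (cases "x \<in> K")
        case True
        have "y \<in> K'" by (rule thick[OF True]) (use n hh in \<open>simp add: dist_norm norm_minus_commute\<close>)
        then have "q x \<le> (1 + eps) * q y" using dq(2)[of x y] True K'(3) n hh by auto
        then show ?thesis using True mult_right_mono[OF _ Z0[of y], of "q x" "(1 + eps) * q y"] by (simp add: mult.assoc)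
      qed (use q(4) opm Z0 in simp)
    qed (use q opm in \<open>auto simp: Z_def\<close>)
    also have "(\<integral>\<^sup>+y. ennreal (q y * Z y) \<partial>lborel) \<le> (\<integral>\<^sup>+y. ennreal (q y * (norm (G y))\<^sup>2) \<partial>lborel)"
      using q(4) by (intro nn_integral_mono ennreal_leI mult_left_mono) (auto simp: Z_def indicator_def)
    also have "\<dots> = ennreal Du" unfolding Du_def by (rule nn_integral_eq_integral[OF iG]) (simp add: q)
    finally show ?thesis using opm by (simp add: ennreal_mult' mult_left_mono)
  qed
  have m2: "(mo.moll f x)\<^sup>2 \<le> mo.moll (\<lambda>x. (f x)\<^sup>2) x" for x by (rule mo.moll_square_le[OF fi f2])
  have g2: "(norm (?g x))\<^sup>2 \<le> mo.moll Z x" for x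
  proof -
    have "(norm (?g x))\<^sup>2 = (\<Sum>i\<in>Basis. (?g x \<bullet> i)\<^sup>2)"
      unfolding power2_norm_eq_inner euclidean_inner[of "?g x" "?g x"] by (simp only: power2_eq_square)
    also have "\<dots> \<le> (\<Sum>i\<in>Basis. mo.moll (\<lambda>x. (F i x)\<^sup>2) x)"
      by (intro sum_mono) (simp add: gi mo.moll_square_le[OF Fi F2] del: inner_sum_left_Basis)
    also have "\<dots> = mo.moll Z x"
      unfolding mo.moll_def Zsum sum_distrib_right
      by (rule Bochner_Integration.integral_sum[symmetric]) (rule mo.b_shift_integrable[OF F2])
    finally show ?thesis .
  qed
  have mollnn: "mo.moll (\<lambda>x. (f x)\<^sup>2) x \<ge> 0" "mo.moll Z x \<ge> 0" for x
    using order_trans[OF zero_le_power2 m2] order_trans[OF zero_le_power2 g2] by auto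
  have mm [measurable]: "mo.moll (\<lambda>x. (f x)\<^sup>2) \<in> borel_measurable borel" "mo.moll Z \<in> borel_measurable borel"
    by (rule mo.moll_meas[OF f2], rule mo.moll_meas[OF Zi])
  have Bv: "(\<integral>x. p x * (v x)\<^sup>2 \<partial>lborel) \<le> (1 + eps) * Bu"
  proof (rule integral_real_bounded)
    show "0 \<le> (1 + eps) * Bu" using opm Bu_nonneg by simp
    have "(\<integral>\<^sup>+x. ennreal (p x * (v x)\<^sup>2) \<partial>lborel) \<le> (\<integral>\<^sup>+x. ennreal ((p x * indicator K x) * mo.moll (\<lambda>x. (f x)\<^sup>2) x) \<partial>lborel)"
    proof (intro nn_integral_mono ennreal_leI)
      fix x
      show "p x * (v x)\<^sup>2 \<le> (p x * indicator K x) * mo.moll (\<lambda>x. (f x)\<^sup>2) x"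
      proof (cases "x \<in> K")
        case True
        have "(\<zeta> x)\<^sup>2 \<le> 1" using \<zeta>(2,3)[of x] by (simp add: power_le_one)
        then have "(v x)\<^sup>2 \<le> 1 * (mo.moll f x)\<^sup>2" unfolding v_def power_mult_distrib by (rule mult_right_mono) simp
        then have "(v x)\<^sup>2 \<le> mo.moll (\<lambda>x. (f x)\<^sup>2) x" using m2[of x] by simp
        then show ?thesis using True p(4)[of x] by (simp add: mult_left_mono)
      qed (simp add: vK)
    qed
    then show "(\<integral>\<^sup>+x. ennreal (p x * (v x)\<^sup>2) \<partial>lborel) \<le> ennreal ((1 + eps) * Bu)" using M1 by (rule order_trans)
  qed
  have Dv: "(\<integral>x. q x * (norm (H x))\<^sup>2 \<partial>lborel) \<le> (1 + eps) * ((1 + \<kappa>) * (Du + \<kappa> * Bu))"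
  proof (rule integral_real_bounded)
    \<comment> \<open>Young's coefficients, the second already multiplied by the bound for the
      gradient of the cutoff. It simplifies to \<open>(1 + \<kappa>) * \<kappa>\<close>, which
      yields the common factor \<open>1 + \<kappa>\<close>.\<close>
    define c1 c2 where "c1 = 1 + \<kappa>" and "c2 = (1 + 1 / \<kappa>) * \<kappa>\<^sup>2"
    have c: "c1 \<ge> 0" "c2 \<ge> 0" using \<kappa>(1) by (auto simp: c1_def c2_def)
    have c2': "c2 = (1 + \<kappa>) * \<kappa>" using \<kappa>(1) by (simp add: c2_def power2_eq_square field_simps)
    show "0 \<le> (1 + eps) * ((1 + \<kappa>) * (Du + \<kappa> * Bu))"
      using eps \<kappa>(1) Du_nonneg Bu_nonneg by (intro mult_nonneg_nonneg add_nonneg_nonneg) auto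
    have "(\<integral>\<^sup>+x. ennreal (q x * (norm (H x))\<^sup>2) \<partial>lborel)
       \<le> (\<integral>\<^sup>+x. ennreal c1 * ennreal ((q x * indicator K x) * mo.moll Z x) + ennreal c2 * ennreal ((p x * indicator K x) * mo.moll (\<lambda>x. (f x)\<^sup>2) x) \<partial>lborel)"
    proof (rule nn_integral_mono)
      fix x
      have "q x * (norm (H x))\<^sup>2 \<le> c1 * ((q x * indicator K x) * mo.moll Z x) + c2 * ((p x * indicator K x) * mo.moll (\<lambda>x. (f x)\<^sup>2) x)"
      proof (cases "x \<in> K")
        case True
        have x1: "(norm (\<zeta> x *\<^sub>R ?g x))\<^sup>2 \<le> mo.moll Z x"
        proof -
          have "(\<zeta> x)\<^sup>2 \<le> 1" using \<zeta>(2,3)[of x] by (simp add: power_le_one)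
          then have "(norm (\<zeta> x *\<^sub>R ?g x))\<^sup>2 \<le> 1 * (norm (?g x))\<^sup>2"
            unfolding norm_scaleR power_mult_distrib power2_abs by (rule mult_right_mono) simp
          then show ?thesis using g2[of x] by linarith
        qed
        have x2: "q x * (norm (mo.moll f x *\<^sub>R D\<zeta> x))\<^sup>2 \<le> \<kappa>\<^sup>2 * (p x * mo.moll (\<lambda>x. (f x)\<^sup>2) x)"
        proof -
          have "q x * (norm (mo.moll f x *\<^sub>R D\<zeta> x))\<^sup>2 = (q x * (norm (D\<zeta> x))\<^sup>2) * (mo.moll f x)\<^sup>2"
            by (simp add: power_mult_distrib)
          also have "\<dots> \<le> (\<kappa>\<^sup>2 * p x) * mo.moll (\<lambda>x. (f x)\<^sup>2) x"
            using m2[of x] p(4)[of x] by (intro mult_mono \<kappa>(2)) auto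
          finally show ?thesis by (simp only: mult.assoc)
        qed
        have "(norm (H x))\<^sup>2 \<le> (1 + \<kappa>) * (norm (\<zeta> x *\<^sub>R ?g x))\<^sup>2 + (1 + 1 / \<kappa>) * (norm (mo.moll f x *\<^sub>R D\<zeta> x))\<^sup>2"
          unfolding H_def by (rule norm_add_square_le[OF \<kappa>(1)])
        then have "q x * (norm (H x))\<^sup>2 \<le> q x * ((1 + \<kappa>) * (norm (\<zeta> x *\<^sub>R ?g x))\<^sup>2 + (1 + 1 / \<kappa>) * (norm (mo.moll f x *\<^sub>R D\<zeta> x))\<^sup>2)"
          by (rule mult_left_mono) (rule q(4))
        also have "\<dots> = (1 + \<kappa>) * (q x * (norm (\<zeta> x *\<^sub>R ?g x))\<^sup>2) + (1 + 1 / \<kappa>) * (q x * (norm (mo.moll f x *\<^sub>R D\<zeta> x))\<^sup>2)"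
          by (simp only: distrib_left mult.left_commute)
        also have "\<dots> \<le> (1 + \<kappa>) * (q x * mo.moll Z x) + (1 + 1 / \<kappa>) * (\<kappa>\<^sup>2 * (p x * mo.moll (\<lambda>x. (f x)\<^sup>2) x))"
          using \<kappa>(1) by (intro add_mono mult_left_mono x1 x2 q(4)) auto
        also have "\<dots> = c1 * (q x * mo.moll Z x) + c2 * (p x * mo.moll (\<lambda>x. (f x)\<^sup>2) x)"
          by (simp only: c1_def c2_def mult.assoc)
        finally show ?thesis using True by simp
      qed (simp add: HK)
      then show "ennreal (q x * (norm (H x))\<^sup>2) \<le> ennreal c1 * ennreal ((q x * indicator K x) * mo.moll Z x) + ennreal c2 * ennreal ((p x * indicator K x) * mo.moll (\<lambda>x. (f x)\<^sup>2) x)"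
        using c p(4)[of x] q(4)[of x] mollnn[of x] by (simp add: ennreal_mult'[symmetric] ennreal_plus[symmetric] ennreal_leI del: ennreal_plus)
    qed
    also have "\<dots> = ennreal c1 * (\<integral>\<^sup>+x. ennreal ((q x * indicator K x) * mo.moll Z x) \<partial>lborel)
        + ennreal c2 * (\<integral>\<^sup>+x. ennreal ((p x * indicator K x) * mo.moll (\<lambda>x. (f x)\<^sup>2) x) \<partial>lborel)"
      by (subst nn_integral_add) (measurable, simp add: nn_integral_cmult)
    also have "\<dots> \<le> ennreal c1 * ennreal ((1 + eps) * Du) + ennreal c2 * ennreal ((1 + eps) * Bu)"
      by (intro add_mono mult_left_mono M1 M2) auto
    also have "\<dots> = ennreal (c1 * ((1 + eps) * Du) + c2 * ((1 + eps) * Bu))"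
      using c opm Du_nonneg Bu_nonneg by (simp add: ennreal_mult'[symmetric])
    also have "c1 * ((1 + eps) * Du) + c2 * ((1 + eps) * Bu) = (1 + eps) * ((1 + \<kappa>) * (Du + \<kappa> * Bu))"
      unfolding c2' c1_def by (simp add: algebra_simps)
    finally show "(\<integral>\<^sup>+x. ennreal (q x * (norm (H x))\<^sup>2) \<partial>lborel) \<le> ennreal ((1 + eps) * ((1 + \<kappa>) * (Du + \<kappa> * Bu)))" .
  qed
  have "integrable lborel (\<lambda>x. mo.moll f x - f x)"
  proof (rule Bochner_Integration.integrable_diff[OF _ fi], rule integrableI_bounded)
    show "mo.moll f \<in> borel_measurable lborel" using mo.moll_meas[OF fi] by simp
    show "(\<integral>\<^sup>+ x. ennreal (norm (mo.moll f x)) \<partial>lborel) < \<infinity>"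
      using mo.moll_L1[OF fi] fi by (auto simp: integrable_iff_bounded intro: le_less_trans)
  qed
  moreover have "v x = \<zeta> x * (u x + (mo.moll f x - f x))" for x
    using K(3)[of x] K'(3) by (cases "x \<in> K") (auto simp: v_def f_def indicator_def)
  ultimately show ?thesis using C1 Bv Dv dm(2)[OF hh(1,5)] by blast
qed

end

section \<open>Limits of approximants and of cutoffs\<close>

lemma nn_integral_Fatou_le:
  fixes g :: "nat \<Rightarrow> 'a::euclidean_space \<Rightarrow> real"
  assumes [measurable]: "\<And>k. g k \<in> borel_measurable borel"
    and lim: "AE x in lborel. (\<lambda>k. g k x) \<longlonglongrightarrow> g' x"
    and le: "\<And>k. (\<integral>\<^sup>+x. ennreal (g k x) \<partial>lborel) \<le> ennreal (c k)" and c: "c \<longlonglongrightarrow> c'"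
  shows "(\<integral>\<^sup>+x. ennreal (g' x) \<partial>lborel) \<le> ennreal c'"
proof -
  have "(\<integral>\<^sup>+x. ennreal (g' x) \<partial>lborel) = (\<integral>\<^sup>+x. liminf (\<lambda>k. ennreal (g k x)) \<partial>lborel)"
  proof (rule nn_integral_cong_AE)
    show "AE x in lborel. ennreal (g' x) = liminf (\<lambda>k. ennreal (g k x))"
      using lim by eventually_elim (rule lim_imp_Liminf[symmetric], simp, rule tendsto_ennrealI)
  qed
  also have "\<dots> \<le> liminf (\<lambda>k. \<integral>\<^sup>+x. ennreal (g k x) \<partial>lborel)"
    by (rule nn_integral_liminf) measurable
  also have "\<dots> \<le> liminf (\<lambda>k. ennreal (c k))"
    by (rule Liminf_mono) (simp add: le)
  also have "\<dots> = ennreal c'"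
    by (rule lim_imp_Liminf) (use c in \<open>auto intro: tendsto_ennrealI\<close>)
  finally show ?thesis .
qed

context cutoff_approx
begin

text \<open>The approximants converge in L1 up to the cutoff, hence almost everywhere along a
  subsequence. Fatou's lemma carries the upper bound to the limit, so integrability of the power on
  the left need not be known in advance.\<close>

theorem cutoff_bound:
  assumes GN: "GN_bound U p q C r a b" and C: "C \<ge> 0" and r: "r > 0" and a: "a > 0" and b: "b > 0"
  shows "(\<integral>\<^sup>+x. ennreal (p x * \<bar>\<zeta> x * u x\<bar> powr r) \<partial>lborel) \<le> ennreal (C * (Bu powr a * ((1 + \<kappa>) * (Du + \<kappa> * Bu)) powr b))"
proof -
  define E where "E = (1 + \<kappa>) * (Du + \<kappa> * Bu)"
  have E: "E \<ge> 0" unfolding E_def using \<kappa>(1) Du_nonneg Bu_nonneg by (intro mult_nonneg_nonneg add_nonneg_nonneg) auto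
  define eps where "eps k = 1 / real (Suc k)" for k
  have eps: "eps k > 0" "eps \<longlonglongrightarrow> 0" for k
    using LIMSEQ_Suc[OF lim_1_over_n] by (auto simp: eps_def[abs_def])
  define Q where "Q k v H f \<longleftrightarrow> C1c U v H \<and> (\<integral>x. p x * (v x)\<^sup>2 \<partial>lborel) \<le> (1 + eps k) * Bu \<and>
     (\<integral>x. q x * (norm (H x))\<^sup>2 \<partial>lborel) \<le> (1 + eps k) * E \<and>
     integrable lborel f \<and> (\<integral>x. \<bar>f x\<bar> \<partial>lborel) \<le> eps k \<and> (\<forall>x. v x = \<zeta> x * (u x + f x))" for k v H f
  have "\<exists>v H f. Q k v H f" for k
    using approximants[OF eps(1)] unfolding E_def Q_def .
  then obtain v H f where vHf: "Q k (v k) (H k) (f k)" for k by metis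
  have c1: "C1c U (v k) (H k)" and Bk: "(\<integral>x. p x * (v k x)\<^sup>2 \<partial>lborel) \<le> (1 + eps k) * Bu"
    and Dk: "(\<integral>x. q x * (norm (H k x))\<^sup>2 \<partial>lborel) \<le> (1 + eps k) * E"
    and fi: "integrable lborel (f k)" and fL: "(\<integral>x. \<bar>f k x\<bar> \<partial>lborel) \<le> eps k"
    and vk: "v k x = \<zeta> x * (u x + f k x)" for k x
    using vHf[of k] unfolding Q_def by blast+
  have vm [measurable]: "v k \<in> borel_measurable borel" for k
    using c1[of k] by (auto simp: C1c_def intro: borel_measurable_continuous_onI)
  note [measurable] = p(1)
  have "(\<lambda>k. \<integral>x. norm (f k x) \<partial>lborel) \<longlonglongrightarrow> 0"
    by (rule tendsto_sandwich[OF _ _ tendsto_const eps(2)]) (use fL in auto)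
  then obtain s where s: "strict_mono s" "AE x in lborel. (\<lambda>k. f (s k) x) \<longlonglongrightarrow> 0"
    using tendsto_L1_AE_subseq[of lborel f, OF fi] by blast
  have bnd: "(\<integral>\<^sup>+x. ennreal (p x * \<bar>v k x\<bar> powr r) \<partial>lborel) \<le> ennreal (C * (((1 + eps k) * Bu) powr a * ((1 + eps k) * E) powr b))" for k
  proof -
    obtain K where K: "compact K" "K \<subseteq> U" "\<And>x. x \<notin> K \<Longrightarrow> v k x = 0"
      using c1[of k] by (auto simp: C1c_def)
    have cv: "continuous_on UNIV (v k)" using c1[of k] by (simp add: C1c_def)
    have "continuous_on UNIV (\<lambda>y::real. \<bar>y\<bar> powr r)"
      by (rule continuous_on_powr') (use r in \<open>auto intro!: continuous_intros\<close>)
    from C1c_weight_integrable[OF U p(2) cv K this]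
    have "integrable lborel (\<lambda>x. p x * \<bar>v k x\<bar> powr r)" by simp
    then have "(\<integral>\<^sup>+x. ennreal (p x * \<bar>v k x\<bar> powr r) \<partial>lborel) = ennreal (\<integral>x. p x * \<bar>v k x\<bar> powr r \<partial>lborel)"
      by (rule nn_integral_eq_integral) (simp add: p)
    also have "(\<integral>x. p x * \<bar>v k x\<bar> powr r \<partial>lborel)
        \<le> C * ((\<integral>x. p x * (v k x)\<^sup>2 \<partial>lborel) powr a * (\<integral>x. q x * (norm (H k x))\<^sup>2 \<partial>lborel) powr b)"
      using GN c1[of k] by (simp add: GN_bound_def)
    also have "\<dots> \<le> C * (((1 + eps k) * Bu) powr a * ((1 + eps k) * E) powr b)"
    proof (intro mult_left_mono mult_mono powr_mono2 Bk Dk)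
      show "0 \<le> (\<integral>x. p x * (v k x)\<^sup>2 \<partial>lborel)"
        by (intro Bochner_Integration.integral_nonneg mult_nonneg_nonneg p zero_le_power2)
      show "0 \<le> (\<integral>x. q x * (norm (H k x))\<^sup>2 \<partial>lborel)"
        by (intro Bochner_Integration.integral_nonneg mult_nonneg_nonneg q zero_le_power2)
    qed (use C a b in auto)
    finally show ?thesis by (simp add: ennreal_leI)
  qed
  show ?thesis
    unfolding E_def[symmetric]
  proof (rule nn_integral_Fatou_le[where g="\<lambda>k x. p x * \<bar>v (s k) x\<bar> powr r"
        and c="\<lambda>k. C * (((1 + eps (s k)) * Bu) powr a * ((1 + eps (s k)) * E) powr b)"])
    show "AE x in lborel. (\<lambda>k. p x * \<bar>v (s k) x\<bar> powr r) \<longlonglongrightarrow> p x * \<bar>\<zeta> x * u x\<bar> powr r"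
      using s(2)
    proof eventually_elim
      case (elim x)
      have "(\<lambda>k. \<bar>\<zeta> x * (u x + f (s k) x)\<bar>) \<longlonglongrightarrow> \<bar>\<zeta> x * (u x + 0)\<bar>" by (intro tendsto_intros elim)
      then have "(\<lambda>k. \<bar>\<zeta> x * (u x + f (s k) x)\<bar> powr r) \<longlonglongrightarrow> \<bar>\<zeta> x * (u x + 0)\<bar> powr r"
        by (rule tendsto_powr') (use r in auto)
      then show ?case unfolding vk by (intro tendsto_mult tendsto_const) simp
    qed
    have es: "(\<lambda>k. eps (s k)) \<longlonglongrightarrow> 0" using LIMSEQ_subseq_LIMSEQ[OF eps(2) s(1)] by (simp add: o_def)
    have "(\<lambda>k. C * (((1 + eps (s k)) * Bu) powr a * ((1 + eps (s k)) * E) powr b)) \<longlonglongrightarrow> C * (((1 + 0) * Bu) powr a * ((1 + 0) * E) powr b)"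
    proof (intro tendsto_mult tendsto_const tendsto_powr' tendsto_add es)
      have "1 + eps (s k) \<ge> 0" for k using eps(1)[of "s k"] by simp
      then show "(1 + 0) * Bu \<noteq> 0 \<or> 0 < a \<and> (\<forall>\<^sub>F k in sequentially. 0 \<le> (1 + eps (s k)) * Bu)"
        "(1 + 0) * E \<noteq> 0 \<or> 0 < b \<and> (\<forall>\<^sub>F k in sequentially. 0 \<le> (1 + eps (s k)) * E)"
        using a b Bu_nonneg E by auto
    qed
    then show "(\<lambda>k. C * (((1 + eps (s k)) * Bu) powr a * ((1 + eps (s k)) * E) powr b)) \<longlonglongrightarrow> C * (Bu powr a * E powr b)" by simp
  qed (use bnd in auto)
qed

end

text \<open>A continuously differentiable quadratic spline descending from 1 at \<open>s = 1\<close>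
  to 0 at \<open>s = 2\<close>, with its inflection at 3/2; the steepest slope, attained there, is
  -2.\<close>

definition step_fun :: "real \<Rightarrow> real" where
  "step_fun s = 1 - 2 * (max 0 (s - 1))\<^sup>2 + 4 * (max 0 (s - 3/2))\<^sup>2 - 2 * (max 0 (s - 2))\<^sup>2"

definition step_fun' :: "real \<Rightarrow> real" where
  "step_fun' s = - 4 * max 0 (s - 1) + 8 * max 0 (s - 3/2) - 4 * max 0 (s - 2)"

lemma pos_part_square_deriv: "((\<lambda>s::real. (max 0 (s - c))\<^sup>2) has_real_derivative 2 * max 0 (s - c)) (at s)"
proof -
  consider "s < c" | "s = c" | "s > c" by linarith
  then show ?thesis
  proof cases
    case 1
    have "((\<lambda>s::real. 0::real) has_real_derivative 0) (at s)" by simp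
    then have "((\<lambda>s::real. (max 0 (s - c))\<^sup>2) has_real_derivative 0) (at s)"
      by (rule has_field_derivative_transform_within_open[where S="{..<c}"]) (use 1 in auto)
    then show ?thesis using 1 by simp
  next
    case 2
    have "((\<lambda>h::real. ((max 0 (c + h - c))\<^sup>2 - (max 0 (c - c))\<^sup>2) / h) \<longlongrightarrow> 0) (at 0)"
    proof (rule Lim_null_comparison)
      show "\<forall>\<^sub>F h in at 0. norm (((max 0 (c + h - c))\<^sup>2 - (max 0 (c - c))\<^sup>2) / h) \<le> \<bar>h\<bar>"
        by (intro always_eventually allI) (auto simp: max_def power2_eq_square)
      show "((\<lambda>h::real. \<bar>h\<bar>) \<longlongrightarrow> 0) (at 0)" by (auto intro!: tendsto_eq_intros)
    qed
    then show ?thesis using 2 by (simp add: DERIV_def)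
  next
    case 3
    have "((\<lambda>s::real. (s - c)\<^sup>2) has_real_derivative 2 * (s - c)) (at s)"
      by (auto intro!: derivative_eq_intros)
    then have "((\<lambda>s::real. (max 0 (s - c))\<^sup>2) has_real_derivative 2 * (s - c)) (at s)"
      by (rule has_field_derivative_transform_within_open[where S="{c<..}"]) (use 3 in auto)
    then show ?thesis using 3 by simp
  qed
qed

lemma step_fun_deriv: "(step_fun has_real_derivative step_fun' s) (at s)"
  unfolding step_fun_def[abs_def] step_fun'_def
  by (rule derivative_eq_intros pos_part_square_deriv refl | simp)+

lemma step_fun_range: "0 \<le> step_fun s" "step_fun s \<le> 1"
  and step_fun_1: "s \<le> 1 \<Longrightarrow> step_fun s = 1" and step_fun_0: "s \<ge> 2 \<Longrightarrow> step_fun s = 0"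
  and step_fun'_0: "s \<ge> 2 \<Longrightarrow> step_fun' s = 0" and step_fun'_bound: "\<bar>step_fun' s\<bar> \<le> 2"
proof -
  show 1: "step_fun s = 1" if "s \<le> 1" for s using that by (simp add: step_fun_def)
  show 0: "step_fun s = 0" if "s \<ge> 2" for s
    using that by (simp add: step_fun_def power2_eq_square algebra_simps)
  show "step_fun' s = 0" if "s \<ge> 2" using that by (simp add: step_fun'_def)
  show "\<bar>step_fun' s\<bar> \<le> 2" by (auto simp: step_fun'_def max_def abs_le_iff)
  have a: "step_fun s = 1 - 2 * (s - 1)\<^sup>2" if "1 \<le> s" "s \<le> 3/2" using that by (simp add: step_fun_def)
  have b: "step_fun s = 2 * (2 - s)\<^sup>2" if "3/2 \<le> s" "s \<le> 2"
    using that by (simp add: step_fun_def power2_eq_square algebra_simps)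
  consider "s \<le> 1" | "1 \<le> s" "s \<le> 3/2" | "3/2 \<le> s" "s \<le> 2" | "s \<ge> 2" by linarith
  then have "0 \<le> step_fun s \<and> step_fun s \<le> 1"
  proof cases
    case 2
    have "(s - 1)\<^sup>2 \<le> (1/2)\<^sup>2" by (rule power_mono) (use 2 in auto)
    then show ?thesis using a[OF 2] by (simp add: power2_eq_square)
  next
    case 3
    have "(2 - s)\<^sup>2 \<le> (1/2)\<^sup>2" by (rule power_mono) (use 3 in auto)
    then show ?thesis using b[OF 3] by (simp add: power2_eq_square)
  qed (simp_all add: 0 1)
  then show "0 \<le> step_fun s" "step_fun s \<le> 1" by auto
qed

lemma step_fun_cont: "continuous_on UNIV step_fun" "continuous_on UNIV step_fun'"
  unfolding step_fun_def[abs_def] step_fun'_def[abs_def] by (intro continuous_intros)+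

text \<open>Completeness of the weighted space enters only through an exhaustion function
  \<open>L\<close> with bounded gradient.\<close>
locale exhaustion =
  fixes U :: "'a::euclidean_space set" and p q L :: "'a \<Rightarrow> real" and DL :: "'a \<Rightarrow> 'a"
  assumes U: "open U"
    and p: "p \<in> borel_measurable borel" "continuous_on U p" "\<And>x. x \<in> U \<Longrightarrow> p x > 0" "\<And>x. x \<notin> U \<Longrightarrow> p x = 0"
    and q: "q \<in> borel_measurable borel" "continuous_on U q" "\<And>x. x \<in> U \<Longrightarrow> q x > 0" "\<And>x. x \<notin> U \<Longrightarrow> q x = 0"
    and L: "continuous_on U L" "continuous_on U DL" "\<And>c. compact {x \<in> U. L x \<le> c}"
    and DL: "\<And>x i. x \<in> U \<Longrightarrow> i \<in> Basis \<Longrightarrow> ((\<lambda>t. L (x + t *\<^sub>R i)) has_real_derivative (DL x \<bullet> i)) (at 0)"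
    and grad: "\<And>x. x \<in> U \<Longrightarrow> q x * (norm (DL x))\<^sup>2 \<le> p x"
begin

lemma p_nonneg: "p x \<ge> 0" and q_nonneg: "q x \<ge> 0"
  using p(3)[of x] p(4)[of x] q(3)[of x] q(4)[of x] by (cases "x \<in> U"; simp add: less_imp_le)+

definition cut :: "real \<Rightarrow> 'a \<Rightarrow> real" where
  "cut d x = (if x \<in> U then step_fun (d * L x) else 0)"

definition Dcut :: "real \<Rightarrow> 'a \<Rightarrow> 'a" where
  "Dcut d x = (if x \<in> U then (step_fun' (d * L x) * d) *\<^sub>R DL x else 0)"

lemma cut_C1c:
  assumes d: "d > 0"
  shows "C1c U (cut d) (Dcut d)"
proof -
  define K where "K = {x \<in> U. L x \<le> 2 / d}"
  have K: "compact K" "K \<subseteq> U" unfolding K_def using L(3) by auto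
  have outK: "d * L x \<ge> 2" if "x \<in> U" "x \<notin> K" for x
    using that d by (auto simp: K_def not_le field_simps)
  have z: "cut d x = 0" "Dcut d x = 0" if "x \<notin> K" for x
    using outK[of x] that by (auto simp: cut_def Dcut_def step_fun_0 step_fun'_0)
  have e: "continuous_on U (cut d) \<longleftrightarrow> continuous_on U (\<lambda>x. step_fun (d * L x))"
    "continuous_on U (Dcut d) \<longleftrightarrow> continuous_on U (\<lambda>x. (step_fun' (d * L x) * d) *\<^sub>R DL x)"
    by (rule continuous_on_cong; simp add: cut_def Dcut_def)+
  have c: "continuous_on U (cut d)" "continuous_on U (Dcut d)"
    unfolding e
    by (intro continuous_on_scaleR continuous_on_mult continuous_on_const L
        continuous_on_compose2[OF step_fun_cont(1)] continuous_on_compose2[OF step_fun_cont(2)] subset_UNIV)+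
  have "((\<lambda>t. cut d (x + t *\<^sub>R i)) has_real_derivative Dcut d x \<bullet> i) (at 0)" if i: "i \<in> Basis" for x i
  proof (cases "x \<in> K")
    case True
    then have xU: "x \<in> U" using K by auto
    have "((\<lambda>t. d * L (x + t *\<^sub>R i)) has_real_derivative d * (DL x \<bullet> i)) (at 0)"
      by (intro DERIV_cmult DL xU i)
    then have "((\<lambda>t. step_fun (d * L (x + t *\<^sub>R i))) has_real_derivative step_fun' (d * L (x + 0 *\<^sub>R i)) * (d * (DL x \<bullet> i))) (at 0)"
      by (rule DERIV_chain2[OF step_fun_deriv])
    moreover have "eventually (\<lambda>t. x + t *\<^sub>R i \<in> U) (nhds 0)"
      by (intro topological_tendstoD[where l=x]) (use xU U in \<open>auto intro!: tendsto_eq_intros filterlim_ident\<close>)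
    then have "eventually (\<lambda>t. step_fun (d * L (x + t *\<^sub>R i)) = cut d (x + t *\<^sub>R i)) (nhds 0)"
      by eventually_elim (simp add: cut_def)
    ultimately show ?thesis
      using DERIV_cong_ev[OF refl _ refl, of "\<lambda>t. step_fun (d * L (x + t *\<^sub>R i))" "\<lambda>t. cut d (x + t *\<^sub>R i)" 0] xU
      by (simp add: Dcut_def mult.assoc)
  next
    case False
    have "open (- K)" using K(1) by (simp add: compact_imp_closed open_Compl)
    then have "eventually (\<lambda>t. x + t *\<^sub>R i \<in> - K) (nhds 0)"
      by (intro topological_tendstoD[where l=x]) (use False in \<open>auto intro!: tendsto_eq_intros filterlim_ident\<close>)
    then have ev: "eventually (\<lambda>t. cut d (x + t *\<^sub>R i) = 0) (nhds 0)"
      by eventually_elim (simp add: z)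
    have "((\<lambda>t::real. 0::real) has_real_derivative 0) (at 0)" by simp
    then show ?thesis using DERIV_cong_ev[OF refl ev refl, of 0] False by (simp add: z)
  qed
  moreover have "continuous_on UNIV (cut d)" "continuous_on UNIV (Dcut d)"
    by (rule continuous_on_local_support[OF U K c(1), where c=0], simp add: z)
       (rule continuous_on_local_support[OF U K c(2), where c=0], simp add: z)
  ultimately show ?thesis unfolding C1c_def using K z by blast
qed

lemma Dcut_bound:
  assumes d: "d > 0"
  shows "q x * (norm (Dcut d x))\<^sup>2 \<le> (2 * d)\<^sup>2 * p x"
proof (cases "x \<in> U")
  case True
  have "(step_fun' (d * L x) * d)\<^sup>2 \<le> (2 * d)\<^sup>2"
  proof (subst abs_le_square_iff[symmetric])
    show "\<bar>step_fun' (d * L x) * d\<bar> \<le> \<bar>2 * d\<bar>"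
      using step_fun'_bound[of "d * L x"] d by (simp add: abs_mult)
  qed
  then have "(step_fun' (d * L x) * d)\<^sup>2 * (q x * (norm (DL x))\<^sup>2) \<le> (2 * d)\<^sup>2 * p x"
    using grad[OF True] q_nonneg[of x] by (intro mult_mono) auto
  then show ?thesis using True by (simp add: Dcut_def power_mult_distrib mult_ac)
qed (simp add: Dcut_def p_nonneg q)

text \<open>The cutoffs \<open>cut d\<close> have relative gradient at most \<open>2 * d\<close>,
  from the slope bound 2 of the spline and the hypothesis on the gradient of \<open>L\<close>. As
  \<open>d\<close> tends to 0 they are eventually 1 at each point of \<open>U\<close>, and Fatou's
  lemma concludes.\<close>

theorem GN_weak:
  assumes u [measurable]: "u \<in> borel_measurable borel" and G [measurable]: "G \<in> borel_measurable borel"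
    and wg: "weak_gradient U u G"
    and iu: "integrable lborel (\<lambda>x. p x * (u x)\<^sup>2)" and iG: "integrable lborel (\<lambda>x. q x * (norm (G x))\<^sup>2)"
    and GN: "GN_bound U p q C r a b" and C: "C \<ge> 0" and r: "r > 0" and a: "a > 0" and b: "b > 0"
  shows "(\<integral>\<^sup>+x. ennreal (p x * \<bar>u x\<bar> powr r) \<partial>lborel)
    \<le> ennreal (C * ((\<integral>x. p x * (u x)\<^sup>2 \<partial>lborel) powr a * (\<integral>x. q x * (norm (G x))\<^sup>2 \<partial>lborel) powr b))"
proof -
  define d where "d k = 1 / real (Suc k)" for k
  have d: "d k > 0" "d \<longlonglongrightarrow> 0" for k
    using LIMSEQ_Suc[OF lim_1_over_n] by (auto simp: d_def[abs_def])
  let ?B = "\<integral>x. p x * (u x)\<^sup>2 \<partial>lborel" and ?D = "\<integral>x. q x * (norm (G x))\<^sup>2 \<partial>lborel"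
  have B0: "?B \<ge> 0" "?D \<ge> 0"
    by (intro Bochner_Integration.integral_nonneg mult_nonneg_nonneg p_nonneg q_nonneg zero_le_power2)+
  note [measurable] = p(1)
  have cm [measurable]: "cut (d k) \<in> borel_measurable borel" for k
    using cut_C1c[OF d(1)[of k]] by (auto simp: C1c_def intro: borel_measurable_continuous_onI)
  have bnd: "(\<integral>\<^sup>+x. ennreal (p x * \<bar>cut (d k) x * u x\<bar> powr r) \<partial>lborel)
     \<le> ennreal (C * (?B powr a * ((1 + 2 * d k) * (?D + 2 * d k * ?B)) powr b))" for k
  proof -
    interpret cutoff_approx U p q u G "cut (d k)" "Dcut (d k)" "2 * d k"
      by unfold_locales
        (use U p q p_nonneg q_nonneg wg iu iG cut_C1c[OF d(1)[of k]] Dcut_bound[OF d(1)[of k]] d(1)[of k] step_fun_range in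
          \<open>auto simp: cut_def\<close>)
    show ?thesis using cutoff_bound[OF GN C r a b] by (simp add: Bu_def Du_def)
  qed
  show ?thesis
  proof (rule nn_integral_Fatou_le[OF _ _ bnd])
    show "AE x in lborel. (\<lambda>k. p x * \<bar>cut (d k) x * u x\<bar> powr r) \<longlonglongrightarrow> p x * \<bar>u x\<bar> powr r"
    proof (rule AE_I2)
      fix x
      show "(\<lambda>k. p x * \<bar>cut (d k) x * u x\<bar> powr r) \<longlonglongrightarrow> p x * \<bar>u x\<bar> powr r"
      proof (cases "x \<in> U")
        case True
        have "(\<lambda>k. d k * L x) \<longlonglongrightarrow> 0 * L x" by (intro tendsto_intros d(2))
        then have "\<forall>\<^sub>F k in sequentially. d k * L x < 1" by (rule order_tendstoD(2)) simp
        then have "\<forall>\<^sub>F k in sequentially. p x * \<bar>cut (d k) x * u x\<bar> powr r = p x * \<bar>u x\<bar> powr r"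
          by eventually_elim (use True in \<open>simp add: cut_def step_fun_1\<close>)
        then show ?thesis by (rule tendsto_eventually)
      qed (simp add: p)
    qed
    have "(\<lambda>k. C * (?B powr a * ((1 + 2 * d k) * (?D + 2 * d k * ?B)) powr b)) \<longlonglongrightarrow> C * (?B powr a * ((1 + 2 * 0) * (?D + 2 * 0 * ?B)) powr b)"
    proof (intro tendsto_mult tendsto_const tendsto_powr' tendsto_add d(2))
      have "0 \<le> (1 + 2 * d k) * (?D + 2 * d k * ?B)" for k
        using d(1)[of k] B0 by (intro mult_nonneg_nonneg add_nonneg_nonneg) auto
      then show "(1 + 2 * 0) * (?D + 2 * 0 * ?B) \<noteq> 0 \<or> 0 < b \<and> (\<forall>\<^sub>F k in sequentially. 0 \<le> (1 + 2 * d k) * (?D + 2 * d k * ?B))"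
        using b by auto
    qed
    then show "(\<lambda>k. C * (?B powr a * ((1 + 2 * d k) * (?D + 2 * d k * ?B)) powr b)) \<longlonglongrightarrow> C * (?B powr a * ?D powr b)" by simp
  qed measurable
qed

end

section \<open>Comparison of the two suprema\<close>

lemma integral_lebesgue_AE_borel:
  fixes f g :: "'a::euclidean_space \<Rightarrow> real"
  assumes f: "f \<in> borel_measurable borel" and g: "g \<in> borel_measurable lebesgue"
    and ae: "AE x in lborel. g x = f x"
  shows "integrable lebesgue g \<longleftrightarrow> integrable lborel f"
    and "(\<integral>x. g x \<partial>lebesgue) = (\<integral>x. f x \<partial>lborel)"
proof -
  have fl: "f \<in> borel_measurable lborel" using f by simp
  have f': "f \<in> borel_measurable lebesgue" using fl by (rule measurable_completion)
  have "integrable lebesgue g \<longleftrightarrow> integrable lebesgue f"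
    by (rule integrable_cong_AE[OF g f' AE_completion[OF ae]])
  then show "integrable lebesgue g \<longleftrightarrow> integrable lborel f"
    by (simp add: integrable_completion[OF fl])
  have "(\<integral>x. g x \<partial>lebesgue) = (\<integral>x. f x \<partial>lebesgue)"
    by (rule integral_cong_AE[OF g f' AE_completion[OF ae]])
  then show "(\<integral>x. g x \<partial>lebesgue) = (\<integral>x. f x \<partial>lborel)"
    by (simp add: integral_completion[OF fl])
qed

lemma lebesgue_borel_representative:
  fixes G :: "'a::euclidean_space \<Rightarrow> 'b::euclidean_space"
  assumes "G \<in> borel_measurable lebesgue"
  obtains G' where "G' \<in> borel_measurable borel" "AE x in lborel. G x = G' x"
proof -
  have "\<exists>g \<in> borel_measurable lborel. AE x in lborel. G x \<bullet> i = g x" for i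
    by (rule completion_ex_borel_measurable_real) (use assms in measurable)
  then obtain g where g: "\<And>i. g i \<in> borel_measurable lborel" "\<And>i. AE x in lborel. G x \<bullet> i = g i x"
    by metis
  show thesis
  proof (rule that[of "\<lambda>x. \<Sum>i\<in>Basis. g i x *\<^sub>R i"])
    note [measurable] = g(1)
    show "(\<lambda>x. \<Sum>i\<in>Basis. g i x *\<^sub>R i) \<in> borel_measurable borel"
      unfolding measurable_lborel1[symmetric] by measurable
    have "AE x in lborel. \<forall>i\<in>Basis. G x \<bullet> i = g i x"
      by (rule AE_finite_allI) (use g(2) in auto)
    then show "AE x in lborel. G x = (\<Sum>i\<in>Basis. g i x *\<^sub>R i)"
    proof eventually_elim
      case (elim x)
      have "G x = (\<Sum>i\<in>Basis. (G x \<bullet> i) *\<^sub>R i)" by (simp add: euclidean_representation)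
      also have "\<dots> = (\<Sum>i\<in>Basis. g i x *\<^sub>R i)" by (rule sum.cong) (use elim in auto)
      finally show ?case .
    qed
  qed
qed

lemma weak_gradient_cong_AE:
  fixes u u' :: "'a::euclidean_space \<Rightarrow> real"
  assumes wg: "weak_gradient U u G" and U: "U \<in> sets borel"
    and u': "u' \<in> borel_measurable lebesgue" "AE x in lborel. u x = u' x"
    and G': "G' \<in> borel_measurable lebesgue" "AE x in lborel. G x = G' x"
  shows "weak_gradient U u' G'"
proof -
  have u: "u \<in> borel_measurable lebesgue" and G: "G \<in> borel_measurable lebesgue"
    using wg by (auto simp: weak_gradient_def)
  note [measurable] = u G u'(1) G'(1)
  have ae: "AE x in lebesgue_on K. P x" if "AE x in lborel. P x" "K \<in> sets borel" for K and P :: "'a \<Rightarrow> bool"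
    using AE_completion[OF that(1)] that(2) by (subst AE_restrict_space_iff) auto
  have mr: "f \<in> borel_measurable lebesgue \<Longrightarrow> f \<in> borel_measurable (lebesgue_on K)" for K and f :: "'a \<Rightarrow> real"
    by (rule measurable_restrict_space1)
  have I1: "integrable (lebesgue_on K) u'" if K: "compact K" "K \<subseteq> U" for K
    using integrable_cong_AE[of u "lebesgue_on K" u', OF mr[OF u] mr[OF u'(1)] ae[OF u'(2)]] K wg
    by (auto simp: weak_gradient_def borel_compact)
  have I2: "integrable (lebesgue_on K) (\<lambda>x. norm (G' x))" if K: "compact K" "K \<subseteq> U" for K
  proof -
    have "AE x in lborel. norm (G x) = norm (G' x)" using G'(2) by eventually_elim simp
    from ae[OF this borel_compact[OF K(1)]]
    have "integrable (lebesgue_on K) (\<lambda>x. norm (G x)) \<longleftrightarrow> integrable (lebesgue_on K) (\<lambda>x. norm (G' x))"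
      by (intro integrable_cong_AE mr) measurable
    then show ?thesis using K wg by (simp add: weak_gradient_def)
  qed
  have I3: "(\<integral>x. u' x * partial \<phi> i x \<partial>lebesgue_on U) = - (\<integral>x. (G' x \<bullet> i) * \<phi> x \<partial>lebesgue_on U)"
    if \<phi>: "test_fun U \<phi>" and i: "i \<in> Basis" for \<phi> i
  proof -
    have "\<phi> \<in> borel_measurable lborel" "partial \<phi> i \<in> borel_measurable lborel"
      using test_fun_continuous[OF \<phi>] test_fun_partial_continuous[OF \<phi> i]
      by (auto intro: borel_measurable_continuous_onI)
    then have [measurable]: "\<phi> \<in> borel_measurable lebesgue" "partial \<phi> i \<in> borel_measurable lebesgue"
      by (auto intro: measurable_completion)
    have "AE x in lborel. u' x * partial \<phi> i x = u x * partial \<phi> i x" using u'(2) by eventually_elim simp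
    then have "(\<integral>x. u' x * partial \<phi> i x \<partial>lebesgue_on U) = (\<integral>x. u x * partial \<phi> i x \<partial>lebesgue_on U)"
      by (intro integral_cong_AE mr ae[OF _ U]) measurable
    moreover have "AE x in lborel. (G' x \<bullet> i) * \<phi> x = (G x \<bullet> i) * \<phi> x" using G'(2) by eventually_elim simp
    then have "(\<integral>x. (G' x \<bullet> i) * \<phi> x \<partial>lebesgue_on U) = (\<integral>x. (G x \<bullet> i) * \<phi> x \<partial>lebesgue_on U)"
      by (intro integral_cong_AE mr ae[OF _ U]) measurable
    ultimately show ?thesis using wg \<phi> i by (simp add: weak_gradient_def)
  qed
  show ?thesis unfolding weak_gradient_def using u'(1) G'(1) I1 I2 I3 by blast
qed

text \<open>Mollification needs Fubini for Borel functions, while Sobolev functions are only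
  Lebesgue measurable. Both the weak gradient and the integrals survive the passage to Borel
  representatives.\<close>

lemma (in exhaustion) GN_weak_lebesgue:
  assumes wg: "weak_gradient U u G"
    and iu: "integrable lebesgue (\<lambda>x. p x * (u x)\<^sup>2)" and iG: "integrable lebesgue (\<lambda>x. q x * (norm (G x))\<^sup>2)"
    and GN: "GN_bound U p q C r a b" and C: "C \<ge> 0" and r: "r > 0" and a: "a > 0" and b: "b > 0"
  shows "(\<integral>\<^sup>+x. ennreal (p x * \<bar>u x\<bar> powr r) \<partial>lborel)
    \<le> ennreal (C * ((\<integral>x. p x * (u x)\<^sup>2 \<partial>lebesgue) powr a * (\<integral>x. q x * (norm (G x))\<^sup>2 \<partial>lebesgue) powr b))"
proof -
  have u: "u \<in> borel_measurable lebesgue" and G: "G \<in> borel_measurable lebesgue"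
    using wg by (auto simp: weak_gradient_def)
  obtain u' where u' [measurable]: "u' \<in> borel_measurable borel" and ueq: "AE x in lborel. u x = u' x"
    using lebesgue_borel_representative[OF u] by blast
  obtain G' where G' [measurable]: "G' \<in> borel_measurable borel" and Geq: "AE x in lborel. G x = G' x"
    using lebesgue_borel_representative[OF G] by blast
  note [measurable] = p(1) q(1)
  have wg': "weak_gradient U u' G'"
    by (rule weak_gradient_cong_AE[OF wg borel_open[OF U] _ ueq _ Geq]) (auto intro: measurable_completion)
  have "AE x in lborel. p x * (u x)\<^sup>2 = p x * (u' x)\<^sup>2" using ueq by eventually_elim simp
  from integral_lebesgue_AE_borel[OF _ borel_measurable_integrable[OF iu] this]
  have ru: "integrable lborel (\<lambda>x. p x * (u' x)\<^sup>2)" "(\<integral>x. p x * (u x)\<^sup>2 \<partial>lebesgue) = (\<integral>x. p x * (u' x)\<^sup>2 \<partial>lborel)"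
    using iu by simp_all
  have "AE x in lborel. q x * (norm (G x))\<^sup>2 = q x * (norm (G' x))\<^sup>2" using Geq by eventually_elim simp
  from integral_lebesgue_AE_borel[OF _ borel_measurable_integrable[OF iG] this]
  have rG: "integrable lborel (\<lambda>x. q x * (norm (G' x))\<^sup>2)" "(\<integral>x. q x * (norm (G x))\<^sup>2 \<partial>lebesgue) = (\<integral>x. q x * (norm (G' x))\<^sup>2 \<partial>lborel)"
    using iG by simp_all
  have "(\<integral>\<^sup>+x. ennreal (p x * \<bar>u x\<bar> powr r) \<partial>lborel) = (\<integral>\<^sup>+x. ennreal (p x * \<bar>u' x\<bar> powr r) \<partial>lborel)"
    by (rule nn_integral_cong_AE) (use ueq in \<open>eventually_elim, simp\<close>)
  also have "\<dots> \<le> ennreal (C * ((\<integral>x. p x * (u' x)\<^sup>2 \<partial>lborel) powr a * (\<integral>x. q x * (norm (G' x))\<^sup>2 \<partial>lborel) powr b))"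
    by (rule GN_weak[OF u' G' wg' ru(1) rG(1) GN C r a b])
  finally show ?thesis by (simp add: ru(2) rG(2))
qed

section \<open>Hyperbolic integrals as weighted integrals; comparing suprema\<close>

lemma hyp_vol_convert:
  fixes F :: "'a::euclidean_space \<Rightarrow> real"
  assumes F: "F \<in> borel_measurable lebesgue"
  shows integrable_hyp_vol: "integrable hyp_vol F \<longleftrightarrow> integrable lebesgue (\<lambda>x. hvw DIM('a) x * F x)"
    and integral_hyp_vol: "(\<integral>x. F x \<partial>hyp_vol) = (\<integral>x. hvw DIM('a) x * F x \<partial>lebesgue)"
    and nn_integral_hyp_vol: "(\<integral>\<^sup>+x. ennreal (F x) \<partial>hyp_vol) = (\<integral>\<^sup>+x. ennreal (hvw DIM('a) x * F x) \<partial>lborel)"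
proof -
  have "rho \<in> borel_measurable (lebesgue :: 'a measure)"
    using hyp_rho_measurable by (intro measurable_completion) simp
  then have R: "(\<lambda>x::'a. rho x ^ DIM('a)) \<in> borel_measurable (lebesgue_on (ball 0 1))"
    by (intro measurable_restrict_space1 borel_measurable_power)
  have F': "F \<in> borel_measurable (lebesgue_on (ball 0 1))" using F by (rule measurable_restrict_space1)
  have pos: "AE x in lebesgue_on (ball 0 1). 0 \<le> rho (x::'a) ^ DIM('a)"
  proof (rule AE_I2)
    fix x :: 'a assume "x \<in> space (lebesgue_on (ball 0 1))"
    then show "0 \<le> rho x ^ DIM('a)" using hyp_rho_pos[of x] by simp
  qed
  have b: "ball (0::'a) 1 \<inter> space lebesgue \<in> sets lebesgue" by simp
  have e: "(\<lambda>x. indicator (ball 0 1) x *\<^sub>R (rho x ^ DIM('a) *\<^sub>R F x)) = (\<lambda>x. hvw DIM('a) x * F x)"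
    by (auto simp: hvw_def)
  show "integrable hyp_vol F \<longleftrightarrow> integrable lebesgue (\<lambda>x. hvw DIM('a) x * F x)"
    unfolding hyp_vol_def integrable_density[OF F' R pos] integrable_restrict_space[OF b] e ..
  show "(\<integral>x. F x \<partial>hyp_vol) = (\<integral>x. hvw DIM('a) x * F x \<partial>lebesgue)"
    unfolding hyp_vol_def integral_density[OF F' R pos] integral_restrict_space[OF b] e ..
  have "(\<integral>\<^sup>+x. ennreal (F x) \<partial>hyp_vol) = (\<integral>\<^sup>+x. ennreal (rho x ^ DIM('a)) * ennreal (F x) * indicator (ball 0 1) x \<partial>lborel)"
    unfolding hyp_vol_def using R F'
    by (subst nn_integral_density) (simp_all add: nn_integral_restrict_space nn_integral_completion)
  also have "\<dots> = (\<integral>\<^sup>+x. ennreal (hvw DIM('a) x * F x) \<partial>lborel)"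
  proof (rule nn_integral_cong)
    fix x :: 'a
    show "ennreal (rho x ^ DIM('a)) * ennreal (F x) * indicator (ball 0 1) x = ennreal (hvw DIM('a) x * F x)"
      using hyp_rho_pos[of x] by (cases "x \<in> ball 0 1") (simp_all add: hvw_def ennreal_mult')
  qed
  finally show "(\<integral>\<^sup>+x. ennreal (F x) \<partial>hyp_vol) = (\<integral>\<^sup>+x. ennreal (hvw DIM('a) x * F x) \<partial>lborel)" .
qed

lemma hvw_gradient:
  fixes x :: "'a::euclidean_space"
  assumes "DIM('a) \<ge> 2"
  shows "hvw DIM('a) x * (y\<^sup>2 / (rho x)\<^sup>2) = hvw (DIM('a) - 2) x * y\<^sup>2"
proof (cases "x \<in> ball 0 1")
  case True
  then have "rho x \<noteq> 0" using hyp_rho_pos[of x] by simp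
  moreover have "rho x ^ (DIM('a) - 2 + 2) = rho x ^ (DIM('a) - 2) * (rho x)\<^sup>2"
    by (rule power_add)
  then have "rho x ^ DIM('a) = rho x ^ (DIM('a) - 2) * (rho x)\<^sup>2"
    using assms by (simp only: le_add_diff_inverse2)
  ultimately show ?thesis using True by (simp add: hvw_def)
qed (simp add: hvw_def)

text \<open>With zero denominator the conventions of \<open>ereal\<close> agree with the product
  form: a positive numerator gives infinity, and 0 divided by 0 is 0. An infinite numerator violates
  both sides.\<close>

lemma W_quot_le_iff:
  assumes C: "C \<ge> 0"
  shows "W_quot M n p u B D \<le> ereal C \<longleftrightarrow>
    (\<integral>\<^sup>+x. ennreal (\<bar>u x\<bar> powr (p + 1)) \<partial>M) \<le> ennreal (C * (B powr (GN_alpha n p / 2) * D powr (GN_beta n p / 2)))"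
proof -
  define A where "A = (\<integral>\<^sup>+x. ennreal (\<bar>u x\<bar> powr (p + 1)) \<partial>M)"
  define d where "d = B powr (GN_alpha n p / 2) * D powr (GN_beta n p / 2)"
  have d: "d \<ge> 0" by (simp add: d_def)
  have "enn2ereal A / ereal d \<le> ereal C \<longleftrightarrow> A \<le> ennreal (C * d)"
  proof (cases A)
    case (real x)
    show ?thesis
    proof (cases "d = 0")
      case True
      then show ?thesis using real C by (cases "x = 0") (auto simp: enn2ereal_ennreal zero_ennreal.rep_eq ennreal_eq_0_iff)
    next
      case False
      then show ?thesis using real C d by (simp add: enn2ereal_ennreal ennreal_le_iff divide_le_eq)
    qed
  next
    case top
    then show ?thesis using d by (cases "d = 0") (auto simp: enn2ereal_top top_unique)
  qed
  then show ?thesis by (simp add: W_quot_def A_def d_def)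
qed

lemma W_quot_pos:
  assumes u: "u \<in> borel_measurable M" and B: "(\<integral>x. (u x)\<^sup>2 \<partial>M) \<noteq> 0"
  shows "W_quot M n p u B' D > 0"
proof (rule ccontr)
  assume "\<not> ?thesis"
  then have "W_quot M n p u B' D \<le> ereal 0" by (simp add: zero_ereal_def)
  then have "(\<integral>\<^sup>+x. ennreal (\<bar>u x\<bar> powr (p + 1)) \<partial>M) = 0" by (subst (asm) W_quot_le_iff) auto
  then have "AE x in M. ennreal (\<bar>u x\<bar> powr (p + 1)) = 0"
    using u by (subst (asm) nn_integral_0_iff_AE) auto
  then have "AE x in M. (u x)\<^sup>2 = 0" by eventually_elim (auto simp: ennreal_eq_0_iff)
  then have "(\<integral>x. (u x)\<^sup>2 \<partial>M) = 0" by (rule integral_eq_zero_AE)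
  then show False using B by simp
qed

text \<open>An infinite supremum on the right leaves nothing to prove, so only real bounds have to
  be transferred. Positivity makes those bounds nonnegative, and if \<open>S\<close> is empty, where
  the supremum is minus infinity, the bound 0 holds vacuously and forces \<open>T\<close> to be
  empty too.\<close>

lemma SUP_le_SUP_by_bounds:
  fixes f :: "'a \<Rightarrow> ereal" and g :: "'b \<Rightarrow> ereal"
  assumes f: "\<And>z. z \<in> S \<Longrightarrow> f z > 0" and g: "\<And>z. z \<in> T \<Longrightarrow> g z > 0"
    and b: "\<And>C z. C \<ge> 0 \<Longrightarrow> (\<And>y. y \<in> S \<Longrightarrow> f y \<le> ereal C) \<Longrightarrow> z \<in> T \<Longrightarrow> g z \<le> ereal C"
  shows "Sup (g ` T) \<le> Sup (f ` S)"
proof (cases "S = {}")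
  case True
  have "T = {}"
  proof (rule ccontr)
    assume "T \<noteq> {}"
    then obtain z where "z \<in> T" by blast
    then show False using b[of 0 z] g[of z] True by (auto simp: zero_ereal_def)
  qed
  then show ?thesis by simp
next
  case False
  then obtain y where y: "y \<in> S" by blast
  have pos: "Sup (f ` S) \<ge> 0" using f[OF y] SUP_upper[OF y, of f] by (meson less_imp_le order_trans)
  show ?thesis
  proof (cases "Sup (f ` S)")
    case (real C)
    show ?thesis
      unfolding real
    proof (rule SUP_least, rule b)
      show "C \<ge> 0" using pos real by simp
      show "f z \<le> ereal C" if "z \<in> S" for z using SUP_upper[OF that, of f] real by simp
    qed
  qed (use pos in auto)
qed

lemma norm_square_line_derivative:
  fixes x e :: "'a::real_inner"
  shows "((\<lambda>t. (norm (x + t *\<^sub>R e))\<^sup>2) has_real_derivative 2 * (x \<bullet> e)) (at 0)"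
proof -
  have e: "(\<lambda>t. (norm (x + t *\<^sub>R e))\<^sup>2) = (\<lambda>t. x \<bullet> x + 2 * t * (x \<bullet> e) + t\<^sup>2 * (e \<bullet> e))"
    unfolding power2_norm_eq_inner
    by (rule ext) (simp add: inner_add_left inner_add_right inner_commute[of e x] power2_eq_square algebra_simps)
  show ?thesis unfolding e by (auto intro!: derivative_eq_intros)
qed

text \<open>The condition says that 1 - |x|^2 is at least 2 exp(-c), which is closed and keeps the
  point away from the unit sphere.\<close>

lemma compact_ball_exhaustion: "compact {x \<in> ball (0::'a::euclidean_space) 1. ln (rho x) \<le> c}"
proof -
  have "{x \<in> ball (0::'a) 1. ln (rho x) \<le> c} = {x. 2 * exp (- c) \<le> 1 - (norm x)\<^sup>2}" (is "?L = ?R")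
  proof (intro set_eqI)
    fix x :: 'a
    show "x \<in> ?L \<longleftrightarrow> x \<in> ?R"
    proof (cases "norm x < 1")
      case True
      have "ln (rho x) \<le> c \<longleftrightarrow> rho x \<le> exp c"
        using hyp_rho_pos[OF True] by (metis exp_le_cancel_iff exp_ln)
      also have "\<dots> \<longleftrightarrow> 2 * exp (- c) \<le> 1 - (norm x)\<^sup>2"
        using norm_less_1_sq[OF True] by (simp add: hyp_rho_def exp_minus field_simps)
      finally show ?thesis using True by simp
    next
      case False
      then have "1 - (norm x)\<^sup>2 \<le> 0" by simp
      then have "\<not> 2 * exp (- c) \<le> 1 - (norm x)\<^sup>2" using exp_gt_zero[of "- c"] by linarith
      then have "x \<notin> ?R" by simp
      then show ?thesis using False by simp
    qed
  qed
  moreover have "closed {x::'a. 2 * exp (- c) \<le> 1 - (norm x)\<^sup>2}"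
    by (intro closed_Collect_le continuous_intros)
  moreover have "?L \<subseteq> ball 0 1" by auto
  ultimately show ?thesis
    using bounded_subset[OF bounded_ball] by (simp add: compact_eq_bounded_closed)
qed

text \<open>Up to a bounded term, \<open>ln (rho x)\<close> is the hyperbolic distance from the
  origin. Its gradient is \<open>rho x *\<^sub>R x\<close>, whose hyperbolic length is
  \<open>norm x < 1\<close>.\<close>

lemma hvw_exhaustion:
  assumes dim: "DIM('a::euclidean_space) \<ge> 2"
  shows "exhaustion (ball 0 1) (hvw DIM('a)) (hvw (DIM('a) - 2)) (\<lambda>x. ln (rho x)) (\<lambda>x::'a. rho x *\<^sub>R x)"
proof
  have c: "continuous_on (ball 0 1) (\<lambda>x::'a. hvw k x)" for k
  proof -
    have "continuous_on (ball 0 1) (\<lambda>x::'a. rho x ^ k)" by (intro continuous_intros hyp_rho_continuous)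
    then show ?thesis by (rule continuous_on_eq) (simp add: hvw_def)
  qed
  show "continuous_on (ball 0 1) (hvw DIM('a) :: 'a \<Rightarrow> real)" "continuous_on (ball 0 1) (hvw (DIM('a) - 2) :: 'a \<Rightarrow> real)"
    using c by (simp_all add: eta_contract_eq)
  show "hvw DIM('a) x > 0" "hvw (DIM('a) - 2) x > 0" if "x \<in> ball 0 1" for x :: 'a
    using hyp_rho_pos[of x] that by (simp_all add: hvw_def)
  show "hvw DIM('a) x = 0" "hvw (DIM('a) - 2) x = 0" if "x \<notin> ball 0 1" for x :: 'a
    using that by (simp_all add: hvw_def)
  show "continuous_on (ball 0 1) (\<lambda>x::'a. ln (rho x))"
    by (intro continuous_on_ln hyp_rho_continuous) (use hyp_rho_pos in force)
  show "continuous_on (ball 0 1) (\<lambda>x::'a. rho x *\<^sub>R x)"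
    by (intro continuous_intros hyp_rho_continuous)
  show "compact {x \<in> ball (0::'a) 1. ln (rho x) \<le> c}" for c by (rule compact_ball_exhaustion)
  show "((\<lambda>t. ln (rho (x + t *\<^sub>R i))) has_real_derivative rho x *\<^sub>R x \<bullet> i) (at 0)" if "x \<in> ball 0 1" for x i :: 'a
  proof -
    have x: "norm x < 1" using that by simp
    have "((\<lambda>t. ln (rho (x + t *\<^sub>R i))) has_real_derivative 1 / rho (x + 0 *\<^sub>R i) * ((rho x)\<^sup>2 * (x \<bullet> i))) (at 0)"
      by (rule DERIV_chain2[OF DERIV_ln_divide hyp_rho_line_derivative[OF x]]) (use hyp_rho_pos[OF x] in simp)
    then show ?thesis using hyp_rho_pos[OF x] by (simp add: power2_eq_square)
  qed
  show "hvw (DIM('a) - 2) x * (norm (rho x *\<^sub>R x))\<^sup>2 \<le> hvw DIM('a) x" if "x \<in> ball 0 1" for x :: 'a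
  proof -
    have x: "norm x < 1" using that by simp
    have "hvw (DIM('a) - 2) x * (norm (rho x *\<^sub>R x))\<^sup>2 = hvw DIM('a) x * ((rho x * norm x)\<^sup>2 / (rho x)\<^sup>2)"
      using hvw_gradient[OF dim, of x "rho x * norm x"] hyp_rho_pos[OF x] by simp
    also have "\<dots> = hvw DIM('a) x * (norm x)\<^sup>2" using hyp_rho_pos[OF x] by (simp add: power_mult_distrib)
    also have "\<dots> \<le> hvw DIM('a) x"
      using norm_less_1_sq[OF x] hvw_nonneg[of "DIM('a)" x] by (intro mult_left_le) auto
    finally show ?thesis .
  qed
qed simp_all

text \<open>The gradient bound is 2 |x| <= 1 + |x|^2.\<close>

lemma euclid_exhaustion:
  "exhaustion UNIV (\<lambda>_. 1) (\<lambda>_. 1) (\<lambda>x. ln (1 + (norm x)\<^sup>2)) (\<lambda>x::'a::euclidean_space. (2 / (1 + (norm x)\<^sup>2)) *\<^sub>R x)"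
proof
  have pos: "1 + (norm x)\<^sup>2 > 0" for x :: 'a by (simp add: add_pos_nonneg)
  then have nz: "1 + (norm x)\<^sup>2 \<noteq> 0" for x :: 'a by (metis less_irrefl)
  show "continuous_on UNIV (\<lambda>x::'a. ln (1 + (norm x)\<^sup>2))" by (intro continuous_intros ballI nz)
  show "continuous_on UNIV (\<lambda>x::'a. (2 / (1 + (norm x)\<^sup>2)) *\<^sub>R x)" by (intro continuous_intros ballI nz)
  show "compact {x \<in> UNIV. ln (1 + (norm (x::'a))\<^sup>2) \<le> c}" for c
  proof -
    have "{x \<in> UNIV. ln (1 + (norm (x::'a))\<^sup>2) \<le> c} = {x. 1 + (norm x)\<^sup>2 \<le> exp c}"
      using pos by (metis UNIV_I exp_le_cancel_iff exp_ln)
    moreover have "closed {x::'a. 1 + (norm x)\<^sup>2 \<le> exp c}" by (intro closed_Collect_le continuous_intros)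
    moreover have "{x::'a. 1 + (norm x)\<^sup>2 \<le> exp c} \<subseteq> cball 0 (sqrt (exp c))"
      by (auto intro!: real_le_rsqrt)
    ultimately show ?thesis
      using bounded_subset[OF bounded_cball] by (metis compact_eq_bounded_closed)
  qed
  show "((\<lambda>t. ln (1 + (norm (x + t *\<^sub>R i))\<^sup>2)) has_real_derivative (2 / (1 + (norm x)\<^sup>2)) *\<^sub>R x \<bullet> i) (at 0)" for x i :: 'a
  proof -
    have "((\<lambda>t. 1 + (norm (x + t *\<^sub>R i))\<^sup>2) has_real_derivative 0 + 2 * (x \<bullet> i)) (at 0)"
      by (intro DERIV_add DERIV_const norm_square_line_derivative)
    then have "((\<lambda>t. ln (1 + (norm (x + t *\<^sub>R i))\<^sup>2)) has_real_derivative 1 / (1 + (norm (x + 0 *\<^sub>R i))\<^sup>2) * (0 + 2 * (x \<bullet> i))) (at 0)"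
      by (intro DERIV_chain2[OF DERIV_ln_divide] pos)
    then show ?thesis by simp
  qed
  show "1 * (norm ((2 / (1 + (norm x)\<^sup>2)) *\<^sub>R x))\<^sup>2 \<le> 1" for x :: 'a
  proof -
    have "2 * norm x \<le> 1 + (norm x)\<^sup>2" using zero_le_power2[of "norm x - 1"] by (simp add: power2_diff)
    then have "2 * norm x / (1 + (norm x)\<^sup>2) \<le> 1" using pos[of x] by simp
    then have "(2 * norm x / (1 + (norm x)\<^sup>2))\<^sup>2 \<le> 1\<^sup>2" using pos[of x] by (intro power_mono) simp_all
    then show ?thesis using pos[of x] by simp
  qed
qed simp_all

section \<open>Concentration at the origin of the ball\<close>

lemma lborel_integral_scale:
  fixes f :: "'a::euclidean_space \<Rightarrow> real"
  assumes c: "c > 0" and f [measurable]: "f \<in> borel_measurable borel"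
  shows "(\<integral>x. f (c *\<^sub>R x) \<partial>lborel) = (1 / c ^ DIM('a)) * (\<integral>x. f x \<partial>lborel)"
proof -
  have "(\<integral>x. f x \<partial>lborel) = (\<integral>x. f x \<partial>density (distr lborel borel (\<lambda>x::'a. 0 + c *\<^sub>R x)) (\<lambda>_. ennreal (\<bar>c\<bar> ^ DIM('a))))"
    using lborel_affine[of c "0::'a"] c by (simp add: ennreal_power)
  also have "\<dots> = (\<integral>x. \<bar>c\<bar> ^ DIM('a) *\<^sub>R f x \<partial>distr lborel borel (\<lambda>x::'a. 0 + c *\<^sub>R x))"
    by (rule integral_density) auto
  also have "\<dots> = (\<integral>x. \<bar>c\<bar> ^ DIM('a) *\<^sub>R f (0 + c *\<^sub>R x) \<partial>lborel)"
    by (rule integral_distr) auto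
  finally show ?thesis using c by simp
qed

text \<open>Concentrating a Euclidean competitor near the origin of the ball, where the conformal
  factor tends to the constant \<open>2\<close>, loses nothing in the limit.\<close>
lemma GN_bound_euclid_of_ball:
  assumes dim: "DIM('a::euclidean_space) \<ge> 2"
    and GN: "GN_bound (ball (0::'a) 1) (hvw DIM('a)) (hvw (DIM('a) - 2)) C r a b"
    and C: "C \<ge> 0" and r: "r > 0" and a: "a > 0" and b: "b > 0"
    and ab: "real DIM('a) * a + (real DIM('a) - 2) * b = real DIM('a)"
  shows "GN_bound (UNIV :: 'a set) (\<lambda>_. 1) (\<lambda>_. 1) C r a b"
  unfolding GN_bound_def
proof (intro allI impI)
  fix v :: "'a \<Rightarrow> real" and H assume vH: "C1c UNIV v H"
  define n where "n = DIM('a)"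
  obtain K where K: "compact K" "\<And>x. x \<notin> K \<Longrightarrow> v x = 0" "\<And>x. x \<notin> K \<Longrightarrow> H x = 0"
    using vH by (auto simp: C1c_def)
  obtain R where R: "R > 0" "\<And>x. x \<in> K \<Longrightarrow> norm x \<le> R"
    using compact_imp_bounded[OF K(1)] by (auto simp: bounded_pos)
  have vc: "continuous_on UNIV v" "continuous_on UNIV H"
    and vd: "\<And>x i. i \<in> Basis \<Longrightarrow> ((\<lambda>t. v (x + t *\<^sub>R i)) has_real_derivative (H x \<bullet> i)) (at 0)"
    using vH by (auto simp: C1c_def)
  define A where "A = (\<integral>x. \<bar>v x\<bar> powr r \<partial>lborel)"
  define B where "B = (\<integral>x. (v x)\<^sup>2 \<partial>lborel)"
  define D where "D = (\<integral>x. (norm (H x))\<^sup>2 \<partial>lborel)"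
  have B0: "B \<ge> 0" and D0: "D \<ge> 0"
    unfolding B_def D_def by (intro Bochner_Integration.integral_nonneg zero_le_power2)+
  have cr: "continuous_on UNIV (\<lambda>y::real. \<bar>y\<bar> powr r)"
    by (rule continuous_on_powr') (use r in \<open>auto intro!: continuous_intros\<close>)
  have step: "A \<le> C * (1 / (1 - R\<^sup>2 / c\<^sup>2)) ^ n * (B powr a * D powr b)" if c: "c > R" for c
  proof -
    have c0: "c > 0" using c R by simp
    \<comment> \<open>The largest value of \<open>rho\<close> on the ball of radius
      \<open>R / c\<close>, which carries the rescaled function; the smallest value used is
      2.\<close>
    define s where "s = 2 / (1 - R\<^sup>2 / c\<^sup>2)"
    have "R\<^sup>2 < c\<^sup>2" using c R by (intro power_strict_mono) auto
    then have rc: "R\<^sup>2 / c\<^sup>2 < 1" using c0 by simp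
    have s0: "s > 0" using rc by (simp add: s_def)
    define w where "w x = v (c *\<^sub>R x)" for x
    define W where "W x = c *\<^sub>R H (c *\<^sub>R x)" for x
    have inK: "norm x \<le> R / c" if "c *\<^sub>R x \<in> K" for x
      using R(2)[OF that] c0 by (simp add: field_simps)
    have Rc: "R / c < 1" using c c0 by simp
    have wW: "C1c (ball 0 1) w W"
      unfolding C1c_def
    proof (intro conjI exI[of _ "cball 0 (R / c)"] allI ballI impI)
      show "continuous_on UNIV w" "continuous_on UNIV W" unfolding w_def[abs_def] W_def[abs_def]
        by (intro continuous_intros continuous_on_compose2[OF vc(1)] continuous_on_compose2[OF vc(2)]; simp)+
      show "cball 0 (R / c) \<subseteq> ball (0::'a) 1" using Rc by auto
      fix x :: 'a
      { assume "x \<notin> cball 0 (R / c)"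
        then have "c *\<^sub>R x \<notin> K" using inK[of x] by auto
        then show "w x = 0" "W x = 0" using K by (auto simp: w_def W_def) }
      fix i :: 'a assume i: "i \<in> Basis"
      have "((\<lambda>t. v (c *\<^sub>R x + (c * t) *\<^sub>R i)) has_real_derivative (H (c *\<^sub>R x) \<bullet> i) * (c * 1)) (at 0)"
        by (rule DERIV_chain2[where g="\<lambda>t. c * t"]) (use vd[OF i, of "c *\<^sub>R x"] in \<open>auto intro!: derivative_eq_intros\<close>)
      then show "((\<lambda>t. w (x + t *\<^sub>R i)) has_real_derivative W x \<bullet> i) (at 0)"
        by (simp add: w_def W_def scaleR_add_right mult.commute)
    qed simp
    have hb: "2 ^ k \<le> hvw k x \<and> hvw k x \<le> s ^ k" if "c *\<^sub>R x \<in> K" for x k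
    proof -
      have x: "norm x < 1" using inK[OF that] Rc by simp
      have "(norm x)\<^sup>2 \<le> (R / c)\<^sup>2" using inK[OF that] by (intro power_mono) auto
      then have "rho x \<le> s" unfolding hyp_rho_def s_def using rc
        by (intro divide_left_mono mult_pos_pos) (auto simp: power_divide)
      then show ?thesis using x hyp_rho_ge_2[OF x] by (auto simp: hvw_def intro!: power_mono)
    qed
    have sc: "(\<integral>x. f (c *\<^sub>R x) \<partial>lborel) = (1 / c ^ n) * (\<integral>x. f x \<partial>lborel)" if "f \<in> borel_measurable borel" for f :: "'a \<Rightarrow> real"
      unfolding n_def by (rule lborel_integral_scale[OF c0 that])
    have m [measurable]: "v \<in> borel_measurable borel" "H \<in> borel_measurable borel"
      using vc by (auto intro: borel_measurable_continuous_onI)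
    obtain K' where K': "compact K'" "K' \<subseteq> ball 0 1" "\<And>x. x \<notin> K' \<Longrightarrow> w x = 0" "\<And>x. x \<notin> K' \<Longrightarrow> W x = 0"
      using wW by (auto simp: C1c_def)
    have wc: "continuous_on UNIV w" "continuous_on UNIV W" using wW by (auto simp: C1c_def)
    interpret E: exhaustion "ball 0 1" "hvw DIM('a)" "hvw (DIM('a) - 2)" "\<lambda>x. ln (rho x)" "\<lambda>x::'a. rho x *\<^sub>R x"
      by (rule hvw_exhaustion[OF dim])
    have ii: "integrable lborel (\<lambda>x. hvw DIM('a) x * \<bar>w x\<bar> powr r)" "integrable lborel (\<lambda>x. hvw DIM('a) x * (w x)\<^sup>2)"
      "integrable lborel (\<lambda>x. hvw (DIM('a) - 2) x * (norm (W x))\<^sup>2)"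
      "integrable lborel (\<lambda>x. 1 * \<bar>w x\<bar> powr r)" "integrable lborel (\<lambda>x. 1 * (w x)\<^sup>2)" "integrable lborel (\<lambda>x. 1 * (norm (W x))\<^sup>2)"
      by (rule C1c_weight_integrable[OF open_ball _ wc(1) K'(1,2,3)] C1c_weight_integrable[OF open_ball _ wc(2) K'(1,2,4)];
          use E.p(2) E.q(2) cr in \<open>auto intro!: continuous_intros\<close>)+
    have "2 ^ n * ((1 / c ^ n) * A) = (\<integral>x. 2 ^ n * \<bar>w x\<bar> powr r \<partial>lborel)"
      unfolding A_def w_def by (simp add: sc[of "\<lambda>x. \<bar>v x\<bar> powr r"])
    also have "\<dots> \<le> (\<integral>x. hvw n x * \<bar>w x\<bar> powr r \<partial>lborel)"
    proof (rule integral_mono)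
      show "2 ^ n * \<bar>w x\<bar> powr r \<le> hvw n x * \<bar>w x\<bar> powr r" for x
        using hb[of x n] K(2)[of "c *\<^sub>R x"] by (cases "c *\<^sub>R x \<in> K") (auto simp: w_def intro!: mult_right_mono)
    qed (use ii in \<open>simp_all add: n_def\<close>)
    also have "\<dots> \<le> C * ((\<integral>x. hvw n x * (w x)\<^sup>2 \<partial>lborel) powr a * (\<integral>x. hvw (n - 2) x * (norm (W x))\<^sup>2 \<partial>lborel) powr b)"
      using GN wW by (simp add: GN_bound_def n_def)
    also have "\<dots> \<le> C * ((s ^ n * ((1 / c ^ n) * B)) powr a * (s ^ (n - 2) * (c\<^sup>2 * ((1 / c ^ n) * D))) powr b)"
    proof (intro mult_left_mono mult_mono powr_mono2)
      show "0 \<le> (\<integral>x. hvw n x * (w x)\<^sup>2 \<partial>lborel)" "0 \<le> (\<integral>x. hvw (n - 2) x * (norm (W x))\<^sup>2 \<partial>lborel)"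
        by (intro Bochner_Integration.integral_nonneg mult_nonneg_nonneg hvw_nonneg zero_le_power2)+
      have "(\<integral>x. hvw n x * (w x)\<^sup>2 \<partial>lborel) \<le> (\<integral>x. s ^ n * (w x)\<^sup>2 \<partial>lborel)"
      proof (rule integral_mono)
        show "hvw n x * (w x)\<^sup>2 \<le> s ^ n * (w x)\<^sup>2" for x
          using hb[of x n] K(2)[of "c *\<^sub>R x"] by (cases "c *\<^sub>R x \<in> K") (auto simp: w_def intro!: mult_right_mono)
      qed (use ii in \<open>simp_all add: n_def\<close>)
      also have "\<dots> = s ^ n * ((1 / c ^ n) * B)"
        unfolding B_def w_def by (simp add: sc[of "\<lambda>x. (v x)\<^sup>2"])
      finally show "(\<integral>x. hvw n x * (w x)\<^sup>2 \<partial>lborel) \<le> s ^ n * ((1 / c ^ n) * B)" .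
      have "(\<integral>x. hvw (n - 2) x * (norm (W x))\<^sup>2 \<partial>lborel) \<le> (\<integral>x. s ^ (n - 2) * (norm (W x))\<^sup>2 \<partial>lborel)"
      proof (rule integral_mono)
        show "hvw (n - 2) x * (norm (W x))\<^sup>2 \<le> s ^ (n - 2) * (norm (W x))\<^sup>2" for x
          using hb[of x "n - 2"] K(3)[of "c *\<^sub>R x"] by (cases "c *\<^sub>R x \<in> K") (auto simp: W_def intro!: mult_right_mono)
      qed (use ii in \<open>simp_all add: n_def\<close>)
      also have "\<dots> = s ^ (n - 2) * (c\<^sup>2 * ((1 / c ^ n) * D))"
        unfolding D_def W_def using c0 by (simp add: sc[of "\<lambda>x. (norm (H x))\<^sup>2"] power_mult_distrib)
      finally show "(\<integral>x. hvw (n - 2) x * (norm (W x))\<^sup>2 \<partial>lborel) \<le> s ^ (n - 2) * (c\<^sup>2 * ((1 / c ^ n) * D))" .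
    qed (use C a b in simp_all)
    \<comment> \<open>Scaling contributes \<open>c^(-n)\<close> to the square integral and
      \<open>c^(2-n)\<close> to the energy, so \<open>s\<close> and \<open>c\<close> occur only
      through \<open>s / c\<close>. The exponents add up to n a + (n - 2) b = n by
      \<open>ab\<close>.\<close>
    also have "\<dots> = C * ((s / c) ^ n * (B powr a * D powr b))"
    proof -
      have n: "n \<ge> 2" using dim by (simp add: n_def)
      have q: "s / c > 0" using s0 c0 by simp
      have "c ^ n = c\<^sup>2 * c ^ (n - 2)" using n by (metis le_add_diff_inverse power_add)
      then have "s ^ (n - 2) * (c\<^sup>2 * ((1 / c ^ n) * D)) = (s / c) ^ (n - 2) * D"
        using c0 by (simp add: power_divide)
      moreover have "s ^ n * ((1 / c ^ n) * B) = (s / c) ^ n * B" by (simp add: power_divide)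
      moreover have "((s / c) ^ n) powr a * ((s / c) ^ (n - 2)) powr b = (s / c) ^ n"
      proof -
        have "((s / c) ^ n) powr a * ((s / c) ^ (n - 2)) powr b = (s / c) powr (real n * a) * (s / c) powr (real (n - 2) * b)"
          using q by (simp add: powr_powr flip: powr_realpow)
        also have "\<dots> = (s / c) powr (real n)"
          using ab n by (simp add: powr_add[symmetric] n_def of_nat_diff)
        finally show ?thesis using q by (simp add: powr_realpow)
      qed
      ultimately show ?thesis using q B0 D0 by (simp add: powr_mult mult_ac)
    qed
    finally have "2 ^ n * ((1 / c ^ n) * A) \<le> C * ((s / c) ^ n * (B powr a * D powr b))" .
    \<comment> \<open>Dividing by the factor \<open>(2/c)^n\<close> of the left side leaves
      \<open>(s/2)^n\<close> on the right, which tends to 1 as \<open>c\<close> grows.\<close>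
    then have "c ^ n / 2 ^ n * (2 ^ n * ((1 / c ^ n) * A)) \<le> c ^ n / 2 ^ n * (C * ((s / c) ^ n * (B powr a * D powr b)))"
      using c0 by (intro mult_left_mono) auto
    moreover have "c ^ n / 2 ^ n * (2 ^ n * ((1 / c ^ n) * A)) = A" using c0 by simp
    moreover have "c ^ n / 2 ^ n * (C * ((s / c) ^ n * (B powr a * D powr b))) = C * (s / 2) ^ n * (B powr a * D powr b)"
      using c0 by (simp add: power_divide)
    moreover have "2 / y / 2 = 1 / y" for y :: real by simp
    then have "s / 2 = 1 / (1 - R\<^sup>2 / c\<^sup>2)" unfolding s_def .
    ultimately show ?thesis by (simp only:)
  qed
  have "((\<lambda>c. C * (1 / (1 - R\<^sup>2 / c\<^sup>2)) ^ n * (B powr a * D powr b)) \<longlongrightarrow> C * (1 / (1 - 0)) ^ n * (B powr a * D powr b)) at_top"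
    by (intro tendsto_intros tendsto_divide_0[OF tendsto_const] filterlim_at_top_imp_at_infinity filterlim_pow_at_top filterlim_ident) auto
  moreover have "\<forall>\<^sub>F c in at_top. A \<le> C * (1 / (1 - R\<^sup>2 / c\<^sup>2)) ^ n * (B powr a * D powr b)"
    using eventually_gt_at_top[of R] by eventually_elim (rule step)
  ultimately have "A \<le> C * (1 / (1 - 0)) ^ n * (B powr a * D powr b)"
    by (rule tendsto_lowerbound) simp
  then show "(\<integral>x. 1 * \<bar>v x\<bar> powr r \<partial>lborel) \<le> C * ((\<integral>x. 1 * (v x)\<^sup>2 \<partial>lborel) powr a * (\<integral>x. 1 * (norm (H x))\<^sup>2 \<partial>lborel) powr b)"
    by (simp add: A_def B_def D_def)
qed

text \<open>For n > 2 the first exponent is positive exactly in the subcritical range, as it means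
  (n - 2)(p - 1) < 4. The identity is the scale invariance used in the concentration
  argument.\<close>

lemma GN_exponents:
  assumes n: "n \<ge> 2" and p: "p > 1" and sub: "n = 2 \<or> p < (real n + 2) / (real n - 2)"
  shows "GN_alpha n p > 0" "GN_beta n p > 0"
    and "real n * (GN_alpha n p / 2) + (real n - 2) * (GN_beta n p / 2) = real n"
proof -
  show "GN_alpha n p > 0"
  proof (cases "n = 2")
    case False
    then have "real n - 2 > 0" and "p < (real n + 2) / (real n - 2)" using n sub by auto
    then have "p * (real n - 2) < real n + 2" by (simp add: pos_less_divide_eq)
    then show ?thesis by (simp add: GN_alpha_def algebra_simps)
  qed (simp add: GN_alpha_def)
  show "GN_beta n p > 0" using n p by (simp add: GN_beta_def)
  show "real n * (GN_alpha n p / 2) + (real n - 2) * (GN_beta n p / 2) = real n"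
    by (simp add: GN_alpha_def GN_beta_def field_simps)
qed

text \<open>Turns the bound on quotients into the integral inequality demanded by the rearrangement.
  Functions vanishing almost everywhere are excluded from the supremum and are treated separately:
  both sides are 0.\<close>

lemma GN_euclid_of_W_quot:
  fixes v :: "'a::euclidean_space \<Rightarrow> real"
  assumes C: "C \<ge> 0" and p: "p > 0"
    and W: "\<And>u G. H1_Rn (u :: 'a \<Rightarrow> real) G \<Longrightarrow> (\<integral>x. (u x)\<^sup>2 \<partial>lebesgue) \<noteq> 0 \<Longrightarrow>
      W_quot lebesgue DIM('a) p u (\<integral>x. (u x)\<^sup>2 \<partial>lebesgue) (\<integral>x. (norm (G x))\<^sup>2 \<partial>lebesgue) \<le> ereal C"
    and v: "H1_Rn v G" "\<And>x. v x \<ge> 0" "\<And>s. s > 0 \<Longrightarrow> integrable lborel (\<lambda>x. v x powr s)"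
    and G: "integrable lborel (\<lambda>x. (norm (G x))\<^sup>2)"
  shows "(\<integral>x. v x powr (p + 1) \<partial>lborel)
    \<le> C * ((\<integral>x. v x powr 2 \<partial>lborel) powr (GN_alpha DIM('a) p / 2) * (\<integral>x. (norm (G x))\<^sup>2 \<partial>lborel) powr (GN_beta DIM('a) p / 2))"
proof -
  have sq: "(v x)\<^sup>2 = v x powr 2" for x using v(2)[of x] by simp
  have i2: "integrable lborel (\<lambda>x. v x powr 2)" by (rule v(3)) simp
  have ir: "integrable lborel (\<lambda>x. v x powr (p + 1))" by (rule v(3)) (use p in simp)
  have e2: "(\<integral>x. (v x)\<^sup>2 \<partial>lebesgue) = (\<integral>x. v x powr 2 \<partial>lborel)"
    unfolding sq by (rule integral_completion) (rule borel_measurable_integrable[OF i2])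
  have eG: "(\<integral>x. (norm (G x))\<^sup>2 \<partial>lebesgue) = (\<integral>x. (norm (G x))\<^sup>2 \<partial>lborel)"
    by (rule integral_completion) (rule borel_measurable_integrable[OF G])
  show ?thesis
  proof (cases "(\<integral>x. v x powr 2 \<partial>lborel) = 0")
    case True
    then have "AE x in lborel. v x powr 2 = 0"
      using integral_nonneg_eq_0_iff_AE[OF i2] by simp
    then have "AE x in lborel. v x powr (p + 1) = 0" by eventually_elim simp
    then have "(\<integral>x. v x powr (p + 1) \<partial>lborel) = 0" by (rule integral_eq_zero_AE)
    then show ?thesis using True C by simp
  next
    case False
    have "W_quot lebesgue DIM('a) p v (\<integral>x. (v x)\<^sup>2 \<partial>lebesgue) (\<integral>x. (norm (G x))\<^sup>2 \<partial>lebesgue) \<le> ereal C"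
      by (rule W[OF v(1)]) (use False e2 in simp)
    then have "(\<integral>\<^sup>+x. ennreal (v x powr (p + 1)) \<partial>lborel) \<le> ennreal (C * ((\<integral>x. v x powr 2 \<partial>lborel) powr (GN_alpha DIM('a) p / 2)
        * (\<integral>x. (norm (G x))\<^sup>2 \<partial>lborel) powr (GN_beta DIM('a) p / 2)))"
      unfolding W_quot_le_iff[OF C] e2 eG nn_integral_completion abs_of_nonneg[OF v(2)] .
    then show ?thesis
      by (subst (asm) nn_integral_eq_integral[OF ir]) (use C in \<open>simp_all add: ennreal_le_iff\<close>)
  qed
qed

text \<open>Rearrangement gives the inequality for compactly supported functions on the ball with
  the Euclidean constant, and the exhaustion by \<open>ln rho\<close> extends it to all of
  H1.\<close>

lemma W_Hn_le_of_W_Rn_le: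
  fixes u :: "'a::euclidean_space \<Rightarrow> real"
  assumes dim: "DIM('a) \<ge> 2" and p: "p > 1" and sub: "DIM('a) = 2 \<or> p < (real DIM('a) + 2) / (real DIM('a) - 2)"
    and C: "C \<ge> 0"
    and W: "\<And>u G. H1_Rn (u :: 'a \<Rightarrow> real) G \<Longrightarrow> (\<integral>x. (u x)\<^sup>2 \<partial>lebesgue) \<noteq> 0 \<Longrightarrow>
      W_quot lebesgue DIM('a) p u (\<integral>x. (u x)\<^sup>2 \<partial>lebesgue) (\<integral>x. (norm (G x))\<^sup>2 \<partial>lebesgue) \<le> ereal C"
    and u: "H1_Hn u G"
  shows "W_quot hyp_vol DIM('a) p u (\<integral>x. (u x)\<^sup>2 \<partial>hyp_vol) (\<integral>x. (norm (G x))\<^sup>2 / (hyp_rho x)\<^sup>2 \<partial>hyp_vol) \<le> ereal C"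
proof -
  have p0: "p > 0" using p by simp
  note ex = GN_exponents[OF dim p sub]
  have ex': "p + 1 > 0" "GN_alpha DIM('a) p / 2 > 0" "GN_beta DIM('a) p / 2 > 0" using ex p by auto
  interpret exhaustion "ball 0 1" "hvw DIM('a)" "hvw (DIM('a) - 2)" "\<lambda>x. ln (rho x)" "\<lambda>x::'a. rho x *\<^sub>R x"
    by (rule hvw_exhaustion[OF dim])
  have GN: "GN_bound (ball (0::'a) 1) (hvw DIM('a)) (hvw (DIM('a) - 2)) C (p + 1) (GN_alpha DIM('a) p / 2) (GN_beta DIM('a) p / 2)"
    unfolding GN_bound_def
  proof (intro allI impI)
    fix v :: "'a \<Rightarrow> real" and H assume "C1c (ball 0 1) v H"
    then interpret ball_C1 v H by unfold_locales (use dim in auto)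
    show "(\<integral>x. hvw DIM('a) x * \<bar>v x\<bar> powr (p + 1) \<partial>lborel) \<le> C * ((\<integral>x. hvw DIM('a) x * (v x)\<^sup>2 \<partial>lborel) powr (GN_alpha DIM('a) p / 2)
        * (\<integral>x. hvw (DIM('a) - 2) x * (norm (H x))\<^sup>2 \<partial>lborel) powr (GN_beta DIM('a) p / 2))"
      by (rule GN_ball_C1c[OF C ex']) (rule GN_euclid_of_W_quot[OF C p0 W])
  qed
  have um: "u \<in> borel_measurable lebesgue" and Gm: "G \<in> borel_measurable lebesgue"
    using u by (auto simp: H1_Hn_def weak_gradient_def)
  have "rho \<in> borel_measurable (lebesgue :: 'a measure)"
    using hyp_rho_measurable by (intro measurable_completion) simp
  note [measurable] = this um Gm
  have m: "(\<lambda>x. (u x)\<^sup>2) \<in> borel_measurable lebesgue" "(\<lambda>x. \<bar>u x\<bar> powr (p + 1)) \<in> borel_measurable lebesgue"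
    "(\<lambda>x. (norm (G x))\<^sup>2 / (rho x)\<^sup>2) \<in> borel_measurable lebesgue"
    by measurable
  have "(\<integral>\<^sup>+x. ennreal (hvw DIM('a) x * \<bar>u x\<bar> powr (p + 1)) \<partial>lborel)
    \<le> ennreal (C * ((\<integral>x. hvw DIM('a) x * (u x)\<^sup>2 \<partial>lebesgue) powr (GN_alpha DIM('a) p / 2)
        * (\<integral>x. hvw (DIM('a) - 2) x * (norm (G x))\<^sup>2 \<partial>lebesgue) powr (GN_beta DIM('a) p / 2)))"
    using u unfolding H1_Hn_def integrable_hyp_vol[OF m(1)] integrable_hyp_vol[OF m(3)] hvw_gradient[OF dim]
    by (elim conjE) (rule GN_weak_lebesgue[OF _ _ _ GN C ex'])
  then show ?thesis
    unfolding W_quot_le_iff[OF C] nn_integral_hyp_vol[OF m(2)] integral_hyp_vol[OF m(1)] integral_hyp_vol[OF m(3)] hvw_gradient[OF dim] .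
qed

text \<open>Compactly supported functions on the ball are hyperbolic competitors, so the bound holds
  for them; concentration transports it to compactly supported functions on the Euclidean space, and
  the Euclidean exhaustion to all of H1.\<close>

lemma W_Rn_le_of_W_Hn_le:
  fixes u :: "'a::euclidean_space \<Rightarrow> real"
  assumes dim: "DIM('a) \<ge> 2" and p: "p > 1" and sub: "DIM('a) = 2 \<or> p < (real DIM('a) + 2) / (real DIM('a) - 2)"
    and C: "C \<ge> 0"
    and W: "\<And>u G. H1_Hn (u :: 'a \<Rightarrow> real) G \<Longrightarrow> (\<integral>x. (u x)\<^sup>2 \<partial>hyp_vol) \<noteq> 0 \<Longrightarrow>
      W_quot hyp_vol DIM('a) p u (\<integral>x. (u x)\<^sup>2 \<partial>hyp_vol) (\<integral>x. (norm (G x))\<^sup>2 / (hyp_rho x)\<^sup>2 \<partial>hyp_vol) \<le> ereal C"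
    and u: "H1_Rn u G"
  shows "W_quot lebesgue DIM('a) p u (\<integral>x. (u x)\<^sup>2 \<partial>lebesgue) (\<integral>x. (norm (G x))\<^sup>2 \<partial>lebesgue) \<le> ereal C"
proof -
  note ex = GN_exponents[OF dim p sub]
  have ex': "p + 1 > 0" "GN_alpha DIM('a) p / 2 > 0" "GN_beta DIM('a) p / 2 > 0" using ex p by auto
  interpret B: exhaustion "ball 0 1" "hvw DIM('a)" "hvw (DIM('a) - 2)" "\<lambda>x. ln (rho x)" "\<lambda>x::'a. rho x *\<^sub>R x"
    by (rule hvw_exhaustion[OF dim])
  interpret E: exhaustion UNIV "\<lambda>_. 1" "\<lambda>_. 1" "\<lambda>x. ln (1 + (norm x)\<^sup>2)" "\<lambda>x::'a. (2 / (1 + (norm x)\<^sup>2)) *\<^sub>R x"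
    by (rule euclid_exhaustion)
  have rm: "rho \<in> borel_measurable (lborel :: 'a measure)" using hyp_rho_measurable by simp
  have GN: "GN_bound (ball (0::'a) 1) (hvw DIM('a)) (hvw (DIM('a) - 2)) C (p + 1) (GN_alpha DIM('a) p / 2) (GN_beta DIM('a) p / 2)"
    unfolding GN_bound_def
  proof (intro allI impI)
    fix v :: "'a \<Rightarrow> real" and H assume vH: "C1c (ball 0 1) v H"
    obtain K where K: "compact K" "K \<subseteq> ball 0 1" "\<And>x. x \<notin> K \<Longrightarrow> v x = 0" "\<And>x. x \<notin> K \<Longrightarrow> H x = 0"
      using vH by (auto simp: C1c_def)
    have c: "continuous_on UNIV v" "continuous_on UNIV H" using vH by (auto simp: C1c_def)
    have "v \<in> borel_measurable lborel" "H \<in> borel_measurable lborel"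
      using c by (auto intro: borel_measurable_continuous_onI)
    note [measurable] = this rm
    have mb: "(\<lambda>x. (v x)\<^sup>2) \<in> borel_measurable lborel" "(\<lambda>x. \<bar>v x\<bar> powr (p + 1)) \<in> borel_measurable lborel"
      "(\<lambda>x. (norm (H x))\<^sup>2 / (rho x)\<^sup>2) \<in> borel_measurable lborel" by measurable
    note m = mb[THEN measurable_completion]
    have cr: "continuous_on UNIV (\<lambda>y::real. \<bar>y\<bar> powr (p + 1))"
      by (rule continuous_on_powr') (use p in \<open>auto intro!: continuous_intros\<close>)
    have ii: "integrable lborel (\<lambda>x. hvw DIM('a) x * \<bar>v x\<bar> powr (p + 1))" "integrable lborel (\<lambda>x. hvw DIM('a) x * (v x)\<^sup>2)"
      "integrable lborel (\<lambda>x. hvw (DIM('a) - 2) x * (norm (H x))\<^sup>2)"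
      by (rule C1c_weight_integrable[OF open_ball _ c(1) K(1,2,3)] C1c_weight_integrable[OF open_ball _ c(2) K(1,2,4)];
          use B.p(2) B.q(2) cr in \<open>auto intro!: continuous_intros\<close>)+
    have il: "integrable lebesgue f \<longleftrightarrow> integrable lborel f" "(\<integral>x. f x \<partial>lebesgue) = (\<integral>x. f x \<partial>lborel)"
      if "integrable lborel f" for f :: "'a \<Rightarrow> real"
      using borel_measurable_integrable[OF that] by (simp_all add: integrable_completion integral_completion)
    have e: "(\<integral>x. (v x)\<^sup>2 \<partial>hyp_vol) = (\<integral>x. hvw DIM('a) x * (v x)\<^sup>2 \<partial>lborel)"
      "(\<integral>x. (norm (H x))\<^sup>2 / (rho x)\<^sup>2 \<partial>hyp_vol) = (\<integral>x. hvw (DIM('a) - 2) x * (norm (H x))\<^sup>2 \<partial>lborel)"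
      unfolding integral_hyp_vol[OF m(1)] integral_hyp_vol[OF m(3)] hvw_gradient[OF dim] il(2)[OF ii(2)] il(2)[OF ii(3)] by (rule refl)+
    have H1: "H1_Hn v H"
      unfolding H1_Hn_def integrable_hyp_vol[OF m(1)] integrable_hyp_vol[OF m(3)] hvw_gradient[OF dim] il(1)[OF ii(2)] il(1)[OF ii(3)]
      using ii C1c_weak_gradient[OF vH] by simp
    let ?R = "C * ((\<integral>x. hvw DIM('a) x * (v x)\<^sup>2 \<partial>lborel) powr (GN_alpha DIM('a) p / 2)
        * (\<integral>x. hvw (DIM('a) - 2) x * (norm (H x))\<^sup>2 \<partial>lborel) powr (GN_beta DIM('a) p / 2))"
    show "(\<integral>x. hvw DIM('a) x * \<bar>v x\<bar> powr (p + 1) \<partial>lborel) \<le> ?R"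
    proof (cases "(\<integral>x. hvw DIM('a) x * (v x)\<^sup>2 \<partial>lborel) = 0")
      case True
      then have "AE x in lborel. hvw DIM('a) x * (v x)\<^sup>2 = 0"
        using integral_nonneg_eq_0_iff_AE[OF ii(2)] by (simp add: hvw_nonneg)
      then have "AE x in lborel. hvw DIM('a) x * \<bar>v x\<bar> powr (p + 1) = 0" by eventually_elim auto
      then have "(\<integral>x. hvw DIM('a) x * \<bar>v x\<bar> powr (p + 1) \<partial>lborel) = 0" by (rule integral_eq_zero_AE)
      then show ?thesis using True C by simp
    next
      case False
      have "W_quot hyp_vol DIM('a) p v (\<integral>x. (v x)\<^sup>2 \<partial>hyp_vol) (\<integral>x. (norm (H x))\<^sup>2 / (rho x)\<^sup>2 \<partial>hyp_vol) \<le> ereal C"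
        by (rule W[OF H1]) (use False e in simp)
      then have "(\<integral>\<^sup>+x. ennreal (hvw DIM('a) x * \<bar>v x\<bar> powr (p + 1)) \<partial>lborel) \<le> ennreal ?R"
        unfolding W_quot_le_iff[OF C] e nn_integral_hyp_vol[OF m(2)] .
      then show ?thesis
        by (subst (asm) nn_integral_eq_integral[OF ii(1)]) (use C in \<open>simp_all add: ennreal_le_iff hvw_nonneg\<close>)
    qed
  qed
  have GN': "GN_bound (UNIV :: 'a set) (\<lambda>_. 1) (\<lambda>_. 1) C (p + 1) (GN_alpha DIM('a) p / 2) (GN_beta DIM('a) p / 2)"
    by (rule GN_bound_euclid_of_ball[OF dim GN C ex' ex(3)])
  have "(\<integral>\<^sup>+x. ennreal (1 * \<bar>u x\<bar> powr (p + 1)) \<partial>lborel)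
    \<le> ennreal (C * ((\<integral>x. 1 * (u x)\<^sup>2 \<partial>lebesgue) powr (GN_alpha DIM('a) p / 2)
        * (\<integral>x. 1 * (norm (G x))\<^sup>2 \<partial>lebesgue) powr (GN_beta DIM('a) p / 2)))"
    by (rule E.GN_weak_lebesgue[OF _ _ _ GN' C ex']) (use u in \<open>simp_all add: H1_Rn_def\<close>)
  then show ?thesis unfolding W_quot_le_iff[OF C] nn_integral_completion by simp
qed

theorem theoremI:
  fixes p :: real
  assumes "DIM('a::euclidean_space) \<ge> 2"
    and "p > 1"
    and "DIM('a) = 2 \<or> p < (real DIM('a) + 2) / (real DIM('a) - 2)"
  shows "W_sup_Hn TYPE('a) p = W_sup_Rn TYPE('a) p"
proof -
  have posR: "W_quot lebesgue DIM('a) p u (\<integral>x. (u x)\<^sup>2 \<partial>lebesgue) D > 0"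
    if "H1_Rn u G" "(\<integral>x. (u x)\<^sup>2 \<partial>lebesgue) \<noteq> 0" for u :: "'a \<Rightarrow> real" and G D
    by (rule W_quot_pos) (use that in \<open>auto simp: H1_Rn_def weak_gradient_def\<close>)
  have posH: "W_quot hyp_vol DIM('a) p u (\<integral>x. (u x)\<^sup>2 \<partial>hyp_vol) D > 0"
    if "H1_Hn u G" "(\<integral>x. (u x)\<^sup>2 \<partial>hyp_vol) \<noteq> 0" for u :: "'a \<Rightarrow> real" and G D
  proof (rule W_quot_pos)
    have "u \<in> borel_measurable (lebesgue_on (ball 0 1))"
      using that by (intro measurable_restrict_space1) (auto simp: H1_Hn_def weak_gradient_def)
    then show "u \<in> borel_measurable hyp_vol" by (simp add: hyp_vol_def)
  qed (use that in simp)
  show ?thesis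
  proof (rule antisym)
    show "W_sup_Hn TYPE('a) p \<le> W_sup_Rn TYPE('a) p"
      unfolding W_sup_Hn_def W_sup_Rn_def
    proof (rule SUP_le_SUP_by_bounds)
      fix C z
      assume C: "C \<ge> 0" and b: "\<And>y. y \<in> {(u :: 'a \<Rightarrow> real, G). H1_Rn u G \<and> (\<integral>x. (u x)\<^sup>2 \<partial>lebesgue) \<noteq> 0} \<Longrightarrow>
          (case y of (u, G) \<Rightarrow> W_quot lebesgue DIM('a) p u (\<integral>x. (u x)\<^sup>2 \<partial>lebesgue) (\<integral>x. (norm (G x))\<^sup>2 \<partial>lebesgue)) \<le> ereal C"
        and z: "z \<in> {(u :: 'a \<Rightarrow> real, G). H1_Hn u G \<and> (\<integral>x. (u x)\<^sup>2 \<partial>hyp_vol) \<noteq> 0}"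
      obtain u G where zuG: "z = (u, G)" "H1_Hn u G" using z by auto
      show "(case z of (u, G) \<Rightarrow> W_quot hyp_vol DIM('a) p u (\<integral>x. (u x)\<^sup>2 \<partial>hyp_vol)
          (\<integral>x. (norm (G x))\<^sup>2 / (hyp_rho x)\<^sup>2 \<partial>hyp_vol)) \<le> ereal C"
        unfolding zuG(1) prod.case
        by (rule W_Hn_le_of_W_Rn_le[OF assms C _ zuG(2)]) (use b[of "(_, _)"] in simp)
    qed (auto simp: posR posH)
    show "W_sup_Rn TYPE('a) p \<le> W_sup_Hn TYPE('a) p"
      unfolding W_sup_Hn_def W_sup_Rn_def
    proof (rule SUP_le_SUP_by_bounds)
      fix C z
      assume C: "C \<ge> 0" and b: "\<And>y. y \<in> {(u :: 'a \<Rightarrow> real, G). H1_Hn u G \<and> (\<integral>x. (u x)\<^sup>2 \<partial>hyp_vol) \<noteq> 0} \<Longrightarrow>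
          (case y of (u, G) \<Rightarrow> W_quot hyp_vol DIM('a) p u (\<integral>x. (u x)\<^sup>2 \<partial>hyp_vol)
            (\<integral>x. (norm (G x))\<^sup>2 / (hyp_rho x)\<^sup>2 \<partial>hyp_vol)) \<le> ereal C"
        and z: "z \<in> {(u :: 'a \<Rightarrow> real, G). H1_Rn u G \<and> (\<integral>x. (u x)\<^sup>2 \<partial>lebesgue) \<noteq> 0}"
      obtain u G where zuG: "z = (u, G)" "H1_Rn u G" using z by auto
      show "(case z of (u, G) \<Rightarrow> W_quot lebesgue DIM('a) p u (\<integral>x. (u x)\<^sup>2 \<partial>lebesgue) (\<integral>x. (norm (G x))\<^sup>2 \<partial>lebesgue)) \<le> ereal C"
        unfolding zuG(1) prod.case
        by (rule W_Rn_le_of_W_Hn_le[OF assms C _ zuG(2)]) (use b[of "(_, _)"] in simp)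
    qed (auto simp: posR posH)
  qed
qed

end
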